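(* Let $\mathcal{C}$ be a modular category, let $U(\mathcal{C})$ be its universal grading group, and let $G(\mathcal{C})$ be the group of (isomorphism classes of) invertible objects of $\mathcal{C}$. There is a canonical isomorphism $U(\mathcal{C})\cong\widehat{G(\mathcal{C})}$.
   Context: $k$ is an algebraically closed field of characteristic $0$. A fusion category is a $k$-linear semisimple rigid tensor category with finitely many isomorphism classes of simple objects, finite-dimensional morphism spaces, and simple unit object. A modular category is a (semisimple) ribbon fusion category with non-degenerate $S$-matrix $s_{ij}=\mathrm{tr}_q(c_{X_i,X_j}\circ c_{X_j,X_i})$, where $c$ is the braiding and $X_i$ runs over representatives of simple objects. For an abelian group $A$, $\widehat{A}$ is its group of characters. Universal grading group $U(\mathcal{C})$: let $R=K_0(\mathcal{C})$ be the Grothendieck ring with basis $B$ the isomorphism classes of simple objects. Let $R_{ad}$ be the smallest subring of $R$ that is spanned by a subset of $B$, is stable under duality, and contains $XX^*$ for all $X\in B$. A based $R_{ad}$-subbimodule of $R$ is the $\mathbb{Z}$-span of a subset of $B$ stable under left and right multiplication by $R_{ad}$. $R$ decomposes uniquely as a direct sum $R=\bigoplus_{a\in A}R_a$ of indecomposable based $R_{ad}$-subbimodules, and $A$ is a group with $ab=c$ if and only if $X_aX_b\in R_c$ for all $X_a\in R_a$, $X_b\in R_b$; its identity corresponds to the component $R_{ad}$. Then $U(\mathcal{C}):=A$. *)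

theory Defs
  imports "HOL-Algebra.Subrings" "HOL-Algebra.AbelCoset" "Jordan_Normal_Form.Determinant"
begin

section \<open>Linear, abelian and semisimple categories\<close>

text \<open>
  The morphism spaces of a linear category are represented as linear subspaces of one ambient
  vector space (the type \<open>'m\<close> with scalar multiplication \<open>scl\<close>), which may always be taken to be
  the direct sum of all morphism spaces. The spaces \<open>Hom x y\<close> are not required to be disjoint, and
  composition and tensor product of morphisms are total functions about which nothing is assumed
  outside of the morphism spaces. Composition is written in the usual order.
\<close>

record ('o, 'm, 'k) linear_cat =
  Obj :: "'o set"
  Hom :: "'o \<Rightarrow> 'o \<Rightarrow> 'm set"
  cmp :: "'m \<Rightarrow> 'm \<Rightarrow> 'm"  (infixl "\<cdot>\<index>" 68)
  idm :: "'o \<Rightarrow> 'm"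
  scl :: "'k \<Rightarrow> 'm \<Rightarrow> 'm"

locale linear_category =
  fixes C :: "('o, 'm::ab_group_add, 'k::field, 'z) linear_cat_scheme" (structure)
  assumes vector_space: "vector_space (scl C)"
    and subspace_Hom:
      "\<lbrakk>x \<in> Obj C; y \<in> Obj C\<rbrakk> \<Longrightarrow> module.subspace (scl C) (Hom C x y)"
    and idm_in_Hom: "x \<in> Obj C \<Longrightarrow> idm C x \<in> Hom C x x"
    and cmp_in_Hom:
      "\<lbrakk>x \<in> Obj C; y \<in> Obj C; z \<in> Obj C; f \<in> Hom C x y; g \<in> Hom C y z\<rbrakk>
        \<Longrightarrow> g \<cdot> f \<in> Hom C x z"
    and cmp_idm_right: "\<lbrakk>x \<in> Obj C; y \<in> Obj C; f \<in> Hom C x y\<rbrakk> \<Longrightarrow> f \<cdot> idm C x = f"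
    and cmp_idm_left: "\<lbrakk>x \<in> Obj C; y \<in> Obj C; f \<in> Hom C x y\<rbrakk> \<Longrightarrow> idm C y \<cdot> f = f"
    and cmp_assoc:
      "\<lbrakk>w \<in> Obj C; x \<in> Obj C; y \<in> Obj C; z \<in> Obj C;
        f \<in> Hom C w x; g \<in> Hom C x y; h \<in> Hom C y z\<rbrakk>
        \<Longrightarrow> h \<cdot> (g \<cdot> f) = (h \<cdot> g) \<cdot> f"
    and cmp_add_right:
      "\<lbrakk>x \<in> Obj C; y \<in> Obj C; z \<in> Obj C; f \<in> Hom C x y; f' \<in> Hom C x y; g \<in> Hom C y z\<rbrakk>
        \<Longrightarrow> g \<cdot> (f + f') = g \<cdot> f + g \<cdot> f'"
    and cmp_add_left:
      "\<lbrakk>x \<in> Obj C; y \<in> Obj C; z \<in> Obj C; f \<in> Hom C x y; g \<in> Hom C y z; g' \<in> Hom C y z\<rbrakk>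
        \<Longrightarrow> (g + g') \<cdot> f = g \<cdot> f + g' \<cdot> f"
    and cmp_scl_right:
      "\<lbrakk>x \<in> Obj C; y \<in> Obj C; z \<in> Obj C; f \<in> Hom C x y; g \<in> Hom C y z\<rbrakk>
        \<Longrightarrow> g \<cdot> scl C a f = scl C a (g \<cdot> f)"
    and cmp_scl_left:
      "\<lbrakk>x \<in> Obj C; y \<in> Obj C; z \<in> Obj C; f \<in> Hom C x y; g \<in> Hom C y z\<rbrakk>
        \<Longrightarrow> scl C a g \<cdot> f = scl C a (g \<cdot> f)"

context
  fixes C :: "('o, 'm::ab_group_add, 'k, 'z) linear_cat_scheme" (structure)
begin

definition inverse_arrows :: "'o \<Rightarrow> 'o \<Rightarrow> 'm \<Rightarrow> 'm \<Rightarrow> bool" where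
  "inverse_arrows x y f g \<longleftrightarrow>
     f \<in> Hom C x y \<and> g \<in> Hom C y x \<and> g \<cdot> f = idm C x \<and> f \<cdot> g = idm C y"

definition iso_arrow :: "'o \<Rightarrow> 'o \<Rightarrow> 'm \<Rightarrow> bool" where
  "iso_arrow x y f \<longleftrightarrow> (\<exists>g. inverse_arrows x y f g)"

definition inv_arrow :: "'o \<Rightarrow> 'o \<Rightarrow> 'm \<Rightarrow> 'm" where
  "inv_arrow x y f = (THE g. inverse_arrows x y f g)"

definition isomorphic :: "'o \<Rightarrow> 'o \<Rightarrow> bool" where
  "isomorphic x y \<longleftrightarrow> (\<exists>f. iso_arrow x y f)"

definition iso_class :: "'o \<Rightarrow> 'o set" where
  "iso_class x = {y \<in> Obj C. isomorphic x y}"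

definition mono_arrow :: "'o \<Rightarrow> 'o \<Rightarrow> 'm \<Rightarrow> bool" where
  "mono_arrow x y f \<longleftrightarrow> f \<in> Hom C x y \<and>
     (\<forall>w \<in> Obj C. \<forall>g \<in> Hom C w x. \<forall>h \<in> Hom C w x. f \<cdot> g = f \<cdot> h \<longrightarrow> g = h)"

definition epi_arrow :: "'o \<Rightarrow> 'o \<Rightarrow> 'm \<Rightarrow> bool" where
  "epi_arrow x y f \<longleftrightarrow> f \<in> Hom C x y \<and>
     (\<forall>z \<in> Obj C. \<forall>g \<in> Hom C y z. \<forall>h \<in> Hom C y z. g \<cdot> f = h \<cdot> f \<longrightarrow> g = h)"

definition is_kernel :: "'o \<Rightarrow> 'm \<Rightarrow> 'o \<Rightarrow> 'm \<Rightarrow> bool" where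
  "is_kernel x f u i \<longleftrightarrow> i \<in> Hom C u x \<and> f \<cdot> i = 0 \<and>
     (\<forall>w \<in> Obj C. \<forall>g \<in> Hom C w x. f \<cdot> g = 0 \<longrightarrow> (\<exists>!h. h \<in> Hom C w u \<and> i \<cdot> h = g))"

definition is_cokernel :: "'o \<Rightarrow> 'm \<Rightarrow> 'o \<Rightarrow> 'm \<Rightarrow> bool" where
  "is_cokernel y f q p \<longleftrightarrow> p \<in> Hom C y q \<and> p \<cdot> f = 0 \<and>
     (\<forall>w \<in> Obj C. \<forall>g \<in> Hom C y w. g \<cdot> f = 0 \<longrightarrow> (\<exists>!h. h \<in> Hom C q w \<and> h \<cdot> p = g))"

definition zero_object :: "'o \<Rightarrow> bool" where
  "zero_object z \<longleftrightarrow> z \<in> Obj C \<and> (\<forall>x \<in> Obj C. Hom C x z = {0} \<and> Hom C z x = {0})"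

text \<open>\<open>v\<close> is a biproduct of the finite list \<open>xs\<close> (a zero object if \<open>xs\<close> is empty).\<close>

definition is_direct_sum :: "'o \<Rightarrow> 'o list \<Rightarrow> bool" where
  "is_direct_sum v xs \<longleftrightarrow> v \<in> Obj C \<and> set xs \<subseteq> Obj C \<and>
     (\<exists>i p. (\<forall>j < length xs. i j \<in> Hom C (xs ! j) v \<and> p j \<in> Hom C v (xs ! j)) \<and>
       (\<forall>j < length xs. \<forall>l < length xs. p l \<cdot> i j = (if j = l then idm C (xs ! j) else 0)) \<and>
       (\<Sum>j < length xs. i j \<cdot> p j) = idm C v)"

definition simple_object :: "'o \<Rightarrow> bool" where
  "simple_object x \<longleftrightarrow> x \<in> Obj C \<and> \<not> zero_object x \<and>
     (\<forall>w \<in> Obj C. \<forall>f. mono_arrow w x f \<longrightarrow> zero_object w \<or> iso_arrow w x f)"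

definition simple_classes :: "'o set set" where
  "simple_classes = iso_class ` Collect simple_object"

end

locale abelian_linear_category = linear_category C
  for C :: "('o, 'm::ab_group_add, 'k::field, 'z) linear_cat_scheme" (structure) +
  assumes direct_sums: "set xs \<subseteq> Obj C \<Longrightarrow> \<exists>v. is_direct_sum C v xs"
    and kernels:
      "\<lbrakk>x \<in> Obj C; y \<in> Obj C; f \<in> Hom C x y\<rbrakk> \<Longrightarrow> \<exists>u \<in> Obj C. \<exists>i. is_kernel C x f u i"
    and cokernels:
      "\<lbrakk>x \<in> Obj C; y \<in> Obj C; f \<in> Hom C x y\<rbrakk> \<Longrightarrow> \<exists>q \<in> Obj C. \<exists>p. is_cokernel C y f q p"
    and mono_is_kernel:
      "\<lbrakk>u \<in> Obj C; x \<in> Obj C; mono_arrow C u x i\<rbrakk>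
        \<Longrightarrow> \<exists>y \<in> Obj C. \<exists>f \<in> Hom C x y. is_kernel C x f u i"
    and epi_is_cokernel:
      "\<lbrakk>y \<in> Obj C; q \<in> Obj C; epi_arrow C y q p\<rbrakk>
        \<Longrightarrow> \<exists>x \<in> Obj C. \<exists>f \<in> Hom C x y. is_cokernel C y f q p"

locale semisimple_linear_category = abelian_linear_category C
  for C :: "('o, 'm::ab_group_add, 'k::field, 'z) linear_cat_scheme" (structure) +
  assumes semisimple:
    "v \<in> Obj C \<Longrightarrow> \<exists>xs. (\<forall>x \<in> set xs. simple_object C x) \<and> is_direct_sum C v xs"


section \<open>Fusion categories\<close>

record ('o, 'm, 'k) monoidal_cat = "('o, 'm, 'k) linear_cat" +
  tns_obj :: "'o \<Rightarrow> 'o \<Rightarrow> 'o"  (infixr "\<otimes>\<^sub>o\<index>" 70)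
  tns_arr :: "'m \<Rightarrow> 'm \<Rightarrow> 'm"  (infixr "\<otimes>\<^sub>a\<index>" 70)
  tunit :: "'o"
  asc :: "'o \<Rightarrow> 'o \<Rightarrow> 'o \<Rightarrow> 'm"
  lun :: "'o \<Rightarrow> 'm"
  run :: "'o \<Rightarrow> 'm"

text \<open>
  The constraint isomorphisms are \<open>asc x y z : (x \<otimes> y) \<otimes> z \<rightarrow> x \<otimes> (y \<otimes> z)\<close>, \<open>lun x : 1 \<otimes> x \<rightarrow> x\<close> and
  \<open>run x : x \<otimes> 1 \<rightarrow> x\<close>; no strictness is assumed.
\<close>

locale linear_monoidal_category = linear_category C
  for C :: "('o, 'm::ab_group_add, 'k::field, 'z) monoidal_cat_scheme" (structure) +
  assumes tunit_in_Obj: "tunit C \<in> Obj C"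
    and tns_in_Obj: "\<lbrakk>x \<in> Obj C; y \<in> Obj C\<rbrakk> \<Longrightarrow> x \<otimes>\<^sub>o y \<in> Obj C"
    and tns_in_Hom:
      "\<lbrakk>x \<in> Obj C; x' \<in> Obj C; y \<in> Obj C; y' \<in> Obj C; f \<in> Hom C x x'; g \<in> Hom C y y'\<rbrakk>
        \<Longrightarrow> f \<otimes>\<^sub>a g \<in> Hom C (x \<otimes>\<^sub>o y) (x' \<otimes>\<^sub>o y')"
    and tns_idm: "\<lbrakk>x \<in> Obj C; y \<in> Obj C\<rbrakk> \<Longrightarrow> idm C x \<otimes>\<^sub>a idm C y = idm C (x \<otimes>\<^sub>o y)"
    and tns_cmp:
      "\<lbrakk>x \<in> Obj C; x' \<in> Obj C; x'' \<in> Obj C; y \<in> Obj C; y' \<in> Obj C; y'' \<in> Obj C;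
        f \<in> Hom C x x'; f' \<in> Hom C x' x''; g \<in> Hom C y y'; g' \<in> Hom C y' y''\<rbrakk>
        \<Longrightarrow> (f' \<cdot> f) \<otimes>\<^sub>a (g' \<cdot> g) = (f' \<otimes>\<^sub>a g') \<cdot> (f \<otimes>\<^sub>a g)"
    and tns_add_left:
      "\<lbrakk>x \<in> Obj C; x' \<in> Obj C; y \<in> Obj C; y' \<in> Obj C;
        f \<in> Hom C x x'; f' \<in> Hom C x x'; g \<in> Hom C y y'\<rbrakk>
        \<Longrightarrow> (f + f') \<otimes>\<^sub>a g = f \<otimes>\<^sub>a g + f' \<otimes>\<^sub>a g"
    and tns_add_right:
      "\<lbrakk>x \<in> Obj C; x' \<in> Obj C; y \<in> Obj C; y' \<in> Obj C;
        f \<in> Hom C x x'; g \<in> Hom C y y'; g' \<in> Hom C y y'\<rbrakk>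
        \<Longrightarrow> f \<otimes>\<^sub>a (g + g') = f \<otimes>\<^sub>a g + f \<otimes>\<^sub>a g'"
    and tns_scl_left:
      "\<lbrakk>x \<in> Obj C; x' \<in> Obj C; y \<in> Obj C; y' \<in> Obj C; f \<in> Hom C x x'; g \<in> Hom C y y'\<rbrakk>
        \<Longrightarrow> scl C a f \<otimes>\<^sub>a g = scl C a (f \<otimes>\<^sub>a g)"
    and tns_scl_right:
      "\<lbrakk>x \<in> Obj C; x' \<in> Obj C; y \<in> Obj C; y' \<in> Obj C; f \<in> Hom C x x'; g \<in> Hom C y y'\<rbrakk>
        \<Longrightarrow> f \<otimes>\<^sub>a scl C a g = scl C a (f \<otimes>\<^sub>a g)"
    and asc_iso:
      "\<lbrakk>x \<in> Obj C; y \<in> Obj C; z \<in> Obj C\<rbrakk>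
        \<Longrightarrow> iso_arrow C ((x \<otimes>\<^sub>o y) \<otimes>\<^sub>o z) (x \<otimes>\<^sub>o (y \<otimes>\<^sub>o z)) (asc C x y z)"
    and asc_natural:
      "\<lbrakk>x \<in> Obj C; x' \<in> Obj C; y \<in> Obj C; y' \<in> Obj C; z \<in> Obj C; z' \<in> Obj C;
        f \<in> Hom C x x'; g \<in> Hom C y y'; h \<in> Hom C z z'\<rbrakk>
        \<Longrightarrow> asc C x' y' z' \<cdot> ((f \<otimes>\<^sub>a g) \<otimes>\<^sub>a h) = (f \<otimes>\<^sub>a (g \<otimes>\<^sub>a h)) \<cdot> asc C x y z"
    and lun_iso: "x \<in> Obj C \<Longrightarrow> iso_arrow C (tunit C \<otimes>\<^sub>o x) x (lun C x)"
    and lun_natural: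
      "\<lbrakk>x \<in> Obj C; x' \<in> Obj C; f \<in> Hom C x x'\<rbrakk>
        \<Longrightarrow> lun C x' \<cdot> (idm C (tunit C) \<otimes>\<^sub>a f) = f \<cdot> lun C x"
    and run_iso: "x \<in> Obj C \<Longrightarrow> iso_arrow C (x \<otimes>\<^sub>o tunit C) x (run C x)"
    and run_natural:
      "\<lbrakk>x \<in> Obj C; x' \<in> Obj C; f \<in> Hom C x x'\<rbrakk>
        \<Longrightarrow> run C x' \<cdot> (f \<otimes>\<^sub>a idm C (tunit C)) = f \<cdot> run C x"
    and pentagon:
      "\<lbrakk>w \<in> Obj C; x \<in> Obj C; y \<in> Obj C; z \<in> Obj C\<rbrakk>
        \<Longrightarrow> (idm C w \<otimes>\<^sub>a asc C x y z) \<cdot> asc C w (x \<otimes>\<^sub>o y) z \<cdot> (asc C w x y \<otimes>\<^sub>a idm C z)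
          = asc C w x (y \<otimes>\<^sub>o z) \<cdot> asc C (w \<otimes>\<^sub>o x) y z"
    and triangle:
      "\<lbrakk>x \<in> Obj C; y \<in> Obj C\<rbrakk>
        \<Longrightarrow> (idm C x \<otimes>\<^sub>a lun C y) \<cdot> asc C x (tunit C) y = run C x \<otimes>\<^sub>a idm C y"

context
  fixes C :: "('o, 'm::ab_group_add, 'k, 'z) monoidal_cat_scheme" (structure)
begin

abbreviation (input) inv_asc :: "'o \<Rightarrow> 'o \<Rightarrow> 'o \<Rightarrow> 'm" where
  "inv_asc x y z \<equiv> inv_arrow C ((x \<otimes>\<^sub>o y) \<otimes>\<^sub>o z) (x \<otimes>\<^sub>o (y \<otimes>\<^sub>o z)) (asc C x y z)"

abbreviation (input) inv_lun :: "'o \<Rightarrow> 'm" where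
  "inv_lun x \<equiv> inv_arrow C (tunit C \<otimes>\<^sub>o x) x (lun C x)"

abbreviation (input) inv_run :: "'o \<Rightarrow> 'm" where
  "inv_run x \<equiv> inv_arrow C (x \<otimes>\<^sub>o tunit C) x (run C x)"

text \<open>\<open>y\<close> is a left dual of \<open>x\<close> with evaluation \<open>e : y \<otimes> x \<rightarrow> 1\<close> and coevaluation
  \<open>c : 1 \<rightarrow> x \<otimes> y\<close>; equivalently, \<open>x\<close> is a right dual of \<open>y\<close>.\<close>

definition left_dual :: "'o \<Rightarrow> 'o \<Rightarrow> 'm \<Rightarrow> 'm \<Rightarrow> bool" where
  "left_dual x y e c \<longleftrightarrow> x \<in> Obj C \<and> y \<in> Obj C \<and>
     e \<in> Hom C (y \<otimes>\<^sub>o x) (tunit C) \<and> c \<in> Hom C (tunit C) (x \<otimes>\<^sub>o y) \<and>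
     run C x \<cdot> (idm C x \<otimes>\<^sub>a e) \<cdot> asc C x y x \<cdot> (c \<otimes>\<^sub>a idm C x) \<cdot> inv_lun x = idm C x \<and>
     lun C y \<cdot> (e \<otimes>\<^sub>a idm C y) \<cdot> inv_asc y x y \<cdot> (idm C y \<otimes>\<^sub>a c) \<cdot> inv_run y = idm C y"

definition invertible_object :: "'o \<Rightarrow> bool" where
  "invertible_object x \<longleftrightarrow> x \<in> Obj C \<and>
     (\<exists>y \<in> Obj C. isomorphic C (x \<otimes>\<^sub>o y) (tunit C) \<and> isomorphic C (y \<otimes>\<^sub>o x) (tunit C))"

end

text \<open>The left dual \<open>dual x\<close> of each object is chosen as part of the structure.\<close>

record ('o, 'm, 'k) rigid_cat = "('o, 'm, 'k) monoidal_cat" +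
  dual :: "'o \<Rightarrow> 'o"
  ev :: "'o \<Rightarrow> 'm"
  coev :: "'o \<Rightarrow> 'm"

locale fusion_category =
    semisimple_linear_category C + linear_monoidal_category C
  for C :: "('o, 'm::ab_group_add, 'k::{alg_closed_field, field_char_0}, 'z) rigid_cat_scheme"
    (structure) +
  assumes left_duals: "x \<in> Obj C \<Longrightarrow> left_dual C x (dual C x) (ev C x) (coev C x)"
    and right_duals: "x \<in> Obj C \<Longrightarrow> \<exists>y e c. left_dual C y x e c"
    and finite_dimensional_Hom:
      "\<lbrakk>x \<in> Obj C; y \<in> Obj C\<rbrakk>
        \<Longrightarrow> \<exists>S. finite S \<and> S \<subseteq> Hom C x y \<and> Hom C x y = module.span (scl C) S"
    and finite_simple_classes: "finite (simple_classes C)"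
    and simple_tunit: "simple_object C (tunit C)"


section \<open>Modular categories\<close>

record ('o, 'm, 'k) ribbon_cat = "('o, 'm, 'k) rigid_cat" +
  braid :: "'o \<Rightarrow> 'o \<Rightarrow> 'm"
  twist :: "'o \<Rightarrow> 'm"

context
  fixes C :: "('o, 'm::ab_group_add, 'k, 'z) ribbon_cat_scheme" (structure)
begin

text \<open>The transpose \<open>f\<^sup>* : y\<^sup>* \<rightarrow> x\<^sup>*\<close> of a morphism \<open>f : x \<rightarrow> y\<close>.\<close>

definition dual_arrow :: "'o \<Rightarrow> 'o \<Rightarrow> 'm \<Rightarrow> 'm" where
  "dual_arrow x y f =
     lun C (dual C x) \<cdot> (ev C y \<otimes>\<^sub>a idm C (dual C x)) \<cdot> inv_asc C (dual C y) y (dual C x)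
       \<cdot> (idm C (dual C y) \<otimes>\<^sub>a (f \<otimes>\<^sub>a idm C (dual C x)))
       \<cdot> (idm C (dual C y) \<otimes>\<^sub>a coev C x) \<cdot> inv_run C (dual C y)"

text \<open>The quantum trace of an endomorphism \<open>f\<close> of \<open>x\<close>, as the scalar by which an endomorphism
  of the (simple) unit object acts.\<close>

definition qtrace :: "'o \<Rightarrow> 'm \<Rightarrow> 'k" where
  "qtrace x f = (THE t. scl C t (idm C (tunit C)) =
     ev C x \<cdot> braid C x (dual C x) \<cdot> ((twist C x \<cdot> f) \<otimes>\<^sub>a idm C (dual C x)) \<cdot> coev C x)"

definition s_entry :: "'o \<Rightarrow> 'o \<Rightarrow> 'k" where
  "s_entry x y = qtrace (y \<otimes>\<^sub>o x) (braid C x y \<cdot> braid C y x)"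

end

locale ribbon_fusion_category = fusion_category C
  for C :: "('o, 'm::ab_group_add, 'k::{alg_closed_field, field_char_0}, 'z) ribbon_cat_scheme"
    (structure) +
  assumes braid_iso:
      "\<lbrakk>x \<in> Obj C; y \<in> Obj C\<rbrakk> \<Longrightarrow> iso_arrow C (x \<otimes>\<^sub>o y) (y \<otimes>\<^sub>o x) (braid C x y)"
    and braid_natural:
      "\<lbrakk>x \<in> Obj C; x' \<in> Obj C; y \<in> Obj C; y' \<in> Obj C; f \<in> Hom C x x'; g \<in> Hom C y y'\<rbrakk>
        \<Longrightarrow> braid C x' y' \<cdot> (f \<otimes>\<^sub>a g) = (g \<otimes>\<^sub>a f) \<cdot> braid C x y"
    and hexagon1:
      "\<lbrakk>x \<in> Obj C; y \<in> Obj C; z \<in> Obj C\<rbrakk>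
        \<Longrightarrow> asc C y z x \<cdot> braid C x (y \<otimes>\<^sub>o z) \<cdot> asc C x y z
          = (idm C y \<otimes>\<^sub>a braid C x z) \<cdot> asc C y x z \<cdot> (braid C x y \<otimes>\<^sub>a idm C z)"
    and hexagon2:
      "\<lbrakk>x \<in> Obj C; y \<in> Obj C; z \<in> Obj C\<rbrakk>
        \<Longrightarrow> inv_asc C z x y \<cdot> braid C (x \<otimes>\<^sub>o y) z \<cdot> inv_asc C x y z
          = (braid C x z \<otimes>\<^sub>a idm C y) \<cdot> inv_asc C x z y \<cdot> (idm C x \<otimes>\<^sub>a braid C y z)"
    and twist_iso: "x \<in> Obj C \<Longrightarrow> iso_arrow C x x (twist C x)"
    and twist_natural:
      "\<lbrakk>x \<in> Obj C; y \<in> Obj C; f \<in> Hom C x y\<rbrakk> \<Longrightarrow> twist C y \<cdot> f = f \<cdot> twist C x"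
    and twist_tns:
      "\<lbrakk>x \<in> Obj C; y \<in> Obj C\<rbrakk>
        \<Longrightarrow> twist C (x \<otimes>\<^sub>o y) = braid C y x \<cdot> braid C x y \<cdot> (twist C x \<otimes>\<^sub>a twist C y)"
    and twist_dual: "x \<in> Obj C \<Longrightarrow> twist C (dual C x) = dual_arrow C x x (twist C x)"

locale modular_category = ribbon_fusion_category C
  for C :: "('o, 'm::ab_group_add, 'k::{alg_closed_field, field_char_0}, 'z) ribbon_cat_scheme"
    (structure) +
  assumes s_matrix_nondegenerate:
    "\<exists>xs. (\<forall>x \<in> set xs. simple_object C x) \<and> distinct (map (iso_class C) xs) \<and>
       iso_class C ` set xs = simple_classes C \<and>
       det (mat (length xs) (length xs) (\<lambda>(i, j). s_entry C (xs ! i) (xs ! j))) \<noteq> 0"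


section \<open>The Grothendieck ring\<close>

context
  fixes C :: "('o, 'm::ab_group_add, 'k, 'z) rigid_cat_scheme" (structure)
begin

text \<open>The number of summands in the class \<open>b\<close> in a decomposition of \<open>v\<close> into simple objects.\<close>

definition multiplicity_in :: "'o \<Rightarrow> 'o set \<Rightarrow> nat" where
  "multiplicity_in v b = (THE n. \<exists>xs. (\<forall>x \<in> set xs. simple_object C x) \<and>
     is_direct_sum C v xs \<and> n = length (filter (\<lambda>x. x \<in> b) xs))"

text \<open>Elements of \<open>K\<^sub>0\<close> are given by their coordinates with respect to the basis of classes of
  simple objects.\<close>

definition K0_class :: "'o \<Rightarrow> 'o set \<Rightarrow> int" where
  "K0_class v = (\<lambda>b. if b \<in> simple_classes C then int (multiplicity_in v b) else 0)"

definition K0 :: "('o set \<Rightarrow> int) ring" where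
  "K0 = \<lparr>carrier = {f. \<forall>b. f b \<noteq> 0 \<longrightarrow> b \<in> simple_classes C},
     monoid.mult = (\<lambda>f g d. \<Sum>b \<in> simple_classes C. \<Sum>c \<in> simple_classes C.
        f b * g c * K0_class ((SOME x. x \<in> b) \<otimes>\<^sub>o (SOME y. y \<in> c)) d),
     one = K0_class (tunit C),
     zero = (\<lambda>_. 0),
     add = (\<lambda>f g b. f b + g b)\<rparr>"

definition basis_span :: "'o set set \<Rightarrow> ('o set \<Rightarrow> int) set" where
  "basis_span T = {f \<in> carrier K0. \<forall>b. f b \<noteq> 0 \<longrightarrow> b \<in> T}"


section \<open>The universal grading group\<close>

definition adjoint_subring :: "('o set \<Rightarrow> int) set" where
  "adjoint_subring = \<Inter> {M. (\<exists>T \<subseteq> simple_classes C. M = basis_span T) \<and> subring M K0 \<and>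
     (\<forall>x. simple_object C x \<and> K0_class x \<in> M \<longrightarrow> K0_class (dual C x) \<in> M) \<and>
     (\<forall>x. simple_object C x \<longrightarrow> K0_class x \<otimes>\<^bsub>K0\<^esub> K0_class (dual C x) \<in> M)}"

definition based_subbimodule :: "('o set \<Rightarrow> int) set \<Rightarrow> bool" where
  "based_subbimodule M \<longleftrightarrow> (\<exists>T \<subseteq> simple_classes C. M = basis_span T) \<and>
     (\<forall>r \<in> adjoint_subring. \<forall>m \<in> M. r \<otimes>\<^bsub>K0\<^esub> m \<in> M \<and> m \<otimes>\<^bsub>K0\<^esub> r \<in> M)"

definition indecomposable_subbimodule :: "('o set \<Rightarrow> int) set \<Rightarrow> bool" where
  "indecomposable_subbimodule M \<longleftrightarrow> based_subbimodule M \<and> M \<noteq> {\<zero>\<^bsub>K0\<^esub>} \<and>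
     \<not> (\<exists>M1 M2. based_subbimodule M1 \<and> based_subbimodule M2 \<and>
          M1 \<noteq> {\<zero>\<^bsub>K0\<^esub>} \<and> M2 \<noteq> {\<zero>\<^bsub>K0\<^esub>} \<and> M1 \<inter> M2 = {\<zero>\<^bsub>K0\<^esub>} \<and> M = M1 <+>\<^bsub>K0\<^esub> M2)"

definition bimodule_decomposition :: "('o set \<Rightarrow> int) set set \<Rightarrow> bool" where
  "bimodule_decomposition A \<longleftrightarrow> finite A \<and> (\<forall>M \<in> A. indecomposable_subbimodule M) \<and>
     (\<forall>f \<in> carrier K0. \<exists>!m. m \<in> (\<Pi>\<^sub>E M \<in> A. M) \<and> f = (\<Oplus>\<^bsub>K0\<^esub>M \<in> A. m M))"

definition bimodule_components :: "('o set \<Rightarrow> int) set set" where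
  "bimodule_components = (THE A. bimodule_decomposition A)"

text \<open>The elements of the universal grading group are the components \<open>R\<^sub>a\<close> themselves.\<close>

definition universal_grading_group :: "('o set \<Rightarrow> int) set monoid" where
  "universal_grading_group = \<lparr>carrier = bimodule_components,
     monoid.mult = (\<lambda>M N. THE P. P \<in> bimodule_components \<and> (\<forall>f \<in> M. \<forall>g \<in> N. f \<otimes>\<^bsub>K0\<^esub> g \<in> P)),
     one = adjoint_subring\<rparr>"

end


section \<open>Invertible objects and characters\<close>

definition invertible_group ::
  "('o, 'm::ab_group_add, 'k, 'z) monoidal_cat_scheme \<Rightarrow> 'o set monoid" where
  "invertible_group C = \<lparr>carrier = iso_class C ` Collect (invertible_object C),
     monoid.mult = (\<lambda>a b. \<Union>x \<in> a. \<Union>y \<in> b. iso_class C (x \<otimes>\<^sub>o\<^bsub>C\<^esub> y)),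
     one = iso_class C (tunit C)\<rparr>"

definition unit_group :: "'k::field monoid" where
  "unit_group = \<lparr>carrier = - {0}, monoid.mult = (*), one = 1\<rparr>"

definition character_group :: "('g, 'b) monoid_scheme \<Rightarrow> ('g \<Rightarrow> 'k::field) monoid" where
  "character_group G = \<lparr>carrier = hom G unit_group \<inter> extensional (carrier G),
     monoid.mult = (\<lambda>\<chi> \<psi>. \<lambda>g \<in> carrier G. \<chi> g * \<psi> g),
     one = (\<lambda>g \<in> carrier G. 1)\<rparr>"

end

theory Submission
  imports Defs
begin

text \<open>
  Let \<open>d\<close> be the quantum dimension, \<open>N\<close> the structure constants of the Grothendieck ring and \<open>S\<close> the
  S-matrix. Encircling a simple strand \<open>y\<close> by a loop coloured \<open>x \<otimes> z\<close> amounts to encircling it by \<open>z\<close>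
  and then by \<open>x\<close>, whence \<open>S x y * S z y = d y * (\<Sum>w. N x z w * S w y)\<close>.
  So \<open>x \<mapsto> S x y / d y\<close> is a character of
  the Grothendieck ring, and non-degeneracy implies that every character arises in this way.

  The double braiding of an invertible object \<open>g\<close> with a simple object \<open>x\<close> is a scalar \<open>\<mu> g x\<close>. It is
  multiplicative in \<open>g\<close> and, on constituents of tensor products, in \<open>x\<close>; hence it is trivial on the
  adjoint subring and defines a pairing between the invertible objects and the universal grading
  group. Since \<open>S g x = \<mu> g x * d g * d x\<close>, non-degeneracy yields that \<open>\<mu> g\<close> determines \<open>g\<close>.

  Conversely, let \<open>\<psi>\<close> be a character of the universal grading group. Then \<open>\<psi> * d\<close> and \<open>d / \<psi>\<close> are characters
  of the Grothendieck ring, so they belong to simple objects \<open>x\<close> and \<open>x'\<close>. The vector \<open>N x x'\<close> and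
  \<open>d x * d x'\<close> times the unit vector at \<open>1\<close> have the same product with \<open>S\<close>, so \<open>x \<otimes> x'\<close> contains
  no simple object but \<open>1\<close>; hence \<open>x\<close> is invertible and \<open>\<psi> = \<mu> x\<close>. Thus the pairing identifies the
  group of invertible objects with the group of characters of
  the finite abelian group \<open>U(C)\<close>, and duality of finite abelian groups gives the theorem.

  The identities between traces are computed in the strict category whose objects are the words
  in the objects of \<open>C\<close>, a morphism of words being a morphism between the iterated tensor products.
\<close>

section \<open>Characters of finite abelian groups\<close>

text \<open>Non-degeneracy is available only as a non-zero determinant, that is, as injectivity and
  surjectivity of \<open>v \<mapsto> v S\<close>; neither the square of S nor any unitarity enters.
  In particular no dimension is known to be non-zero at the start: the relation for
  \<open>S x y * S z y\<close> is therefore kept free of division, and dimensions turn out to be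
  non-zero because a vanishing one would annihilate a row of S. The character
  \<open>d / \<psi>\<close> is there to supply a candidate for the inverse of \<open>x\<close> that
  can be tested against \<open>x\<close> by S alone.

  Two features of the definitions shape the rest. The Grothendieck ring, its adjoint subring and its
  components are given by integral spans and definite descriptions, while the grading depends only
  on which simple classes occur in which products; so it is first built on sets of classes and then
  carried over to spans. And the associators of C are arbitrary, so that even a short diagrammatic
  identity would be buried under brackets; this is the reason for the detour through words.\<close>

lemma hom_unit_groupD:
  assumes "\<chi> \<in> hom G unit_group"
  shows "x \<in> carrier G \<Longrightarrow> \<chi> x \<noteq> 0"
    and "\<lbrakk>x \<in> carrier G; y \<in> carrier G\<rbrakk> \<Longrightarrow> \<chi> (x \<otimes>\<^bsub>G\<^esub> y) = \<chi> x * \<chi> y"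
  using assms by (auto simp: hom_def unit_group_def)

lemma hom_unit_groupI:
  assumes "\<And>x. x \<in> carrier G \<Longrightarrow> \<chi> x \<noteq> 0"
    and "\<And>x y. \<lbrakk>x \<in> carrier G; y \<in> carrier G\<rbrakk> \<Longrightarrow> \<chi> (x \<otimes>\<^bsub>G\<^esub> y) = \<chi> x * \<chi> y"
  shows "\<chi> \<in> hom G unit_group"
  using assms by (auto simp: hom_def unit_group_def)

context group
begin

lemma hom_unit_group_one:
  assumes "\<chi> \<in> hom G (unit_group :: 'k::field monoid)"
  shows "\<chi> \<one> = 1"
  using hom_unit_groupD[OF assms, of \<one>] by (metis l_one mult_cancel_left1 one_closed)

lemma group_character_group: "group (character_group G :: ('a \<Rightarrow> 'k::field) monoid)"
proof (rule groupI)
  let ?D = "character_group G :: ('a \<Rightarrow> 'k) monoid"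
  show "\<one>\<^bsub>?D\<^esub> \<in> carrier ?D"
    by (auto simp: character_group_def intro!: hom_unit_groupI)
  show "x \<otimes>\<^bsub>?D\<^esub> y \<in> carrier ?D" if "x \<in> carrier ?D" "y \<in> carrier ?D" for x y
    using that by (auto simp: character_group_def hom_unit_groupD intro!: hom_unit_groupI)
  show "x \<otimes>\<^bsub>?D\<^esub> y \<otimes>\<^bsub>?D\<^esub> z = x \<otimes>\<^bsub>?D\<^esub> (y \<otimes>\<^bsub>?D\<^esub> z)" for x y z
    by (auto simp: character_group_def restrict_def)
  show "\<one>\<^bsub>?D\<^esub> \<otimes>\<^bsub>?D\<^esub> x = x" if "x \<in> carrier ?D" for x
    using that by (auto simp: character_group_def extensional_def)
  show "\<exists>y \<in> carrier ?D. y \<otimes>\<^bsub>?D\<^esub> x = \<one>\<^bsub>?D\<^esub>" if "x \<in> carrier ?D" for x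
  proof
    have x: "x \<in> hom G unit_group" using that by (simp add: character_group_def)
    let ?y = "\<lambda>g \<in> carrier G. inverse (x g)"
    show "?y \<in> carrier ?D"
      using hom_unit_groupD[OF x] by (auto simp: character_group_def intro!: hom_unit_groupI)
    show "?y \<otimes>\<^bsub>?D\<^esub> x = \<one>\<^bsub>?D\<^esub>"
      using hom_unit_groupD[OF x] by (auto simp: character_group_def)
  qed
qed

text \<open>Translation by \<open>h\<close> permutes the group but multiplies the sum by
  \<open>\<chi> h\<close>.\<close>

lemma sum_character_eq_0:
  assumes "\<chi> \<in> hom G (unit_group :: 'k::field monoid)" "h \<in> carrier G" "\<chi> h \<noteq> 1"
  shows "(\<Sum>g \<in> carrier G. \<chi> g) = 0"
proof -
  have "(\<Sum>g \<in> carrier G. \<chi> g) = (\<Sum>g \<in> carrier G. \<chi> (h \<otimes> g))"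
    by (rule sum.reindex_bij_witness[of _ "\<lambda>g. h \<otimes> g" "\<lambda>g. inv h \<otimes> g"])
      (use assms(2) in \<open>auto simp: m_assoc[symmetric]\<close>)
  also have "\<dots> = \<chi> h * (\<Sum>g \<in> carrier G. \<chi> g)"
    using assms by (simp add: hom_unit_groupD sum_distrib_left)
  finally show ?thesis using assms(3) by simp
qed

end

section \<open>Extension of characters from subgroups\<close>

context comm_group
begin

text \<open>An extension must send \<open>h \<otimes> a [^] i\<close> to
  \<open>\<psi> h * t ^ i\<close>, and the condition on \<open>t\<close> is what makes this
  independent of the presentation. The value at \<open>a\<close> is prescribed because the lemma is
  also applied to the trivial subgroup, where \<open>t\<close> decides that the new character is
  non-trivial.\<close>

lemma extend_character_by_root:
  fixes \<psi> :: "'a \<Rightarrow> 'k::field"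
  assumes fin: "finite (carrier G)" and H: "subgroup H G"
    and \<psi>: "\<psi> \<in> hom (G\<lparr>carrier := H\<rparr>) unit_group"
    and a: "a \<in> carrier G" and t: "t \<noteq> 0" "\<And>n::nat. a [^] n \<in> H \<Longrightarrow> \<psi> (a [^] n) = t ^ n"
  shows "\<exists>K \<psi>'. subgroup K G \<and> H \<subseteq> K \<and> a \<in> K \<and> \<psi>' \<in> hom (G\<lparr>carrier := K\<rparr>) unit_group \<and>
    (\<forall>x \<in> H. \<psi>' x = \<psi> x) \<and> \<psi>' a = t"
proof -
  \<comment> \<open>Natural exponents suffice: in a finite group inverses are powers.\<close>
  define K where "K = {h \<otimes> a [^] i | h (i::nat). h \<in> H}"
  define rep :: "'a \<Rightarrow> 'a \<times> nat" where
    "rep x = (SOME p. fst p \<in> H \<and> x = fst p \<otimes> a [^] snd p)" for x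
  define \<psi>' where "\<psi>' x = \<psi> (fst (rep x)) * t ^ snd (rep x)" for x
  have HG: "h \<in> H \<Longrightarrow> h \<in> carrier G" for h by (rule subgroup.mem_carrier[OF H])
  have \<psi>_mult: "\<psi> (g \<otimes> h) = \<psi> g * \<psi> h" if "g \<in> H" "h \<in> H" for g h
    using hom_unit_groupD(2)[OF \<psi>] that by simp
  have \<psi>_nz: "\<psi> g \<noteq> 0" if "g \<in> H" for g
    using hom_unit_groupD(1)[OF \<psi>] that by simp
  \<comment> \<open>Cancelling leaves \<open>a [^] (j - i) \<in> H\<close>, where the condition on
    \<open>t\<close> applies; ordering the exponents avoids negative powers.\<close>
  have wd': "\<psi> h * t ^ i = \<psi> g * t ^ j"
    if "h \<in> H" "g \<in> H" "h \<otimes> a [^] i = g \<otimes> a [^] j" "i \<le> j" for h g and i j :: nat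
  proof -
    have "h \<otimes> a [^] i = (g \<otimes> a [^] (j - i)) \<otimes> a [^] i"
      using that(3,4) a HG[OF that(1)] HG[OF that(2)] by (simp add: m_assoc nat_pow_mult)
    then have h: "h = g \<otimes> a [^] (j - i)"
      using a HG[OF that(1)] HG[OF that(2)] by (meson m_closed nat_pow_closed right_cancel)
    have "a [^] (j - i) = inv g \<otimes> (g \<otimes> a [^] (j - i))"
      using a HG[OF that(2)] by (simp add: m_assoc[symmetric])
    then have "a [^] (j - i) = inv g \<otimes> h" by (simp only: h)
    then have "a [^] (j - i) \<in> H"
      using that(1,2) H subgroup.m_closed subgroup.m_inv_closed by metis
    then have "\<psi> h = \<psi> g * t ^ (j - i)"
      using \<psi>_mult[OF that(2), of "a [^] (j - i)"] t(2) by (simp add: h)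
    then show ?thesis using \<open>i \<le> j\<close> by (simp add: power_add[symmetric])
  qed
  have wd: "\<psi> h * t ^ i = \<psi> g * t ^ j"
    if "h \<in> H" "g \<in> H" "h \<otimes> a [^] i = g \<otimes> a [^] j" for h g and i j :: nat
    using wd'[OF that] wd'[OF that(2,1) that(3)[symmetric]] by (metis nat_le_linear)
  have \<psi>'_eq: "\<psi>' (h \<otimes> a [^] i) = \<psi> h * t ^ i" if "h \<in> H" for h i
  proof -
    have "fst (rep (h \<otimes> a [^] i)) \<in> H \<and>
        h \<otimes> a [^] i = fst (rep (h \<otimes> a [^] i)) \<otimes> a [^] snd (rep (h \<otimes> a [^] i))"
      using someI[of "\<lambda>p. fst p \<in> H \<and> h \<otimes> a [^] i = fst p \<otimes> a [^] snd p" "(h, i)"] that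
      by (simp add: rep_def)
    then show ?thesis unfolding \<psi>'_def using wd[OF that] by metis
  qed
  have mult: "(h \<otimes> a [^] i) \<otimes> (g \<otimes> a [^] j) = (h \<otimes> g) \<otimes> a [^] (i + j)"
    if "h \<in> H" "g \<in> H" for h g and i j :: nat
    using HG[OF that(1)] HG[OF that(2)] a by (simp add: nat_pow_mult[symmetric] m_ac)
  have KI: "h \<otimes> a [^] i \<in> K" if "h \<in> H" for h and i :: nat using that by (auto simp: K_def)
  have "subgroup K G"
  proof (rule subgroupI)
    show "K \<subseteq> carrier G" using a HG by (auto simp: K_def)
    show "K \<noteq> {}" using subgroup.one_closed[OF H] by (auto simp: K_def)
    fix x y assume "x \<in> K" "y \<in> K"
    then obtain h i g j where "x = h \<otimes> a [^] (i::nat)" "h \<in> H" "y = g \<otimes> a [^] (j::nat)" "g \<in> H"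
      by (auto simp: K_def)
    then show "x \<otimes> y \<in> K" using mult KI[of "h \<otimes> g" "i + j"] subgroup.m_closed[OF H] by simp
  next
    fix x assume "x \<in> K"
    then obtain h i where x: "x = h \<otimes> a [^] (i::nat)" "h \<in> H" by (auto simp: K_def)
    \<comment> \<open>Since \<open>a [^] N = \<one>\<close>, the power
      \<open>a [^] (i * (N - 1))\<close> inverts \<open>a [^] i\<close>.\<close>
    define N where "N = Coset.order G"
    have "N > 0" unfolding N_def using fin order_gt_0_iff_finite by blast
    then have "i + i * (N - 1) = N * i" by (cases N) auto
    then have "a [^] i \<otimes> a [^] (i * (N - 1)) = (a [^] N) [^] i"
      using a by (simp add: nat_pow_mult nat_pow_pow)
    also have "\<dots> = \<one>" unfolding N_def using pow_order_eq_1[OF a] nat_pow_one by simp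
    finally have "inv (a [^] i) = a [^] (i * (N - 1))"
      using a by (intro inv_equality) (simp_all add: m_comm)
    then have "inv x = inv h \<otimes> a [^] (i * (N - 1))" using x(1) a HG[OF x(2)] by (simp add: inv_mult)
    then show "inv x \<in> K" using KI[OF subgroup.m_inv_closed[OF H x(2)]] by simp
  qed
  moreover have sub: "h \<in> K" "\<psi>' h = \<psi> h" if "h \<in> H" for h
    using KI[OF that, of 0] \<psi>'_eq[OF that, of 0] HG[OF that] by auto
  moreover have "a \<in> K" "\<psi>' a = t"
  proof -
    have one: "\<one> \<in> H" by (rule subgroup.one_closed[OF H])
    then have "\<psi> \<one> = 1" using t(2)[of 0] by simp
    then show "a \<in> K" "\<psi>' a = t" using KI[OF one, of 1] \<psi>'_eq[OF one, of 1] a by auto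
  qed
  moreover have "\<psi>' \<in> hom (G\<lparr>carrier := K\<rparr>) unit_group"
  proof (rule hom_unit_groupI)
    fix x assume "x \<in> carrier (G\<lparr>carrier := K\<rparr>)"
    then show "\<psi>' x \<noteq> 0" using t \<psi>_nz by (auto simp: K_def \<psi>'_eq)
  next
    fix x y assume "x \<in> carrier (G\<lparr>carrier := K\<rparr>)" "y \<in> carrier (G\<lparr>carrier := K\<rparr>)"
    then obtain h i g j where "x = h \<otimes> a [^] (i::nat)" "h \<in> H" "y = g \<otimes> a [^] (j::nat)" "g \<in> H"
      by (auto simp: K_def)
    then show "\<psi>' (x \<otimes>\<^bsub>G\<lparr>carrier := K\<rparr>\<^esub> y) = \<psi>' x * \<psi>' y"
      using H by (simp add: mult \<psi>'_eq \<psi>_mult subgroup.m_closed power_add)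
  qed
  ultimately show ?thesis by blast
qed

text \<open>Let \<open>n\<close> be the least positive exponent with \<open>a [^] n \<in> H\<close>.
  Division with remainder shows that all exponents of this kind are multiples of \<open>n\<close>,
  so every \<open>n\<close>-th root of \<open>\<psi> (a [^] n)\<close> is an admissible value at
  \<open>a\<close>, and an algebraically closed field contains one.\<close>

lemma extend_character:
  fixes \<psi> :: "'a \<Rightarrow> 'k::alg_closed_field"
  assumes fin: "finite (carrier G)" and H: "subgroup H G"
    and \<psi>: "\<psi> \<in> hom (G\<lparr>carrier := H\<rparr>) unit_group" and a: "a \<in> carrier G"
  shows "\<exists>K \<psi>'. subgroup K G \<and> H \<subseteq> K \<and> a \<in> K \<and> \<psi>' \<in> hom (G\<lparr>carrier := K\<rparr>) unit_group \<and>
    (\<forall>x \<in> H. \<psi>' x = \<psi> x)"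
proof -
  interpret H: group "G\<lparr>carrier := H\<rparr>" by (rule subgroup_imp_group[OF H])
  define n where "n = (LEAST n::nat. n > 0 \<and> a [^] n \<in> H)"
  have "Coset.order G > 0" using fin order_gt_0_iff_finite by blast
  moreover have "a [^] Coset.order G \<in> H" using pow_order_eq_1[OF a] subgroup.one_closed[OF H] by simp
  ultimately have "n > 0 \<and> a [^] n \<in> H" 
    unfolding n_def using LeastI[of "\<lambda>n. n > 0 \<and> a [^] n \<in> H" "Coset.order G"] by blast
  then have n: "n > 0" "a [^] n \<in> H" by auto
  have least: "n \<le> m" if "m > 0" "a [^] m \<in> H" for m :: nat
    unfolding n_def using Least_le[of "\<lambda>n. n > 0 \<and> a [^] n \<in> H" m] that by blast
  obtain t :: 'k where t: "t ^ n = \<psi> (a [^] n)" using nth_root_exists[OF n(1)] by blast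
  have nz: "\<psi> (a [^] n) \<noteq> 0" using hom_unit_groupD(1)[OF \<psi>] n by simp
  have pow_\<psi>: "x [^] q \<in> H \<and> \<psi> (x [^] q) = \<psi> x ^ q" if "x \<in> H" for x and q :: nat
  proof (induction q)
    case 0
    then show ?case using subgroup.one_closed[OF H] H.hom_unit_group_one[OF \<psi>] by simp
  next
    case (Suc q)
    then show ?case
      using hom_unit_groupD(2)[OF \<psi>, of "x [^] q" x] that H by (simp add: subgroup.m_closed)
  qed
  have t0: "t \<noteq> 0" using nz t n(1) by (metis power_eq_0_iff)
  have "\<psi> (a [^] m) = t ^ m" if m: "a [^] m \<in> H" for m :: nat
  proof -
    define q :: nat where "q = m div n"
    have split: "a [^] m = (a [^] n) [^] q \<otimes> a [^] (m mod n)"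
      using a by (simp add: nat_pow_pow nat_pow_mult q_def)
    have q: "(a [^] n) [^] q \<in> H" "\<psi> ((a [^] n) [^] q) = \<psi> (a [^] n) ^ q"
      using pow_\<psi>[OF n(2)] by auto
    have "a [^] (m mod n) = inv ((a [^] n) [^] q) \<otimes> a [^] m"
      using a by (simp add: split m_assoc[symmetric])
    then have "a [^] (m mod n) \<in> H"
      using m q H by (simp add: subgroup.m_closed subgroup.m_inv_closed)
    then have "m mod n = 0" using least[of "m mod n"] mod_less_divisor[OF n(1), of m] by linarith
    then have m: "m = n * q" unfolding q_def by (metis add.right_neutral mult_div_mod_eq)
    have "a [^] m = (a [^] n) [^] q" unfolding m using a by (simp add: nat_pow_pow)
    then have "\<psi> (a [^] m) = (t ^ n) ^ q" using q(2) t by simp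
    then show "\<psi> (a [^] m) = t ^ m" by (simp add: m power_mult)
  qed
  from extend_character_by_root[OF fin H \<psi> a t0 this] show ?thesis by blast
qed

text \<open>Some subgroup containing \<open>u\<close> carries a character that is non-trivial at
  \<open>u\<close>. Among such subgroups one of largest cardinality is the whole group, as otherwise
  \<open>extend_character\<close> would enlarge it.\<close>

lemma characters_separate_points:
  assumes fin: "finite (carrier G)" and u: "u \<in> carrier G" "u \<noteq> \<one>"
  obtains \<chi> :: "'a \<Rightarrow> 'k::{alg_closed_field, field_char_0}"
  where "\<chi> \<in> hom G unit_group" "\<chi> u \<noteq> 1"
proof -
  define P :: "'a set \<Rightarrow> ('a \<Rightarrow> 'k) \<Rightarrow> bool" where
    "P H \<psi> \<longleftrightarrow> subgroup H G \<and> u \<in> H \<and> \<psi> \<in> hom (G\<lparr>carrier := H\<rparr>) unit_group \<and> \<psi> u \<noteq> 1" for H \<psi>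
  define n where "n = ord u"
  have "n \<noteq> 0" "n \<noteq> 1"
    unfolding n_def using fin u ord_ge_1 ord_eq_1 by force+
  then have n: "n \<ge> 2" by auto
  \<comment> \<open>A root of \<open>1 + X + ... + X ^ (n - 1)\<close> is an \<open>n\<close>-th
    root of unity. It differs from \<open>1\<close>, where the polynomial takes the value
    \<open>n\<close>, which is non-zero in characteristic 0.\<close>
  obtain t :: 'k where t: "(\<Sum>k \<le> n - 1. 1 * t ^ k) = 0"
    using alg_closed[of "n - 1" "\<lambda>_. 1 :: 'k"] n by auto
  have "t \<noteq> 1" using t n by auto
  have "t ^ n = 1"
  proof -
    have "{..n - 1} = {..<n}" using n by auto
    then have "t ^ n - 1 = 0" using t power_diff_1_eq[of t n] by simp
    then show ?thesis by simp
  qed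
  then have "t \<noteq> 0" using n by (metis power_0_left zero_neq_one not_numeral_le_zero)
  interpret triv: group "G\<lparr>carrier := {\<one>}\<rparr>" by (rule subgroup_imp_group[OF triv_subgroup])
  have "\<exists>K \<psi>'. subgroup K G \<and> {\<one>} \<subseteq> K \<and> u \<in> K \<and> \<psi>' \<in> hom (G\<lparr>carrier := K\<rparr>) unit_group \<and>
    (\<forall>x \<in> {\<one>}. \<psi>' x = 1) \<and> \<psi>' u = t"
  proof (rule extend_character_by_root[OF fin triv_subgroup _ u(1) \<open>t \<noteq> 0\<close>])
    show "(\<lambda>_. 1) \<in> hom (G\<lparr>carrier := {\<one>}\<rparr>) unit_group" by (rule hom_unit_groupI) auto
    fix m :: nat assume "u [^] m \<in> {\<one>}"
    then have "n dvd m" unfolding n_def using u pow_eq_id by auto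
    then show "1 = t ^ m" using \<open>t ^ n = 1\<close> by (auto simp: dvd_def power_mult)
  qed
  then obtain K \<psi>' where "subgroup K G" "u \<in> K" "\<psi>' \<in> hom (G\<lparr>carrier := K\<rparr>) unit_group" "\<psi>' u = t"
    by blast
  then have "P K \<psi>'" using \<open>t \<noteq> 1\<close> by (simp add: P_def)
  have sub: "H \<subseteq> carrier G" if "P H \<psi>" for H \<psi> using that by (auto simp: P_def dest: subgroup.subset)
  have "card H < Suc (card (carrier G))" if "P H \<psi>" for H \<psi>
    using sub[OF that] fin by (simp add: card_mono less_Suc_eq_le)
  then obtain H \<psi> where H: "P H \<psi>" and max: "\<And>K \<phi>. P K \<phi> \<Longrightarrow> card K \<le> card H"
    using ex_has_greatest_nat[of "\<lambda>H. Ex (P H)" K card "Suc (card (carrier G))"] \<open>P K \<psi>'\<close>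
    by (metis less_imp_le)
  have "carrier G \<subseteq> H"
  proof
    fix a assume "a \<in> carrier G"
    then obtain K \<phi> where K: "subgroup K G" "H \<subseteq> K" "a \<in> K"
      "\<phi> \<in> hom (G\<lparr>carrier := K\<rparr>) unit_group" "\<And>x. x \<in> H \<Longrightarrow> \<phi> x = \<psi> x"
      using extend_character[OF fin, of H \<psi> a] H by (auto simp: P_def)
    have PK: "P K \<phi>" using H K by (auto simp: P_def)
    have "H = K"
      by (rule card_seteq[OF finite_subset[OF sub[OF PK] fin] K(2) max[OF PK]])
    then show "a \<in> H" using K by simp
  qed
  then have "H = carrier G" using sub[OF H] by blast
  then show ?thesis using H that[of \<psi>] by (simp add: P_def)
qed

end

text \<open>The hypotheses identify \<open>G\<close> with the characters of \<open>U\<close>, so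
  injectivity of the map is separation of the points of \<open>U\<close>. For surjectivity, a
  character of \<open>G\<close> that is missed is orthogonal to every \<open>\<beta> _ u\<close>;
  summing these relations over \<open>u\<close> isolates its value at the identity and gives
  \<open>card (carrier U) = 0\<close>. No count of characters enters.\<close>

lemma perfect_pairing_iso:
  fixes \<beta> :: "'g \<Rightarrow> 'u \<Rightarrow> 'k::{alg_closed_field, field_char_0}"
  assumes G: "group G" "finite (carrier G)" and U: "comm_group U" "finite (carrier U)"
    and \<beta>_left: "\<And>u. u \<in> carrier U \<Longrightarrow> (\<lambda>g. \<beta> g u) \<in> hom G unit_group"
    and \<beta>_right: "\<And>g. g \<in> carrier G \<Longrightarrow> \<beta> g \<in> hom U unit_group"
    and inj: "\<And>g h. \<lbrakk>g \<in> carrier G; h \<in> carrier G; \<And>u. u \<in> carrier U \<Longrightarrow> \<beta> g u = \<beta> h u\<rbrakk> \<Longrightarrow> g = h"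
    and surj: "\<And>\<psi>. \<psi> \<in> hom U (unit_group :: 'k monoid) \<Longrightarrow>
      \<exists>g \<in> carrier G. \<forall>u \<in> carrier U. \<psi> u = \<beta> g u"
  shows "(\<lambda>u. \<lambda>g \<in> carrier G. \<beta> g u) \<in> iso U (character_group G)"
proof -
  interpret G: group G by fact
  interpret U: comm_group U by fact
  let ?f = "\<lambda>u. \<lambda>g \<in> carrier G. \<beta> g u"
  have hom: "?f \<in> hom U (character_group G)"
  proof (rule homI)
    fix u assume "u \<in> carrier U"
    from hom_unit_groupD[OF \<beta>_left[OF this]] show "?f u \<in> carrier (character_group G)"
      by (auto simp: character_group_def intro!: hom_unit_groupI)
  next
    fix u v assume "u \<in> carrier U" "v \<in> carrier U"
    then show "?f (u \<otimes>\<^bsub>U\<^esub> v) = ?f u \<otimes>\<^bsub>character_group G\<^esub> ?f v"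
      using hom_unit_groupD(2)[OF \<beta>_right]
      by (auto simp: character_group_def restrict_def)
  qed
  interpret D: group "character_group G :: ('g \<Rightarrow> 'k) monoid" by (rule G.group_character_group)
  interpret f: group_hom U "character_group G" ?f
    using hom by unfold_locales
  have "kernel U (character_group G) ?f = {\<one>\<^bsub>U\<^esub>}"
  proof (rule ccontr)
    assume "kernel U (character_group G) ?f \<noteq> {\<one>\<^bsub>U\<^esub>}"
    then obtain u where u: "u \<in> carrier U" "?f u = \<one>\<^bsub>character_group G\<^esub>" "u \<noteq> \<one>\<^bsub>U\<^esub>"
      using subgroup.one_closed[OF f.subgroup_kernel] by (auto simp: kernel_def)
    obtain \<chi> :: "'u \<Rightarrow> 'k" where \<chi>: "\<chi> \<in> hom U unit_group" "\<chi> u \<noteq> 1"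
      using U.characters_separate_points[OF U(2) u(1,3)] by blast
    obtain g where g: "g \<in> carrier G" "\<chi> u = \<beta> g u" using surj[OF \<chi>(1)] u(1) by blast
    have "\<beta> g u = 1" using fun_cong[OF u(2), of g] g(1) by (simp add: character_group_def)
    then show False using g(2) \<chi>(2) by simp
  qed
  then have inj_f: "inj_on ?f (carrier U)" by (rule f.trivial_ker_imp_inj)
  have "\<chi> \<in> ?f ` carrier U" if \<chi>: "\<chi> \<in> carrier (character_group G)" for \<chi>
  proof (rule ccontr)
    assume contr: "\<chi> \<notin> ?f ` carrier U"
    have \<chi>': "\<chi> \<in> hom G unit_group" "\<chi> \<in> extensional (carrier G)"
      using \<chi> by (auto simp: character_group_def)
    have \<beta>_inv: "inverse (\<beta> g u) = \<beta> (inv\<^bsub>G\<^esub> g) u" if "g \<in> carrier G" "u \<in> carrier U" for g u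
    proof -
      have "\<beta> g u * \<beta> (inv\<^bsub>G\<^esub> g) u = 1"
        using hom_unit_groupD(2)[OF \<beta>_left, of u g "inv\<^bsub>G\<^esub> g"] that
          G.hom_unit_group_one[OF \<beta>_left] by simp
      then show ?thesis by (metis inverse_unique)
    qed
    \<comment> \<open>The quotient of \<open>\<chi>\<close> by \<open>\<beta> _ u\<close> is a
      non-trivial character of \<open>G\<close>.\<close>
    have zero: "(\<Sum>g \<in> carrier G. \<chi> g * inverse (\<beta> g u)) = 0" if u: "u \<in> carrier U" for u
    proof -
      have "\<chi> \<noteq> ?f u" using contr u by blast
      then obtain h where h: "h \<in> carrier G" "\<chi> h \<noteq> \<beta> h u"
        using extensionalityI[OF \<chi>'(2) restrict_extensional] by (metis restrict_apply')
      have "(\<lambda>g. \<chi> g * inverse (\<beta> g u)) \<in> hom G unit_group"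
        using hom_unit_groupD[OF \<chi>'(1)] hom_unit_groupD[OF \<beta>_left[OF u]]
        by (intro hom_unit_groupI) auto
      moreover have "\<chi> h * inverse (\<beta> h u) \<noteq> 1"
        using h hom_unit_groupD(1)[OF \<beta>_left[OF u] h(1)] by (simp add: field_simps)
      ultimately show ?thesis using G.sum_character_eq_0 h(1) by blast
    qed
    \<comment> \<open>For \<open>g\<close> other than the identity, the inverses of the values of
      \<open>\<beta> g\<close> are those of a character of \<open>U\<close> that is non-trivial by
      \<open>inj\<close>.\<close>
    have "(\<Sum>u \<in> carrier U. inverse (\<beta> g u)) = (if g = \<one>\<^bsub>G\<^esub> then of_nat (card (carrier U)) else 0)"
      if g: "g \<in> carrier G" for g
    proof (cases "g = \<one>\<^bsub>G\<^esub>")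
      case True
      then show ?thesis using G.hom_unit_group_one[OF \<beta>_left] by simp
    next
      case False
      then have ne: "inv\<^bsub>G\<^esub> g \<noteq> \<one>\<^bsub>G\<^esub>" using g by simp
      have "\<exists>u \<in> carrier U. \<beta> (inv\<^bsub>G\<^esub> g) u \<noteq> 1"
      proof (rule ccontr)
        assume "\<not> ?thesis"
        then have "inv\<^bsub>G\<^esub> g = \<one>\<^bsub>G\<^esub>"
          using inj[of "inv\<^bsub>G\<^esub> g" "\<one>\<^bsub>G\<^esub>"] g G.hom_unit_group_one[OF \<beta>_left] by simp
        then show False using ne by simp
      qed
      then have "(\<Sum>u \<in> carrier U. \<beta> (inv\<^bsub>G\<^esub> g) u) = 0"
        using U.sum_character_eq_0[OF \<beta>_right[of "inv\<^bsub>G\<^esub> g"]] g by blast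
      then show ?thesis using False g by (simp add: \<beta>_inv)
    qed
    then have "(\<Sum>g \<in> carrier G. \<chi> g * (\<Sum>u \<in> carrier U. inverse (\<beta> g u)))
        = (\<Sum>g \<in> carrier G. if g = \<one>\<^bsub>G\<^esub> then \<chi> g * of_nat (card (carrier U)) else 0)"
      by (intro sum.cong) auto
    also have "\<dots> = of_nat (card (carrier U))"
      using G(2) G.hom_unit_group_one[OF \<chi>'(1)] by (simp add: sum.delta)
    also have "(\<Sum>g \<in> carrier G. \<chi> g * (\<Sum>u \<in> carrier U. inverse (\<beta> g u)))
        = (\<Sum>u \<in> carrier U. \<Sum>g \<in> carrier G. \<chi> g * inverse (\<beta> g u))"
      by (subst sum.swap) (simp add: sum_distrib_left)
    also have "\<dots> = 0" using zero by simp
    finally have "card (carrier U) = 0" by (metis of_nat_eq_0_iff)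
    then show False using U(2) U.one_closed by (metis card_0_eq empty_iff)
  qed
  moreover have "?f u \<in> carrier (character_group G)" if "u \<in> carrier U" for u
    using hom that by (rule hom_in_carrier)
  ultimately show ?thesis
    using hom inj_f unfolding iso_def bij_betw_def by blast
qed

section \<open>String diagrams in strict ribbon categories\<close>

text \<open>Objects are words, so that the tensor product of objects is \<open>@\<close>: its
  associativity and unit laws are equations, and the simplifier can check the types of all
  composites. Arrows of the wrong type are left unconstrained.\<close>

locale strict_monoidal =
  fixes ar :: "'a \<Rightarrow> bool" and dm cd :: "'a \<Rightarrow> 'w list" and I :: "'w list \<Rightarrow> 'a"
    and cmp_s :: "'a \<Rightarrow> 'a \<Rightarrow> 'a" (infixr "\<cdot>\<^sub>s" 60)
    and tns_s :: "'a \<Rightarrow> 'a \<Rightarrow> 'a" (infixr "\<otimes>\<^sub>s" 70)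
    and sc :: "'k::field \<Rightarrow> 'a \<Rightarrow> 'a"
  assumes ar_I [simp]: "ar (I w)" "dm (I w) = w" "cd (I w) = w"
    and ar_cmp [simp]: "\<lbrakk>ar f; ar g; cd f = dm g\<rbrakk> \<Longrightarrow> ar (g \<cdot>\<^sub>s f)"
    and dm_cmp [simp]: "\<lbrakk>ar f; ar g; cd f = dm g\<rbrakk> \<Longrightarrow> dm (g \<cdot>\<^sub>s f) = dm f"
    and cd_cmp [simp]: "\<lbrakk>ar f; ar g; cd f = dm g\<rbrakk> \<Longrightarrow> cd (g \<cdot>\<^sub>s f) = cd g"
    and cmp_I [simp]: "\<lbrakk>ar f; dm f = w\<rbrakk> \<Longrightarrow> f \<cdot>\<^sub>s I w = f"
    and I_cmp [simp]: "\<lbrakk>ar f; cd f = w\<rbrakk> \<Longrightarrow> I w \<cdot>\<^sub>s f = f"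
    and cmp_assoc: "\<lbrakk>ar f; ar g; ar h; cd f = dm g; cd g = dm h\<rbrakk>
      \<Longrightarrow> (h \<cdot>\<^sub>s g) \<cdot>\<^sub>s f = h \<cdot>\<^sub>s (g \<cdot>\<^sub>s f)"
    and ar_tns [simp]: "\<lbrakk>ar f; ar g\<rbrakk> \<Longrightarrow> ar (f \<otimes>\<^sub>s g)"
    and dm_tns [simp]: "\<lbrakk>ar f; ar g\<rbrakk> \<Longrightarrow> dm (f \<otimes>\<^sub>s g) = dm f @ dm g"
    and cd_tns [simp]: "\<lbrakk>ar f; ar g\<rbrakk> \<Longrightarrow> cd (f \<otimes>\<^sub>s g) = cd f @ cd g"
    and tns_assoc: "\<lbrakk>ar f; ar g; ar h\<rbrakk> \<Longrightarrow> (f \<otimes>\<^sub>s g) \<otimes>\<^sub>s h = f \<otimes>\<^sub>s (g \<otimes>\<^sub>s h)"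
    and tns_I: "I v \<otimes>\<^sub>s I w = I (v @ w)"
    and tns_I_Nil [simp]: "ar f \<Longrightarrow> f \<otimes>\<^sub>s I [] = f" "ar f \<Longrightarrow> I [] \<otimes>\<^sub>s f = f"
    and interchange: "\<lbrakk>ar f; ar f'; ar g; ar g'; cd f = dm f'; cd g = dm g'\<rbrakk>
      \<Longrightarrow> (f' \<otimes>\<^sub>s g') \<cdot>\<^sub>s (f \<otimes>\<^sub>s g) = (f' \<cdot>\<^sub>s f) \<otimes>\<^sub>s (g' \<cdot>\<^sub>s g)"
    and ar_sc [simp]: "ar f \<Longrightarrow> ar (sc k f)" "dm (sc k f) = dm f" "cd (sc k f) = cd f"
    and sc_cmp [simp]: "\<lbrakk>ar f; ar g; cd f = dm g\<rbrakk> \<Longrightarrow> sc k g \<cdot>\<^sub>s f = sc k (g \<cdot>\<^sub>s f)"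
      "\<lbrakk>ar f; ar g; cd f = dm g\<rbrakk> \<Longrightarrow> g \<cdot>\<^sub>s sc k f = sc k (g \<cdot>\<^sub>s f)"
    and sc_tns [simp]: "\<lbrakk>ar f; ar g\<rbrakk> \<Longrightarrow> sc k f \<otimes>\<^sub>s g = sc k (f \<otimes>\<^sub>s g)"
      "\<lbrakk>ar f; ar g\<rbrakk> \<Longrightarrow> f \<otimes>\<^sub>s sc k g = sc k (f \<otimes>\<^sub>s g)"
    and sc_sc [simp]: "sc k (sc l f) = sc (k * l) f"
begin

lemma slide:
  assumes "ar f" "ar g"
  shows "(f \<otimes>\<^sub>s I (cd g)) \<cdot>\<^sub>s (I (dm f) \<otimes>\<^sub>s g) = f \<otimes>\<^sub>s g"
    and "(I (cd f) \<otimes>\<^sub>s g) \<cdot>\<^sub>s (f \<otimes>\<^sub>s I (dm g)) = f \<otimes>\<^sub>s g"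
  using assms by (simp_all add: interchange)

lemma whisker_left: "\<lbrakk>ar f; ar g; cd f = dm g\<rbrakk> \<Longrightarrow> I w \<otimes>\<^sub>s (g \<cdot>\<^sub>s f) = (I w \<otimes>\<^sub>s g) \<cdot>\<^sub>s (I w \<otimes>\<^sub>s f)"
  by (simp add: interchange)

lemma whisker_right: "\<lbrakk>ar f; ar g; cd f = dm g\<rbrakk> \<Longrightarrow> (g \<cdot>\<^sub>s f) \<otimes>\<^sub>s I w = (g \<otimes>\<^sub>s I w) \<cdot>\<^sub>s (f \<otimes>\<^sub>s I w)"
  by (simp add: interchange)

lemma tns_I_left: "ar f \<Longrightarrow> I v \<otimes>\<^sub>s I w \<otimes>\<^sub>s f = I (v @ w) \<otimes>\<^sub>s f"
  by (simp add: tns_assoc[symmetric] tns_I)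

definition dual_pair :: "'w list \<Rightarrow> 'w list \<Rightarrow> 'a \<Rightarrow> 'a \<Rightarrow> bool" where
  "dual_pair x y e n \<longleftrightarrow> ar e \<and> dm e = y @ x \<and> cd e = [] \<and> ar n \<and> dm n = [] \<and> cd n = x @ y \<and>
     (I x \<otimes>\<^sub>s e) \<cdot>\<^sub>s (n \<otimes>\<^sub>s I x) = I x \<and> (e \<otimes>\<^sub>s I y) \<cdot>\<^sub>s (I y \<otimes>\<^sub>s n) = I y"

lemma dual_pairD:
  assumes "dual_pair x y e n"
  shows "ar e" "dm e = y @ x" "cd e = []" "ar n" "dm n = []" "cd n = x @ y"
  using assms by (auto simp: dual_pair_def)

lemma dual_pair_zigzag:
  assumes "dual_pair x y e n"
  shows "(I x \<otimes>\<^sub>s e) \<cdot>\<^sub>s (n \<otimes>\<^sub>s I x) = I x" "(e \<otimes>\<^sub>s I y) \<cdot>\<^sub>s (I y \<otimes>\<^sub>s n) = I y"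
  using assms by (auto simp: dual_pair_def)

text \<open>The strand \<open>x'\<close> is bent and bent back. Sliding \<open>k\<close> past the
  cap \<open>e\<close> brings cap and cup together, and the zigzag identity straightens the strand.
  With \<open>transpose_up_down\<close> this is the adjunction between \<open>x' @ _\<close> and
  \<open>x @ _\<close>.\<close>

lemma transpose_down_up:
  assumes d: "dual_pair x x' e n" and k: "ar k" "dm k = x' @ a" "cd k = b"
  shows "(e \<otimes>\<^sub>s I b) \<cdot>\<^sub>s (I x' \<otimes>\<^sub>s ((I x \<otimes>\<^sub>s k) \<cdot>\<^sub>s (n \<otimes>\<^sub>s I a))) = k"
proof -
  note [simp] = dual_pairD[OF d] k
  have "(e \<otimes>\<^sub>s I b) \<cdot>\<^sub>s (I x' \<otimes>\<^sub>s ((I x \<otimes>\<^sub>s k) \<cdot>\<^sub>s (n \<otimes>\<^sub>s I a)))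
      = (e \<otimes>\<^sub>s I b) \<cdot>\<^sub>s (I (x' @ x) \<otimes>\<^sub>s k) \<cdot>\<^sub>s (I x' \<otimes>\<^sub>s n \<otimes>\<^sub>s I a)"
    by (simp add: whisker_left tns_I_left)
  also have "\<dots> = ((e \<otimes>\<^sub>s I b) \<cdot>\<^sub>s (I (x' @ x) \<otimes>\<^sub>s k)) \<cdot>\<^sub>s (I x' \<otimes>\<^sub>s n \<otimes>\<^sub>s I a)"
    by (simp add: cmp_assoc)
  also have "(e \<otimes>\<^sub>s I b) \<cdot>\<^sub>s (I (x' @ x) \<otimes>\<^sub>s k) = k \<cdot>\<^sub>s (e \<otimes>\<^sub>s I (x' @ a))"
    using slide[of e k] by simp
  also have "(k \<cdot>\<^sub>s (e \<otimes>\<^sub>s I (x' @ a))) \<cdot>\<^sub>s (I x' \<otimes>\<^sub>s n \<otimes>\<^sub>s I a)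
      = k \<cdot>\<^sub>s (((e \<otimes>\<^sub>s I x') \<cdot>\<^sub>s (I x' \<otimes>\<^sub>s n)) \<otimes>\<^sub>s I a)"
    by (simp add: cmp_assoc whisker_right tns_assoc tns_I)
  also have "\<dots> = k"
    by (simp add: dual_pair_zigzag[OF d] tns_I)
  finally show ?thesis .
qed

lemma transpose_up_down:
  assumes d: "dual_pair x x' e n" and k: "ar l" "dm l = a" "cd l = x @ b"
  shows "(I x \<otimes>\<^sub>s ((e \<otimes>\<^sub>s I b) \<cdot>\<^sub>s (I x' \<otimes>\<^sub>s l))) \<cdot>\<^sub>s (n \<otimes>\<^sub>s I a) = l"
proof -
  note [simp] = dual_pairD[OF d] k
  have "(I x \<otimes>\<^sub>s ((e \<otimes>\<^sub>s I b) \<cdot>\<^sub>s (I x' \<otimes>\<^sub>s l))) \<cdot>\<^sub>s (n \<otimes>\<^sub>s I a)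
      = (I x \<otimes>\<^sub>s e \<otimes>\<^sub>s I b) \<cdot>\<^sub>s (I (x @ x') \<otimes>\<^sub>s l) \<cdot>\<^sub>s (n \<otimes>\<^sub>s I a)"
    by (simp add: whisker_left tns_I_left cmp_assoc)
  also have "(I (x @ x') \<otimes>\<^sub>s l) \<cdot>\<^sub>s (n \<otimes>\<^sub>s I a) = (n \<otimes>\<^sub>s I (x @ b)) \<cdot>\<^sub>s l"
    using slide[of n l] by simp
  also have "(I x \<otimes>\<^sub>s e \<otimes>\<^sub>s I b) \<cdot>\<^sub>s (n \<otimes>\<^sub>s I (x @ b)) \<cdot>\<^sub>s l
      = (((I x \<otimes>\<^sub>s e) \<cdot>\<^sub>s (n \<otimes>\<^sub>s I x)) \<otimes>\<^sub>s I b) \<cdot>\<^sub>s l"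
    by (simp add: cmp_assoc whisker_right tns_assoc tns_I)
  also have "\<dots> = l"
    by (simp add: dual_pair_zigzag[OF d] tns_I)
  finally show ?thesis .
qed

text \<open>Nested caps and cups, with the dual words in reversed order. In each zigzag a cup of one
  factor slides past a cap of the other, which leaves one zigzag of \<open>v\<close> and one of
  \<open>y\<close>.\<close>

lemma dual_pair_tns:
  assumes v: "dual_pair v v' \<epsilon> nv" and y: "dual_pair y y' ey ny"
  shows "dual_pair (v @ y) (y' @ v') (ey \<cdot>\<^sub>s (I y' \<otimes>\<^sub>s \<epsilon> \<otimes>\<^sub>s I y)) ((I v \<otimes>\<^sub>s ny \<otimes>\<^sub>s I v') \<cdot>\<^sub>s nv)"
proof -
  note [simp] = dual_pairD[OF v] dual_pairD[OF y]
  let ?e = "ey \<cdot>\<^sub>s (I y' \<otimes>\<^sub>s \<epsilon> \<otimes>\<^sub>s I y)" and ?n = "(I v \<otimes>\<^sub>s ny \<otimes>\<^sub>s I v') \<cdot>\<^sub>s nv"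
  have "(I (v @ y) \<otimes>\<^sub>s ?e) \<cdot>\<^sub>s (?n \<otimes>\<^sub>s I (v @ y))
     = (I v \<otimes>\<^sub>s ((I y \<otimes>\<^sub>s ey) \<cdot>\<^sub>s (I (y @ y') \<otimes>\<^sub>s \<epsilon> \<otimes>\<^sub>s I y) \<cdot>\<^sub>s (ny \<otimes>\<^sub>s I (v' @ v @ y)))) \<cdot>\<^sub>s
       (nv \<otimes>\<^sub>s I (v @ y))"
    by (simp add: whisker_left whisker_right tns_assoc tns_I tns_I_left cmp_assoc)
  also have "(I (y @ y') \<otimes>\<^sub>s \<epsilon> \<otimes>\<^sub>s I y) \<cdot>\<^sub>s (ny \<otimes>\<^sub>s I (v' @ v @ y)) = (ny \<otimes>\<^sub>s I y) \<cdot>\<^sub>s (\<epsilon> \<otimes>\<^sub>s I y)"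
    using slide[of ny "\<epsilon> \<otimes>\<^sub>s I y"] by (simp add: tns_I_left)
  also have "(I y \<otimes>\<^sub>s ey) \<cdot>\<^sub>s (ny \<otimes>\<^sub>s I y) \<cdot>\<^sub>s (\<epsilon> \<otimes>\<^sub>s I y) = \<epsilon> \<otimes>\<^sub>s I y"
    by (simp add: cmp_assoc[symmetric] dual_pair_zigzag[OF y])
  also have "(I v \<otimes>\<^sub>s \<epsilon> \<otimes>\<^sub>s I y) \<cdot>\<^sub>s (nv \<otimes>\<^sub>s I (v @ y)) = ((I v \<otimes>\<^sub>s \<epsilon>) \<cdot>\<^sub>s (nv \<otimes>\<^sub>s I v)) \<otimes>\<^sub>s I y"
    by (simp add: whisker_right tns_assoc tns_I)
  also have "\<dots> = I (v @ y)" by (simp add: dual_pair_zigzag[OF v] tns_I)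
  finally have 1: "(I (v @ y) \<otimes>\<^sub>s ?e) \<cdot>\<^sub>s (?n \<otimes>\<^sub>s I (v @ y)) = I (v @ y)" .
  have "(?e \<otimes>\<^sub>s I (y' @ v')) \<cdot>\<^sub>s (I (y' @ v') \<otimes>\<^sub>s ?n)
    = (ey \<otimes>\<^sub>s I (y' @ v')) \<cdot>\<^sub>s
      (I y' \<otimes>\<^sub>s ((\<epsilon> \<otimes>\<^sub>s I (y @ y' @ v')) \<cdot>\<^sub>s (I (v' @ v) \<otimes>\<^sub>s ny \<otimes>\<^sub>s I v') \<cdot>\<^sub>s (I v' \<otimes>\<^sub>s nv)))"
    by (simp add: whisker_left whisker_right tns_assoc tns_I tns_I_left cmp_assoc)
  also have "(\<epsilon> \<otimes>\<^sub>s I (y @ y' @ v')) \<cdot>\<^sub>s (I (v' @ v) \<otimes>\<^sub>s ny \<otimes>\<^sub>s I v') \<cdot>\<^sub>s (I v' \<otimes>\<^sub>s nv)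
     = ((\<epsilon> \<otimes>\<^sub>s I (y @ y' @ v')) \<cdot>\<^sub>s (I (v' @ v) \<otimes>\<^sub>s ny \<otimes>\<^sub>s I v')) \<cdot>\<^sub>s (I v' \<otimes>\<^sub>s nv)"
    by (simp add: cmp_assoc)
  also have "(\<epsilon> \<otimes>\<^sub>s I (y @ y' @ v')) \<cdot>\<^sub>s (I (v' @ v) \<otimes>\<^sub>s ny \<otimes>\<^sub>s I v') = (ny \<otimes>\<^sub>s I v') \<cdot>\<^sub>s (\<epsilon> \<otimes>\<^sub>s I v')"
    using slide[of \<epsilon> "ny \<otimes>\<^sub>s I v'"] by simp
  also have "((ny \<otimes>\<^sub>s I v') \<cdot>\<^sub>s (\<epsilon> \<otimes>\<^sub>s I v')) \<cdot>\<^sub>s (I v' \<otimes>\<^sub>s nv) = ny \<otimes>\<^sub>s I v'"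
    by (simp add: cmp_assoc dual_pair_zigzag[OF v])
  also have "(ey \<otimes>\<^sub>s I (y' @ v')) \<cdot>\<^sub>s (I y' \<otimes>\<^sub>s ny \<otimes>\<^sub>s I v') = ((ey \<otimes>\<^sub>s I y') \<cdot>\<^sub>s (I y' \<otimes>\<^sub>s ny)) \<otimes>\<^sub>s I v'"
    by (simp add: whisker_right tns_assoc tns_I)
  also have "\<dots> = I (y' @ v')" by (simp add: dual_pair_zigzag[OF y] tns_I)
  finally show ?thesis using 1 by (simp add: dual_pair_def)
qed

text \<open>An endomorphism of the dual is determined by its transpose, which is an endomorphism of
  \<open>x\<close>; undoing the transposition carries a scalar to the same scalar.\<close>

lemma dual_endo_scalar:
  assumes d: "dual_pair x x' e n" and f: "ar f" "dm f = x'" "cd f = x'"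
    and sc: "(I x \<otimes>\<^sub>s (e \<cdot>\<^sub>s (f \<otimes>\<^sub>s I x))) \<cdot>\<^sub>s (n \<otimes>\<^sub>s I x) = sc a (I x)"
  shows "f = sc a (I x')"
proof -
  note [simp] = dual_pairD[OF d] f
  have "e \<cdot>\<^sub>s (f \<otimes>\<^sub>s I x) = (e \<otimes>\<^sub>s I []) \<cdot>\<^sub>s (I x' \<otimes>\<^sub>s ((I x \<otimes>\<^sub>s (e \<cdot>\<^sub>s (f \<otimes>\<^sub>s I x))) \<cdot>\<^sub>s (n \<otimes>\<^sub>s I x)))"
    using transpose_down_up[OF d, of "e \<cdot>\<^sub>s (f \<otimes>\<^sub>s I x)" x "[]"] by simp
  also have "\<dots> = sc a e" unfolding sc by (simp add: tns_I)
  finally have *: "e \<cdot>\<^sub>s (f \<otimes>\<^sub>s I x) = sc a e" .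
  \<comment> \<open>The zigzag identity recovers \<open>f\<close> from the composite computed in
    \<open>*\<close>.\<close>
  have "f = ((e \<otimes>\<^sub>s I x') \<cdot>\<^sub>s (I x' \<otimes>\<^sub>s n)) \<cdot>\<^sub>s f" by (simp add: dual_pair_zigzag[OF d])
  also have "\<dots> = (e \<otimes>\<^sub>s I x') \<cdot>\<^sub>s (f \<otimes>\<^sub>s n)"
    using slide(2)[of f n] by (simp add: cmp_assoc)
  also have "f \<otimes>\<^sub>s n = (f \<otimes>\<^sub>s I (x @ x')) \<cdot>\<^sub>s (I x' \<otimes>\<^sub>s n)"
    using slide(1)[of f n] by simp
  also have "(e \<otimes>\<^sub>s I x') \<cdot>\<^sub>s (f \<otimes>\<^sub>s I (x @ x')) \<cdot>\<^sub>s (I x' \<otimes>\<^sub>s n)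
     = ((e \<cdot>\<^sub>s (f \<otimes>\<^sub>s I x)) \<otimes>\<^sub>s I x') \<cdot>\<^sub>s (I x' \<otimes>\<^sub>s n)"
    by (simp add: whisker_right tns_assoc tns_I cmp_assoc)
  also have "\<dots> = sc a (I x')" unfolding * by (simp add: dual_pair_zigzag[OF d])
  finally show ?thesis .
qed

end

section \<open>Braiding, twist and partial traces\<close>

locale strict_ribbon = strict_monoidal ar dm cd I cmp_s tns_s sc
  for ar :: "'a \<Rightarrow> bool" and dm cd :: "'a \<Rightarrow> 'w list" and I :: "'w list \<Rightarrow> 'a"
    and cmp_s :: "'a \<Rightarrow> 'a \<Rightarrow> 'a" (infixr "\<cdot>\<^sub>s" 60)
    and tns_s :: "'a \<Rightarrow> 'a \<Rightarrow> 'a" (infixr "\<otimes>\<^sub>s" 70)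
    and sc :: "'k::field \<Rightarrow> 'a \<Rightarrow> 'a" +
  fixes br :: "'w list \<Rightarrow> 'w list \<Rightarrow> 'a" and tw :: "'w list \<Rightarrow> 'a"
  assumes ar_br [simp]: "ar (br v w)" "dm (br v w) = v @ w" "cd (br v w) = w @ v"
    and br_natural: "\<lbrakk>ar f; ar g\<rbrakk> \<Longrightarrow> br (cd f) (cd g) \<cdot>\<^sub>s (f \<otimes>\<^sub>s g) = (g \<otimes>\<^sub>s f) \<cdot>\<^sub>s br (dm f) (dm g)"
    and br_tns_right: "br u (v @ w) = (I v \<otimes>\<^sub>s br u w) \<cdot>\<^sub>s (br u v \<otimes>\<^sub>s I w)"
    and br_tns_left: "br (u @ v) w = (br u w \<otimes>\<^sub>s I v) \<cdot>\<^sub>s (I u \<otimes>\<^sub>s br v w)"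
    and br_Nil [simp]: "br w [] = I w" "br [] w = I w"
    and ar_tw [simp]: "ar (tw w)" "dm (tw w) = w" "cd (tw w) = w"
    and tw_natural: "ar f \<Longrightarrow> tw (cd f) \<cdot>\<^sub>s f = f \<cdot>\<^sub>s tw (dm f)"
    and tw_Nil [simp]: "tw [] = I []"
    and tw_tns: "tw (v @ w) = (br w v \<cdot>\<^sub>s br v w) \<cdot>\<^sub>s (tw v \<otimes>\<^sub>s tw w)"
begin

text \<open>The evaluation \<open>x \<otimes> y \<rightarrow> 1\<close> obtained from \<open>e : y \<otimes> x \<rightarrow> 1\<close> by means of the braiding and the twist;
  \<open>ptr\<close> and \<open>str\<close> are the resulting partial trace over \<open>x\<close> and full quantum trace.\<close>

definition rcap :: "'w list \<Rightarrow> 'w list \<Rightarrow> 'a \<Rightarrow> 'a" where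
  "rcap x y e = e \<cdot>\<^sub>s br x y \<cdot>\<^sub>s (tw x \<otimes>\<^sub>s I y)"

definition ptr :: "'w list \<Rightarrow> 'w list \<Rightarrow> 'w list \<Rightarrow> 'a \<Rightarrow> 'a \<Rightarrow> 'a \<Rightarrow> 'a" where
  "ptr v x y e n h = (I v \<otimes>\<^sub>s rcap x y e) \<cdot>\<^sub>s (h \<otimes>\<^sub>s I y) \<cdot>\<^sub>s (I v \<otimes>\<^sub>s n)"

definition str :: "'w list \<Rightarrow> 'w list \<Rightarrow> 'a \<Rightarrow> 'a \<Rightarrow> 'a \<Rightarrow> 'a" where
  "str x y e n f = rcap x y e \<cdot>\<^sub>s (f \<otimes>\<^sub>s I y) \<cdot>\<^sub>s n"

lemma ar_rcap:
  assumes "dual_pair x y e n"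
  shows "ar (rcap x y e)" "dm (rcap x y e) = x @ y" "cd (rcap x y e) = []"
  using dual_pairD[OF assms] by (simp_all add: rcap_def)

text \<open>\<open>g\<close> is carried around the loop. Its transpose is \<open>t\<close>, and
  \<open>g\<close> can be exchanged for \<open>t\<close> at the cup (\<open>a\<close>), at the cap
  (\<open>b\<close>) and therefore, by naturality of braiding and twist, at the closing cap
  (\<open>c\<close>). As the two dual pairs are unrelated, the case of an identity shows that the
  trace does not depend on the chosen dual.\<close>

lemma str_cyclic:
  assumes x: "dual_pair x x' e n" and y: "dual_pair y y' e2 n2"
    and f: "ar f" "dm f = y" "cd f = x" and g: "ar g" "dm g = x" "cd g = y"
  shows "str x x' e n (f \<cdot>\<^sub>s g) = str y y' e2 n2 (g \<cdot>\<^sub>s f)"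
proof -
  note [simp] = dual_pairD[OF x] dual_pairD[OF y] f g ar_rcap[OF x] ar_rcap[OF y]
  define h where "h = (g \<otimes>\<^sub>s I x') \<cdot>\<^sub>s n"
  define t where "t = (e2 \<otimes>\<^sub>s I x') \<cdot>\<^sub>s (I y' \<otimes>\<^sub>s h)"
  have [simp]: "ar h" "dm h = []" "cd h = y @ x'" by (simp_all add: h_def)
  have [simp]: "ar t" "dm t = y'" "cd t = x'" by (simp_all add: t_def)
  have a: "(I y \<otimes>\<^sub>s t) \<cdot>\<^sub>s n2 = (g \<otimes>\<^sub>s I x') \<cdot>\<^sub>s n"
    using transpose_up_down[OF y, of h "[]" x'] by (simp add: t_def h_def)
  have "e \<cdot>\<^sub>s (t \<otimes>\<^sub>s I x) = (e \<cdot>\<^sub>s (e2 \<otimes>\<^sub>s I (x' @ x))) \<cdot>\<^sub>s (I y' \<otimes>\<^sub>s h \<otimes>\<^sub>s I x)"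
    by (simp add: t_def whisker_right tns_assoc tns_I cmp_assoc)
  also have "e \<cdot>\<^sub>s (e2 \<otimes>\<^sub>s I (x' @ x)) = e2 \<cdot>\<^sub>s (I (y' @ y) \<otimes>\<^sub>s e)"
    using slide[of e2 e] by simp
  also have "(e2 \<cdot>\<^sub>s (I (y' @ y) \<otimes>\<^sub>s e)) \<cdot>\<^sub>s (I y' \<otimes>\<^sub>s h \<otimes>\<^sub>s I x)
      = e2 \<cdot>\<^sub>s (I y' \<otimes>\<^sub>s (((I y \<otimes>\<^sub>s e) \<cdot>\<^sub>s (g \<otimes>\<^sub>s I (x' @ x))) \<cdot>\<^sub>s (n \<otimes>\<^sub>s I x)))"
    by (simp add: h_def whisker_left whisker_right tns_assoc tns_I tns_I_left cmp_assoc)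
  also have "(I y \<otimes>\<^sub>s e) \<cdot>\<^sub>s (g \<otimes>\<^sub>s I (x' @ x)) = g \<cdot>\<^sub>s (I x \<otimes>\<^sub>s e)"
    using slide[of g e] by simp
  also have "(g \<cdot>\<^sub>s (I x \<otimes>\<^sub>s e)) \<cdot>\<^sub>s (n \<otimes>\<^sub>s I x) = g"
    by (simp add: cmp_assoc dual_pair_zigzag[OF x])
  finally have b: "e \<cdot>\<^sub>s (t \<otimes>\<^sub>s I x) = e2 \<cdot>\<^sub>s (I y' \<otimes>\<^sub>s g)" .
  have "rcap x x' e \<cdot>\<^sub>s (I x \<otimes>\<^sub>s t) = e \<cdot>\<^sub>s (br x x' \<cdot>\<^sub>s (I x \<otimes>\<^sub>s t)) \<cdot>\<^sub>s (tw x \<otimes>\<^sub>s I y')"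
    using slide[of "tw x" t] by (simp add: rcap_def cmp_assoc)
  also have "br x x' \<cdot>\<^sub>s (I x \<otimes>\<^sub>s t) = (t \<otimes>\<^sub>s I x) \<cdot>\<^sub>s br x y'"
    using br_natural[of "I x" t] by simp
  also have "e \<cdot>\<^sub>s ((t \<otimes>\<^sub>s I x) \<cdot>\<^sub>s br x y') \<cdot>\<^sub>s (tw x \<otimes>\<^sub>s I y')
      = (e \<cdot>\<^sub>s (t \<otimes>\<^sub>s I x)) \<cdot>\<^sub>s br x y' \<cdot>\<^sub>s (tw x \<otimes>\<^sub>s I y')"
    by (simp add: cmp_assoc)
  also have "\<dots> = e2 \<cdot>\<^sub>s ((I y' \<otimes>\<^sub>s g) \<cdot>\<^sub>s br x y') \<cdot>\<^sub>s (tw x \<otimes>\<^sub>s I y')"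
    unfolding b by (simp add: cmp_assoc)
  also have "(I y' \<otimes>\<^sub>s g) \<cdot>\<^sub>s br x y' = br y y' \<cdot>\<^sub>s (g \<otimes>\<^sub>s I y')"
    using br_natural[of g "I y'"] by simp
  also have "e2 \<cdot>\<^sub>s (br y y' \<cdot>\<^sub>s (g \<otimes>\<^sub>s I y')) \<cdot>\<^sub>s (tw x \<otimes>\<^sub>s I y')
      = e2 \<cdot>\<^sub>s br y y' \<cdot>\<^sub>s ((g \<cdot>\<^sub>s tw x) \<otimes>\<^sub>s I y')"
    by (simp add: cmp_assoc whisker_right)
  also have "g \<cdot>\<^sub>s tw x = tw y \<cdot>\<^sub>s g" using tw_natural[of g] by simp
  also have "e2 \<cdot>\<^sub>s br y y' \<cdot>\<^sub>s ((tw y \<cdot>\<^sub>s g) \<otimes>\<^sub>s I y') = rcap y y' e2 \<cdot>\<^sub>s (g \<otimes>\<^sub>s I y')"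
    by (simp add: rcap_def cmp_assoc whisker_right)
  finally have c: "rcap x x' e \<cdot>\<^sub>s (I x \<otimes>\<^sub>s t) = rcap y y' e2 \<cdot>\<^sub>s (g \<otimes>\<^sub>s I y')" .
  have "str x x' e n (f \<cdot>\<^sub>s g) = rcap x x' e \<cdot>\<^sub>s (f \<otimes>\<^sub>s I x') \<cdot>\<^sub>s ((g \<otimes>\<^sub>s I x') \<cdot>\<^sub>s n)"
    by (simp add: str_def whisker_right cmp_assoc)
  also have "\<dots> = rcap x x' e \<cdot>\<^sub>s ((f \<otimes>\<^sub>s I x') \<cdot>\<^sub>s (I y \<otimes>\<^sub>s t)) \<cdot>\<^sub>s n2"
    unfolding a[symmetric] by (simp add: cmp_assoc)
  also have "(f \<otimes>\<^sub>s I x') \<cdot>\<^sub>s (I y \<otimes>\<^sub>s t) = (I x \<otimes>\<^sub>s t) \<cdot>\<^sub>s (f \<otimes>\<^sub>s I y')"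
    using slide[of f t] by simp
  also have "rcap x x' e \<cdot>\<^sub>s ((I x \<otimes>\<^sub>s t) \<cdot>\<^sub>s (f \<otimes>\<^sub>s I y')) \<cdot>\<^sub>s n2
      = (rcap x x' e \<cdot>\<^sub>s (I x \<otimes>\<^sub>s t)) \<cdot>\<^sub>s (f \<otimes>\<^sub>s I y') \<cdot>\<^sub>s n2"
    by (simp add: cmp_assoc)
  also have "\<dots> = str y y' e2 n2 (g \<cdot>\<^sub>s f)"
    unfolding c by (simp add: str_def whisker_right cmp_assoc)
  finally show ?thesis .
qed

text \<open>The balancing axiom \<open>tw_tns\<close> is what makes the right evaluations monoidal.\<close>

lemma rcap_tns:
  assumes v: "dual_pair v v' \<epsilon> nv" and y: "dual_pair y y' ey ny"
  shows "rcap (v @ y) (y' @ v') (ey \<cdot>\<^sub>s (I y' \<otimes>\<^sub>s \<epsilon> \<otimes>\<^sub>s I y))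
    = rcap v v' \<epsilon> \<cdot>\<^sub>s (I v \<otimes>\<^sub>s rcap y y' ey \<otimes>\<^sub>s I v')"
proof -
  note [simp] = dual_pairD[OF v] dual_pairD[OF y] ar_rcap[OF v] ar_rcap[OF y]
  define av where "av = \<epsilon> \<cdot>\<^sub>s br v v'"
  define ay where "ay = ey \<cdot>\<^sub>s br y y'"
  define m where "m = br y v \<cdot>\<^sub>s br v y"
  have [simp]: "ar av" "dm av = v @ v'" "cd av = []" "ar ay" "dm ay = y @ y'" "cd ay = []"
    "ar m" "dm m = v @ y" "cd m = v @ y"
    by (simp_all add: av_def ay_def m_def)
  \<comment> \<open>The double braiding \<open>m\<close>, contributed by the balancing axiom,
    consists of two crossings. \<open>n1\<close> spends one of them on pulling the strand
    \<open>y\<close> through the cap over \<open>v\<close>, and \<open>n4\<close> spends the other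
    on pulling \<open>v\<close> through the cap over \<open>y\<close>.\<close>
  have n1: "(av \<otimes>\<^sub>s I y) \<cdot>\<^sub>s (I v \<otimes>\<^sub>s br y v') \<cdot>\<^sub>s (br y v \<otimes>\<^sub>s I v') = I y \<otimes>\<^sub>s av"
    using br_natural[of "I y" av] by (simp add: br_tns_right)
  have n2: "(\<epsilon> \<otimes>\<^sub>s I y) \<cdot>\<^sub>s br (v @ y) v' = (av \<otimes>\<^sub>s I y) \<cdot>\<^sub>s (I v \<otimes>\<^sub>s br y v')"
    by (simp add: br_tns_left av_def whisker_right cmp_assoc)
  have n3: "br (v @ y) y' \<cdot>\<^sub>s (m \<otimes>\<^sub>s I y') = (I y' \<otimes>\<^sub>s m) \<cdot>\<^sub>s br (v @ y) y'"
    using br_natural[of m "I y'"] by simp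
  have n4: "(ey \<otimes>\<^sub>s I v) \<cdot>\<^sub>s (I y' \<otimes>\<^sub>s br v y) \<cdot>\<^sub>s br (v @ y) y' = I v \<otimes>\<^sub>s ay"
  proof -
    have "(ey \<otimes>\<^sub>s I v) \<cdot>\<^sub>s (I y' \<otimes>\<^sub>s br v y) \<cdot>\<^sub>s br (v @ y) y'
       = ((ey \<otimes>\<^sub>s I v) \<cdot>\<^sub>s br v (y' @ y)) \<cdot>\<^sub>s (I v \<otimes>\<^sub>s br y y')"
      by (simp add: br_tns_left br_tns_right cmp_assoc)
    also have "(ey \<otimes>\<^sub>s I v) \<cdot>\<^sub>s br v (y' @ y) = I v \<otimes>\<^sub>s ey"
      using br_natural[of "I v" ey] by simp
    finally show ?thesis by (simp add: ay_def whisker_left)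
  qed
  have "(ey \<cdot>\<^sub>s (I y' \<otimes>\<^sub>s \<epsilon> \<otimes>\<^sub>s I y)) \<cdot>\<^sub>s br (v @ y) (y' @ v') \<cdot>\<^sub>s (m \<otimes>\<^sub>s I (y' @ v'))
     = ey \<cdot>\<^sub>s (I y' \<otimes>\<^sub>s ((\<epsilon> \<otimes>\<^sub>s I y) \<cdot>\<^sub>s br (v @ y) v')) \<cdot>\<^sub>s
       ((br (v @ y) y' \<cdot>\<^sub>s (m \<otimes>\<^sub>s I y')) \<otimes>\<^sub>s I v')"
    by (simp add: br_tns_right[of "v @ y"] whisker_left whisker_right tns_assoc tns_I cmp_assoc)
  also have "\<dots> = ey \<cdot>\<^sub>s (I y' \<otimes>\<^sub>s ((av \<otimes>\<^sub>s I y) \<cdot>\<^sub>s (I v \<otimes>\<^sub>s br y v') \<cdot>\<^sub>s (br y v \<otimes>\<^sub>s I v'))) \<cdot>\<^sub>s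
       (I y' \<otimes>\<^sub>s br v y \<otimes>\<^sub>s I v') \<cdot>\<^sub>s (br (v @ y) y' \<otimes>\<^sub>s I v')"
    unfolding n2 n3 unfolding m_def
    by (simp add: whisker_left whisker_right tns_assoc tns_I tns_I_left cmp_assoc)
  also have "\<dots> = (ey \<cdot>\<^sub>s (I (y' @ y) \<otimes>\<^sub>s av)) \<cdot>\<^sub>s
       (I y' \<otimes>\<^sub>s br v y \<otimes>\<^sub>s I v') \<cdot>\<^sub>s (br (v @ y) y' \<otimes>\<^sub>s I v')"
    unfolding n1 by (simp add: tns_I_left cmp_assoc)
  also have "ey \<cdot>\<^sub>s (I (y' @ y) \<otimes>\<^sub>s av) = av \<cdot>\<^sub>s (ey \<otimes>\<^sub>s I (v @ v'))"
    using slide[of ey av] by simp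
  also have "(av \<cdot>\<^sub>s (ey \<otimes>\<^sub>s I (v @ v'))) \<cdot>\<^sub>s (I y' \<otimes>\<^sub>s br v y \<otimes>\<^sub>s I v') \<cdot>\<^sub>s (br (v @ y) y' \<otimes>\<^sub>s I v')
     = av \<cdot>\<^sub>s (((ey \<otimes>\<^sub>s I v) \<cdot>\<^sub>s (I y' \<otimes>\<^sub>s br v y) \<cdot>\<^sub>s br (v @ y) y') \<otimes>\<^sub>s I v')"
    by (simp add: whisker_right tns_assoc tns_I cmp_assoc)
  also have "\<dots> = av \<cdot>\<^sub>s (I v \<otimes>\<^sub>s ay \<otimes>\<^sub>s I v')"
    unfolding n4 by (simp add: tns_assoc)
  finally have core: "(ey \<cdot>\<^sub>s (I y' \<otimes>\<^sub>s \<epsilon> \<otimes>\<^sub>s I y)) \<cdot>\<^sub>s br (v @ y) (y' @ v') \<cdot>\<^sub>s (m \<otimes>\<^sub>s I (y' @ v'))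
     = av \<cdot>\<^sub>s (I v \<otimes>\<^sub>s ay \<otimes>\<^sub>s I v')" .
  have "rcap (v @ y) (y' @ v') (ey \<cdot>\<^sub>s (I y' \<otimes>\<^sub>s \<epsilon> \<otimes>\<^sub>s I y))
    = ((ey \<cdot>\<^sub>s (I y' \<otimes>\<^sub>s \<epsilon> \<otimes>\<^sub>s I y)) \<cdot>\<^sub>s br (v @ y) (y' @ v') \<cdot>\<^sub>s (m \<otimes>\<^sub>s I (y' @ v'))) \<cdot>\<^sub>s
      (tw v \<otimes>\<^sub>s tw y \<otimes>\<^sub>s I (y' @ v'))"
    unfolding rcap_def tw_tns m_def[symmetric]
    by (simp add: whisker_right[of "tw v \<otimes>\<^sub>s tw y" m] tns_assoc cmp_assoc)
  also have "\<dots> = av \<cdot>\<^sub>s ((I v \<otimes>\<^sub>s ay \<otimes>\<^sub>s I v') \<cdot>\<^sub>s (tw v \<otimes>\<^sub>s (tw y \<otimes>\<^sub>s I y') \<otimes>\<^sub>s I v'))"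
    unfolding core by (simp add: tns_assoc tns_I cmp_assoc)
  also have "(I v \<otimes>\<^sub>s ay \<otimes>\<^sub>s I v') \<cdot>\<^sub>s (tw v \<otimes>\<^sub>s (tw y \<otimes>\<^sub>s I y') \<otimes>\<^sub>s I v')
     = tw v \<otimes>\<^sub>s rcap y y' ey \<otimes>\<^sub>s I v'"
    by (simp add: interchange rcap_def ay_def cmp_assoc)
  also have "\<dots> = (tw v \<otimes>\<^sub>s I v') \<cdot>\<^sub>s (I v \<otimes>\<^sub>s rcap y y' ey \<otimes>\<^sub>s I v')"
    by (simp add: interchange)
  finally show ?thesis by (simp add: rcap_def av_def cmp_assoc)
qed

text \<open>The nested dual pair is used because \<open>rcap_tns\<close> splits its closing cap into
  a cap over \<open>y\<close> and one over \<open>v\<close>, so that the strands can be closed one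
  after the other.\<close>

lemma str_eq_str_ptr:
  assumes v: "dual_pair v v' \<epsilon> nv" and y: "dual_pair y y' ey ny"
    and h: "ar h" "dm h = v @ y" "cd h = v @ y"
  shows "str (v @ y) (y' @ v') (ey \<cdot>\<^sub>s (I y' \<otimes>\<^sub>s \<epsilon> \<otimes>\<^sub>s I y)) ((I v \<otimes>\<^sub>s ny \<otimes>\<^sub>s I v') \<cdot>\<^sub>s nv) h
    = str v v' \<epsilon> nv (ptr v y y' ey ny h)"
proof -
  note [simp] = dual_pairD[OF v] dual_pairD[OF y] ar_rcap[OF v] ar_rcap[OF y] h
  show ?thesis unfolding str_def rcap_tns[OF v y] ptr_def
    by (simp add: whisker_right tns_assoc tns_I cmp_assoc)
qed

lemma ptr_tns:
  assumes y: "dual_pair y y' ey ny" and z: "dual_pair z z' ez nz"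
    and h: "ar h" "dm h = v @ y @ z" "cd h = v @ y @ z"
  shows "ptr v (y @ z) (z' @ y') (ez \<cdot>\<^sub>s (I z' \<otimes>\<^sub>s ey \<otimes>\<^sub>s I z)) ((I y \<otimes>\<^sub>s nz \<otimes>\<^sub>s I y') \<cdot>\<^sub>s ny) h
    = ptr v y y' ey ny (ptr (v @ y) z z' ez nz h)"
proof -
  note [simp] = dual_pairD[OF y] dual_pairD[OF z] ar_rcap[OF y] ar_rcap[OF z] h
  show ?thesis unfolding ptr_def rcap_tns[OF y z]
    by (simp add: whisker_left whisker_right tns_assoc tns_I tns_I_left cmp_assoc)
qed

text \<open>Encircling the strand \<open>y\<close> by a loop coloured \<open>x @ z\<close> is encircling it by \<open>z\<close> and then by \<open>x\<close>.\<close>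

lemma ptr_monodromy_tns:
  assumes x: "dual_pair x x' ex nx" and z: "dual_pair z z' ez nz"
    and a: "ptr y z z' ez nz (br z y \<cdot>\<^sub>s br y z) = sc a (I y)"
    and b: "ptr y x x' ex nx (br x y \<cdot>\<^sub>s br y x) = sc b (I y)"
  shows "ptr y (x @ z) (z' @ x') (ez \<cdot>\<^sub>s (I z' \<otimes>\<^sub>s ex \<otimes>\<^sub>s I z)) ((I x \<otimes>\<^sub>s nz \<otimes>\<^sub>s I x') \<cdot>\<^sub>s nx)
      (br (x @ z) y \<cdot>\<^sub>s br y (x @ z)) = sc (a * b) (I y)"
proof -
  note [simp] = dual_pairD[OF x] dual_pairD[OF z] ar_rcap[OF x] ar_rcap[OF z]
  define M where "M = br z y \<cdot>\<^sub>s br y z"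
  have [simp]: "ar M" "dm M = y @ z" "cd M = y @ z" by (simp_all add: M_def)
  have e1: "br (x @ z) y \<cdot>\<^sub>s br y (x @ z) = (br x y \<otimes>\<^sub>s I z) \<cdot>\<^sub>s (I x \<otimes>\<^sub>s M) \<cdot>\<^sub>s (br y x \<otimes>\<^sub>s I z)"
    by (simp add: br_tns_left br_tns_right M_def whisker_left cmp_assoc)
  \<comment> \<open>The crossings of \<open>x\<close> with \<open>y\<close> do not touch the loop
    \<open>z\<close>. They slide out of the partial trace over \<open>z\<close>, and what remains
    inside is the scalar \<open>a\<close>.\<close>
  have s1: "(I (y @ x) \<otimes>\<^sub>s rcap z z' ez) \<cdot>\<^sub>s (br x y \<otimes>\<^sub>s I (z @ z')) = br x y \<cdot>\<^sub>s (I (x @ y) \<otimes>\<^sub>s rcap z z' ez)"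
    using slide[of "br x y" "rcap z z' ez"] by simp
  have s2: "(br y x \<otimes>\<^sub>s I (z @ z')) \<cdot>\<^sub>s (I (y @ x) \<otimes>\<^sub>s nz) = (I (x @ y) \<otimes>\<^sub>s nz) \<cdot>\<^sub>s br y x"
    using slide[of "br y x" nz] by simp
  have "ptr (y @ x) z z' ez nz ((br x y \<otimes>\<^sub>s I z) \<cdot>\<^sub>s (I x \<otimes>\<^sub>s M) \<cdot>\<^sub>s (br y x \<otimes>\<^sub>s I z))
     = ((I (y @ x) \<otimes>\<^sub>s rcap z z' ez) \<cdot>\<^sub>s (br x y \<otimes>\<^sub>s I (z @ z'))) \<cdot>\<^sub>s (I x \<otimes>\<^sub>s M \<otimes>\<^sub>s I z') \<cdot>\<^sub>s
       ((br y x \<otimes>\<^sub>s I (z @ z')) \<cdot>\<^sub>s (I (y @ x) \<otimes>\<^sub>s nz))"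
    by (simp add: ptr_def whisker_right tns_assoc tns_I cmp_assoc)
  also have "\<dots> = br x y \<cdot>\<^sub>s (I x \<otimes>\<^sub>s ptr y z z' ez nz M) \<cdot>\<^sub>s br y x"
    unfolding s1 s2 by (simp add: ptr_def whisker_left tns_I_left cmp_assoc)
  also have "\<dots> = sc a (br x y \<cdot>\<^sub>s br y x)"
    unfolding M_def a by (simp add: tns_I)
  finally have e2: "ptr (y @ x) z z' ez nz ((br x y \<otimes>\<^sub>s I z) \<cdot>\<^sub>s (I x \<otimes>\<^sub>s M) \<cdot>\<^sub>s (br y x \<otimes>\<^sub>s I z))
     = sc a (br x y \<cdot>\<^sub>s br y x)" .
  have "ptr y (x @ z) (z' @ x') (ez \<cdot>\<^sub>s (I z' \<otimes>\<^sub>s ex \<otimes>\<^sub>s I z)) ((I x \<otimes>\<^sub>s nz \<otimes>\<^sub>s I x') \<cdot>\<^sub>s nx)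
      (br (x @ z) y \<cdot>\<^sub>s br y (x @ z)) = ptr y x x' ex nx (sc a (br x y \<cdot>\<^sub>s br y x))"
    by (subst ptr_tns[OF x z]) (simp_all add: e1 e2)
  also have "\<dots> = sc a (ptr y x x' ex nx (br x y \<cdot>\<^sub>s br y x))"
    by (simp add: ptr_def)
  finally show ?thesis unfolding b by simp
qed

text \<open>By the hexagons the double braiding with \<open>y\<close> sits between the two crossings
  with \<open>x\<close>; being a scalar it moves out, and the crossings with \<open>x\<close>
  meet.\<close>

lemma monodromy_scalar_tns:
  assumes "br x g \<cdot>\<^sub>s br g x = sc a (I (g @ x))" and "br y g \<cdot>\<^sub>s br g y = sc b (I (g @ y))"
  shows "br (x @ y) g \<cdot>\<^sub>s br g (x @ y) = sc (a * b) (I (g @ x @ y))"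
proof -
  have "br (x @ y) g \<cdot>\<^sub>s br g (x @ y)
      = (br x g \<otimes>\<^sub>s I y) \<cdot>\<^sub>s (I x \<otimes>\<^sub>s (br y g \<cdot>\<^sub>s br g y)) \<cdot>\<^sub>s (br g x \<otimes>\<^sub>s I y)"
    by (simp add: br_tns_left br_tns_right whisker_left cmp_assoc)
  also have "\<dots> = sc b ((br x g \<cdot>\<^sub>s br g x) \<otimes>\<^sub>s I y)"
    unfolding assms(2) by (simp add: tns_I whisker_right)
  also have "\<dots> = sc (a * b) (I (g @ x @ y))"
    unfolding assms(1) by (simp add: tns_I mult.commute)
  finally show ?thesis .
qed

end

section \<open>Mac Lane strictification\<close>

text \<open>The bracketed counterpart of \<open>strict_monoidal\<close>. The inverses of the
  constraints are parameters with typing rules of their own, which keeps definite descriptions such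
  as \<open>inv_arrow\<close> out of the calculations.\<close>

locale mon =
  fixes ob :: "'o \<Rightarrow> bool" and ar :: "'a \<Rightarrow> bool" and dm cd :: "'a \<Rightarrow> 'o" and I :: "'o \<Rightarrow> 'a"
    and cmp_a :: "'a \<Rightarrow> 'a \<Rightarrow> 'a" (infixr "\<cdot>\<^sub>n" 60)
    and tO :: "'o \<Rightarrow> 'o \<Rightarrow> 'o" and tA :: "'a \<Rightarrow> 'a \<Rightarrow> 'a" (infixr "\<otimes>\<^sub>n" 70)
    and sc :: "'k::field \<Rightarrow> 'a \<Rightarrow> 'a"
    and un :: 'o and as as' :: "'o \<Rightarrow> 'o \<Rightarrow> 'o \<Rightarrow> 'a" and lu lu' ru ru' :: "'o \<Rightarrow> 'a"
  assumes ob_dm [simp]: "ar f \<Longrightarrow> ob (dm f)" and ob_cd [simp]: "ar f \<Longrightarrow> ob (cd f)"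
    and ob_un [simp]: "ob un" and ob_tO [simp]: "\<lbrakk>ob x; ob y\<rbrakk> \<Longrightarrow> ob (tO x y)"
    and ar_I [simp]: "ob x \<Longrightarrow> ar (I x)" "ob x \<Longrightarrow> dm (I x) = x" "ob x \<Longrightarrow> cd (I x) = x"
    and ar_cmp [simp]: "\<lbrakk>ar f; ar g; cd f = dm g\<rbrakk> \<Longrightarrow> ar (g \<cdot>\<^sub>n f)"
    and dm_cmp [simp]: "\<lbrakk>ar f; ar g; cd f = dm g\<rbrakk> \<Longrightarrow> dm (g \<cdot>\<^sub>n f) = dm f"
    and cd_cmp [simp]: "\<lbrakk>ar f; ar g; cd f = dm g\<rbrakk> \<Longrightarrow> cd (g \<cdot>\<^sub>n f) = cd g"
    and cmp_I [simp]: "\<lbrakk>ar f; dm f = x\<rbrakk> \<Longrightarrow> f \<cdot>\<^sub>n I x = f"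
    and I_cmp [simp]: "\<lbrakk>ar f; cd f = x\<rbrakk> \<Longrightarrow> I x \<cdot>\<^sub>n f = f"
    and cmp_assoc: "\<lbrakk>ar f; ar g; ar h; cd f = dm g; cd g = dm h\<rbrakk>
      \<Longrightarrow> (h \<cdot>\<^sub>n g) \<cdot>\<^sub>n f = h \<cdot>\<^sub>n (g \<cdot>\<^sub>n f)"
    and ar_tA [simp]: "\<lbrakk>ar f; ar g\<rbrakk> \<Longrightarrow> ar (f \<otimes>\<^sub>n g)"
      "\<lbrakk>ar f; ar g\<rbrakk> \<Longrightarrow> dm (f \<otimes>\<^sub>n g) = tO (dm f) (dm g)"
      "\<lbrakk>ar f; ar g\<rbrakk> \<Longrightarrow> cd (f \<otimes>\<^sub>n g) = tO (cd f) (cd g)"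
    and tA_I [simp]: "\<lbrakk>ob x; ob y\<rbrakk> \<Longrightarrow> I x \<otimes>\<^sub>n I y = I (tO x y)"
    and interchange: "\<lbrakk>ar f; ar f'; ar g; ar g'; cd f = dm f'; cd g = dm g'\<rbrakk>
      \<Longrightarrow> (f' \<otimes>\<^sub>n g') \<cdot>\<^sub>n (f \<otimes>\<^sub>n g) = (f' \<cdot>\<^sub>n f) \<otimes>\<^sub>n (g' \<cdot>\<^sub>n g)"
    and ar_sc [simp]: "ar f \<Longrightarrow> ar (sc k f)" "dm (sc k f) = dm f" "cd (sc k f) = cd f"
    and sc_cmp [simp]: "\<lbrakk>ar f; ar g; cd f = dm g\<rbrakk> \<Longrightarrow> sc k g \<cdot>\<^sub>n f = sc k (g \<cdot>\<^sub>n f)"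
      "\<lbrakk>ar f; ar g; cd f = dm g\<rbrakk> \<Longrightarrow> g \<cdot>\<^sub>n sc k f = sc k (g \<cdot>\<^sub>n f)"
    and sc_tA [simp]: "\<lbrakk>ar f; ar g\<rbrakk> \<Longrightarrow> sc k f \<otimes>\<^sub>n g = sc k (f \<otimes>\<^sub>n g)"
      "\<lbrakk>ar f; ar g\<rbrakk> \<Longrightarrow> f \<otimes>\<^sub>n sc k g = sc k (f \<otimes>\<^sub>n g)"
    and sc_sc [simp]: "sc k (sc l f) = sc (k * l) f"
    and as [simp]: "\<lbrakk>ob x; ob y; ob z\<rbrakk> \<Longrightarrow> ar (as x y z)"
      "\<lbrakk>ob x; ob y; ob z\<rbrakk> \<Longrightarrow> dm (as x y z) = tO (tO x y) z"
      "\<lbrakk>ob x; ob y; ob z\<rbrakk> \<Longrightarrow> cd (as x y z) = tO x (tO y z)"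
      "\<lbrakk>ob x; ob y; ob z\<rbrakk> \<Longrightarrow> ar (as' x y z)"
      "\<lbrakk>ob x; ob y; ob z\<rbrakk> \<Longrightarrow> cd (as' x y z) = tO (tO x y) z"
      "\<lbrakk>ob x; ob y; ob z\<rbrakk> \<Longrightarrow> dm (as' x y z) = tO x (tO y z)"
      "\<lbrakk>ob x; ob y; ob z\<rbrakk> \<Longrightarrow> as' x y z \<cdot>\<^sub>n as x y z = I (tO (tO x y) z)"
      "\<lbrakk>ob x; ob y; ob z\<rbrakk> \<Longrightarrow> as x y z \<cdot>\<^sub>n as' x y z = I (tO x (tO y z))"
    and as_natural: "\<lbrakk>ar f; ar g; ar h\<rbrakk>
      \<Longrightarrow> as (cd f) (cd g) (cd h) \<cdot>\<^sub>n ((f \<otimes>\<^sub>n g) \<otimes>\<^sub>n h) = (f \<otimes>\<^sub>n g \<otimes>\<^sub>n h) \<cdot>\<^sub>n as (dm f) (dm g) (dm h)"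
    and lu [simp]: "ob x \<Longrightarrow> ar (lu x)" "ob x \<Longrightarrow> dm (lu x) = tO un x" "ob x \<Longrightarrow> cd (lu x) = x"
      "ob x \<Longrightarrow> ar (lu' x)" "ob x \<Longrightarrow> cd (lu' x) = tO un x" "ob x \<Longrightarrow> dm (lu' x) = x"
      "ob x \<Longrightarrow> lu' x \<cdot>\<^sub>n lu x = I (tO un x)" "ob x \<Longrightarrow> lu x \<cdot>\<^sub>n lu' x = I x"
    and lu_natural: "ar f \<Longrightarrow> lu (cd f) \<cdot>\<^sub>n (I un \<otimes>\<^sub>n f) = f \<cdot>\<^sub>n lu (dm f)"
    and ru [simp]: "ob x \<Longrightarrow> ar (ru x)" "ob x \<Longrightarrow> dm (ru x) = tO x un" "ob x \<Longrightarrow> cd (ru x) = x"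
      "ob x \<Longrightarrow> ar (ru' x)" "ob x \<Longrightarrow> cd (ru' x) = tO x un" "ob x \<Longrightarrow> dm (ru' x) = x"
      "ob x \<Longrightarrow> ru' x \<cdot>\<^sub>n ru x = I (tO x un)" "ob x \<Longrightarrow> ru x \<cdot>\<^sub>n ru' x = I x"
    and ru_natural: "ar f \<Longrightarrow> ru (cd f) \<cdot>\<^sub>n (f \<otimes>\<^sub>n I un) = f \<cdot>\<^sub>n ru (dm f)"
    and pentagon: "\<lbrakk>ob w; ob x; ob y; ob z\<rbrakk>
      \<Longrightarrow> (I w \<otimes>\<^sub>n as x y z) \<cdot>\<^sub>n as w (tO x y) z \<cdot>\<^sub>n (as w x y \<otimes>\<^sub>n I z) = as w x (tO y z) \<cdot>\<^sub>n as (tO w x) y z"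
    and triangle: "\<lbrakk>ob x; ob y\<rbrakk> \<Longrightarrow> (I x \<otimes>\<^sub>n lu y) \<cdot>\<^sub>n as x un y = ru x \<otimes>\<^sub>n I y"
begin

section \<open>Coherence of the unit constraints\<close>

lemma whisker_left: "\<lbrakk>ar f; ar g; cd f = dm g; ob w\<rbrakk> \<Longrightarrow> I w \<otimes>\<^sub>n (g \<cdot>\<^sub>n f) = (I w \<otimes>\<^sub>n g) \<cdot>\<^sub>n (I w \<otimes>\<^sub>n f)"
  by (simp add: interchange)

lemma whisker_right: "\<lbrakk>ar f; ar g; cd f = dm g; ob w\<rbrakk> \<Longrightarrow> (g \<cdot>\<^sub>n f) \<otimes>\<^sub>n I w = (g \<otimes>\<^sub>n I w) \<cdot>\<^sub>n (f \<otimes>\<^sub>n I w)"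
  by (simp add: interchange)

lemma cancel_right:
  assumes "f \<cdot>\<^sub>n k = g \<cdot>\<^sub>n k" "k \<cdot>\<^sub>n k' = I (cd k)" "ar f" "ar g" "ar k" "ar k'"
    "dm f = cd k" "dm g = cd k" "cd k' = dm k"
  shows "f = g"
proof -
  have "(f \<cdot>\<^sub>n k) \<cdot>\<^sub>n k' = (g \<cdot>\<^sub>n k) \<cdot>\<^sub>n k'" using assms(1) by simp
  then show ?thesis using assms(2-) by (simp add: cmp_assoc)
qed

lemma cancel_left:
  assumes "k \<cdot>\<^sub>n f = k \<cdot>\<^sub>n g" "k' \<cdot>\<^sub>n k = I (dm k)" "ar f" "ar g" "ar k" "ar k'"
    "cd f = dm k" "cd g = dm k" "dm k' = cd k"
  shows "f = g"
proof -
  have "k' \<cdot>\<^sub>n (k \<cdot>\<^sub>n f) = k' \<cdot>\<^sub>n (k \<cdot>\<^sub>n g)" using assms(1) by simp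
  then show ?thesis using assms(2-) by (simp add: cmp_assoc[symmetric])
qed

lemma inverse_unique:
  assumes "k' \<cdot>\<^sub>n k = I (dm k)" "k \<cdot>\<^sub>n k'' = I (cd k)" "ar k" "ar k'" "ar k''" "dm k' = cd k" "cd k'' = dm k"
  shows "k' = k''"
  using assms cmp_assoc[of k'' k k'] by simp

text \<open>\<open>lu\<close> is a natural isomorphism from \<open>I un \<otimes>\<^sub>n _\<close>
  to the identity, so tensoring with the unit loses nothing.\<close>

lemma unit_tensor_faithful:
  assumes "I un \<otimes>\<^sub>n f = I un \<otimes>\<^sub>n g" "ar f" "ar g" "dm f = dm g" "cd f = cd g"
  shows "f = g"
proof (rule cancel_right[where k = "lu (dm f)" and k' = "lu' (dm f)"])
  show "f \<cdot>\<^sub>n lu (dm f) = g \<cdot>\<^sub>n lu (dm f)" using lu_natural[of f] lu_natural[of g] assms by simp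
qed (use assms in simp_all)

lemma tensor_unit_faithful:
  assumes "f \<otimes>\<^sub>n I un = g \<otimes>\<^sub>n I un" "ar f" "ar g" "dm f = dm g" "cd f = cd g"
  shows "f = g"
proof (rule cancel_right[where k = "ru (dm f)" and k' = "ru' (dm f)"])
  show "f \<cdot>\<^sub>n ru (dm f) = g \<cdot>\<^sub>n ru (dm f)" using ru_natural[of f] ru_natural[of g] assms by simp
qed (use assms in simp_all)

text \<open>Kelly's argument: after tensoring with the unit, the claim is one region of the pentagon
  for \<open>un\<close>, \<open>un\<close>, \<open>x\<close>, \<open>y\<close>, whose remaining
  regions commute by the triangle axiom and naturality. The isomorphism \<open>?k\<close> is the
  path in the pentagon along which the two sides are compared.\<close>

lemma lu_tensor:
  assumes [simp]: "ob x" "ob y"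
  shows "lu (tO x y) \<cdot>\<^sub>n as un x y = lu x \<otimes>\<^sub>n I y"
proof (rule unit_tensor_faithful)
  let ?k = "as un (tO un x) y \<cdot>\<^sub>n (as un un x \<otimes>\<^sub>n I y)"
  let ?k' = "(as' un un x \<otimes>\<^sub>n I y) \<cdot>\<^sub>n as' un (tO un x) y"
  show "I un \<otimes>\<^sub>n (lu (tO x y) \<cdot>\<^sub>n as un x y) = I un \<otimes>\<^sub>n (lu x \<otimes>\<^sub>n I y)"
  proof (rule cancel_right[where k = ?k and k' = ?k'])
    have "(I un \<otimes>\<^sub>n (lu (tO x y) \<cdot>\<^sub>n as un x y)) \<cdot>\<^sub>n ?k
       = (I un \<otimes>\<^sub>n lu (tO x y)) \<cdot>\<^sub>n ((I un \<otimes>\<^sub>n as un x y) \<cdot>\<^sub>n ?k)"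
      by (simp add: whisker_left cmp_assoc)
    also have "\<dots> = ((I un \<otimes>\<^sub>n lu (tO x y)) \<cdot>\<^sub>n as un un (tO x y)) \<cdot>\<^sub>n as (tO un un) x y"
      by (simp add: pentagon cmp_assoc)
    also have "\<dots> = (ru un \<otimes>\<^sub>n I x \<otimes>\<^sub>n I y) \<cdot>\<^sub>n as (tO un un) x y" by (simp add: triangle)
    also have "\<dots> = as un x y \<cdot>\<^sub>n ((ru un \<otimes>\<^sub>n I x) \<otimes>\<^sub>n I y)"
      using as_natural[of "ru un" "I x" "I y"] by simp
    also have "(ru un \<otimes>\<^sub>n I x) \<otimes>\<^sub>n I y = ((I un \<otimes>\<^sub>n lu x) \<otimes>\<^sub>n I y) \<cdot>\<^sub>n (as un un x \<otimes>\<^sub>n I y)"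
      by (simp add: triangle[symmetric] whisker_right)
    also have "as un x y \<cdot>\<^sub>n ((I un \<otimes>\<^sub>n lu x) \<otimes>\<^sub>n I y) \<cdot>\<^sub>n (as un un x \<otimes>\<^sub>n I y)
       = (as un x y \<cdot>\<^sub>n ((I un \<otimes>\<^sub>n lu x) \<otimes>\<^sub>n I y)) \<cdot>\<^sub>n (as un un x \<otimes>\<^sub>n I y)"
      by (simp add: cmp_assoc)
    also have "as un x y \<cdot>\<^sub>n ((I un \<otimes>\<^sub>n lu x) \<otimes>\<^sub>n I y) = (I un \<otimes>\<^sub>n lu x \<otimes>\<^sub>n I y) \<cdot>\<^sub>n as un (tO un x) y"
      using as_natural[of "I un" "lu x" "I y"] by simp
    finally show "(I un \<otimes>\<^sub>n (lu (tO x y) \<cdot>\<^sub>n as un x y)) \<cdot>\<^sub>n ?k = (I un \<otimes>\<^sub>n (lu x \<otimes>\<^sub>n I y)) \<cdot>\<^sub>n ?k"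
      by (simp add: cmp_assoc)
    have "?k \<cdot>\<^sub>n ?k' = as un (tO un x) y \<cdot>\<^sub>n ((as un un x \<otimes>\<^sub>n I y) \<cdot>\<^sub>n
      (as' un un x \<otimes>\<^sub>n I y)) \<cdot>\<^sub>n as' un (tO un x) y"
      by (simp add: cmp_assoc)
    then show "?k \<cdot>\<^sub>n ?k' = I (cd ?k)" by (simp add: interchange)
  qed simp_all
qed simp_all

text \<open>The mirror image of \<open>lu_tensor\<close>, with the pentagon for \<open>x\<close>,
  \<open>y\<close>, \<open>un\<close>, \<open>un\<close>.\<close>

lemma ru_tensor:
  assumes [simp]: "ob x" "ob y"
  shows "(I x \<otimes>\<^sub>n ru y) \<cdot>\<^sub>n as x y un = ru (tO x y)"
proof (rule tensor_unit_faithful)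
  show "((I x \<otimes>\<^sub>n ru y) \<cdot>\<^sub>n as x y un) \<otimes>\<^sub>n I un = ru (tO x y) \<otimes>\<^sub>n I un"
  proof (rule cancel_left[where k = "as x y un" and k' = "as' x y un"])
    have "as x y un \<cdot>\<^sub>n (((I x \<otimes>\<^sub>n ru y) \<cdot>\<^sub>n as x y un) \<otimes>\<^sub>n I un)
      = (as x y un \<cdot>\<^sub>n ((I x \<otimes>\<^sub>n ru y) \<otimes>\<^sub>n I un)) \<cdot>\<^sub>n (as x y un \<otimes>\<^sub>n I un)"
      by (simp add: whisker_right cmp_assoc)
    also have "as x y un \<cdot>\<^sub>n ((I x \<otimes>\<^sub>n ru y) \<otimes>\<^sub>n I un) = (I x \<otimes>\<^sub>n ru y \<otimes>\<^sub>n I un) \<cdot>\<^sub>n as x (tO y un) un"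
      using as_natural[of "I x" "ru y" "I un"] by simp
    also have "ru y \<otimes>\<^sub>n I un = (I y \<otimes>\<^sub>n lu un) \<cdot>\<^sub>n as y un un" by (simp add: triangle)
    also have "((I x \<otimes>\<^sub>n ((I y \<otimes>\<^sub>n lu un) \<cdot>\<^sub>n as y un un)) \<cdot>\<^sub>n as x (tO y un) un) \<cdot>\<^sub>n (as x y un \<otimes>\<^sub>n I un)
      = (I x \<otimes>\<^sub>n I y \<otimes>\<^sub>n lu un) \<cdot>\<^sub>n
        ((I x \<otimes>\<^sub>n as y un un) \<cdot>\<^sub>n as x (tO y un) un \<cdot>\<^sub>n (as x y un \<otimes>\<^sub>n I un))"
      by (simp add: whisker_left cmp_assoc)
    also have "\<dots> = ((I x \<otimes>\<^sub>n I y \<otimes>\<^sub>n lu un) \<cdot>\<^sub>n as x y (tO un un)) \<cdot>\<^sub>n as (tO x y) un un"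
      by (simp add: pentagon cmp_assoc)
    also have "(I x \<otimes>\<^sub>n I y \<otimes>\<^sub>n lu un) \<cdot>\<^sub>n as x y (tO un un) = as x y un \<cdot>\<^sub>n (I (tO x y) \<otimes>\<^sub>n lu un)"
      using as_natural[of "I x" "I y" "lu un"] by simp
    also have "(as x y un \<cdot>\<^sub>n (I (tO x y) \<otimes>\<^sub>n lu un)) \<cdot>\<^sub>n as (tO x y) un un
      = as x y un \<cdot>\<^sub>n (ru (tO x y) \<otimes>\<^sub>n I un)"
      by (simp add: triangle[symmetric] cmp_assoc)
    finally show "as x y un \<cdot>\<^sub>n (((I x \<otimes>\<^sub>n ru y) \<cdot>\<^sub>n as x y un) \<otimes>\<^sub>n I un)
      = as x y un \<cdot>\<^sub>n (ru (tO x y) \<otimes>\<^sub>n I un)" .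
  qed simp_all
qed simp_all

text \<open>Naturality of \<open>lu\<close> at \<open>lu un\<close> identifies
  \<open>I un \<otimes>\<^sub>n lu un\<close> with \<open>lu (tO un un)\<close>. After composition
  with the associator the first becomes \<open>ru un \<otimes>\<^sub>n I un\<close> by the triangle
  and the second \<open>lu un \<otimes>\<^sub>n I un\<close> by \<open>lu_tensor\<close>.\<close>

lemma lu_un_eq_ru_un: "lu un = ru un"
proof (rule tensor_unit_faithful)
  have "I un \<otimes>\<^sub>n lu un = lu (tO un un)"
    by (rule cancel_left[where k = "lu un" and k' = "lu' un"]) (use lu_natural[of "lu un"] in simp_all)
  then show "lu un \<otimes>\<^sub>n I un = ru un \<otimes>\<^sub>n I un"
    using lu_tensor[of un un] triangle[of un un] by simp
qed simp_all

text \<open>Every list is an object of the strict category: letters outside of \<open>ob\<close> are read as the unit.\<close>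

definition nm :: "'o \<Rightarrow> 'o" where "nm x = (if ob x then x else un)"

lemma ob_nm [simp]: "ob (nm x)" "ob x \<Longrightarrow> nm x = x"
  by (simp_all add: nm_def)

text \<open>The product is bracketed to the right and ends in the unit, so for an object
  \<open>x\<close> the value of \<open>[x]\<close> is \<open>tO x un\<close> and not
  \<open>x\<close>. This is why \<open>ru x\<close> is the comparison between objects and one-letter
  words below.\<close>

primrec wt :: "'o list \<Rightarrow> 'o" where
  "wt [] = un"
| "wt (x # w) = tO (nm x) (wt w)"

lemma ob_wt [simp]: "ob (wt w)"
  by (induction w) auto

text \<open>\<open>L w v\<close> is the canonical isomorphism from \<open>tO (wt w) (wt v)\<close>
  to \<open>wt (w @ v)\<close>, and \<open>L'\<close> is its inverse.\<close>

primrec L :: "'o list \<Rightarrow> 'o list \<Rightarrow> 'a" where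
  "L [] v = lu (wt v)"
| "L (x # w) v = (I (nm x) \<otimes>\<^sub>n L w v) \<cdot>\<^sub>n as (nm x) (wt w) (wt v)"

primrec L' :: "'o list \<Rightarrow> 'o list \<Rightarrow> 'a" where
  "L' [] v = lu' (wt v)"
| "L' (x # w) v = as' (nm x) (wt w) (wt v) \<cdot>\<^sub>n (I (nm x) \<otimes>\<^sub>n L' w v)"

lemma L_ar [simp]: "ar (L w v) \<and> dm (L w v) = tO (wt w) (wt v) \<and> cd (L w v) = wt (w @ v)"
  by (induction w) auto

lemma L'_ar [simp]: "ar (L' w v) \<and> cd (L' w v) = tO (wt w) (wt v) \<and> dm (L' w v) = wt (w @ v)"
  by (induction w) auto

lemma L_L' [simp]: "L w v \<cdot>\<^sub>n L' w v = I (wt (w @ v))"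
proof (induction w)
  case (Cons x w)
  have "L (x # w) v \<cdot>\<^sub>n L' (x # w) v
    = (I (nm x) \<otimes>\<^sub>n L w v) \<cdot>\<^sub>n (as (nm x) (wt w) (wt v) \<cdot>\<^sub>n as' (nm x) (wt w) (wt v)) \<cdot>\<^sub>n (I (nm x) \<otimes>\<^sub>n L' w v)"
    by (simp add: cmp_assoc del: as(7,8))
  then show ?case using Cons by (simp add: interchange)
qed simp

lemma L'_L [simp]: "L' w v \<cdot>\<^sub>n L w v = I (tO (wt w) (wt v))"
proof (induction w)
  case (Cons x w)
  have "L' (x # w) v \<cdot>\<^sub>n L (x # w) v
    = as' (nm x) (wt w) (wt v) \<cdot>\<^sub>n (I (nm x) \<otimes>\<^sub>n (L' w v \<cdot>\<^sub>n L w v)) \<cdot>\<^sub>n as (nm x) (wt w) (wt v)"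
    by (simp add: cmp_assoc whisker_left del: Cons)
  then show ?case using Cons by simp
qed simp

text \<open>The instance of coherence on which strict associativity rests: the two ways of merging
  three words agree. In the induction on the first word, the empty word is \<open>lu_tensor\<close>
  and an additional letter is the pentagon.\<close>

lemma L_coherence:
  "L (w @ v) u \<cdot>\<^sub>n (L w v \<otimes>\<^sub>n I (wt u)) = L w (v @ u) \<cdot>\<^sub>n (I (wt w) \<otimes>\<^sub>n L v u) \<cdot>\<^sub>n as (wt w) (wt v) (wt u)"
proof (induction w)
  case Nil
  have "L v u \<cdot>\<^sub>n (lu (wt v) \<otimes>\<^sub>n I (wt u)) = (L v u \<cdot>\<^sub>n lu (tO (wt v) (wt u))) \<cdot>\<^sub>n as un (wt v) (wt u)"
    by (simp add: lu_tensor[symmetric] cmp_assoc)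
  also have "L v u \<cdot>\<^sub>n lu (tO (wt v) (wt u)) = lu (wt (v @ u)) \<cdot>\<^sub>n (I un \<otimes>\<^sub>n L v u)"
    using lu_natural[of "L v u"] by simp
  finally show ?case by (simp add: cmp_assoc)
next
  case (Cons x w)
  let ?x = "nm x" and ?w = "wt w" and ?v = "wt v" and ?u = "wt u"
  have "L ((x # w) @ v) u \<cdot>\<^sub>n (L (x # w) v \<otimes>\<^sub>n I ?u)
    = (I ?x \<otimes>\<^sub>n L (w @ v) u) \<cdot>\<^sub>n (as ?x (wt (w @ v)) ?u \<cdot>\<^sub>n ((I ?x \<otimes>\<^sub>n L w v) \<otimes>\<^sub>n I ?u)) \<cdot>\<^sub>n (as ?x ?w ?v \<otimes>\<^sub>n I ?u)"
    by (simp add: whisker_right cmp_assoc)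
  also have "as ?x (wt (w @ v)) ?u \<cdot>\<^sub>n ((I ?x \<otimes>\<^sub>n L w v) \<otimes>\<^sub>n I ?u)
    = (I ?x \<otimes>\<^sub>n L w v \<otimes>\<^sub>n I ?u) \<cdot>\<^sub>n as ?x (tO ?w ?v) ?u"
    using as_natural[of "I ?x" "L w v" "I ?u"] by simp
  also have "(I ?x \<otimes>\<^sub>n L (w @ v) u) \<cdot>\<^sub>n ((I ?x \<otimes>\<^sub>n L w v \<otimes>\<^sub>n I ?u) \<cdot>\<^sub>n as ?x (tO ?w ?v) ?u) \<cdot>\<^sub>n
    (as ?x ?w ?v \<otimes>\<^sub>n I ?u)
    = (I ?x \<otimes>\<^sub>n (L (w @ v) u \<cdot>\<^sub>n (L w v \<otimes>\<^sub>n I ?u))) \<cdot>\<^sub>n as ?x (tO ?w ?v) ?u \<cdot>\<^sub>n (as ?x ?w ?v \<otimes>\<^sub>n I ?u)"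
    by (simp add: whisker_left cmp_assoc)
  also have "\<dots> = (I ?x \<otimes>\<^sub>n L w (v @ u)) \<cdot>\<^sub>n (I ?x \<otimes>\<^sub>n I ?w \<otimes>\<^sub>n L v u) \<cdot>\<^sub>n
      ((I ?x \<otimes>\<^sub>n as ?w ?v ?u) \<cdot>\<^sub>n as ?x (tO ?w ?v) ?u \<cdot>\<^sub>n (as ?x ?w ?v \<otimes>\<^sub>n I ?u))"
    unfolding Cons by (simp add: whisker_left cmp_assoc)
  also have "\<dots> = (I ?x \<otimes>\<^sub>n L w (v @ u)) \<cdot>\<^sub>n ((I ?x \<otimes>\<^sub>n I ?w \<otimes>\<^sub>n L v u) \<cdot>\<^sub>n as ?x ?w (tO ?v ?u)) \<cdot>\<^sub>n
    as (tO ?x ?w) ?v ?u"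
    by (simp add: pentagon cmp_assoc)
  also have "(I ?x \<otimes>\<^sub>n I ?w \<otimes>\<^sub>n L v u) \<cdot>\<^sub>n as ?x ?w (tO ?v ?u)
    = as ?x ?w (wt (v @ u)) \<cdot>\<^sub>n (I (tO ?x ?w) \<otimes>\<^sub>n L v u)"
    using as_natural[of "I ?x" "I ?w" "L v u"] by simp
  finally show ?case by (simp add: cmp_assoc)
qed

text \<open>The two sides are inverse to the two sides of \<open>L_coherence\<close>.\<close>

lemma L'_coherence:
  "(L' w v \<otimes>\<^sub>n I (wt u)) \<cdot>\<^sub>n L' (w @ v) u = as' (wt w) (wt v) (wt u) \<cdot>\<^sub>n (I (wt w) \<otimes>\<^sub>n L' v u) \<cdot>\<^sub>n L' w (v @ u)"
proof (rule inverse_unique[where k = "L (w @ v) u \<cdot>\<^sub>n (L w v \<otimes>\<^sub>n I (wt u))"])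
  have "((L' w v \<otimes>\<^sub>n I (wt u)) \<cdot>\<^sub>n L' (w @ v) u) \<cdot>\<^sub>n L (w @ v) u \<cdot>\<^sub>n (L w v \<otimes>\<^sub>n I (wt u))
    = (L' w v \<otimes>\<^sub>n I (wt u)) \<cdot>\<^sub>n (L' (w @ v) u \<cdot>\<^sub>n L (w @ v) u) \<cdot>\<^sub>n (L w v \<otimes>\<^sub>n I (wt u))"
    by (simp add: cmp_assoc del: L'_L)
  then show "((L' w v \<otimes>\<^sub>n I (wt u)) \<cdot>\<^sub>n L' (w @ v) u) \<cdot>\<^sub>n L (w @ v) u \<cdot>\<^sub>n (L w v \<otimes>\<^sub>n I (wt u))
    = I (dm (L (w @ v) u \<cdot>\<^sub>n (L w v \<otimes>\<^sub>n I (wt u))))"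
    by (simp add: interchange)
  have "(L (w @ v) u \<cdot>\<^sub>n (L w v \<otimes>\<^sub>n I (wt u))) \<cdot>\<^sub>n as' (wt w) (wt v) (wt u) \<cdot>\<^sub>n
    (I (wt w) \<otimes>\<^sub>n L' v u) \<cdot>\<^sub>n L' w (v @ u)
    = L w (v @ u) \<cdot>\<^sub>n (I (wt w) \<otimes>\<^sub>n L v u) \<cdot>\<^sub>n (as (wt w) (wt v) (wt u) \<cdot>\<^sub>n as' (wt w) (wt v) (wt u)) \<cdot>\<^sub>n
      (I (wt w) \<otimes>\<^sub>n L' v u) \<cdot>\<^sub>n L' w (v @ u)"
    unfolding L_coherence by (simp add: cmp_assoc del: as(7,8))
  also have "\<dots> = L w (v @ u) \<cdot>\<^sub>n ((I (wt w) \<otimes>\<^sub>n L v u) \<cdot>\<^sub>n (I (wt w) \<otimes>\<^sub>n L' v u)) \<cdot>\<^sub>n L' w (v @ u)"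
    by (simp add: cmp_assoc)
  also have "\<dots> = I (cd (L (w @ v) u \<cdot>\<^sub>n (L w v \<otimes>\<^sub>n I (wt u))))"
    by (simp add: interchange)
  finally show "(L (w @ v) u \<cdot>\<^sub>n (L w v \<otimes>\<^sub>n I (wt u))) \<cdot>\<^sub>n as' (wt w) (wt v) (wt u) \<cdot>\<^sub>n
    (I (wt w) \<otimes>\<^sub>n L' v u) \<cdot>\<^sub>n L' w (v @ u)
    = I (cd (L (w @ v) u \<cdot>\<^sub>n (L w v \<otimes>\<^sub>n I (wt u))))" .
qed simp_all

text \<open>The recursion of \<open>L\<close> ends in \<open>lu\<close>, not in \<open>ru\<close>:
  \<open>lu_un_eq_ru_un\<close> starts the induction and \<open>ru_tensor\<close> carries it
  on.\<close>

lemma L_Nil: "L w [] = ru (wt w)"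
  by (induction w) (simp_all add: lu_un_eq_ru_un ru_tensor)

lemma L'_Nil: "L' w [] = ru' (wt w)"
  by (rule inverse_unique[where k = "ru (wt w)"]) (use L'_L[of w "[]"] in \<open>simp_all add: L_Nil\<close>)

text \<open>An arrow stores its words because the morphism alone does not determine them: distinct
  words can have the same tensor product.\<close>

definition arS :: "'o list \<times> 'a \<times> 'o list \<Rightarrow> bool" where
  "arS = (\<lambda>(w, f, v). ar f \<and> dm f = wt w \<and> cd f = wt v)"

definition IS :: "'o list \<Rightarrow> 'o list \<times> 'a \<times> 'o list" where
  "IS w = (w, I (wt w), w)"

definition cmpS :: "'o list \<times> 'a \<times> 'o list \<Rightarrow> 'o list \<times> 'a \<times> 'o list \<Rightarrow> 'o list \<times> 'a \<times> 'o list" where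
  "cmpS = (\<lambda>(w', g, v') (w, f, v). (w, g \<cdot>\<^sub>n f, v'))"

definition tnsS :: "'o list \<times> 'a \<times> 'o list \<Rightarrow> 'o list \<times> 'a \<times> 'o list \<Rightarrow> 'o list \<times> 'a \<times> 'o list" where
  "tnsS = (\<lambda>(w, f, v) (w', f', v'). (w @ w', L v v' \<cdot>\<^sub>n (f \<otimes>\<^sub>n f') \<cdot>\<^sub>n L' w w', v @ v'))"

definition scS :: "'k \<Rightarrow> 'o list \<times> 'a \<times> 'o list \<Rightarrow> 'o list \<times> 'a \<times> 'o list" where
  "scS k = (\<lambda>(w, f, v). (w, sc k f, v))"

text \<open>Naturality of the associator in the middle, with \<open>L_coherence\<close> and
  \<open>L'_coherence\<close> rebracketing target and source.\<close>

lemma tns_assoc_aux: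
  assumes [simp]: "ar f" "ar g" "ar h" "dm f = wt w1" "dm g = wt w2" "dm h = wt w3"
    "cd f = wt v1" "cd g = wt v2" "cd h = wt v3"
  shows "L (v1 @ v2) v3 \<cdot>\<^sub>n ((L v1 v2 \<cdot>\<^sub>n (f \<otimes>\<^sub>n g) \<cdot>\<^sub>n L' w1 w2) \<otimes>\<^sub>n h) \<cdot>\<^sub>n L' (w1 @ w2) w3
    = L v1 (v2 @ v3) \<cdot>\<^sub>n (f \<otimes>\<^sub>n (L v2 v3 \<cdot>\<^sub>n (g \<otimes>\<^sub>n h) \<cdot>\<^sub>n L' w2 w3)) \<cdot>\<^sub>n L' w1 (w2 @ w3)"
proof -
  have "(L v1 v2 \<cdot>\<^sub>n (f \<otimes>\<^sub>n g) \<cdot>\<^sub>n L' w1 w2) \<otimes>\<^sub>n h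
    = (L v1 v2 \<otimes>\<^sub>n I (wt v3)) \<cdot>\<^sub>n ((f \<otimes>\<^sub>n g) \<otimes>\<^sub>n h) \<cdot>\<^sub>n (L' w1 w2 \<otimes>\<^sub>n I (wt w3))"
    by (simp add: interchange)
  then have "L (v1 @ v2) v3 \<cdot>\<^sub>n ((L v1 v2 \<cdot>\<^sub>n (f \<otimes>\<^sub>n g) \<cdot>\<^sub>n L' w1 w2) \<otimes>\<^sub>n h) \<cdot>\<^sub>n L' (w1 @ w2) w3
    = (L (v1 @ v2) v3 \<cdot>\<^sub>n (L v1 v2 \<otimes>\<^sub>n I (wt v3))) \<cdot>\<^sub>n ((f \<otimes>\<^sub>n g) \<otimes>\<^sub>n h) \<cdot>\<^sub>n
      ((L' w1 w2 \<otimes>\<^sub>n I (wt w3)) \<cdot>\<^sub>n L' (w1 @ w2) w3)"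
    by (simp add: cmp_assoc)
  also have "\<dots> = L v1 (v2 @ v3) \<cdot>\<^sub>n (I (wt v1) \<otimes>\<^sub>n L v2 v3) \<cdot>\<^sub>n
      (as (wt v1) (wt v2) (wt v3) \<cdot>\<^sub>n ((f \<otimes>\<^sub>n g) \<otimes>\<^sub>n h)) \<cdot>\<^sub>n as' (wt w1) (wt w2) (wt w3) \<cdot>\<^sub>n
      (I (wt w1) \<otimes>\<^sub>n L' w2 w3) \<cdot>\<^sub>n L' w1 (w2 @ w3)"
    unfolding L_coherence L'_coherence by (simp add: cmp_assoc)
  also have "as (wt v1) (wt v2) (wt v3) \<cdot>\<^sub>n ((f \<otimes>\<^sub>n g) \<otimes>\<^sub>n h) = (f \<otimes>\<^sub>n g \<otimes>\<^sub>n h) \<cdot>\<^sub>n as (wt w1) (wt w2) (wt w3)"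
    using as_natural[of f g h] by simp
  also have "L v1 (v2 @ v3) \<cdot>\<^sub>n (I (wt v1) \<otimes>\<^sub>n L v2 v3) \<cdot>\<^sub>n
      ((f \<otimes>\<^sub>n g \<otimes>\<^sub>n h) \<cdot>\<^sub>n as (wt w1) (wt w2) (wt w3)) \<cdot>\<^sub>n as' (wt w1) (wt w2) (wt w3) \<cdot>\<^sub>n
      (I (wt w1) \<otimes>\<^sub>n L' w2 w3) \<cdot>\<^sub>n L' w1 (w2 @ w3)
    = L v1 (v2 @ v3) \<cdot>\<^sub>n (I (wt v1) \<otimes>\<^sub>n L v2 v3) \<cdot>\<^sub>n (f \<otimes>\<^sub>n g \<otimes>\<^sub>n h) \<cdot>\<^sub>n
      (as (wt w1) (wt w2) (wt w3) \<cdot>\<^sub>n as' (wt w1) (wt w2) (wt w3)) \<cdot>\<^sub>n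
      (I (wt w1) \<otimes>\<^sub>n L' w2 w3) \<cdot>\<^sub>n L' w1 (w2 @ w3)"
    by (simp add: cmp_assoc del: as(7,8))
  also have "\<dots> = L v1 (v2 @ v3) \<cdot>\<^sub>n
      ((I (wt v1) \<otimes>\<^sub>n L v2 v3) \<cdot>\<^sub>n (f \<otimes>\<^sub>n g \<otimes>\<^sub>n h) \<cdot>\<^sub>n (I (wt w1) \<otimes>\<^sub>n L' w2 w3)) \<cdot>\<^sub>n L' w1 (w2 @ w3)"
    by (simp add: cmp_assoc)
  also have "(I (wt v1) \<otimes>\<^sub>n L v2 v3) \<cdot>\<^sub>n (f \<otimes>\<^sub>n g \<otimes>\<^sub>n h) \<cdot>\<^sub>n (I (wt w1) \<otimes>\<^sub>n L' w2 w3)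
    = f \<otimes>\<^sub>n (L v2 v3 \<cdot>\<^sub>n (g \<otimes>\<^sub>n h) \<cdot>\<^sub>n L' w2 w3)"
    by (simp add: interchange)
  finally show ?thesis .
qed

lemma interchange_aux:
  assumes [simp]: "ar f" "ar f'" "ar g" "ar g'" "dm f = wt w1" "dm g = wt w2" "cd f = wt v1" "cd g = wt v2"
    "dm f' = wt v1" "dm g' = wt v2" "cd f' = wt u1" "cd g' = wt u2"
  shows "(L u1 u2 \<cdot>\<^sub>n (f' \<otimes>\<^sub>n g') \<cdot>\<^sub>n L' v1 v2) \<cdot>\<^sub>n (L v1 v2 \<cdot>\<^sub>n (f \<otimes>\<^sub>n g) \<cdot>\<^sub>n L' w1 w2)
    = L u1 u2 \<cdot>\<^sub>n ((f' \<cdot>\<^sub>n f) \<otimes>\<^sub>n (g' \<cdot>\<^sub>n g)) \<cdot>\<^sub>n L' w1 w2"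
proof -
  have "(L u1 u2 \<cdot>\<^sub>n (f' \<otimes>\<^sub>n g') \<cdot>\<^sub>n L' v1 v2) \<cdot>\<^sub>n (L v1 v2 \<cdot>\<^sub>n (f \<otimes>\<^sub>n g) \<cdot>\<^sub>n L' w1 w2)
    = L u1 u2 \<cdot>\<^sub>n (f' \<otimes>\<^sub>n g') \<cdot>\<^sub>n (L' v1 v2 \<cdot>\<^sub>n L v1 v2) \<cdot>\<^sub>n (f \<otimes>\<^sub>n g) \<cdot>\<^sub>n L' w1 w2"
    by (simp add: cmp_assoc del: L'_L)
  also have "\<dots> = L u1 u2 \<cdot>\<^sub>n ((f' \<otimes>\<^sub>n g') \<cdot>\<^sub>n (f \<otimes>\<^sub>n g)) \<cdot>\<^sub>n L' w1 w2"
    by (simp add: cmp_assoc)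
  finally show ?thesis by (simp add: interchange)
qed

sublocale S: strict_monoidal arS fst "\<lambda>a. snd (snd a)" IS cmpS tnsS scS
proof
  fix f :: "'o list \<times> 'a \<times> 'o list"
  obtain w a v where f: "f = (w, a, v)" by (cases f) auto
  \<comment> \<open>Merging with the empty word is a unit constraint, so the strict unit laws are
    the naturality of \<open>ru\<close> and \<open>lu\<close>.\<close>
  show "tnsS f (IS []) = f" if "arS f"
    using that ru_natural[of a]
    by (simp add: f arS_def tnsS_def IS_def L_Nil L'_Nil cmp_assoc[symmetric])
       (simp add: cmp_assoc)
  show "tnsS (IS []) f = f" if "arS f"
    using that lu_natural[of a]
    by (simp add: f arS_def tnsS_def IS_def cmp_assoc[symmetric])
       (simp add: cmp_assoc)
qed (auto simp: arS_def IS_def cmpS_def tnsS_def scS_def tns_assoc_aux interchange_aux, simp add: cmp_assoc)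

end

section \<open>Braiding and twist on words\<close>

locale mon_ribbon = mon ob ar dm cd I cmp_a tO tA sc un as as' lu lu' ru ru'
  for ob :: "'o \<Rightarrow> bool" and ar :: "'a \<Rightarrow> bool" and dm cd :: "'a \<Rightarrow> 'o" and I :: "'o \<Rightarrow> 'a"
    and cmp_a :: "'a \<Rightarrow> 'a \<Rightarrow> 'a" (infixr "\<cdot>\<^sub>n" 60)
    and tO :: "'o \<Rightarrow> 'o \<Rightarrow> 'o" and tA :: "'a \<Rightarrow> 'a \<Rightarrow> 'a" (infixr "\<otimes>\<^sub>n" 70)
    and sc :: "'k::field \<Rightarrow> 'a \<Rightarrow> 'a"
    and un :: 'o and as as' :: "'o \<Rightarrow> 'o \<Rightarrow> 'o \<Rightarrow> 'a" and lu lu' ru ru' :: "'o \<Rightarrow> 'a" +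
  fixes br br' :: "'o \<Rightarrow> 'o \<Rightarrow> 'a" and tw tw' :: "'o \<Rightarrow> 'a"
  assumes br [simp]: "\<lbrakk>ob x; ob y\<rbrakk> \<Longrightarrow> ar (br x y)" "\<lbrakk>ob x; ob y\<rbrakk> \<Longrightarrow> dm (br x y) = tO x y"
      "\<lbrakk>ob x; ob y\<rbrakk> \<Longrightarrow> cd (br x y) = tO y x" "\<lbrakk>ob x; ob y\<rbrakk> \<Longrightarrow> ar (br' x y)"
      "\<lbrakk>ob x; ob y\<rbrakk> \<Longrightarrow> cd (br' x y) = tO x y" "\<lbrakk>ob x; ob y\<rbrakk> \<Longrightarrow> dm (br' x y) = tO y x"
      "\<lbrakk>ob x; ob y\<rbrakk> \<Longrightarrow> br' x y \<cdot>\<^sub>n br x y = I (tO x y)"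
    and br_natural: "\<lbrakk>ar f; ar g\<rbrakk> \<Longrightarrow> br (cd f) (cd g) \<cdot>\<^sub>n (f \<otimes>\<^sub>n g) = (g \<otimes>\<^sub>n f) \<cdot>\<^sub>n br (dm f) (dm g)"
    and hexagon1: "\<lbrakk>ob x; ob y; ob z\<rbrakk> \<Longrightarrow> as y z x \<cdot>\<^sub>n br x (tO y z) \<cdot>\<^sub>n as x y z
      = (I y \<otimes>\<^sub>n br x z) \<cdot>\<^sub>n as y x z \<cdot>\<^sub>n (br x y \<otimes>\<^sub>n I z)"
    and hexagon2: "\<lbrakk>ob x; ob y; ob z\<rbrakk> \<Longrightarrow> as' z x y \<cdot>\<^sub>n br (tO x y) z \<cdot>\<^sub>n as' x y z
      = (br x z \<otimes>\<^sub>n I y) \<cdot>\<^sub>n as' x z y \<cdot>\<^sub>n (I x \<otimes>\<^sub>n br y z)"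
    and tw [simp]: "ob x \<Longrightarrow> ar (tw x)" "ob x \<Longrightarrow> dm (tw x) = x" "ob x \<Longrightarrow> cd (tw x) = x"
      "ob x \<Longrightarrow> ar (tw' x)" "ob x \<Longrightarrow> dm (tw' x) = x" "ob x \<Longrightarrow> cd (tw' x) = x"
      "ob x \<Longrightarrow> tw' x \<cdot>\<^sub>n tw x = I x"
    and tw_natural: "ar f \<Longrightarrow> tw (cd f) \<cdot>\<^sub>n f = f \<cdot>\<^sub>n tw (dm f)"
    and tw_tA: "\<lbrakk>ob x; ob y\<rbrakk> \<Longrightarrow> tw (tO x y) = (br y x \<cdot>\<^sub>n br x y) \<cdot>\<^sub>n (tw x \<otimes>\<^sub>n tw y)"
begin

lemma L'_L_cancel [simp]: "\<lbrakk>ar r; cd r = tO (wt w) (wt v)\<rbrakk> \<Longrightarrow> L' w v \<cdot>\<^sub>n L w v \<cdot>\<^sub>n r = r"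
  by (simp add: cmp_assoc[symmetric])

definition brS :: "'o list \<Rightarrow> 'o list \<Rightarrow> 'o list \<times> 'a \<times> 'o list" where
  "brS w v = (w @ v, L v w \<cdot>\<^sub>n br (wt w) (wt v) \<cdot>\<^sub>n L' w v, v @ w)"

definition twS :: "'o list \<Rightarrow> 'o list \<times> 'a \<times> 'o list" where
  "twS w = (w, tw (wt w), w)"

text \<open>The first hexagon conjugated by merging isomorphisms: \<open>L_coherence\<close> and
  \<open>L'_coherence\<close> supply the associators that it contains, and naturality of the
  braiding moves \<open>L v w\<close> across.\<close>

lemma brS_right:
  "L (v @ w) u \<cdot>\<^sub>n br (wt u) (wt (v @ w)) \<cdot>\<^sub>n L' u (v @ w)
   = (L v (w @ u) \<cdot>\<^sub>n (I (wt v) \<otimes>\<^sub>n (L w u \<cdot>\<^sub>n br (wt u) (wt w) \<cdot>\<^sub>n L' u w)) \<cdot>\<^sub>n L' v (u @ w)) \<cdot>\<^sub>n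
     (L (v @ u) w \<cdot>\<^sub>n ((L v u \<cdot>\<^sub>n br (wt u) (wt v) \<cdot>\<^sub>n L' u v) \<otimes>\<^sub>n I (wt w)) \<cdot>\<^sub>n L' (u @ v) w)"
proof -
  let ?u = "wt u" and ?v = "wt v" and ?w = "wt w"
  have "(L v (w @ u) \<cdot>\<^sub>n (I ?v \<otimes>\<^sub>n (L w u \<cdot>\<^sub>n br ?u ?w \<cdot>\<^sub>n L' u w)) \<cdot>\<^sub>n L' v (u @ w)) \<cdot>\<^sub>n
     (L (v @ u) w \<cdot>\<^sub>n ((L v u \<cdot>\<^sub>n br ?u ?v \<cdot>\<^sub>n L' u v) \<otimes>\<^sub>n I ?w) \<cdot>\<^sub>n L' (u @ v) w)
    = L v (w @ u) \<cdot>\<^sub>n (I ?v \<otimes>\<^sub>n L w u) \<cdot>\<^sub>n (I ?v \<otimes>\<^sub>n br ?u ?w) \<cdot>\<^sub>n (I ?v \<otimes>\<^sub>n L' u w) \<cdot>\<^sub>n L' v (u @ w) \<cdot>\<^sub>n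
      (L (v @ u) w \<cdot>\<^sub>n (L v u \<otimes>\<^sub>n I ?w)) \<cdot>\<^sub>n (br ?u ?v \<otimes>\<^sub>n I ?w) \<cdot>\<^sub>n (L' u v \<otimes>\<^sub>n I ?w) \<cdot>\<^sub>n L' (u @ v) w"
    by (simp add: whisker_left whisker_right cmp_assoc)
  also have "\<dots> = L v (w @ u) \<cdot>\<^sub>n (I ?v \<otimes>\<^sub>n L w u) \<cdot>\<^sub>n (I ?v \<otimes>\<^sub>n br ?u ?w) \<cdot>\<^sub>n ((I ?v \<otimes>\<^sub>n L' u w) \<cdot>\<^sub>n
      (I ?v \<otimes>\<^sub>n L u w)) \<cdot>\<^sub>n as ?v ?u ?w \<cdot>\<^sub>n (br ?u ?v \<otimes>\<^sub>n I ?w) \<cdot>\<^sub>n (L' u v \<otimes>\<^sub>n I ?w) \<cdot>\<^sub>n L' (u @ v) w"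
    unfolding L_coherence by (simp add: cmp_assoc)
  also have "\<dots> = L v (w @ u) \<cdot>\<^sub>n (I ?v \<otimes>\<^sub>n L w u) \<cdot>\<^sub>n ((I ?v \<otimes>\<^sub>n br ?u ?w) \<cdot>\<^sub>n as ?v ?u ?w \<cdot>\<^sub>n
      (br ?u ?v \<otimes>\<^sub>n I ?w)) \<cdot>\<^sub>n (L' u v \<otimes>\<^sub>n I ?w) \<cdot>\<^sub>n L' (u @ v) w"
    by (simp add: interchange cmp_assoc)
  also have "\<dots> = (L v (w @ u) \<cdot>\<^sub>n (I ?v \<otimes>\<^sub>n L w u) \<cdot>\<^sub>n as ?v ?w ?u) \<cdot>\<^sub>n br ?u (tO ?v ?w) \<cdot>\<^sub>n as ?u ?v ?w \<cdot>\<^sub>n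
      ((L' u v \<otimes>\<^sub>n I ?w) \<cdot>\<^sub>n L' (u @ v) w)"
    by (simp add: hexagon1[symmetric] cmp_assoc)
  also have "\<dots> = (L (v @ w) u \<cdot>\<^sub>n (L v w \<otimes>\<^sub>n I ?u)) \<cdot>\<^sub>n br ?u (tO ?v ?w) \<cdot>\<^sub>n (as ?u ?v ?w \<cdot>\<^sub>n
      as' ?u ?v ?w) \<cdot>\<^sub>n (I ?u \<otimes>\<^sub>n L' v w) \<cdot>\<^sub>n L' u (v @ w)"
    unfolding L'_coherence L_coherence[symmetric] by (simp add: cmp_assoc del: as(7,8))
  also have "\<dots> = L (v @ w) u \<cdot>\<^sub>n ((L v w \<otimes>\<^sub>n I ?u) \<cdot>\<^sub>n br ?u (tO ?v ?w)) \<cdot>\<^sub>n (I ?u \<otimes>\<^sub>n L' v w) \<cdot>\<^sub>n L' u (v @ w)"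
    by (simp add: cmp_assoc)
  also have "(L v w \<otimes>\<^sub>n I ?u) \<cdot>\<^sub>n br ?u (tO ?v ?w) = br ?u (wt (v @ w)) \<cdot>\<^sub>n (I ?u \<otimes>\<^sub>n L v w)"
    using br_natural[of "I ?u" "L v w"] by simp
  also have "L (v @ w) u \<cdot>\<^sub>n (br ?u (wt (v @ w)) \<cdot>\<^sub>n (I ?u \<otimes>\<^sub>n L v w)) \<cdot>\<^sub>n (I ?u \<otimes>\<^sub>n L' v w) \<cdot>\<^sub>n L' u (v @ w)
    = L (v @ w) u \<cdot>\<^sub>n br ?u (wt (v @ w)) \<cdot>\<^sub>n ((I ?u \<otimes>\<^sub>n L v w) \<cdot>\<^sub>n (I ?u \<otimes>\<^sub>n L' v w)) \<cdot>\<^sub>n L' u (v @ w)"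
    by (simp add: cmp_assoc)
  finally show ?thesis by (simp add: interchange)
qed

text \<open>The counterpart of \<open>brS_right\<close> for the second hexagon.\<close>

lemma brS_left:
  "L w (u @ v) \<cdot>\<^sub>n br (wt (u @ v)) (wt w) \<cdot>\<^sub>n L' (u @ v) w
   = (L (w @ u) v \<cdot>\<^sub>n ((L w u \<cdot>\<^sub>n br (wt u) (wt w) \<cdot>\<^sub>n L' u w) \<otimes>\<^sub>n I (wt v)) \<cdot>\<^sub>n L' (u @ w) v) \<cdot>\<^sub>n
     (L u (w @ v) \<cdot>\<^sub>n (I (wt u) \<otimes>\<^sub>n (L w v \<cdot>\<^sub>n br (wt v) (wt w) \<cdot>\<^sub>n L' v w)) \<cdot>\<^sub>n L' u (v @ w))"
proof -
  let ?u = "wt u" and ?v = "wt v" and ?w = "wt w"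
  have "(L (w @ u) v \<cdot>\<^sub>n ((L w u \<cdot>\<^sub>n br ?u ?w \<cdot>\<^sub>n L' u w) \<otimes>\<^sub>n I ?v) \<cdot>\<^sub>n L' (u @ w) v) \<cdot>\<^sub>n
     (L u (w @ v) \<cdot>\<^sub>n (I ?u \<otimes>\<^sub>n (L w v \<cdot>\<^sub>n br ?v ?w \<cdot>\<^sub>n L' v w)) \<cdot>\<^sub>n L' u (v @ w))
    = (L (w @ u) v \<cdot>\<^sub>n (L w u \<otimes>\<^sub>n I ?v)) \<cdot>\<^sub>n (br ?u ?w \<otimes>\<^sub>n I ?v) \<cdot>\<^sub>n ((L' u w \<otimes>\<^sub>n I ?v) \<cdot>\<^sub>n L' (u @ w) v) \<cdot>\<^sub>n
      L u (w @ v) \<cdot>\<^sub>n (I ?u \<otimes>\<^sub>n L w v) \<cdot>\<^sub>n (I ?u \<otimes>\<^sub>n br ?v ?w) \<cdot>\<^sub>n (I ?u \<otimes>\<^sub>n L' v w) \<cdot>\<^sub>n L' u (v @ w)"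
    by (simp add: whisker_left whisker_right cmp_assoc)
  also have "\<dots> = (L (w @ u) v \<cdot>\<^sub>n (L w u \<otimes>\<^sub>n I ?v)) \<cdot>\<^sub>n (br ?u ?w \<otimes>\<^sub>n I ?v) \<cdot>\<^sub>n as' ?u ?w ?v \<cdot>\<^sub>n
    ((I ?u \<otimes>\<^sub>n L' w v) \<cdot>\<^sub>n
      (I ?u \<otimes>\<^sub>n L w v)) \<cdot>\<^sub>n (I ?u \<otimes>\<^sub>n br ?v ?w) \<cdot>\<^sub>n (I ?u \<otimes>\<^sub>n L' v w) \<cdot>\<^sub>n L' u (v @ w)"
    unfolding L'_coherence by (simp add: cmp_assoc)
  also have "\<dots> = (L (w @ u) v \<cdot>\<^sub>n (L w u \<otimes>\<^sub>n I ?v)) \<cdot>\<^sub>n ((br ?u ?w \<otimes>\<^sub>n I ?v) \<cdot>\<^sub>n as' ?u ?w ?v \<cdot>\<^sub>n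
      (I ?u \<otimes>\<^sub>n br ?v ?w)) \<cdot>\<^sub>n (I ?u \<otimes>\<^sub>n L' v w) \<cdot>\<^sub>n L' u (v @ w)"
    by (simp add: interchange cmp_assoc)
  also have "\<dots> = L w (u @ v) \<cdot>\<^sub>n (I ?w \<otimes>\<^sub>n L u v) \<cdot>\<^sub>n (as ?w ?u ?v \<cdot>\<^sub>n as' ?w ?u ?v) \<cdot>\<^sub>n br (tO ?u ?v) ?w \<cdot>\<^sub>n
      (as' ?u ?v ?w \<cdot>\<^sub>n (I ?u \<otimes>\<^sub>n L' v w) \<cdot>\<^sub>n L' u (v @ w))"
    unfolding hexagon2[symmetric, OF ob_wt ob_wt ob_wt] L_coherence by (simp add: cmp_assoc del: as(7,8))
  also have "\<dots> = L w (u @ v) \<cdot>\<^sub>n ((I ?w \<otimes>\<^sub>n L u v) \<cdot>\<^sub>n br (tO ?u ?v) ?w) \<cdot>\<^sub>n (L' u v \<otimes>\<^sub>n I ?w) \<cdot>\<^sub>n L' (u @ v) w"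
    unfolding L'_coherence[symmetric] by (simp add: cmp_assoc)
  also have "(I ?w \<otimes>\<^sub>n L u v) \<cdot>\<^sub>n br (tO ?u ?v) ?w = br (wt (u @ v)) ?w \<cdot>\<^sub>n (L u v \<otimes>\<^sub>n I ?w)"
    using br_natural[of "L u v" "I ?w"] by simp
  also have "L w (u @ v) \<cdot>\<^sub>n (br (wt (u @ v)) ?w \<cdot>\<^sub>n (L u v \<otimes>\<^sub>n I ?w)) \<cdot>\<^sub>n (L' u v \<otimes>\<^sub>n I ?w) \<cdot>\<^sub>n L' (u @ v) w
    = L w (u @ v) \<cdot>\<^sub>n br (wt (u @ v)) ?w \<cdot>\<^sub>n ((L u v \<otimes>\<^sub>n I ?w) \<cdot>\<^sub>n (L' u v \<otimes>\<^sub>n I ?w)) \<cdot>\<^sub>n L' (u @ v) w"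
    by (simp add: cmp_assoc)
  finally show ?thesis by (simp add: interchange)
qed

lemma brS_natural:
  assumes [simp]: "ar f" "ar g" "dm f = wt w" "cd f = wt w'" "dm g = wt v" "cd g = wt v'"
  shows "(L v' w' \<cdot>\<^sub>n br (wt w') (wt v') \<cdot>\<^sub>n L' w' v') \<cdot>\<^sub>n (L w' v' \<cdot>\<^sub>n (f \<otimes>\<^sub>n g) \<cdot>\<^sub>n L' w v)
    = (L v' w' \<cdot>\<^sub>n (g \<otimes>\<^sub>n f) \<cdot>\<^sub>n L' v w) \<cdot>\<^sub>n (L v w \<cdot>\<^sub>n br (wt w) (wt v) \<cdot>\<^sub>n L' w v)"
proof -
  have "(L v' w' \<cdot>\<^sub>n br (wt w') (wt v') \<cdot>\<^sub>n L' w' v') \<cdot>\<^sub>n (L w' v' \<cdot>\<^sub>n (f \<otimes>\<^sub>n g) \<cdot>\<^sub>n L' w v)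
     = L v' w' \<cdot>\<^sub>n (br (wt w') (wt v') \<cdot>\<^sub>n (f \<otimes>\<^sub>n g)) \<cdot>\<^sub>n L' w v"
    by (simp add: cmp_assoc)
  also have "br (wt w') (wt v') \<cdot>\<^sub>n (f \<otimes>\<^sub>n g) = (g \<otimes>\<^sub>n f) \<cdot>\<^sub>n br (wt w) (wt v)"
    using br_natural[of f g] by simp
  finally show ?thesis by (simp add: cmp_assoc)
qed

lemma brS_typed [simp]: "arS (brS w v)" "fst (brS w v) = w @ v" "snd (snd (brS w v)) = v @ w"
  by (simp_all add: brS_def arS_def)

lemma brS_tns:
  "brS u (v @ w) = cmpS (tnsS (IS v) (brS u w)) (tnsS (brS u v) (IS w))"
  "brS (u @ v) w = cmpS (tnsS (brS u w) (IS v)) (tnsS (IS u) (brS v w))"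
  using brS_right[of v w u] brS_left[of w u v] by (simp_all add: brS_def cmpS_def tnsS_def IS_def)

lemma brS_cancel:
  assumes "cmpS (brS w v) k = cmpS (brS w v) k'" "arS k" "arS k'" "snd (snd k) = w @ v" "snd (snd k') = w @ v"
    "fst k = fst k'"
  shows "k = k'"
proof -
  obtain a f b a' f' b' where k: "k = (a, f, b)" "k' = (a', f', b')" by (metis prod.exhaust)
  let ?b = "L v w \<cdot>\<^sub>n br (wt w) (wt v) \<cdot>\<^sub>n L' w v" and ?b' = "L w v \<cdot>\<^sub>n br' (wt w) (wt v) \<cdot>\<^sub>n L' v w"
  have "?b' \<cdot>\<^sub>n ?b = L w v \<cdot>\<^sub>n (br' (wt w) (wt v) \<cdot>\<^sub>n br (wt w) (wt v)) \<cdot>\<^sub>n L' w v"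
    by (simp add: cmp_assoc del: br(7))
  then have "?b' \<cdot>\<^sub>n ?b = I (wt (w @ v))" by simp
  moreover have "?b \<cdot>\<^sub>n f = ?b \<cdot>\<^sub>n f'" using assms(1) by (simp add: k cmpS_def brS_def)
  ultimately have "f = f'"
    using cancel_left[of ?b f f' ?b'] assms(2-) by (auto simp: k arS_def)
  then show ?thesis using assms by (auto simp: k)
qed

text \<open>The hexagons with empty words show that these braidings are idempotent, and an
  invertible idempotent is an identity.\<close>

lemma brS_Nil: "brS w [] = IS w" "brS [] w = IS w"
proof -
  have "cmpS (brS w []) (brS w []) = cmpS (brS w []) (IS w)"
    using brS_tns(1)[of w "[]" "[]"] by simp
  then show "brS w [] = IS w" by (rule brS_cancel) simp_all
  have "cmpS (brS [] w) (brS [] w) = cmpS (brS [] w) (IS w)"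
    using brS_tns(2)[of "[]" "[]" w] by simp
  then show "brS [] w = IS w" by (rule brS_cancel) simp_all
qed

lemma twS_tns: "twS (v @ w) = cmpS (cmpS (brS w v) (brS v w)) (tnsS (twS v) (twS w))"
proof -
  have "tw (wt (v @ w)) = tw (wt (v @ w)) \<cdot>\<^sub>n L v w \<cdot>\<^sub>n L' v w" by simp
  also have "\<dots> = (tw (wt (v @ w)) \<cdot>\<^sub>n L v w) \<cdot>\<^sub>n L' v w" by (simp add: cmp_assoc del: L_L')
  also have "tw (wt (v @ w)) \<cdot>\<^sub>n L v w = L v w \<cdot>\<^sub>n tw (tO (wt v) (wt w))"
    using tw_natural[of "L v w"] by simp
  also have "(L v w \<cdot>\<^sub>n tw (tO (wt v) (wt w))) \<cdot>\<^sub>n L' v w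
     = ((L v w \<cdot>\<^sub>n br (wt w) (wt v) \<cdot>\<^sub>n L' w v) \<cdot>\<^sub>n (L w v \<cdot>\<^sub>n br (wt v) (wt w) \<cdot>\<^sub>n L' v w)) \<cdot>\<^sub>n
       (L v w \<cdot>\<^sub>n (tw (wt v) \<otimes>\<^sub>n tw (wt w)) \<cdot>\<^sub>n L' v w)"
    by (simp add: tw_tA cmp_assoc)
  finally show ?thesis by (simp add: twS_def brS_def cmpS_def tnsS_def)
qed

text \<open>By balancing, the twist of the empty word is idempotent; it is invertible, hence the
  identity.\<close>

lemma twS_Nil: "twS [] = IS []"
proof -
  have typed: "arS (twS [])" "fst (twS []) = []" "snd (snd (twS [])) = []"
    by (simp_all add: twS_def arS_def)
  have "tnsS (twS []) (twS []) = cmpS (twS []) (twS [])"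
    using S.slide(1)[of "twS []" "twS []"] typed by simp
  then have "twS [] = cmpS (twS []) (twS [])"
    using twS_tns[of "[]" "[]"] typed by (simp add: brS_Nil)
  then have "tw un = tw un \<cdot>\<^sub>n tw un" by (simp add: twS_def cmpS_def)
  then have "tw un = I un" using cancel_left[of "tw un" "tw un" "I un" "tw' un"] by simp
  then show ?thesis by (simp add: twS_def IS_def)
qed

sublocale S: strict_ribbon arS fst "\<lambda>a. snd (snd a)" IS cmpS tnsS scS brS twS
proof
  fix f g :: "'o list \<times> 'a \<times> 'o list"
  obtain w a w' v b v' where f: "f = (w, a, w')" and g: "g = (v, b, v')" by (metis prod.exhaust)
  show "cmpS (brS (snd (snd f)) (snd (snd g))) (tnsS f g) = cmpS (tnsS g f) (brS (fst f) (fst g))"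
    if "arS f" "arS g"
    using that brS_natural[of a b w w' v v'] by (simp add: f g arS_def brS_def tnsS_def cmpS_def)
  show "cmpS (twS (snd (snd f))) f = cmpS f (twS (fst f))" if "arS f"
    using that tw_natural[of a] by (simp add: f arS_def twS_def cmpS_def)
qed (simp_all add: brS_tns brS_Nil twS_Nil, simp_all add: twS_tns, simp_all add: twS_def arS_def)

section \<open>Transport of duals, braidings and traces to words\<close>

lemma L_coherence_mid: "L' w (v @ u) \<cdot>\<^sub>n L (w @ v) u \<cdot>\<^sub>n (L w v \<otimes>\<^sub>n I (wt u))
  = (I (wt w) \<otimes>\<^sub>n L v u) \<cdot>\<^sub>n as (wt w) (wt v) (wt u)"
  by (simp add: L_coherence)

lemma L'_coherence_mid:
  "(L' w v \<otimes>\<^sub>n I (wt u)) \<cdot>\<^sub>n L' (w @ v) u \<cdot>\<^sub>n L w (v @ u) \<cdot>\<^sub>n (I (wt w) \<otimes>\<^sub>n L v u) = as' (wt w) (wt v) (wt u)"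
proof -
  have "(L' w v \<otimes>\<^sub>n I (wt u)) \<cdot>\<^sub>n L' (w @ v) u \<cdot>\<^sub>n L w (v @ u) \<cdot>\<^sub>n (I (wt w) \<otimes>\<^sub>n L v u)
    = ((L' w v \<otimes>\<^sub>n I (wt u)) \<cdot>\<^sub>n L' (w @ v) u) \<cdot>\<^sub>n L w (v @ u) \<cdot>\<^sub>n (I (wt w) \<otimes>\<^sub>n L v u)"
    by (simp add: cmp_assoc)
  also have "\<dots> = as' (wt w) (wt v) (wt u) \<cdot>\<^sub>n (I (wt w) \<otimes>\<^sub>n L' v u) \<cdot>\<^sub>n (I (wt w) \<otimes>\<^sub>n L v u)"
    unfolding L'_coherence by (simp add: cmp_assoc)
  finally show ?thesis by (simp add: interchange)
qed

text \<open>In most uses \<open>u\<close> is \<open>wt p\<close>, and the word \<open>p\<close> is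
  then said to represent \<open>x\<close>. An object may be represented by several words:
  \<open>tO x z\<close> by a single letter as well as by \<open>[x] @ [z]\<close>.\<close>

definition inv_pair :: "'a \<Rightarrow> 'a \<Rightarrow> 'o \<Rightarrow> 'o \<Rightarrow> bool" where
  "inv_pair \<alpha> \<alpha>' u x \<longleftrightarrow> ob u \<and> ob x \<and> ar \<alpha> \<and> ar \<alpha>' \<and> dm \<alpha> = u \<and> cd \<alpha> = x \<and> dm \<alpha>' = x \<and> cd \<alpha>' = u \<and>
     \<alpha>' \<cdot>\<^sub>n \<alpha> = I u \<and> \<alpha> \<cdot>\<^sub>n \<alpha>' = I x"

lemma inv_pairD:
  assumes "inv_pair \<alpha> \<alpha>' u x"
  shows "ob u" "ob x" "ar \<alpha>" "ar \<alpha>'" "dm \<alpha> = u" "cd \<alpha> = x" "dm \<alpha>' = x" "cd \<alpha>' = u"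
    "\<alpha>' \<cdot>\<^sub>n \<alpha> = I u" "\<alpha> \<cdot>\<^sub>n \<alpha>' = I x"
  using assms by (auto simp: inv_pair_def)

lemma inv_pair_cancel:
  assumes "inv_pair \<alpha> \<alpha>' u x" "ar r"
  shows "cd r = u \<Longrightarrow> \<alpha>' \<cdot>\<^sub>n \<alpha> \<cdot>\<^sub>n r = r" "cd r = x \<Longrightarrow> \<alpha> \<cdot>\<^sub>n \<alpha>' \<cdot>\<^sub>n r = r"
  using assms(2) inv_pairD[OF assms(1)] by (simp_all add: cmp_assoc[symmetric])

lemma inv_pair_ru: "ob x \<Longrightarrow> inv_pair (ru x) (ru' x) (wt [x]) x"
  by (simp add: inv_pair_def)

lemma inv_pair_un: "inv_pair (I un) (I un) (wt []) un"
  by (simp add: inv_pair_def)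

lemma inv_pair_append:
  assumes a: "inv_pair \<alpha> \<alpha>' (wt p) x" and b: "inv_pair \<beta> \<beta>' (wt q) y"
  shows "inv_pair ((\<alpha> \<otimes>\<^sub>n \<beta>) \<cdot>\<^sub>n L' p q) (L p q \<cdot>\<^sub>n (\<alpha>' \<otimes>\<^sub>n \<beta>')) (wt (p @ q)) (tO x y)"
proof -
  note [simp] = inv_pairD[OF a] inv_pairD[OF b]
  have "(L p q \<cdot>\<^sub>n (\<alpha>' \<otimes>\<^sub>n \<beta>')) \<cdot>\<^sub>n (\<alpha> \<otimes>\<^sub>n \<beta>) \<cdot>\<^sub>n L' p q = L p q \<cdot>\<^sub>n ((\<alpha>' \<otimes>\<^sub>n \<beta>') \<cdot>\<^sub>n (\<alpha> \<otimes>\<^sub>n \<beta>)) \<cdot>\<^sub>n L' p q"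
    by (simp add: cmp_assoc)
  moreover have "((\<alpha> \<otimes>\<^sub>n \<beta>) \<cdot>\<^sub>n L' p q) \<cdot>\<^sub>n L p q \<cdot>\<^sub>n (\<alpha>' \<otimes>\<^sub>n \<beta>') = (\<alpha> \<otimes>\<^sub>n \<beta>) \<cdot>\<^sub>n (\<alpha>' \<otimes>\<^sub>n \<beta>')"
    by (simp add: cmp_assoc)
  ultimately show ?thesis by (simp add: inv_pair_def interchange)
qed

definition mdual :: "'o \<Rightarrow> 'o \<Rightarrow> 'a \<Rightarrow> 'a \<Rightarrow> bool" where
  "mdual x y e n \<longleftrightarrow> ob x \<and> ob y \<and> ar e \<and> dm e = tO y x \<and> cd e = un \<and> ar n \<and> dm n = un \<and> cd n = tO x y \<and>
     ru x \<cdot>\<^sub>n (I x \<otimes>\<^sub>n e) \<cdot>\<^sub>n as x y x \<cdot>\<^sub>n (n \<otimes>\<^sub>n I x) \<cdot>\<^sub>n lu' x = I x \<and>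
     lu y \<cdot>\<^sub>n (e \<otimes>\<^sub>n I y) \<cdot>\<^sub>n as' y x y \<cdot>\<^sub>n (I y \<otimes>\<^sub>n n) \<cdot>\<^sub>n ru' y = I y"

text \<open>The composite from which \<open>qtrace\<close> extracts a scalar, for an arbitrary
  choice of dual.\<close>

definition mtr :: "'o \<Rightarrow> 'o \<Rightarrow> 'a \<Rightarrow> 'a \<Rightarrow> 'a \<Rightarrow> 'a" where
  "mtr x y e n f = e \<cdot>\<^sub>n br x y \<cdot>\<^sub>n ((tw x \<cdot>\<^sub>n f) \<otimes>\<^sub>n I y) \<cdot>\<^sub>n n"

lemma lu'_natural: "ar f \<Longrightarrow> (I un \<otimes>\<^sub>n f) \<cdot>\<^sub>n lu' (dm f) = lu' (cd f) \<cdot>\<^sub>n f"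
  by (rule cancel_left[where k = "lu (cd f)" and k' = "lu' (cd f)"])
    (simp_all add: cmp_assoc[symmetric] lu_natural, simp add: cmp_assoc)

lemma ru'_natural: "ar f \<Longrightarrow> (f \<otimes>\<^sub>n I un) \<cdot>\<^sub>n ru' (dm f) = ru' (cd f) \<cdot>\<^sub>n f"
  by (rule cancel_left[where k = "ru (cd f)" and k' = "ru' (cd f)"])
    (simp_all add: cmp_assoc[symmetric] ru_natural, simp add: cmp_assoc)

lemma as'_natural:
  assumes [simp]: "ar f" "ar g" "ar h"
  shows "as' (cd f) (cd g) (cd h) \<cdot>\<^sub>n (f \<otimes>\<^sub>n g \<otimes>\<^sub>n h) = ((f \<otimes>\<^sub>n g) \<otimes>\<^sub>n h) \<cdot>\<^sub>n as' (dm f) (dm g) (dm h)"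
proof (rule cancel_left[where k = "as (cd f) (cd g) (cd h)" and k' = "as' (cd f) (cd g) (cd h)"])
  have "as (cd f) (cd g) (cd h) \<cdot>\<^sub>n ((f \<otimes>\<^sub>n g) \<otimes>\<^sub>n h) \<cdot>\<^sub>n as' (dm f) (dm g) (dm h)
     = ((f \<otimes>\<^sub>n g \<otimes>\<^sub>n h) \<cdot>\<^sub>n as (dm f) (dm g) (dm h)) \<cdot>\<^sub>n as' (dm f) (dm g) (dm h)"
    by (simp add: as_natural[symmetric] cmp_assoc)
  also have "\<dots> = f \<otimes>\<^sub>n g \<otimes>\<^sub>n h" by (simp add: cmp_assoc)
  finally show "as (cd f) (cd g) (cd h) \<cdot>\<^sub>n as' (cd f) (cd g) (cd h) \<cdot>\<^sub>n (f \<otimes>\<^sub>n g \<otimes>\<^sub>n h)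
     = as (cd f) (cd g) (cd h) \<cdot>\<^sub>n ((f \<otimes>\<^sub>n g) \<otimes>\<^sub>n h) \<cdot>\<^sub>n as' (dm f) (dm g) (dm h)"
    by (simp add: cmp_assoc[symmetric])
qed simp_all

context
  fixes x y e n p q \<alpha> \<alpha>' \<beta> \<beta>'
  assumes d: "mdual x y e n" and a: "inv_pair \<alpha> \<alpha>' (wt p) x" and b: "inv_pair \<beta> \<beta>' (wt q) y"
begin

lemma mdualD: "ar e" "dm e = tO y x" "cd e = un" "ar n" "dm n = un" "cd n = tO x y"
  "ru x \<cdot>\<^sub>n (I x \<otimes>\<^sub>n e) \<cdot>\<^sub>n as x y x \<cdot>\<^sub>n (n \<otimes>\<^sub>n I x) \<cdot>\<^sub>n lu' x = I x"
  "lu y \<cdot>\<^sub>n (e \<otimes>\<^sub>n I y) \<cdot>\<^sub>n as' y x y \<cdot>\<^sub>n (I y \<otimes>\<^sub>n n) \<cdot>\<^sub>n ru' y = I y"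
  using d by (auto simp: mdual_def)

text \<open>Naturality moves \<open>\<alpha>\<close> and \<open>\<beta>\<close> outwards until the
  zigzag identity of \<open>x\<close> and \<open>y\<close> stands alone between
  \<open>\<alpha>'\<close> and \<open>\<alpha>\<close>.\<close>

lemma mdual_zigzag1:
  "ru (wt p) \<cdot>\<^sub>n (I (wt p) \<otimes>\<^sub>n (e \<cdot>\<^sub>n (\<beta> \<otimes>\<^sub>n \<alpha>))) \<cdot>\<^sub>n as (wt p) (wt q) (wt p) \<cdot>\<^sub>n
    (((\<alpha>' \<otimes>\<^sub>n \<beta>') \<cdot>\<^sub>n n) \<otimes>\<^sub>n I (wt p)) \<cdot>\<^sub>n lu' (wt p) = I (wt p)"
proof -
  note [simp] = inv_pairD[OF a] inv_pairD[OF b] mdualD(1-6)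
  let ?p = "wt p" and ?q = "wt q"
  have "ru ?p \<cdot>\<^sub>n (I ?p \<otimes>\<^sub>n (e \<cdot>\<^sub>n (\<beta> \<otimes>\<^sub>n \<alpha>))) \<cdot>\<^sub>n as ?p ?q ?p \<cdot>\<^sub>n (((\<alpha>' \<otimes>\<^sub>n \<beta>') \<cdot>\<^sub>n n) \<otimes>\<^sub>n I ?p) \<cdot>\<^sub>n lu' ?p
     = ru ?p \<cdot>\<^sub>n (I ?p \<otimes>\<^sub>n (e \<cdot>\<^sub>n (\<beta> \<otimes>\<^sub>n \<alpha>))) \<cdot>\<^sub>n (as ?p ?q ?p \<cdot>\<^sub>n ((\<alpha>' \<otimes>\<^sub>n \<beta>') \<otimes>\<^sub>n I ?p)) \<cdot>\<^sub>n (n \<otimes>\<^sub>n I ?p) \<cdot>\<^sub>n lu' ?p"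
    by (simp add: whisker_right cmp_assoc)
  also have "as ?p ?q ?p \<cdot>\<^sub>n ((\<alpha>' \<otimes>\<^sub>n \<beta>') \<otimes>\<^sub>n I ?p) = (\<alpha>' \<otimes>\<^sub>n \<beta>' \<otimes>\<^sub>n I ?p) \<cdot>\<^sub>n as x y ?p"
    using as_natural[of \<alpha>' \<beta>' "I ?p"] by simp
  also have "ru ?p \<cdot>\<^sub>n (I ?p \<otimes>\<^sub>n (e \<cdot>\<^sub>n (\<beta> \<otimes>\<^sub>n \<alpha>))) \<cdot>\<^sub>n ((\<alpha>' \<otimes>\<^sub>n \<beta>' \<otimes>\<^sub>n I ?p) \<cdot>\<^sub>n as x y ?p) \<cdot>\<^sub>n (n \<otimes>\<^sub>n I ?p) \<cdot>\<^sub>n lu' ?p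
     = ru ?p \<cdot>\<^sub>n ((I ?p \<otimes>\<^sub>n (e \<cdot>\<^sub>n (\<beta> \<otimes>\<^sub>n \<alpha>))) \<cdot>\<^sub>n (\<alpha>' \<otimes>\<^sub>n \<beta>' \<otimes>\<^sub>n I ?p)) \<cdot>\<^sub>n as x y ?p \<cdot>\<^sub>n (n \<otimes>\<^sub>n I ?p) \<cdot>\<^sub>n lu' ?p"
    by (simp add: cmp_assoc)
  also have "(I ?p \<otimes>\<^sub>n (e \<cdot>\<^sub>n (\<beta> \<otimes>\<^sub>n \<alpha>))) \<cdot>\<^sub>n (\<alpha>' \<otimes>\<^sub>n \<beta>' \<otimes>\<^sub>n I ?p)
    = (\<alpha>' \<otimes>\<^sub>n I un) \<cdot>\<^sub>n (I x \<otimes>\<^sub>n e) \<cdot>\<^sub>n (I x \<otimes>\<^sub>n I y \<otimes>\<^sub>n \<alpha>)"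
    by (simp add: interchange cmp_assoc)
  also have "ru ?p \<cdot>\<^sub>n ((\<alpha>' \<otimes>\<^sub>n I un) \<cdot>\<^sub>n (I x \<otimes>\<^sub>n e) \<cdot>\<^sub>n (I x \<otimes>\<^sub>n I y \<otimes>\<^sub>n \<alpha>)) \<cdot>\<^sub>n as x y ?p \<cdot>\<^sub>n (n \<otimes>\<^sub>n I ?p) \<cdot>\<^sub>n lu' ?p
     = (ru ?p \<cdot>\<^sub>n (\<alpha>' \<otimes>\<^sub>n I un)) \<cdot>\<^sub>n (I x \<otimes>\<^sub>n e) \<cdot>\<^sub>n ((I x \<otimes>\<^sub>n I y \<otimes>\<^sub>n \<alpha>) \<cdot>\<^sub>n as x y ?p) \<cdot>\<^sub>n (n \<otimes>\<^sub>n I ?p) \<cdot>\<^sub>n lu' ?p"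
    by (simp add: cmp_assoc del: tA_I)
  also have "ru ?p \<cdot>\<^sub>n (\<alpha>' \<otimes>\<^sub>n I un) = \<alpha>' \<cdot>\<^sub>n ru x" using ru_natural[of \<alpha>'] by simp
  also have "(I x \<otimes>\<^sub>n I y \<otimes>\<^sub>n \<alpha>) \<cdot>\<^sub>n as x y ?p = as x y x \<cdot>\<^sub>n (I (tO x y) \<otimes>\<^sub>n \<alpha>)"
    using as_natural[of "I x" "I y" \<alpha>] by simp
  also have "(\<alpha>' \<cdot>\<^sub>n ru x) \<cdot>\<^sub>n (I x \<otimes>\<^sub>n e) \<cdot>\<^sub>n (as x y x \<cdot>\<^sub>n (I (tO x y) \<otimes>\<^sub>n \<alpha>)) \<cdot>\<^sub>n (n \<otimes>\<^sub>n I ?p) \<cdot>\<^sub>n lu' ?p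
     = (\<alpha>' \<cdot>\<^sub>n ru x) \<cdot>\<^sub>n (I x \<otimes>\<^sub>n e) \<cdot>\<^sub>n as x y x \<cdot>\<^sub>n ((I (tO x y) \<otimes>\<^sub>n \<alpha>) \<cdot>\<^sub>n (n \<otimes>\<^sub>n I ?p)) \<cdot>\<^sub>n lu' ?p"
    by (simp add: cmp_assoc)
  also have "(I (tO x y) \<otimes>\<^sub>n \<alpha>) \<cdot>\<^sub>n (n \<otimes>\<^sub>n I ?p) = (n \<otimes>\<^sub>n I x) \<cdot>\<^sub>n (I un \<otimes>\<^sub>n \<alpha>)"
    by (simp add: interchange)
  also have "(\<alpha>' \<cdot>\<^sub>n ru x) \<cdot>\<^sub>n (I x \<otimes>\<^sub>n e) \<cdot>\<^sub>n as x y x \<cdot>\<^sub>n ((n \<otimes>\<^sub>n I x) \<cdot>\<^sub>n (I un \<otimes>\<^sub>n \<alpha>)) \<cdot>\<^sub>n lu' ?p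
     = (\<alpha>' \<cdot>\<^sub>n ru x) \<cdot>\<^sub>n (I x \<otimes>\<^sub>n e) \<cdot>\<^sub>n as x y x \<cdot>\<^sub>n (n \<otimes>\<^sub>n I x) \<cdot>\<^sub>n ((I un \<otimes>\<^sub>n \<alpha>) \<cdot>\<^sub>n lu' ?p)"
    by (simp add: cmp_assoc)
  also have "(I un \<otimes>\<^sub>n \<alpha>) \<cdot>\<^sub>n lu' ?p = lu' x \<cdot>\<^sub>n \<alpha>" using lu'_natural[of \<alpha>] by simp
  also have "(\<alpha>' \<cdot>\<^sub>n ru x) \<cdot>\<^sub>n (I x \<otimes>\<^sub>n e) \<cdot>\<^sub>n as x y x \<cdot>\<^sub>n (n \<otimes>\<^sub>n I x) \<cdot>\<^sub>n (lu' x \<cdot>\<^sub>n \<alpha>)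
     = \<alpha>' \<cdot>\<^sub>n (ru x \<cdot>\<^sub>n (I x \<otimes>\<^sub>n e) \<cdot>\<^sub>n as x y x \<cdot>\<^sub>n (n \<otimes>\<^sub>n I x) \<cdot>\<^sub>n lu' x) \<cdot>\<^sub>n \<alpha>"
    by (simp add: cmp_assoc)
  finally show ?thesis unfolding mdualD(7) by simp
qed

lemma mdual_zigzag2:
  "lu (wt q) \<cdot>\<^sub>n ((e \<cdot>\<^sub>n (\<beta> \<otimes>\<^sub>n \<alpha>)) \<otimes>\<^sub>n I (wt q)) \<cdot>\<^sub>n as' (wt q) (wt p) (wt q) \<cdot>\<^sub>n
    (I (wt q) \<otimes>\<^sub>n ((\<alpha>' \<otimes>\<^sub>n \<beta>') \<cdot>\<^sub>n n)) \<cdot>\<^sub>n ru' (wt q) = I (wt q)"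
proof -
  note [simp] = inv_pairD[OF a] inv_pairD[OF b] mdualD(1-6)
  let ?p = "wt p" and ?q = "wt q"
  have "lu ?q \<cdot>\<^sub>n ((e \<cdot>\<^sub>n (\<beta> \<otimes>\<^sub>n \<alpha>)) \<otimes>\<^sub>n I ?q) \<cdot>\<^sub>n as' ?q ?p ?q \<cdot>\<^sub>n (I ?q \<otimes>\<^sub>n ((\<alpha>' \<otimes>\<^sub>n \<beta>') \<cdot>\<^sub>n n)) \<cdot>\<^sub>n ru' ?q
     = lu ?q \<cdot>\<^sub>n ((e \<cdot>\<^sub>n (\<beta> \<otimes>\<^sub>n \<alpha>)) \<otimes>\<^sub>n I ?q) \<cdot>\<^sub>n (as' ?q ?p ?q \<cdot>\<^sub>n (I ?q \<otimes>\<^sub>n \<alpha>' \<otimes>\<^sub>n \<beta>')) \<cdot>\<^sub>n (I ?q \<otimes>\<^sub>n n) \<cdot>\<^sub>n ru' ?q"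
    by (simp add: whisker_left cmp_assoc)
  also have "as' ?q ?p ?q \<cdot>\<^sub>n (I ?q \<otimes>\<^sub>n \<alpha>' \<otimes>\<^sub>n \<beta>') = ((I ?q \<otimes>\<^sub>n \<alpha>') \<otimes>\<^sub>n \<beta>') \<cdot>\<^sub>n as' ?q x y"
    using as'_natural[of "I ?q" \<alpha>' \<beta>'] by simp
  also have "lu ?q \<cdot>\<^sub>n ((e \<cdot>\<^sub>n (\<beta> \<otimes>\<^sub>n \<alpha>)) \<otimes>\<^sub>n I ?q) \<cdot>\<^sub>n (((I ?q \<otimes>\<^sub>n \<alpha>') \<otimes>\<^sub>n \<beta>') \<cdot>\<^sub>n as' ?q x y) \<cdot>\<^sub>n
    (I ?q \<otimes>\<^sub>n n) \<cdot>\<^sub>n ru' ?q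
     = lu ?q \<cdot>\<^sub>n (((e \<cdot>\<^sub>n (\<beta> \<otimes>\<^sub>n \<alpha>)) \<otimes>\<^sub>n I ?q) \<cdot>\<^sub>n ((I ?q \<otimes>\<^sub>n \<alpha>') \<otimes>\<^sub>n \<beta>')) \<cdot>\<^sub>n as' ?q x y \<cdot>\<^sub>n (I ?q \<otimes>\<^sub>n n) \<cdot>\<^sub>n ru' ?q"
    by (simp add: cmp_assoc)
  also have "((e \<cdot>\<^sub>n (\<beta> \<otimes>\<^sub>n \<alpha>)) \<otimes>\<^sub>n I ?q) \<cdot>\<^sub>n ((I ?q \<otimes>\<^sub>n \<alpha>') \<otimes>\<^sub>n \<beta>')
    = (I un \<otimes>\<^sub>n \<beta>') \<cdot>\<^sub>n (e \<otimes>\<^sub>n I y) \<cdot>\<^sub>n ((\<beta> \<otimes>\<^sub>n I x) \<otimes>\<^sub>n I y)"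
    by (simp add: interchange cmp_assoc)
  also have "lu ?q \<cdot>\<^sub>n ((I un \<otimes>\<^sub>n \<beta>') \<cdot>\<^sub>n (e \<otimes>\<^sub>n I y) \<cdot>\<^sub>n ((\<beta> \<otimes>\<^sub>n I x) \<otimes>\<^sub>n I y)) \<cdot>\<^sub>n as' ?q x y \<cdot>\<^sub>n
    (I ?q \<otimes>\<^sub>n n) \<cdot>\<^sub>n ru' ?q
     = (lu ?q \<cdot>\<^sub>n (I un \<otimes>\<^sub>n \<beta>')) \<cdot>\<^sub>n (e \<otimes>\<^sub>n I y) \<cdot>\<^sub>n (((\<beta> \<otimes>\<^sub>n I x) \<otimes>\<^sub>n I y) \<cdot>\<^sub>n as' ?q x y) \<cdot>\<^sub>n (I ?q \<otimes>\<^sub>n n) \<cdot>\<^sub>n ru' ?q"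
    by (simp add: cmp_assoc del: tA_I)
  also have "lu ?q \<cdot>\<^sub>n (I un \<otimes>\<^sub>n \<beta>') = \<beta>' \<cdot>\<^sub>n lu y" using lu_natural[of \<beta>'] by simp
  also have "((\<beta> \<otimes>\<^sub>n I x) \<otimes>\<^sub>n I y) \<cdot>\<^sub>n as' ?q x y = as' y x y \<cdot>\<^sub>n (\<beta> \<otimes>\<^sub>n I (tO x y))"
    using as'_natural[of \<beta> "I x" "I y"] by simp
  also have "(\<beta>' \<cdot>\<^sub>n lu y) \<cdot>\<^sub>n (e \<otimes>\<^sub>n I y) \<cdot>\<^sub>n (as' y x y \<cdot>\<^sub>n (\<beta> \<otimes>\<^sub>n I (tO x y))) \<cdot>\<^sub>n (I ?q \<otimes>\<^sub>n n) \<cdot>\<^sub>n ru' ?q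
     = (\<beta>' \<cdot>\<^sub>n lu y) \<cdot>\<^sub>n (e \<otimes>\<^sub>n I y) \<cdot>\<^sub>n as' y x y \<cdot>\<^sub>n ((\<beta> \<otimes>\<^sub>n I (tO x y)) \<cdot>\<^sub>n (I ?q \<otimes>\<^sub>n n)) \<cdot>\<^sub>n ru' ?q"
    by (simp add: cmp_assoc)
  also have "(\<beta> \<otimes>\<^sub>n I (tO x y)) \<cdot>\<^sub>n (I ?q \<otimes>\<^sub>n n) = (I y \<otimes>\<^sub>n n) \<cdot>\<^sub>n (\<beta> \<otimes>\<^sub>n I un)"
    by (simp add: interchange)
  also have "(\<beta>' \<cdot>\<^sub>n lu y) \<cdot>\<^sub>n (e \<otimes>\<^sub>n I y) \<cdot>\<^sub>n as' y x y \<cdot>\<^sub>n ((I y \<otimes>\<^sub>n n) \<cdot>\<^sub>n (\<beta> \<otimes>\<^sub>n I un)) \<cdot>\<^sub>n ru' ?q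
     = (\<beta>' \<cdot>\<^sub>n lu y) \<cdot>\<^sub>n (e \<otimes>\<^sub>n I y) \<cdot>\<^sub>n as' y x y \<cdot>\<^sub>n (I y \<otimes>\<^sub>n n) \<cdot>\<^sub>n ((\<beta> \<otimes>\<^sub>n I un) \<cdot>\<^sub>n ru' ?q)"
    by (simp add: cmp_assoc)
  also have "(\<beta> \<otimes>\<^sub>n I un) \<cdot>\<^sub>n ru' ?q = ru' y \<cdot>\<^sub>n \<beta>" using ru'_natural[of \<beta>] by simp
  also have "(\<beta>' \<cdot>\<^sub>n lu y) \<cdot>\<^sub>n (e \<otimes>\<^sub>n I y) \<cdot>\<^sub>n as' y x y \<cdot>\<^sub>n (I y \<otimes>\<^sub>n n) \<cdot>\<^sub>n (ru' y \<cdot>\<^sub>n \<beta>)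
     = \<beta>' \<cdot>\<^sub>n (lu y \<cdot>\<^sub>n (e \<otimes>\<^sub>n I y) \<cdot>\<^sub>n as' y x y \<cdot>\<^sub>n (I y \<otimes>\<^sub>n n) \<cdot>\<^sub>n ru' y) \<cdot>\<^sub>n \<beta>"
    by (simp add: cmp_assoc)
  finally show ?thesis unfolding mdualD(8) by simp
qed

abbreviation (input) eS :: "'o list \<times> 'a \<times> 'o list" where
  "eS \<equiv> (q @ p, e \<cdot>\<^sub>n (\<beta> \<otimes>\<^sub>n \<alpha>) \<cdot>\<^sub>n L' q p, [])"

abbreviation (input) nS :: "'o list \<times> 'a \<times> 'o list" where
  "nS \<equiv> ([], L p q \<cdot>\<^sub>n (\<alpha>' \<otimes>\<^sub>n \<beta>') \<cdot>\<^sub>n n, p @ q)"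

text \<open>The merging isomorphisms inside a strict zigzag collapse to a single associator by
  \<open>L_coherence_mid\<close> and \<open>L'_coherence_mid\<close>; what is left is the bracketed
  zigzag.\<close>

lemma dual_pairS: "S.dual_pair p q eS nS"
proof -
  note [simp] = inv_pairD[OF a] inv_pairD[OF b] mdualD(1-6)
  let ?p = "wt p" and ?q = "wt q"
  have "(L p [] \<cdot>\<^sub>n (I ?p \<otimes>\<^sub>n (e \<cdot>\<^sub>n (\<beta> \<otimes>\<^sub>n \<alpha>) \<cdot>\<^sub>n L' q p)) \<cdot>\<^sub>n L' p (q @ p)) \<cdot>\<^sub>n
      (L (p @ q) p \<cdot>\<^sub>n ((L p q \<cdot>\<^sub>n (\<alpha>' \<otimes>\<^sub>n \<beta>') \<cdot>\<^sub>n n) \<otimes>\<^sub>n I ?p) \<cdot>\<^sub>n L' [] p)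
     = ru ?p \<cdot>\<^sub>n (I ?p \<otimes>\<^sub>n (e \<cdot>\<^sub>n (\<beta> \<otimes>\<^sub>n \<alpha>))) \<cdot>\<^sub>n (I ?p \<otimes>\<^sub>n L' q p) \<cdot>\<^sub>n (L' p (q @ p) \<cdot>\<^sub>n L (p @ q) p \<cdot>\<^sub>n
       (L p q \<otimes>\<^sub>n I ?p)) \<cdot>\<^sub>n
      (((\<alpha>' \<otimes>\<^sub>n \<beta>') \<cdot>\<^sub>n n) \<otimes>\<^sub>n I ?p) \<cdot>\<^sub>n lu' ?p"
    by (simp add: whisker_left whisker_right cmp_assoc L_Nil)
  also have "\<dots> = ru ?p \<cdot>\<^sub>n (I ?p \<otimes>\<^sub>n (e \<cdot>\<^sub>n (\<beta> \<otimes>\<^sub>n \<alpha>))) \<cdot>\<^sub>n ((I ?p \<otimes>\<^sub>n L' q p) \<cdot>\<^sub>n (I ?p \<otimes>\<^sub>n L q p)) \<cdot>\<^sub>n as ?p ?q ?p \<cdot>\<^sub>n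
      (((\<alpha>' \<otimes>\<^sub>n \<beta>') \<cdot>\<^sub>n n) \<otimes>\<^sub>n I ?p) \<cdot>\<^sub>n lu' ?p"
    unfolding L_coherence_mid by (simp add: cmp_assoc)
  also have "\<dots> = I ?p" by (simp add: mdual_zigzag1 interchange)
  finally have 1: "(L p [] \<cdot>\<^sub>n (I ?p \<otimes>\<^sub>n (e \<cdot>\<^sub>n (\<beta> \<otimes>\<^sub>n \<alpha>) \<cdot>\<^sub>n L' q p)) \<cdot>\<^sub>n L' p (q @ p)) \<cdot>\<^sub>n
      (L (p @ q) p \<cdot>\<^sub>n ((L p q \<cdot>\<^sub>n (\<alpha>' \<otimes>\<^sub>n \<beta>') \<cdot>\<^sub>n n) \<otimes>\<^sub>n I ?p) \<cdot>\<^sub>n L' [] p) = I ?p" .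
  have "(L [] q \<cdot>\<^sub>n ((e \<cdot>\<^sub>n (\<beta> \<otimes>\<^sub>n \<alpha>) \<cdot>\<^sub>n L' q p) \<otimes>\<^sub>n I ?q) \<cdot>\<^sub>n L' (q @ p) q) \<cdot>\<^sub>n
      (L q (p @ q) \<cdot>\<^sub>n (I ?q \<otimes>\<^sub>n (L p q \<cdot>\<^sub>n (\<alpha>' \<otimes>\<^sub>n \<beta>') \<cdot>\<^sub>n n)) \<cdot>\<^sub>n L' q [])
     = lu ?q \<cdot>\<^sub>n ((e \<cdot>\<^sub>n (\<beta> \<otimes>\<^sub>n \<alpha>)) \<otimes>\<^sub>n I ?q) \<cdot>\<^sub>n ((L' q p \<otimes>\<^sub>n I ?q) \<cdot>\<^sub>n L' (q @ p) q \<cdot>\<^sub>n L q (p @ q) \<cdot>\<^sub>n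
       (I ?q \<otimes>\<^sub>n L p q)) \<cdot>\<^sub>n
      (I ?q \<otimes>\<^sub>n ((\<alpha>' \<otimes>\<^sub>n \<beta>') \<cdot>\<^sub>n n)) \<cdot>\<^sub>n ru' ?q"
    by (simp add: whisker_left whisker_right cmp_assoc L'_Nil del: L'_L_cancel)
  also have "\<dots> = I ?q" unfolding L'_coherence_mid mdual_zigzag2 ..
  finally have 2: "(L [] q \<cdot>\<^sub>n ((e \<cdot>\<^sub>n (\<beta> \<otimes>\<^sub>n \<alpha>) \<cdot>\<^sub>n L' q p) \<otimes>\<^sub>n I ?q) \<cdot>\<^sub>n L' (q @ p) q) \<cdot>\<^sub>n
      (L q (p @ q) \<cdot>\<^sub>n (I ?q \<otimes>\<^sub>n (L p q \<cdot>\<^sub>n (\<alpha>' \<otimes>\<^sub>n \<beta>') \<cdot>\<^sub>n n)) \<cdot>\<^sub>n L' q []) = I ?q" .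
  show ?thesis using 1 2
    unfolding S.dual_pair_def by (simp add: arS_def tnsS_def cmpS_def IS_def)
qed

text \<open>The merging isomorphisms cancel in pairs, and conjugation by \<open>\<alpha>\<close>
  passes through braiding and twist, so the strict trace computes the bracketed one.\<close>

lemma strS:
  assumes [simp]: "ar f" "dm f = x" "cd f = x"
  shows "S.str p q eS nS (p, \<alpha>' \<cdot>\<^sub>n f \<cdot>\<^sub>n \<alpha>, p) = ([], mtr x y e n f, [])"
proof -
  note [simp] = inv_pairD[OF a] inv_pairD[OF b] mdualD(1-6)
  let ?p = "wt p" and ?q = "wt q"
  have "((e \<cdot>\<^sub>n (\<beta> \<otimes>\<^sub>n \<alpha>) \<cdot>\<^sub>n L' q p) \<cdot>\<^sub>n (L q p \<cdot>\<^sub>n br ?p ?q \<cdot>\<^sub>n L' p q) \<cdot>\<^sub>n (L p q \<cdot>\<^sub>n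
    (tw ?p \<otimes>\<^sub>n I ?q) \<cdot>\<^sub>n L' p q)) \<cdot>\<^sub>n
      (L p q \<cdot>\<^sub>n ((\<alpha>' \<cdot>\<^sub>n f \<cdot>\<^sub>n \<alpha>) \<otimes>\<^sub>n I ?q) \<cdot>\<^sub>n L' p q) \<cdot>\<^sub>n (L p q \<cdot>\<^sub>n (\<alpha>' \<otimes>\<^sub>n \<beta>') \<cdot>\<^sub>n n)
    = e \<cdot>\<^sub>n ((\<beta> \<otimes>\<^sub>n \<alpha>) \<cdot>\<^sub>n br ?p ?q) \<cdot>\<^sub>n ((tw ?p \<otimes>\<^sub>n I ?q) \<cdot>\<^sub>n ((\<alpha>' \<cdot>\<^sub>n f \<cdot>\<^sub>n \<alpha>) \<otimes>\<^sub>n I ?q) \<cdot>\<^sub>n (\<alpha>' \<otimes>\<^sub>n \<beta>')) \<cdot>\<^sub>n n"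
    by (simp add: cmp_assoc)
  also have "(\<beta> \<otimes>\<^sub>n \<alpha>) \<cdot>\<^sub>n br ?p ?q = br x y \<cdot>\<^sub>n (\<alpha> \<otimes>\<^sub>n \<beta>)"
    using br_natural[of \<alpha> \<beta>] by simp
  also have "(tw ?p \<otimes>\<^sub>n I ?q) \<cdot>\<^sub>n ((\<alpha>' \<cdot>\<^sub>n f \<cdot>\<^sub>n \<alpha>) \<otimes>\<^sub>n I ?q) \<cdot>\<^sub>n (\<alpha>' \<otimes>\<^sub>n \<beta>') = (tw ?p \<cdot>\<^sub>n \<alpha>' \<cdot>\<^sub>n f) \<otimes>\<^sub>n \<beta>'"
    by (simp add: interchange cmp_assoc)
  also have "tw ?p \<cdot>\<^sub>n \<alpha>' \<cdot>\<^sub>n f = \<alpha>' \<cdot>\<^sub>n tw x \<cdot>\<^sub>n f"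
    using tw_natural[of \<alpha>'] by (simp add: cmp_assoc[symmetric])
  also have "e \<cdot>\<^sub>n (br x y \<cdot>\<^sub>n (\<alpha> \<otimes>\<^sub>n \<beta>)) \<cdot>\<^sub>n ((\<alpha>' \<cdot>\<^sub>n tw x \<cdot>\<^sub>n f) \<otimes>\<^sub>n \<beta>') \<cdot>\<^sub>n n
    = e \<cdot>\<^sub>n br x y \<cdot>\<^sub>n ((\<alpha> \<otimes>\<^sub>n \<beta>) \<cdot>\<^sub>n ((\<alpha>' \<cdot>\<^sub>n tw x \<cdot>\<^sub>n f) \<otimes>\<^sub>n \<beta>')) \<cdot>\<^sub>n n"
    by (simp add: cmp_assoc)
  also have "(\<alpha> \<otimes>\<^sub>n \<beta>) \<cdot>\<^sub>n ((\<alpha>' \<cdot>\<^sub>n tw x \<cdot>\<^sub>n f) \<otimes>\<^sub>n \<beta>') = (tw x \<cdot>\<^sub>n f) \<otimes>\<^sub>n I y"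
    by (simp add: interchange inv_pair_cancel[OF a])
  finally show ?thesis
    unfolding S.str_def S.rcap_def by (simp add: cmpS_def tnsS_def brS_def twS_def IS_def mtr_def)
qed

end

text \<open>By naturality of the braiding, \<open>brS\<close> can be computed on any objects that
  the words represent.\<close>

lemma brS_eq:
  assumes a: "inv_pair \<alpha> \<alpha>' (wt p) x" and b: "inv_pair \<beta> \<beta>' (wt q) y"
  shows "brS p q = (p @ q, (L q p \<cdot>\<^sub>n (\<beta>' \<otimes>\<^sub>n \<alpha>')) \<cdot>\<^sub>n br x y \<cdot>\<^sub>n (\<alpha> \<otimes>\<^sub>n \<beta>) \<cdot>\<^sub>n L' p q, q @ p)"
proof -
  note [simp] = inv_pairD[OF a] inv_pairD[OF b]
  have "(L q p \<cdot>\<^sub>n (\<beta>' \<otimes>\<^sub>n \<alpha>')) \<cdot>\<^sub>n br x y \<cdot>\<^sub>n (\<alpha> \<otimes>\<^sub>n \<beta>) \<cdot>\<^sub>n L' p q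
    = L q p \<cdot>\<^sub>n (\<beta>' \<otimes>\<^sub>n \<alpha>') \<cdot>\<^sub>n (br x y \<cdot>\<^sub>n (\<alpha> \<otimes>\<^sub>n \<beta>)) \<cdot>\<^sub>n L' p q"
    by (simp add: cmp_assoc)
  also have "br x y \<cdot>\<^sub>n (\<alpha> \<otimes>\<^sub>n \<beta>) = (\<beta> \<otimes>\<^sub>n \<alpha>) \<cdot>\<^sub>n br (wt p) (wt q)"
    using br_natural[of \<alpha> \<beta>] by simp
  also have "L q p \<cdot>\<^sub>n (\<beta>' \<otimes>\<^sub>n \<alpha>') \<cdot>\<^sub>n ((\<beta> \<otimes>\<^sub>n \<alpha>) \<cdot>\<^sub>n br (wt p) (wt q)) \<cdot>\<^sub>n L' p q
    = L q p \<cdot>\<^sub>n ((\<beta>' \<otimes>\<^sub>n \<alpha>') \<cdot>\<^sub>n (\<beta> \<otimes>\<^sub>n \<alpha>)) \<cdot>\<^sub>n br (wt p) (wt q) \<cdot>\<^sub>n L' p q"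
    by (simp add: cmp_assoc)
  finally show ?thesis by (simp add: brS_def interchange)
qed

lemma monodromyS_eq:
  assumes a: "inv_pair \<alpha> \<alpha>' (wt p) x" and b: "inv_pair \<beta> \<beta>' (wt q) y"
  shows "cmpS (brS q p) (brS p q)
    = (p @ q, (L p q \<cdot>\<^sub>n (\<alpha>' \<otimes>\<^sub>n \<beta>')) \<cdot>\<^sub>n (br y x \<cdot>\<^sub>n br x y) \<cdot>\<^sub>n (\<alpha> \<otimes>\<^sub>n \<beta>) \<cdot>\<^sub>n L' p q, p @ q)"
proof -
  note [simp] = inv_pairD[OF a] inv_pairD[OF b]
  have "((L p q \<cdot>\<^sub>n (\<alpha>' \<otimes>\<^sub>n \<beta>')) \<cdot>\<^sub>n br y x \<cdot>\<^sub>n (\<beta> \<otimes>\<^sub>n \<alpha>) \<cdot>\<^sub>n L' q p) \<cdot>\<^sub>n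
      (L q p \<cdot>\<^sub>n (\<beta>' \<otimes>\<^sub>n \<alpha>')) \<cdot>\<^sub>n br x y \<cdot>\<^sub>n (\<alpha> \<otimes>\<^sub>n \<beta>) \<cdot>\<^sub>n L' p q
    = L p q \<cdot>\<^sub>n (\<alpha>' \<otimes>\<^sub>n \<beta>') \<cdot>\<^sub>n br y x \<cdot>\<^sub>n ((\<beta> \<otimes>\<^sub>n \<alpha>) \<cdot>\<^sub>n (\<beta>' \<otimes>\<^sub>n \<alpha>')) \<cdot>\<^sub>n br x y \<cdot>\<^sub>n (\<alpha> \<otimes>\<^sub>n \<beta>) \<cdot>\<^sub>n L' p q"
    by (simp add: cmp_assoc)
  also have "\<dots> = (L p q \<cdot>\<^sub>n (\<alpha>' \<otimes>\<^sub>n \<beta>')) \<cdot>\<^sub>n (br y x \<cdot>\<^sub>n br x y) \<cdot>\<^sub>n (\<alpha> \<otimes>\<^sub>n \<beta>) \<cdot>\<^sub>n L' p q"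
    by (simp add: interchange cmp_assoc)
  finally show ?thesis
    by (simp add: brS_eq[OF a b] brS_eq[OF b a] cmpS_def)
qed

lemma conj_cancel:
  assumes a: "inv_pair \<alpha> \<alpha>' u x" and b: "inv_pair \<beta> \<beta>' v y"
    and f: "ar f" "dm f = x" "cd f = y" and g: "ar g" "dm g = x" "cd g = y"
    and eq: "\<beta>' \<cdot>\<^sub>n f \<cdot>\<^sub>n \<alpha> = \<beta>' \<cdot>\<^sub>n g \<cdot>\<^sub>n \<alpha>"
  shows "f = g"
proof -
  note [simp] = inv_pairD[OF a] inv_pairD[OF b] f g
  have "\<beta> \<cdot>\<^sub>n (\<beta>' \<cdot>\<^sub>n f \<cdot>\<^sub>n \<alpha>) \<cdot>\<^sub>n \<alpha>' = \<beta> \<cdot>\<^sub>n (\<beta>' \<cdot>\<^sub>n g \<cdot>\<^sub>n \<alpha>) \<cdot>\<^sub>n \<alpha>'" using eq by simp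
  then show ?thesis by (simp add: cmp_assoc inv_pair_cancel[OF b])
qed

lemma mtr_cyclic:
  assumes d: "mdual x y e n" and d': "mdual x' y' e' n'"
    and f: "ar f" "dm f = x'" "cd f = x" and g: "ar g" "dm g = x" "cd g = x'"
  shows "mtr x y e n (f \<cdot>\<^sub>n g) = mtr x' y' e' n' (g \<cdot>\<^sub>n f)"
proof -
  have ob [simp]: "ob x" "ob y" "ob x'" "ob y'" using d d' by (auto simp: mdual_def)
  note p = inv_pair_ru[OF ob(1)] and q = inv_pair_ru[OF ob(2)]
    and p' = inv_pair_ru[OF ob(3)] and q' = inv_pair_ru[OF ob(4)]
  note [simp] = f g
  let ?F = "([x'], ru' x \<cdot>\<^sub>n f \<cdot>\<^sub>n ru x', [x])" and ?G = "([x], ru' x' \<cdot>\<^sub>n g \<cdot>\<^sub>n ru x, [x'])"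
  have "cmpS ?F ?G = ([x], ru' x \<cdot>\<^sub>n (f \<cdot>\<^sub>n g) \<cdot>\<^sub>n ru x, [x])"
    "cmpS ?G ?F = ([x'], ru' x' \<cdot>\<^sub>n (g \<cdot>\<^sub>n f) \<cdot>\<^sub>n ru x', [x'])"
    by (simp_all add: cmpS_def cmp_assoc inv_pair_cancel[OF p] inv_pair_cancel[OF p'])
  moreover have "arS ?F" "arS ?G" by (simp_all add: arS_def)
  ultimately show ?thesis
    using S.str_cyclic[OF dual_pairS[OF d p q] dual_pairS[OF d' p' q'], of ?F ?G]
      strS[OF d p q, of "f \<cdot>\<^sub>n g"] strS[OF d' p' q', of "g \<cdot>\<^sub>n f"] by simp
qed

section \<open>Loops around an object with scalar endomorphisms\<close>

lemma mtr_sc: "mdual x y e n \<Longrightarrow> ar f \<Longrightarrow> dm f = x \<Longrightarrow> cd f = x \<Longrightarrow> mtr x y e n (sc a f) = sc a (mtr x y e n f)"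
  by (auto simp: mdual_def mtr_def)

text \<open>The form in which simplicity enters the diagram calculus.\<close>

definition scalar_endos :: "'o \<Rightarrow> bool" where
  "scalar_endos x \<longleftrightarrow> (\<forall>f. ar f \<and> dm f = x \<and> cd f = x \<longrightarrow> (\<exists>a. f = sc a (I x)))"

lemma scalar_endosS:
  assumes s: "scalar_endos x" and a: "inv_pair \<alpha> \<alpha>' (wt p) x"
    and F: "arS F" "fst F = p" "snd (snd F) = p"
  shows "\<exists>c. F = scS c (IS p)"
proof -
  note [simp] = inv_pairD[OF a]
  obtain f where f: "F = (p, f, p)" "ar f" "dm f = wt p" "cd f = wt p"
    using F by (cases F) (auto simp: arS_def)
  then have "ar (\<alpha> \<cdot>\<^sub>n f \<cdot>\<^sub>n \<alpha>') \<and> dm (\<alpha> \<cdot>\<^sub>n f \<cdot>\<^sub>n \<alpha>') = x \<and> cd (\<alpha> \<cdot>\<^sub>n f \<cdot>\<^sub>n \<alpha>') = x" by simp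
  then obtain c where c: "\<alpha> \<cdot>\<^sub>n f \<cdot>\<^sub>n \<alpha>' = sc c (I x)" using s unfolding scalar_endos_def by blast
  have "f = \<alpha>' \<cdot>\<^sub>n (\<alpha> \<cdot>\<^sub>n f \<cdot>\<^sub>n \<alpha>') \<cdot>\<^sub>n \<alpha>"
    using f by (simp add: cmp_assoc inv_pair_cancel[OF a])
  then have "f = sc c (I (wt p))" unfolding c by simp
  then show ?thesis using f by (auto simp: scS_def IS_def)
qed

lemma arSD:
  assumes "arS F"
  shows "ar (fst (snd F))" "dm (fst (snd F)) = wt (fst F)" "cd (fst (snd F)) = wt (snd (snd F))"
  using assms by (auto simp: arS_def)

text \<open>Closing \<open>w\<close> first turns the double braiding into an endomorphism of
  \<open>y\<close>, here the scalar \<open>c\<close>; closing \<open>y\<close> then yields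
  \<open>c\<close> times the dimension of \<open>y\<close>. The word \<open>q\<close> that
  represents \<open>w\<close> may have several letters, as is required when \<open>w\<close> is a
  tensor product.\<close>

lemma mtr_loop:
  assumes dq: "S.dual_pair q q' eq' nq" and b: "inv_pair \<beta> \<beta>' (wt q) w"
    and dy: "mdual y y' e n" and dyw: "mdual (tO y w) y2 e2 n2"
    and ptr: "S.ptr [y] q q' eq' nq (cmpS (brS q [y]) (brS [y] q)) = scS c (IS [y])"
  shows "mtr (tO y w) y2 e2 n2 (br w y \<cdot>\<^sub>n br y w) = sc c (mtr y y' e n (I y))"
proof -
  have ob [simp]: "ob y" "ob w" "ob y'" "ob y2" using dy dyw inv_pairD[OF b] by (auto simp: mdual_def)
  note py = inv_pair_ru[OF ob(1)] and py' = inv_pair_ru[OF ob(3)] and py2 = inv_pair_ru[OF ob(4)]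
  note [simp] = inv_pairD[OF b]
  note A = inv_pair_append[OF py b]
  let ?M = "cmpS (brS q [y]) (brS [y] q)"
  have M [simp]: "arS ?M" "fst ?M = [y] @ q" "snd (snd ?M) = [y] @ q" by simp_all
  note DY = dual_pairS[OF dy py py']
  have t: "ar (br w y \<cdot>\<^sub>n br y w)" "dm (br w y \<cdot>\<^sub>n br y w) = tO y w" "cd (br w y \<cdot>\<^sub>n br y w)
    = tO y w" by simp_all
  have unit: "cmpS ?M (IS ([y] @ q)) = ?M" "cmpS (IS ([y] @ q)) ?M = ?M" by (rule S.cmp_I S.I_cmp; fact M)+
  note e1 = strS[OF dyw A py2 t, folded monodromyS_eq[OF py b]]
  \<comment> \<open>Cyclicity with an identity replaces the chosen dual of \<open>tO y w\<close> by
    the nested dual, for which the trace splits.\<close>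
  note e2 = S.str_cyclic[OF dual_pairS[OF dyw A py2] S.dual_pair_tns[OF DY dq] M S.ar_I, unfolded unit]
  have "([], mtr (tO y w) y2 e2 n2 (br w y \<cdot>\<^sub>n br y w), [])
      = S.str [y] [y'] ([y'] @ [y], e \<cdot>\<^sub>n (ru y' \<otimes>\<^sub>n ru y) \<cdot>\<^sub>n L' [y'] [y], [])
         ([], L [y] [y'] \<cdot>\<^sub>n (ru' y \<otimes>\<^sub>n ru' y') \<cdot>\<^sub>n n, [y] @ [y']) (S.ptr [y] q q' eq' nq ?M)"
    by (rule trans[OF e1[symmetric] trans[OF e2 S.str_eq_str_ptr[OF DY dq M]]])
  also have "\<dots> = scS c (S.str [y] [y'] ([y'] @ [y], e \<cdot>\<^sub>n (ru y' \<otimes>\<^sub>n ru y) \<cdot>\<^sub>n L' [y'] [y], [])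
         ([], L [y] [y'] \<cdot>\<^sub>n (ru' y \<otimes>\<^sub>n ru' y') \<cdot>\<^sub>n n, [y] @ [y']) (IS [y]))"
    unfolding ptr S.str_def using S.ar_rcap[OF DY] S.dual_pairD[OF DY] by simp
  also have "IS [y] = ([y], ru' y \<cdot>\<^sub>n I y \<cdot>\<^sub>n ru y, [y])" by (simp add: IS_def)
  also have "scS c (S.str [y] [y'] ([y'] @ [y], e \<cdot>\<^sub>n (ru y' \<otimes>\<^sub>n ru y) \<cdot>\<^sub>n L' [y'] [y], [])
         ([], L [y] [y'] \<cdot>\<^sub>n (ru' y \<otimes>\<^sub>n ru' y') \<cdot>\<^sub>n n, [y] @ [y']) ([y], ru' y \<cdot>\<^sub>n I y \<cdot>\<^sub>n ru y, [y]))
       = ([], sc c (mtr y y' e n (I y)), [])"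
    using strS[OF dy py py', of "I y"] by (simp add: scS_def)
  finally show ?thesis by simp
qed

text \<open>The scalars \<open>a\<close> and \<open>b\<close> are the effects on \<open>y\<close> of
  loops coloured \<open>x\<close> and \<open>z\<close>; they exist because all endomorphisms of
  \<open>y\<close> are scalars. Representing \<open>tO x z\<close> by the word
  \<open>[x] @ [z]\<close> makes \<open>ptr_monodromy_tns\<close> applicable, which multiplies
  them.\<close>

lemma mtr_loop_mult:
  assumes s: "scalar_endos y" and dx: "mdual x x' ex nx" and dz: "mdual z z' ez nz" and dy: "mdual y y' e n"
    and d1: "mdual (tO y x) y1 e1 n1" and d2: "mdual (tO y z) y2 e2 n2"
      and d3: "mdual (tO y (tO x z)) y3 e3 n3"
  obtains a b where "mtr (tO y x) y1 e1 n1 (br x y \<cdot>\<^sub>n br y x) = sc a (mtr y y' e n (I y))"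
    "mtr (tO y z) y2 e2 n2 (br z y \<cdot>\<^sub>n br y z) = sc b (mtr y y' e n (I y))"
    "mtr (tO y (tO x z)) y3 e3 n3 (br (tO x z) y \<cdot>\<^sub>n br y (tO x z)) = sc (a * b) (mtr y y' e n (I y))"
proof -
  have ob [simp]: "ob x" "ob y" "ob z" "ob x'" "ob z'" using dx dy dz by (auto simp: mdual_def)
  note px = inv_pair_ru[OF ob(1)] and py = inv_pair_ru[OF ob(2)] and pz = inv_pair_ru[OF ob(3)]
  note DX = dual_pairS[OF dx px inv_pair_ru[OF ob(4)]] and DZ = dual_pairS[OF dz pz inv_pair_ru[OF ob(5)]]
  have ptr_typed: "arS (S.ptr [y] q q' eq' nq (cmpS (brS q [y]) (brS [y] q)))"
    "fst (S.ptr [y] q q' eq' nq (cmpS (brS q [y]) (brS [y] q))) = [y]"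
    "snd (snd (S.ptr [y] q q' eq' nq (cmpS (brS q [y]) (brS [y] q)))) = [y]"
    if "S.dual_pair q q' eq' nq" for q q' eq' nq
    using S.ar_rcap[OF that] S.dual_pairD[OF that] by (simp_all add: S.ptr_def)
  from scalar_endosS[OF s py ptr_typed[OF DX]] obtain a where a: "S.ptr [y] [x] [x']
    ([x'] @ [x], ex \<cdot>\<^sub>n (ru x' \<otimes>\<^sub>n ru x) \<cdot>\<^sub>n L' [x'] [x], [])
      ([], L [x] [x'] \<cdot>\<^sub>n (ru' x \<otimes>\<^sub>n ru' x') \<cdot>\<^sub>n nx, [x] @ [x']) (cmpS (brS [x] [y]) (brS [y] [x]))
        = scS a (IS [y])" ..
  from scalar_endosS[OF s py ptr_typed[OF DZ]] obtain b where b: "S.ptr [y] [z] [z']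
    ([z'] @ [z], ez \<cdot>\<^sub>n (ru z' \<otimes>\<^sub>n ru z) \<cdot>\<^sub>n L' [z'] [z], [])
      ([], L [z] [z'] \<cdot>\<^sub>n (ru' z \<otimes>\<^sub>n ru' z') \<cdot>\<^sub>n nz, [z] @ [z']) (cmpS (brS [z] [y]) (brS [y] [z]))
        = scS b (IS [y])" ..
  note c = S.ptr_monodromy_tns[OF DX DZ b a]
  note m = mtr_loop[OF S.dual_pair_tns[OF DX DZ] inv_pair_append[OF px pz] dy d3 c]
  show ?thesis
    by (rule that[OF mtr_loop[OF DX px dy d1 a] mtr_loop[OF DZ pz dy d2 b] m[unfolded mult.commute[of b a]]])
qed

lemma monodromy_scalarS:
  assumes a: "inv_pair \<alpha> \<alpha>' (wt p) x" and b: "inv_pair \<beta> \<beta>' (wt q) y"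
  shows "br y x \<cdot>\<^sub>n br x y = sc c (I (tO x y)) \<longleftrightarrow> cmpS (brS q p) (brS p q) = scS c (IS (p @ q))"
proof -
  note A = inv_pair_append[OF a b]
  note [simp] = inv_pairD[OF a] inv_pairD[OF b]
  have sc: "(L p q \<cdot>\<^sub>n (\<alpha>' \<otimes>\<^sub>n \<beta>')) \<cdot>\<^sub>n sc c (I (tO x y)) \<cdot>\<^sub>n (\<alpha> \<otimes>\<^sub>n \<beta>) \<cdot>\<^sub>n L' p q = sc c (I (wt (p @ q)))"
  proof -
    have "(L p q \<cdot>\<^sub>n (\<alpha>' \<otimes>\<^sub>n \<beta>')) \<cdot>\<^sub>n sc c (I (tO x y)) \<cdot>\<^sub>n (\<alpha> \<otimes>\<^sub>n \<beta>) \<cdot>\<^sub>n L' p q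
      = sc c ((L p q \<cdot>\<^sub>n (\<alpha>' \<otimes>\<^sub>n \<beta>')) \<cdot>\<^sub>n (\<alpha> \<otimes>\<^sub>n \<beta>) \<cdot>\<^sub>n L' p q)" by simp
    then show ?thesis unfolding inv_pairD(9)[OF A] .
  qed
  have t: "ar (br y x \<cdot>\<^sub>n br x y)" "dm (br y x \<cdot>\<^sub>n br x y) = tO x y" "cd (br y x \<cdot>\<^sub>n br x y) = tO x y"
    "ar (sc c (I (tO x y)))" "dm (sc c (I (tO x y))) = tO x y" "cd (sc c (I (tO x y))) = tO x y" by simp_all
  show ?thesis
  proof
    assume *: "br y x \<cdot>\<^sub>n br x y = sc c (I (tO x y))"
    show "cmpS (brS q p) (brS p q) = scS c (IS (p @ q))"
      unfolding monodromyS_eq[OF a b] * sc by (simp only: scS_def IS_def prod.case)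
  next
    assume "cmpS (brS q p) (brS p q) = scS c (IS (p @ q))"
    then have "(L p q \<cdot>\<^sub>n (\<alpha>' \<otimes>\<^sub>n \<beta>')) \<cdot>\<^sub>n (br y x \<cdot>\<^sub>n br x y) \<cdot>\<^sub>n (\<alpha> \<otimes>\<^sub>n \<beta>) \<cdot>\<^sub>n L' p q = sc c (I (wt (p @ q)))"
      unfolding monodromyS_eq[OF a b] by (simp only: scS_def IS_def prod.case prod.inject)
    then show "br y x \<cdot>\<^sub>n br x y = sc c (I (tO x y))"
      unfolding sc[symmetric] by (rule conj_cancel[OF A A t])
  qed
qed

lemma monodromy_tns:
  assumes ob [simp]: "ob g" "ob x" "ob y"
    and x: "br x g \<cdot>\<^sub>n br g x = sc a (I (tO g x))" and y: "br y g \<cdot>\<^sub>n br g y = sc b (I (tO g y))"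
  shows "br (tO x y) g \<cdot>\<^sub>n br g (tO x y) = sc (a * b) (I (tO g (tO x y)))"
proof -
  note pg = inv_pair_ru[OF ob(1)] and px = inv_pair_ru[OF ob(2)] and py = inv_pair_ru[OF ob(3)]
  show ?thesis
    using S.monodromy_scalar_tns[of "[x]" "[g]" a "[y]" b] x y
    unfolding monodromy_scalarS[OF pg inv_pair_append[OF px py]]
      monodromy_scalarS[OF pg px] monodromy_scalarS[OF pg py] by simp
qed

text \<open>The unit is represented by the empty word, and braidings with the empty word are
  identities.\<close>

lemma monodromy_un:
  assumes ob [simp]: "ob x"
  shows "br x un \<cdot>\<^sub>n br un x = I (tO un x)"
proof -
  note A = inv_pair_append[OF inv_pair_un inv_pair_ru[OF ob]]
  note [simp] = inv_pairD[OF A]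
  have t: "ar (br x un \<cdot>\<^sub>n br un x)" "dm (br x un \<cdot>\<^sub>n br un x) = tO un x" "cd (br x un \<cdot>\<^sub>n br un x) = tO un x"
    "ar (I (tO un x))" "dm (I (tO un x)) = tO un x" "cd (I (tO un x)) = tO un x" by simp_all
  have "cmpS (brS [x] []) (brS [] [x]) = IS ([] @ [x])" by simp
  then have "(L [] [x] \<cdot>\<^sub>n (I un \<otimes>\<^sub>n ru' x)) \<cdot>\<^sub>n (br x un \<cdot>\<^sub>n br un x) \<cdot>\<^sub>n (I un \<otimes>\<^sub>n ru x) \<cdot>\<^sub>n L' [] [x]
    = I (wt ([] @ [x]))"
    unfolding monodromyS_eq[OF inv_pair_un inv_pair_ru[OF ob]] IS_def by (simp only: prod.inject)
  also have "\<dots> = (L [] [x] \<cdot>\<^sub>n (I un \<otimes>\<^sub>n ru' x)) \<cdot>\<^sub>n I (tO un x) \<cdot>\<^sub>n (I un \<otimes>\<^sub>n ru x) \<cdot>\<^sub>n L' [] [x]"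
    using inv_pairD(9)[OF A] by simp
  finally show ?thesis by (rule conj_cancel[OF A A t])
qed

text \<open>Cyclicity compares the given dual of the unit with the empty word, which is its own dual
  and has trivial trace.\<close>

lemma mtr_un:
  assumes d: "mdual un y e n"
  shows "mtr un y e n (I un) = I un"
proof -
  have ob [simp]: "ob y" using d by (simp add: mdual_def)
  have 0: "S.dual_pair [] [] (IS []) (IS [])" by (simp add: S.dual_pair_def)
  have t: "ar (I un)" "dm (I un) = un" "cd (I un) = un" by simp_all
  have c: "([], I un \<cdot>\<^sub>n I un \<cdot>\<^sub>n I un, []) = IS []" by (simp add: IS_def)
  have unit: "cmpS (IS []) (IS []) = IS []" by simp
  note e1 = strS[OF d inv_pair_un inv_pair_ru[OF ob] t, unfolded c]
  note e2 = S.str_cyclic[OF dual_pairS[OF d inv_pair_un inv_pair_ru[OF ob]] 0 S.ar_I S.ar_I, unfolded unit]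
  have e3: "S.str [] [] (IS []) (IS []) (IS []) = IS []" by (simp add: S.str_def S.rcap_def)
  have "([], mtr un y e n (I un), []) = IS []"
    by (rule trans[OF e1[symmetric] trans[OF e2 e3]])
  then show ?thesis by (simp add: IS_def)
qed

lemma scalar_endos_dual:
  assumes d: "mdual x y e n" and s: "scalar_endos x"
  shows "scalar_endos y"
  unfolding scalar_endos_def
proof (intro allI impI)
  fix f assume f: "ar f \<and> dm f = y \<and> cd f = y"
  have ob [simp]: "ob x" "ob y" using d by (auto simp: mdual_def)
  note px = inv_pair_ru[OF ob(1)] and py = inv_pair_ru[OF ob(2)]
  note D = dual_pairS[OF d px py]
  let ?F = "([y], ru' y \<cdot>\<^sub>n f \<cdot>\<^sub>n ru y, [y])"
  let ?E = "([y] @ [x], e \<cdot>\<^sub>n (ru y \<otimes>\<^sub>n ru x) \<cdot>\<^sub>n L' [y] [x], [])"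
  let ?N = "([], L [x] [y] \<cdot>\<^sub>n (ru' x \<otimes>\<^sub>n ru' y) \<cdot>\<^sub>n n, [x] @ [y])"
  have F: "arS ?F" "fst ?F = [y]" "snd (snd ?F) = [y]" using f by (simp_all add: arS_def)
  let ?T = "cmpS (tnsS (IS [x]) (cmpS ?E (tnsS ?F (IS [x])))) (tnsS ?N (IS [x]))"
  have "arS ?T" "fst ?T = [x]" "snd (snd ?T) = [x]"
    using F S.dual_pairD[OF D] by simp_all
  then obtain a where "?T = scS a (IS [x])" using scalar_endosS[OF s px] by blast
  from S.dual_endo_scalar[OF D F this] have "ru' y \<cdot>\<^sub>n f \<cdot>\<^sub>n ru y = sc a (I (wt [y]))"
    by (simp add: scS_def IS_def)
  also have "\<dots> = ru' y \<cdot>\<^sub>n sc a (I y) \<cdot>\<^sub>n ru y" by simp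
  finally have "f = sc a (I y)" using conj_cancel[OF py py] f by simp
  then show "\<exists>a. f = sc a (I y)" by blast
qed

text \<open>Transposition of words, carried back to objects. Compatibility with scalars is recorded
  because it preserves zero and proportionality of morphisms, which are the two facts drawn from it
  later.\<close>

lemma adjunction:
  assumes d: "mdual x y e n" and ob [simp]: "ob a" "ob b"
  obtains \<Phi> \<Psi> where
    "\<And>k. \<lbrakk>ar k; dm k = tO y a; cd k = b\<rbrakk> \<Longrightarrow> ar (\<Phi> k) \<and> dm (\<Phi> k) = a \<and> cd (\<Phi> k) = tO x b \<and> \<Psi> (\<Phi> k) = k"
    "\<And>l. \<lbrakk>ar l; dm l = a; cd l = tO x b\<rbrakk> \<Longrightarrow> ar (\<Psi> l) \<and> dm (\<Psi> l) = tO y a \<and> cd (\<Psi> l) = b \<and> \<Phi> (\<Psi> l) = l"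
    "\<And>k c. \<lbrakk>ar k; dm k = tO y a; cd k = b\<rbrakk> \<Longrightarrow> \<Phi> (sc c k) = sc c (\<Phi> k)"
    "\<And>l c. \<lbrakk>ar l; dm l = a; cd l = tO x b\<rbrakk> \<Longrightarrow> \<Psi> (sc c l) = sc c (\<Psi> l)"
proof -
  have ob' [simp]: "ob x" "ob y" using d by (auto simp: mdual_def)
  note px = inv_pair_ru[OF ob'(1)] and py = inv_pair_ru[OF ob'(2)]
    and pa = inv_pair_ru[OF ob(1)] and pb = inv_pair_ru[OF ob(2)]
  note D = dual_pairS[OF d px py]
  define E where "E = ([y] @ [x], e \<cdot>\<^sub>n (ru y \<otimes>\<^sub>n ru x) \<cdot>\<^sub>n L' [y] [x], [] :: 'o list)"
  define N where "N = ([] :: 'o list, L [x] [y] \<cdot>\<^sub>n (ru' x \<otimes>\<^sub>n ru' y) \<cdot>\<^sub>n n, [x] @ [y])"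
  define A where "A = (ru y \<otimes>\<^sub>n ru a) \<cdot>\<^sub>n L' [y] [a]"
  define A' where "A' = L [y] [a] \<cdot>\<^sub>n (ru' y \<otimes>\<^sub>n ru' a)"
  define B where "B = (ru x \<otimes>\<^sub>n ru b) \<cdot>\<^sub>n L' [x] [b]"
  define B' where "B' = L [x] [b] \<cdot>\<^sub>n (ru' x \<otimes>\<^sub>n ru' b)"
  have D: "S.dual_pair [x] [y] E N" using D by (simp add: E_def N_def)
  have A: "inv_pair A A' (wt ([y] @ [a])) (tO y a)" and B: "inv_pair B B' (wt ([x] @ [b])) (tO x b)"
    unfolding A_def A'_def B_def B'_def by (rule inv_pair_append[OF py pa] inv_pair_append[OF px pb])+
  note [simp] = inv_pairD[OF A] inv_pairD[OF B] S.dual_pairD[OF D]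
  \<comment> \<open>\<open>K\<close> and \<open>M\<close> read morphisms between objects as arrows
    between words; \<open>KS\<close> and \<open>MS\<close> are the mutually inverse transpositions
    of these arrows.\<close>
  define K where "K k = ([y] @ [a], ru' b \<cdot>\<^sub>n k \<cdot>\<^sub>n A, [b])" for k
  define M where "M l = ([a], B' \<cdot>\<^sub>n l \<cdot>\<^sub>n ru a, [x] @ [b])" for l
  define KS where "KS F = cmpS (tnsS (IS [x]) F) (tnsS N (IS [a]))" for F
  define MS where "MS F = cmpS (tnsS E (IS [b])) (tnsS (IS [y]) F)" for F
  define \<Phi> where "\<Phi> k = B \<cdot>\<^sub>n fst (snd (KS (K k))) \<cdot>\<^sub>n ru' a" for k
  define \<Psi> where "\<Psi> l = ru b \<cdot>\<^sub>n fst (snd (MS (M l))) \<cdot>\<^sub>n A'" for l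
  have K: "arS (K k)" "fst (K k) = [y] @ [a]" "snd (snd (K k)) = [b]"
    if "ar k" "dm k = tO y a" "cd k = b" for k
    using that by (simp_all add: K_def arS_def)
  have M: "arS (M l)" "fst (M l) = [a]" "snd (snd (M l)) = [x] @ [b]"
    if "ar l" "dm l = a" "cd l = tO x b" for l
    using that by (simp_all add: M_def arS_def)
  have KS: "arS (KS F)" "fst (KS F) = [a]" "snd (snd (KS F)) = [x] @ [b]" "MS (KS F) = F"
    if "arS F" "fst F = [y] @ [a]" "snd (snd F) = [b]" for F
    using that S.transpose_down_up[OF D that] by (simp_all add: KS_def MS_def)
  have MS: "arS (MS F)" "fst (MS F) = [y] @ [a]" "snd (snd (MS F)) = [b]" "KS (MS F) = F"
    if "arS F" "fst F = [a]" "snd (snd F) = [x] @ [b]" for F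
    using that S.transpose_up_down[OF D that] by (simp_all add: KS_def MS_def)
  have F_KS: "ar (fst (snd (KS F)))" "dm (fst (snd (KS F))) = wt [a]" "cd (fst (snd (KS F))) = wt ([x] @ [b])"
    if "arS F" "fst F = [y] @ [a]" "snd (snd F) = [b]" for F
    using arSD[OF KS(1)[OF that]] KS(2,3)[OF that] by simp_all
  have F_MS: "ar (fst (snd (MS F)))" "dm (fst (snd (MS F))) = wt ([y] @ [a])" "cd (fst (snd (MS F))) = wt [b]"
    if "arS F" "fst F = [a]" "snd (snd F) = [x] @ [b]" for F
    using arSD[OF MS(1)[OF that]] MS(2,3)[OF that] by simp_all
  have M\<Phi>: "M (\<Phi> k) = KS (K k)" if "ar k" "dm k = tO y a" "cd k = b" for k
  proof -
    have "B' \<cdot>\<^sub>n (B \<cdot>\<^sub>n fst (snd (KS (K k))) \<cdot>\<^sub>n ru' a) \<cdot>\<^sub>n ru a = fst (snd (KS (K k)))"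
      using F_KS[OF K[OF that]] by (simp add: cmp_assoc inv_pair_cancel[OF B])
    then show ?thesis using KS(2,3)[OF K[OF that]] by (simp add: M_def \<Phi>_def prod_eq_iff)
  qed
  have K\<Psi>: "K (\<Psi> l) = MS (M l)" if "ar l" "dm l = a" "cd l = tO x b" for l
  proof -
    have "ru' b \<cdot>\<^sub>n (ru b \<cdot>\<^sub>n fst (snd (MS (M l))) \<cdot>\<^sub>n A') \<cdot>\<^sub>n A = fst (snd (MS (M l)))"
      using F_MS[OF M[OF that]] by (simp add: cmp_assoc inv_pair_cancel[OF pb])
    then show ?thesis using MS(2,3)[OF M[OF that]] by (simp add: K_def \<Psi>_def prod_eq_iff)
  qed
  have sK: "K (sc c k) = scS c (K k)" if "ar k" "dm k = tO y a" "cd k = b" for k c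
    using that by (simp add: K_def scS_def)
  have sM: "M (sc c l) = scS c (M l)" if "ar l" "dm l = a" "cd l = tO x b" for l c
    using that by (simp add: M_def scS_def)
  have sKS: "KS (scS c F) = scS c (KS F)" if "arS F" "fst F = [y] @ [a]" "snd (snd F) = [b]" for F c
    using that by (simp add: KS_def)
  have sMS: "MS (scS c F) = scS c (MS F)" if "arS F" "fst F = [a]" "snd (snd F) = [x] @ [b]" for F c
    using that by (simp add: MS_def)
  have fs: "fst (snd (scS c F)) = sc c (fst (snd F))" for c F by (cases F) (simp add: scS_def)
  show ?thesis
  proof (rule that[of \<Phi> \<Psi>])
    fix k c assume k: "ar k" "dm k = tO y a" "cd k = b"
    have "\<Psi> (\<Phi> k) = ru b \<cdot>\<^sub>n (ru' b \<cdot>\<^sub>n k \<cdot>\<^sub>n A) \<cdot>\<^sub>n A'"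
      unfolding \<Psi>_def M\<Phi>[OF k] KS(4)[OF K[OF k]] by (simp add: K_def)
    also have "\<dots> = k" using k by (simp add: cmp_assoc inv_pair_cancel[OF pb])
    finally show "ar (\<Phi> k) \<and> dm (\<Phi> k) = a \<and> cd (\<Phi> k) = tO x b \<and> \<Psi> (\<Phi> k) = k"
      using F_KS[OF K[OF k]] by (simp add: \<Phi>_def)
    show "\<Phi> (sc c k) = sc c (\<Phi> k)"
      using F_KS[OF K[OF k]] by (simp add: \<Phi>_def sK[OF k] sKS[OF K[OF k]] fs)
  next
    fix l c assume l: "ar l" "dm l = a" "cd l = tO x b"
    have "\<Phi> (\<Psi> l) = B \<cdot>\<^sub>n (B' \<cdot>\<^sub>n l \<cdot>\<^sub>n ru a) \<cdot>\<^sub>n ru' a"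
      unfolding \<Phi>_def K\<Psi>[OF l] MS(4)[OF M[OF l]] by (simp add: M_def)
    also have "\<dots> = l" using l by (simp add: cmp_assoc inv_pair_cancel[OF B])
    finally show "ar (\<Psi> l) \<and> dm (\<Psi> l) = tO y a \<and> cd (\<Psi> l) = b \<and> \<Phi> (\<Psi> l) = l"
      using F_MS[OF M[OF l]] by (simp add: \<Psi>_def)
    show "\<Psi> (sc c l) = sc c (\<Psi> l)"
      using F_MS[OF M[OF l]] by (simp add: \<Psi>_def sM[OF l] sMS[OF M[OF l]] fs)
  qed
qed

end

section \<open>Linear and semisimple categories\<close>

context linear_category
begin

sublocale vs: vector_space "scl C"
  by (rule vector_space)

lemma comp_Hom:
  "\<lbrakk>f \<in> Hom C x y; g \<in> Hom C y z; x \<in> Obj C; y \<in> Obj C; z \<in> Obj C\<rbrakk> \<Longrightarrow> g \<cdot> f \<in> Hom C x z"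
  by (rule cmp_in_Hom)

lemma Hom_closed:
  assumes "x \<in> Obj C" "y \<in> Obj C"
  shows zero_in_Hom: "0 \<in> Hom C x y"
    and add_in_Hom: "\<lbrakk>f \<in> Hom C x y; g \<in> Hom C x y\<rbrakk> \<Longrightarrow> f + g \<in> Hom C x y"
    and scl_in_Hom: "f \<in> Hom C x y \<Longrightarrow> scl C a f \<in> Hom C x y"
    and diff_in_Hom: "\<lbrakk>f \<in> Hom C x y; g \<in> Hom C x y\<rbrakk> \<Longrightarrow> f - g \<in> Hom C x y"
    and sum_in_Hom: "(\<And>j. j \<in> A \<Longrightarrow> h j \<in> Hom C x y) \<Longrightarrow> sum h A \<in> Hom C x y"
  using subspace_Hom[OF assms]
  by (auto intro: vs.subspace_0 vs.subspace_add vs.subspace_scale vs.subspace_diff vs.subspace_sum)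

lemma cmp_zero_right: "\<lbrakk>g \<in> Hom C y z; x \<in> Obj C; y \<in> Obj C; z \<in> Obj C\<rbrakk> \<Longrightarrow> g \<cdot> 0 = 0"
  using cmp_scl_right[of x y z 0 g 0] zero_in_Hom[of x y] by simp

lemma cmp_zero_left: "\<lbrakk>f \<in> Hom C x y; x \<in> Obj C; y \<in> Obj C; z \<in> Obj C\<rbrakk> \<Longrightarrow> 0 \<cdot> f = 0"
  using cmp_scl_left[of x y z f 0 0] zero_in_Hom[of y z] by simp

lemma cmp_diff_right:
  assumes "x \<in> Obj C" "y \<in> Obj C" "z \<in> Obj C" "f \<in> Hom C x y" "f' \<in> Hom C x y" "g \<in> Hom C y z"
  shows "g \<cdot> (f - f') = g \<cdot> f - g \<cdot> f'"
  using cmp_add_right[of x y z "f - f'" f' g] diff_in_Hom[of x y f f'] assms by simp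

lemma cmp_diff_left:
  assumes "x \<in> Obj C" "y \<in> Obj C" "z \<in> Obj C" "f \<in> Hom C x y" "g \<in> Hom C y z" "g' \<in> Hom C y z"
  shows "(g - g') \<cdot> f = g \<cdot> f - g' \<cdot> f"
  using cmp_add_left[of x y z f "g - g'" g'] diff_in_Hom[of y z g g'] assms by simp

lemma cmp_sum_right:
  assumes "x \<in> Obj C" "y \<in> Obj C" "z \<in> Obj C" "\<And>j. j \<in> A \<Longrightarrow> f j \<in> Hom C x y" "g \<in> Hom C y z"
  shows "g \<cdot> sum f A = (\<Sum>j \<in> A. g \<cdot> f j)"
  using assms(4)
proof (induction A rule: infinite_finite_induct)
  case (insert a A)
  then show ?case using assms cmp_add_right[of x y z "f a" "sum f A" g] by (simp add: sum_in_Hom)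
qed (use assms cmp_zero_right in auto)

lemma cmp_sum_left:
  assumes "x \<in> Obj C" "y \<in> Obj C" "z \<in> Obj C" "\<And>j. j \<in> A \<Longrightarrow> g j \<in> Hom C y z" "f \<in> Hom C x y"
  shows "sum g A \<cdot> f = (\<Sum>j \<in> A. g j \<cdot> f)"
  using assms(4)
proof (induction A rule: infinite_finite_induct)
  case (insert a A)
  then show ?case using assms cmp_add_left[of x y z f "g a" "sum g A"] by (simp add: sum_in_Hom)
qed (use assms cmp_zero_left in auto)

lemma inverse_arrows_sym: "inverse_arrows C x y f g \<Longrightarrow> inverse_arrows C y x g f"
  by (auto simp: inverse_arrows_def)

lemma inverse_arrows_unique:
  assumes "inverse_arrows C x y f g" "inverse_arrows C x y f g'" "x \<in> Obj C" "y \<in> Obj C"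
  shows "g = g'"
proof -
  have h: "f \<in> Hom C x y" "g \<in> Hom C y x" "g' \<in> Hom C y x" "g \<cdot> f = idm C x" "f \<cdot> g' = idm C y"
    using assms by (auto simp: inverse_arrows_def)
  have "g = g \<cdot> (f \<cdot> g')" using h assms cmp_idm_right by simp
  also have "\<dots> = (g \<cdot> f) \<cdot> g'" by (rule cmp_assoc) (use h assms in auto)
  also have "\<dots> = g'" using h assms cmp_idm_left by simp
  finally show ?thesis .
qed

lemma inv_arrow:
  assumes "iso_arrow C x y f" "x \<in> Obj C" "y \<in> Obj C"
  shows "inverse_arrows C x y f (inv_arrow C x y f)"
  unfolding inv_arrow_def using assms inverse_arrows_unique
  by (metis (mono_tags, lifting) iso_arrow_def theI)

lemma iso_arrowD:
  assumes "iso_arrow C x y f" "x \<in> Obj C" "y \<in> Obj C"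
  shows "f \<in> Hom C x y" "inv_arrow C x y f \<in> Hom C y x"
    "inv_arrow C x y f \<cdot> f = idm C x" "f \<cdot> inv_arrow C x y f = idm C y"
  using inv_arrow[OF assms] by (auto simp: inverse_arrows_def)

lemma inverse_arrows_comp:
  assumes "inverse_arrows C x y f g" "inverse_arrows C y z f' g'"
    and xyz: "x \<in> Obj C" "y \<in> Obj C" "z \<in> Obj C"
  shows "inverse_arrows C x z (f' \<cdot> f) (g \<cdot> g')"
proof -
  have h: "f \<in> Hom C x y" "g \<in> Hom C y x" "g \<cdot> f = idm C x" "f \<cdot> g = idm C y"
    "f' \<in> Hom C y z" "g' \<in> Hom C z y" "g' \<cdot> f' = idm C y" "f' \<cdot> g' = idm C z"
    using assms by (auto simp: inverse_arrows_def)
  have h': "f' \<cdot> f \<in> Hom C x z" "g \<cdot> g' \<in> Hom C z x" using h xyz comp_Hom by blast+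
  have "(g \<cdot> g') \<cdot> (f' \<cdot> f) = g \<cdot> ((g' \<cdot> f') \<cdot> f)"
    using h h' xyz by (simp add: cmp_assoc[symmetric, of x z y x] cmp_assoc[of x y z y])
  moreover have "(f' \<cdot> f) \<cdot> (g \<cdot> g') = f' \<cdot> ((f \<cdot> g) \<cdot> g')"
    using h h' xyz by (simp add: cmp_assoc[symmetric, of z x y z] cmp_assoc[of z y x y])
  ultimately show ?thesis
    using h h' xyz by (simp add: inverse_arrows_def cmp_idm_left)
qed

lemma isomorphic_refl: "x \<in> Obj C \<Longrightarrow> isomorphic C x x"
  using idm_in_Hom cmp_idm_left unfolding isomorphic_def iso_arrow_def inverse_arrows_def by blast

lemma isomorphic_sym: "isomorphic C x y \<Longrightarrow> isomorphic C y x"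
  unfolding isomorphic_def iso_arrow_def using inverse_arrows_sym by blast

lemma isomorphic_trans:
  "\<lbrakk>isomorphic C x y; isomorphic C y z; x \<in> Obj C; y \<in> Obj C; z \<in> Obj C\<rbrakk> \<Longrightarrow> isomorphic C x z"
  unfolding isomorphic_def iso_arrow_def using inverse_arrows_comp by metis

lemma iso_class_eq_iff:
  assumes "x \<in> Obj C" "y \<in> Obj C"
  shows "iso_class C x = iso_class C y \<longleftrightarrow> isomorphic C x y"
proof
  assume "iso_class C x = iso_class C y"
  then show "isomorphic C x y" using assms isomorphic_refl by (auto simp: iso_class_def)
next
  assume "isomorphic C x y"
  then show "iso_class C x = iso_class C y"
    using assms isomorphic_sym isomorphic_trans unfolding iso_class_def by blast
qed

lemma zero_object_iff_idm: "x \<in> Obj C \<Longrightarrow> zero_object C x \<longleftrightarrow> idm C x = 0"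
proof
  assume x: "x \<in> Obj C" and 0: "idm C x = 0"
  have "f = 0" if "y \<in> Obj C" "f \<in> Hom C x y" for f y
    using cmp_idm_right[OF x that] cmp_zero_right[OF that(2) x x that(1)] 0 by simp
  moreover have "f = 0" if "y \<in> Obj C" "f \<in> Hom C y x" for f y
    using cmp_idm_left[OF that(1) x that(2)] cmp_zero_left[OF that(2,1) x x] 0 by simp
  ultimately show "zero_object C x"
    using x zero_in_Hom by (auto simp: zero_object_def)
qed (use idm_in_Hom in \<open>auto simp: zero_object_def\<close>)

lemma zero_object_isomorphic:
  assumes "isomorphic C x y" "x \<in> Obj C" "y \<in> Obj C" "zero_object C x"
  shows "zero_object C y"
proof -
  obtain f g where "f \<in> Hom C x y" "g \<in> Hom C y x" "f \<cdot> g = idm C y"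
    using assms by (auto simp: isomorphic_def iso_arrow_def inverse_arrows_def)
  moreover have "f = 0" using assms calculation by (auto simp: zero_object_def)
  ultimately have "idm C y = 0" using assms cmp_zero_left[of g y x y] by simp
  then show ?thesis using assms by (simp add: zero_object_iff_idm)
qed

text \<open>\<open>is_direct_sum\<close> with its injections and projections made explicit, so that
  several statements can refer to the same ones.\<close>

definition biproduct :: "'o \<Rightarrow> 'o list \<Rightarrow> (nat \<Rightarrow> 'm) \<Rightarrow> (nat \<Rightarrow> 'm) \<Rightarrow> bool" where
  "biproduct v xs i p \<longleftrightarrow> v \<in> Obj C \<and> set xs \<subseteq> Obj C \<and>
     (\<forall>j < length xs. i j \<in> Hom C (xs ! j) v \<and> p j \<in> Hom C v (xs ! j)) \<and>
     (\<forall>j < length xs. \<forall>l < length xs. p l \<cdot> i j = (if j = l then idm C (xs ! j) else 0)) \<and>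
     (\<Sum>j < length xs. i j \<cdot> p j) = idm C v"

lemma is_direct_sum_iff: "is_direct_sum C v xs \<longleftrightarrow> (\<exists>i p. biproduct v xs i p)"
  unfolding is_direct_sum_def biproduct_def by auto

lemma biproductD:
  assumes "biproduct v xs i p"
  shows "v \<in> Obj C" "set xs \<subseteq> Obj C" "j < length xs \<Longrightarrow> xs ! j \<in> Obj C"
    "j < length xs \<Longrightarrow> i j \<in> Hom C (xs ! j) v" "j < length xs \<Longrightarrow> p j \<in> Hom C v (xs ! j)"
    "j < length xs \<Longrightarrow> p j \<cdot> i j = idm C (xs ! j)"
    "\<lbrakk>j < length xs; l < length xs; j \<noteq> l\<rbrakk> \<Longrightarrow> p l \<cdot> i j = 0"
    "(\<Sum>j < length xs. i j \<cdot> p j) = idm C v"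
  using assms unfolding biproduct_def by (auto simp: subset_iff)

lemma biproduct_expand:
  assumes b: "biproduct v xs i p" and z: "z \<in> Obj C" and g: "g \<in> Hom C z v"
  shows "g = (\<Sum>j < length xs. i j \<cdot> (p j \<cdot> g))"
proof -
  note D = biproductD[OF b]
  have "g = (\<Sum>j < length xs. i j \<cdot> p j) \<cdot> g" using D(8) g z D(1) cmp_idm_left by simp
  also have "\<dots> = (\<Sum>j < length xs. (i j \<cdot> p j) \<cdot> g)"
    by (rule cmp_sum_left[of z v v]) (use D g z in \<open>auto intro!: comp_Hom[OF D(5) D(4)]\<close>)
  also have "\<dots> = (\<Sum>j < length xs. i j \<cdot> (p j \<cdot> g))"
  proof (rule sum.cong)
    fix j assume "j \<in> {..<length xs}"
    then show "(i j \<cdot> p j) \<cdot> g = i j \<cdot> (p j \<cdot> g)"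
      using cmp_assoc[of z v "xs ! j" v g "p j" "i j"] D g z by simp
  qed simp
  finally show ?thesis .
qed

end

section \<open>Schur's lemma\<close>

context abelian_linear_category
begin

text \<open>The kernel of \<open>f\<close> is a subobject of the simple object \<open>x\<close> and
  not all of it, hence zero. Then \<open>f\<close> is a monomorphism from a non-zero object into the
  simple object \<open>y\<close>.\<close>

lemma schur:
  assumes x: "simple_object C x" and y: "simple_object C y" and f: "f \<in> Hom C x y" "f \<noteq> 0"
  shows "iso_arrow C x y f"
proof -
  have xy: "x \<in> Obj C" "y \<in> Obj C" using x y by (auto simp: simple_object_def)
  obtain u i where u: "u \<in> Obj C" and ker: "is_kernel C x f u i" using kernels[OF xy f(1)] by blast
  have i: "i \<in> Hom C u x" "f \<cdot> i = 0" using ker by (auto simp: is_kernel_def)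
  have ker': "\<exists>!h. h \<in> Hom C w u \<and> i \<cdot> h = g" if "w \<in> Obj C" "g \<in> Hom C w x" "f \<cdot> g = 0" for w g
    using ker that by (auto simp: is_kernel_def)
  have "mono_arrow C u x i"
    unfolding mono_arrow_def
  proof (intro conjI ballI impI)
    fix w g h assume w: "w \<in> Obj C" "g \<in> Hom C w u" "h \<in> Hom C w u" and eq: "i \<cdot> g = i \<cdot> h"
    have "f \<cdot> (i \<cdot> g) = (f \<cdot> i) \<cdot> g" by (rule cmp_assoc) (use w i u xy f in auto)
    then have 0: "f \<cdot> (i \<cdot> g) = 0" using i cmp_zero_left w u xy by simp
    have ig: "i \<cdot> g \<in> Hom C w x" using w i u xy by (auto intro: comp_Hom)
    show "g = h" using ker'[OF w(1) ig 0] w eq by (metis (no_types))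
  qed (fact i)
  then have "zero_object C u \<or> iso_arrow C u x i" using x u by (auto simp: simple_object_def)
  then have uz: "zero_object C u"
  proof
    assume iso: "iso_arrow C u x i"
    then obtain k where k: "k \<in> Hom C x u" "i \<cdot> k = idm C x"
      by (auto simp: iso_arrow_def inverse_arrows_def)
    have "f = f \<cdot> (i \<cdot> k)" using k f xy cmp_idm_right by simp
    also have "\<dots> = (f \<cdot> i) \<cdot> k" by (rule cmp_assoc) (use k i u xy f in auto)
    also have "\<dots> = 0" using i k cmp_zero_left u xy by simp
    finally show ?thesis using f by simp
  qed
  have "mono_arrow C x y f"
    unfolding mono_arrow_def
  proof (intro conjI ballI impI)
    fix w g h assume w: "w \<in> Obj C" "g \<in> Hom C w x" "h \<in> Hom C w x" and eq: "f \<cdot> g = f \<cdot> h"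
    have "f \<cdot> (g - h) = 0" using cmp_diff_right[OF w(1) xy w(2,3) f(1)] eq by simp
    then obtain k where k: "k \<in> Hom C w u" "i \<cdot> k = g - h"
      using ker'[OF w(1) diff_in_Hom[OF w(1) xy(1) w(2,3)]] by blast
    have "k = 0" using k(1) uz w(1) by (auto simp: zero_object_def)
    then have "g - h = 0" using k cmp_zero_right[OF i(1) w(1) u xy(1)] by simp
    then show "g = h" by simp
  qed (fact f)
  then show ?thesis using x y by (auto simp: simple_object_def)
qed

lemma simple_idm_nonzero: "simple_object C x \<Longrightarrow> idm C x \<noteq> 0"
  using zero_object_iff_idm by (auto simp: simple_object_def)

lemma simple_Hom_zero:
  "\<lbrakk>simple_object C x; simple_object C y; \<not> isomorphic C x y; f \<in> Hom C x y\<rbrakk> \<Longrightarrow> f = 0"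
  using schur by (auto simp: isomorphic_def)

lemma simple_object_isomorphic:
  assumes x: "simple_object C x" and y: "y \<in> Obj C" and iso: "isomorphic C x y"
  shows "simple_object C y"
proof -
  have xO: "x \<in> Obj C" using x by (simp add: simple_object_def)
  obtain k l where kl: "inverse_arrows C y x k l"
    using isomorphic_sym[OF iso] by (auto simp: isomorphic_def iso_arrow_def)
  then have k: "k \<in> Hom C y x" and l: "l \<in> Hom C x y" and lk: "l \<cdot> k = idm C y"
    by (auto simp: inverse_arrows_def)
  have nz: "\<not> zero_object C y"
    using zero_object_isomorphic[OF isomorphic_sym[OF iso] y xO] x by (auto simp: simple_object_def)
  have "zero_object C w \<or> iso_arrow C w y f" if w: "w \<in> Obj C" and f: "mono_arrow C w y f" for w f
  proof -
    have fH: "f \<in> Hom C w y" using f by (simp add: mono_arrow_def)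
    have lkf: "l \<cdot> (k \<cdot> g) = g" if "v \<in> Obj C" "g \<in> Hom C v y" for v g
      using cmp_assoc[of v y x y g k l] that y xO k l lk cmp_idm_left by simp
    have "mono_arrow C w x (k \<cdot> f)"
      unfolding mono_arrow_def
    proof (intro conjI ballI impI)
      show "k \<cdot> f \<in> Hom C w x" using fH k w y xO by (auto intro: comp_Hom)
      fix v g h assume v: "v \<in> Obj C" "g \<in> Hom C v w" "h \<in> Hom C v w" and eq: "(k \<cdot> f) \<cdot> g = (k \<cdot> f) \<cdot> h"
      have "k \<cdot> (f \<cdot> g) = k \<cdot> (f \<cdot> h)"
        using eq cmp_assoc[of v w y x _ f k] v fH k w y xO by simp
      then have "f \<cdot> g = f \<cdot> h" using lkf[OF v(1)] comp_Hom[OF _ fH v(1) w y] v by metis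
      then show "g = h" using f v by (auto simp: mono_arrow_def)
    qed
    then have "zero_object C w \<or> iso_arrow C w x (k \<cdot> f)" using x w by (auto simp: simple_object_def)
    then show ?thesis
    proof
      assume "iso_arrow C w x (k \<cdot> f)"
      then obtain g where "inverse_arrows C w x (k \<cdot> f) g" by (auto simp: iso_arrow_def)
      from inverse_arrows_comp[OF this inverse_arrows_sym[OF kl] w xO y]
      show ?thesis using lkf[OF w fH] by (auto simp: iso_arrow_def)
    qed simp
  qed
  then show ?thesis using y nz by (simp add: simple_object_def)
qed

end

text \<open>As \<open>dependent\<close> speaks of sets, it does not see the relation
  \<open>P i - P j = 0\<close> between repeated vectors; repetitions are therefore a case of their
  own.\<close>

lemma (in vector_space) sequence_dependent:
  assumes S: "finite S" and P: "\<And>n::nat. P n \<in> span S"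
  obtains a :: "nat \<Rightarrow> 'a" and N where "(\<Sum>n\<le>N. scale (a n) (P n)) = 0" "\<exists>n\<le>N. a n \<noteq> 0"
proof (cases "inj_on P {..card S}")
  case True
  have "dependent (P ` {..card S})"
  proof (rule ccontr)
    assume ind: "\<not> dependent (P ` {..card S})"
    have "card (P ` {..card S}) \<le> card S"
      using independent_span_bound[OF S ind] P by auto
    then show False using True by (simp add: card_image)
  qed
  then obtain u where u: "\<exists>v \<in> P ` {..card S}. u v \<noteq> 0" "(\<Sum>v \<in> P ` {..card S}. scale (u v) v) = 0"
    using dependent_finite[of "P ` {..card S}"] by auto
  show ?thesis
    by (rule that[where N = "card S" and a = "\<lambda>n. u (P n)"])
      (use u True in \<open>auto simp: sum.reindex\<close>)
next
  case False
  then obtain i j where ij: "i \<noteq> j" "P i = P j" by (auto simp: inj_on_def)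
  let ?a = "\<lambda>n. if n = i then 1 else if n = j then -1 else 0"
  have "(\<Sum>n\<le>i+j. scale (?a n) (P n)) = (\<Sum>n\<in>{i, j}. scale (?a n) (P n))"
    by (rule sum.mono_neutral_right) auto
  also have "\<dots> = 0" using ij by simp
  finally show ?thesis by (rule that) (auto intro: exI[of _ i])
qed

section \<open>Endomorphisms and multiplicities of simple objects\<close>

context fusion_category
begin

lemma simple_object_Obj [simp]: "simple_object C x \<Longrightarrow> x \<in> Obj C"
  by (simp add: simple_object_def)

text \<open>Induction on the degree of an annihilating polynomial. After a root \<open>a\<close> is
  split off, \<open>f\<close> minus the scalar \<open>a\<close> is zero or invertible by Schur; in
  the second case it cancels, and the quotient polynomial annihilates \<open>f\<close>. Powers of
  \<open>f\<close> are written as iterated composition with \<open>f\<close>.\<close>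

lemma endo_scalar_of_poly:
  assumes x: "simple_object C x" and f: "f \<in> Hom C x x"
    and p: "(\<Sum>n\<le>degree p. scl C (coeff p n) (((\<lambda>g. f \<cdot> g) ^^ n) (idm C x))) = 0" "p \<noteq> 0"
  shows "\<exists>a. f = scl C a (idm C x)"
  using p
proof (induction "degree p" arbitrary: p)
  case 0
  then have "coeff p 0 \<noteq> 0" by (metis leading_coeff_0_iff)
  then have "idm C x = 0" using 0 by simp
  then show ?case using simple_idm_nonzero[OF x] by simp
next
  case (Suc d)
  let ?P = "\<lambda>n. ((\<lambda>g. f \<cdot> g) ^^ n) (idm C x)"
  have xO: "x \<in> Obj C" using x by simp
  have P: "?P n \<in> Hom C x x" for n
    by (induction n) (use f xO idm_in_Hom in \<open>auto intro: comp_Hom\<close>)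
  obtain a where "poly p a = 0" using alg_closed_imp_poly_has_root[of p] Suc(2) by auto
  then obtain q where q: "p = [:-a, 1:] * q" by (auto simp: poly_eq_0_iff_dvd)
  have q0: "q \<noteq> 0" using q Suc(4) by auto
  then have dp: "degree p = Suc (degree q)"
    unfolding q by (subst degree_mult_eq) auto
  define E where "E = (\<Sum>n\<le>degree q. scl C (coeff q n) (?P n))"
  have E: "E \<in> Hom C x x" unfolding E_def
    by (intro sum_in_Hom scl_in_Hom xO P)
  \<comment> \<open>Coefficientwise \<open>p\<close> is \<open>pCons 0 q\<close> minus
    \<open>a\<close> times \<open>q\<close>; the shift by one degree becomes composition with
    \<open>f\<close>.\<close>
  have "(\<Sum>n\<le>degree p. scl C (coeff p n) (?P n))
      = (\<Sum>n\<le>Suc (degree q). scl C (coeff (pCons 0 q) n) (?P n) - scl C a (scl C (coeff q n) (?P n)))"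
    unfolding dp by (intro sum.cong) (simp_all add: q vs.scale_left_diff_distrib)
  also have "\<dots> = (\<Sum>n\<le>Suc (degree q). scl C (coeff (pCons 0 q) n) (?P n))
      - scl C a (\<Sum>n\<le>Suc (degree q). scl C (coeff q n) (?P n))"
    by (simp only: sum_subtractf vs.scale_sum_right)
  also have "(\<Sum>n\<le>Suc (degree q). scl C (coeff q n) (?P n)) = E"
    by (simp add: E_def coeff_eq_0)
  also have "(\<Sum>n\<le>Suc (degree q). scl C (coeff (pCons 0 q) n) (?P n))
      = (\<Sum>n\<le>degree q. scl C (coeff q n) (f \<cdot> ?P n))"
    by (subst sum.atMost_Suc_shift) simp
  also have "\<dots> = f \<cdot> E"
    unfolding E_def
    by (subst cmp_sum_right[of x x x]) (use f P xO in \<open>auto intro: scl_in_Hom simp: cmp_scl_right\<close>)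
  also have "f \<cdot> E - scl C a E = (f - scl C a (idm C x)) \<cdot> E"
    using cmp_diff_left[OF xO xO xO E f, of "scl C a (idm C x)"] cmp_scl_left[OF xO xO xO E, of "idm C x" a]
      cmp_idm_left[OF xO xO E] scl_in_Hom[OF xO xO] idm_in_Hom[OF xO] by simp
  finally have 0: "(f - scl C a (idm C x)) \<cdot> E = 0" using Suc(3) by simp
  have h: "f - scl C a (idm C x) \<in> Hom C x x"
    using f xO by (simp add: diff_in_Hom scl_in_Hom idm_in_Hom)
  show ?case
  proof (cases "f - scl C a (idm C x) = 0")
    case True
    then show ?thesis by auto
  next
    case False
    from schur[OF x x h this] obtain g where g: "g \<in> Hom C x x" "g \<cdot> (f - scl C a (idm C x)) = idm C x"
      by (auto simp: iso_arrow_def inverse_arrows_def)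
    have "E = (g \<cdot> (f - scl C a (idm C x))) \<cdot> E" using g E xO cmp_idm_left by simp
    also have "\<dots> = g \<cdot> ((f - scl C a (idm C x)) \<cdot> E)"
      by (rule cmp_assoc[symmetric]) (use g h E xO in auto)
    also have "\<dots> = 0" using 0 cmp_zero_right[OF g(1)] xO by simp
    finally show ?thesis using Suc(1)[of q] dp Suc(2) q0 unfolding E_def by simp
  qed
qed

text \<open>The powers of \<open>f\<close> lie in a finite-dimensional space, so they satisfy a
  linear relation, which is an annihilating polynomial.\<close>

lemma endo_scalar:
  assumes x: "simple_object C x" and f: "f \<in> Hom C x x"
  obtains a where "f = scl C a (idm C x)"
proof -
  have xO: "x \<in> Obj C" using x by simp
  let ?P = "\<lambda>n. ((\<lambda>g. f \<cdot> g) ^^ n) (idm C x)"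
  have P: "?P n \<in> Hom C x x" for n
    by (induction n) (use f xO idm_in_Hom in \<open>auto intro: comp_Hom\<close>)
  obtain S where S: "finite S" "Hom C x x = vs.span S" using finite_dimensional_Hom[OF xO xO] by blast
  obtain a :: "nat \<Rightarrow> 'k" and N where a: "(\<Sum>n\<le>N. scl C (a n) (?P n)) = 0" "\<exists>n\<le>N. a n \<noteq> 0"
    using vs.sequence_dependent[OF S(1), of ?P] P S(2) by blast
  define p where "p = (\<Sum>n\<le>N. monom (a n) n)"
  have cp: "coeff p n = (if n \<le> N then a n else 0)" for n
    unfolding p_def by (simp add: coeff_sum)
  have "p \<noteq> 0" using a(2) cp by (metis coeff_0)
  have "degree p \<le> N" using cp by (intro degree_le) auto
  have "(\<Sum>n\<le>degree p. scl C (coeff p n) (?P n)) = (\<Sum>n\<le>N. scl C (coeff p n) (?P n))"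
    by (rule sum.mono_neutral_left) (use \<open>degree p \<le> N\<close> in \<open>auto simp: coeff_eq_0\<close>)
  also have "\<dots> = 0" using a(1) cp by simp
  finally show ?thesis using endo_scalar_of_poly[OF x f _ \<open>p \<noteq> 0\<close>] that by blast
qed

lemma Hom_simple_proportional:
  assumes x: "simple_object C x" and y: "y \<in> Obj C" and f: "iso_arrow C x y f" and g: "g \<in> Hom C x y"
  obtains a where "g = scl C a f"
proof -
  have xO: "x \<in> Obj C" using x by simp
  note F = iso_arrowD[OF f xO y]
  obtain a where a: "inv_arrow C x y f \<cdot> g = scl C a (idm C x)"
    using endo_scalar[OF x] comp_Hom[OF g F(2)] xO y by metis
  have "g = (f \<cdot> inv_arrow C x y f) \<cdot> g" using F g xO y cmp_idm_left by simp
  also have "\<dots> = f \<cdot> scl C a (idm C x)"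
    unfolding a[symmetric] by (rule cmp_assoc[symmetric]) (use F g xO y in auto)
  also have "\<dots> = scl C a f"
    using cmp_scl_right[OF xO xO y idm_in_Hom[OF xO] F(1)] cmp_idm_right[OF xO y F(1)] by simp
  finally show ?thesis by (rule that)
qed

text \<open>The injections of the summands isomorphic to \<open>z\<close>, precomposed with
  isomorphisms from \<open>z\<close>, form a basis of \<open>Hom C z v\<close>; by Schur the other
  summands contribute nothing. Hence the number of these summands does not depend on the
  decomposition.\<close>

lemma dim_Hom_biproduct:
  assumes z: "simple_object C z" and xs: "\<forall>x \<in> set xs. simple_object C x" and v: "is_direct_sum C v xs"
  shows "vs.dim (Hom C z v) = length (filter (isomorphic C z) xs)"
proof -
  obtain i p where b: "biproduct v xs i p" using v is_direct_sum_iff by blast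
  note D = biproductD[OF b]
  have zO: "z \<in> Obj C" using z by simp
  have sx: "simple_object C (xs ! j)" if "j < length xs" for j using xs that by simp
  define J where "J = {j. j < length xs \<and> isomorphic C z (xs ! j)}"
  have "\<exists>\<phi>. \<forall>j \<in> J. iso_arrow C z (xs ! j) (\<phi> j)"
    by (intro bchoice) (auto simp: J_def isomorphic_def)
  then obtain \<phi> where \<phi>: "iso_arrow C z (xs ! j) (\<phi> j)" if "j \<in> J" for j by blast
  have JD: "j < length xs" "xs ! j \<in> Obj C" "i j \<in> Hom C (xs ! j) v" "p j \<in> Hom C v (xs ! j)"
    "\<phi> j \<in> Hom C z (xs ! j)" if "j \<in> J" for j
    using that D iso_arrowD(1)[OF \<phi>[OF that] zO] by (auto simp: J_def)
  have \<phi>0: "\<phi> j \<noteq> 0" if j: "j \<in> J" for j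
  proof
    assume "\<phi> j = 0"
    then have "idm C z = 0"
      using iso_arrowD(2,3)[OF \<phi>[OF j] zO JD(2)[OF j]] cmp_zero_right[OF _ zO JD(2)[OF j] zO] by metis
    then show False using simple_idm_nonzero[OF z] by simp
  qed
  define e where "e j = i j \<cdot> \<phi> j" for j
  have eH: "e j \<in> Hom C z v" if "j \<in> J" for j
    unfolding e_def using JD[OF that] zO D(1) by (auto intro: comp_Hom)
  have pe: "p l \<cdot> e j = (if j = l then \<phi> j else 0)" if j: "j \<in> J" and l: "l \<in> J" for j l
  proof -
    have "p l \<cdot> e j = (p l \<cdot> i j) \<cdot> \<phi> j"
      unfolding e_def by (rule cmp_assoc[of z "xs ! j" v "xs ! l"]) (use JD[OF j] JD[OF l] zO D(1) in auto)
    then show ?thesis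
      using D(6)[OF JD(1)[OF j]] D(7)[OF JD(1)[OF j] JD(1)[OF l]] JD[OF j] JD[OF l] zO
        cmp_idm_left[of z "xs ! j" "\<phi> j"] cmp_zero_left[of "\<phi> j" z "xs ! j" "xs ! l"] by auto
  qed
  have finJ: "finite J" by (simp add: J_def)
  have inj: "inj_on e J"
    by (rule inj_onI) (metis pe \<phi>0)
  have span: "g \<in> vs.span (e ` J)" if g: "g \<in> Hom C z v" for g
  proof -
    have tm: "i j \<cdot> (p j \<cdot> g) \<in> vs.span (e ` J)" if j: "j < length xs" for j
    proof (cases "j \<in> J")
      case True
      have pg: "p j \<cdot> g \<in> Hom C z (xs ! j)" using JD[OF True] g zO D(1) by (auto intro: comp_Hom)
      obtain a where a: "p j \<cdot> g = scl C a (\<phi> j)"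
        using Hom_simple_proportional[OF z JD(2)[OF True] \<phi>[OF True] pg] by blast
      have "i j \<cdot> scl C a (\<phi> j) = scl C a (e j)"
        unfolding e_def by (rule cmp_scl_right) (use JD[OF True] zO D(1) in auto)
      then show ?thesis using a True by (simp add: vs.span_scale vs.span_base)
    next
      case False
      have pg: "p j \<cdot> g \<in> Hom C z (xs ! j)" using D j g zO by (auto intro: comp_Hom)
      have "p j \<cdot> g = 0" using simple_Hom_zero[OF z sx[OF j] _ pg] False j by (auto simp: J_def)
      then show ?thesis using cmp_zero_right[OF D(4)[OF j] zO D(3)[OF j] D(1)] vs.span_zero by simp
    qed
    show ?thesis
      by (subst biproduct_expand[OF b zO g]) (use tm in \<open>auto intro: vs.span_sum\<close>)
  qed
  have indep: "vs.independent (e ` J)"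
  proof (rule vs.independent_if_scalars_zero)
    fix u w assume 0: "(\<Sum>w \<in> e ` J. scl C (u w) w) = 0" and w: "w \<in> e ` J"
    obtain l where l: "l \<in> J" "w = e l" using w by blast
    \<comment> \<open>Composition with the projection \<open>p l\<close> isolates the coefficient of
      \<open>e l\<close>.\<close>
    have "0 = p l \<cdot> (\<Sum>j \<in> J. scl C (u (e j)) (e j))"
      using 0 inj cmp_zero_right[OF JD(4)[OF l(1)] zO D(1) JD(2)[OF l(1)]] by (simp add: sum.reindex)
    also have "\<dots> = (\<Sum>j \<in> J. p l \<cdot> scl C (u (e j)) (e j))"
      by (rule cmp_sum_right[of z v "xs ! l"])
        (use zO D(1) JD[OF l(1)] eH in \<open>auto intro: scl_in_Hom\<close>)
    also have "\<dots> = (\<Sum>j \<in> J. if j = l then scl C (u (e l)) (\<phi> l) else 0)"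
    proof (rule sum.cong)
      fix j assume j: "j \<in> J"
      have "p l \<cdot> scl C (u (e j)) (e j) = scl C (u (e j)) (p l \<cdot> e j)"
        by (rule cmp_scl_right) (use zO D(1) JD[OF l(1)] eH[OF j] in auto)
      then show "p l \<cdot> scl C (u (e j)) (e j) = (if j = l then scl C (u (e l)) (\<phi> l) else 0)"
        using pe[OF j l(1)] by simp
    qed simp
    also have "\<dots> = scl C (u (e l)) (\<phi> l)" using finJ l by simp
    finally show "u w = 0" using \<phi>0[OF l(1)] l(2) by (metis vs.scale_eq_0_iff)
  qed (use finJ in simp)
  have "card (e ` J) = vs.dim (Hom C z v)"
    by (rule vs.basis_card_eq_dim) (use eH span indep in auto)
  then have "vs.dim (Hom C z v) = card J" using inj by (simp add: card_image)
  also have "\<dots> = length (filter (isomorphic C z) xs)"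
    by (simp add: J_def length_filter_conv_card)
  finally show ?thesis .
qed

text \<open>This makes the definite description in \<open>multiplicity_in\<close> meaningful: all
  decompositions give the same number.\<close>

lemma multiplicity_in_eq_dim:
  assumes z: "simple_object C z" and v: "v \<in> Obj C"
  shows "multiplicity_in C v (iso_class C z) = vs.dim (Hom C z v)"
proof -
  have eq: "filter (\<lambda>x. x \<in> iso_class C z) xs = filter (isomorphic C z) xs"
    if "\<forall>x \<in> set xs. simple_object C x" for xs
    using that by (intro filter_cong) (auto simp: iso_class_def)
  obtain xs where "\<forall>x \<in> set xs. simple_object C x" "is_direct_sum C v xs" using semisimple[OF v] by blast
  then show ?thesis
    unfolding multiplicity_in_def using dim_Hom_biproduct[OF z] eq by (intro the_equality) (metis)+
qed

lemma multiplicity_in_biproduct: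
  assumes z: "simple_object C z" and xs: "\<forall>x \<in> set xs. simple_object C x" and v: "is_direct_sum C v xs"
  shows "multiplicity_in C v (iso_class C z) = length (filter (isomorphic C z) xs)"
proof -
  have "v \<in> Obj C" using v by (simp add: is_direct_sum_def)
  then show ?thesis using multiplicity_in_eq_dim[OF z] dim_Hom_biproduct[OF assms] by simp
qed

text \<open>Some component of \<open>g\<close> in a decomposition of \<open>v\<close> is non-zero,
  hence an isomorphism onto a simple summand. Projecting and inverting it gives the
  retraction.\<close>

lemma simple_splits:
  assumes z: "simple_object C z" and v: "v \<in> Obj C" and g: "g \<in> Hom C z v" "g \<noteq> 0"
  shows "\<exists>p \<in> Hom C v z. p \<cdot> g = idm C z"
proof -
  have zO: "z \<in> Obj C" using z by simp
  obtain xs where xs: "\<forall>x \<in> set xs. simple_object C x" "is_direct_sum C v xs" using semisimple[OF v] by blast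
  then obtain i p where b: "biproduct v xs i p" using is_direct_sum_iff by blast
  note D = biproductD[OF b]
  obtain j where j: "j < length xs" "p j \<cdot> g \<noteq> 0"
  proof (rule ccontr)
    assume "\<not> thesis"
    then have "\<forall>j<length xs. p j \<cdot> g = 0" using that by blast
    then have "g = 0"
      using biproduct_expand[OF b zO g(1)] cmp_zero_right[OF D(4) zO D(3) v] by simp
    then show False using g by simp
  qed
  have "iso_arrow C z (xs ! j) (p j \<cdot> g)"
    using schur[OF z _ comp_Hom[OF g(1) D(5)[OF j(1)] zO v D(3)[OF j(1)]] j(2)] xs j(1) by simp
  from iso_arrowD[OF this zO D(3)[OF j(1)]] obtain k where
    k: "k \<in> Hom C (xs ! j) z" "k \<cdot> (p j \<cdot> g) = idm C z" by blast
  have "(k \<cdot> p j) \<cdot> g = idm C z"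
    using k cmp_assoc[OF zO v D(3)[OF j(1)] zO g(1) D(5)[OF j(1)] k(1)] by simp
  moreover have "k \<cdot> p j \<in> Hom C v z"
    by (rule comp_Hom[OF D(5)[OF j(1)] k(1) v D(3)[OF j(1)] zO])
  ultimately show ?thesis by blast
qed

end

section \<open>Traces in ribbon fusion categories\<close>

context ribbon_fusion_category
begin

text \<open>Morphisms are tagged with source and target, as the morphism spaces need not be disjoint.\<close>

definition arT :: "'o \<times> 'm \<times> 'o \<Rightarrow> bool" where
  "arT = (\<lambda>(x, f, y). x \<in> Obj C \<and> y \<in> Obj C \<and> f \<in> Hom C x y)"

definition IT :: "'o \<Rightarrow> 'o \<times> 'm \<times> 'o" where
  "IT x = (x, idm C x, x)"

definition cmpT :: "'o \<times> 'm \<times> 'o \<Rightarrow> 'o \<times> 'm \<times> 'o \<Rightarrow> 'o \<times> 'm \<times> 'o" where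
  "cmpT = (\<lambda>(y', g, z) (x, f, y). (x, g \<cdot> f, z))"

definition tnsT :: "'o \<times> 'm \<times> 'o \<Rightarrow> 'o \<times> 'm \<times> 'o \<Rightarrow> 'o \<times> 'm \<times> 'o" where
  "tnsT = (\<lambda>(x, f, y) (x', g, y'). (x \<otimes>\<^sub>o x', f \<otimes>\<^sub>a g, y \<otimes>\<^sub>o y'))"

definition scT :: "'k \<Rightarrow> 'o \<times> 'm \<times> 'o \<Rightarrow> 'o \<times> 'm \<times> 'o" where
  "scT a = (\<lambda>(x, f, y). (x, scl C a f, y))"

abbreviation (input) "asT x y z \<equiv> ((x \<otimes>\<^sub>o y) \<otimes>\<^sub>o z, asc C x y z, x \<otimes>\<^sub>o (y \<otimes>\<^sub>o z))"
abbreviation (input) "asT' x y z \<equiv> (x \<otimes>\<^sub>o (y \<otimes>\<^sub>o z), inv_asc C x y z, (x \<otimes>\<^sub>o y) \<otimes>\<^sub>o z)"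
abbreviation (input) "luT x \<equiv> (tunit C \<otimes>\<^sub>o x, lun C x, x)"
abbreviation (input) "luT' x \<equiv> (x, inv_lun C x, tunit C \<otimes>\<^sub>o x)"
abbreviation (input) "ruT x \<equiv> (x \<otimes>\<^sub>o tunit C, run C x, x)"
abbreviation (input) "ruT' x \<equiv> (x, inv_run C x, x \<otimes>\<^sub>o tunit C)"
abbreviation (input) "brT x y \<equiv> (x \<otimes>\<^sub>o y, braid C x y, y \<otimes>\<^sub>o x)"
abbreviation (input) "brT' x y \<equiv> (y \<otimes>\<^sub>o x, inv_arrow C (x \<otimes>\<^sub>o y) (y \<otimes>\<^sub>o x) (braid C x y), x \<otimes>\<^sub>o y)"
abbreviation (input) "twT x \<equiv> (x, twist C x, x)"
abbreviation (input) "twT' x \<equiv> (x, inv_arrow C x x (twist C x), x)"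

declare tunit_in_Obj [simp] tns_in_Obj [simp] idm_in_Hom [simp]

lemma typed [simp]:
  "\<lbrakk>x \<in> Obj C; y \<in> Obj C; z \<in> Obj C\<rbrakk> \<Longrightarrow> asc C x y z \<in> Hom C ((x \<otimes>\<^sub>o y) \<otimes>\<^sub>o z) (x \<otimes>\<^sub>o (y \<otimes>\<^sub>o z))"
  "\<lbrakk>x \<in> Obj C; y \<in> Obj C; z \<in> Obj C\<rbrakk> \<Longrightarrow> inv_asc C x y z \<in> Hom C (x \<otimes>\<^sub>o (y \<otimes>\<^sub>o z)) ((x \<otimes>\<^sub>o y) \<otimes>\<^sub>o z)"
  "x \<in> Obj C \<Longrightarrow> lun C x \<in> Hom C (tunit C \<otimes>\<^sub>o x) x"
  "x \<in> Obj C \<Longrightarrow> inv_lun C x \<in> Hom C x (tunit C \<otimes>\<^sub>o x)"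
  "x \<in> Obj C \<Longrightarrow> run C x \<in> Hom C (x \<otimes>\<^sub>o tunit C) x"
  "x \<in> Obj C \<Longrightarrow> inv_run C x \<in> Hom C x (x \<otimes>\<^sub>o tunit C)"
  "\<lbrakk>x \<in> Obj C; y \<in> Obj C\<rbrakk> \<Longrightarrow> braid C x y \<in> Hom C (x \<otimes>\<^sub>o y) (y \<otimes>\<^sub>o x)"
  "\<lbrakk>x \<in> Obj C; y \<in> Obj C\<rbrakk> \<Longrightarrow> inv_arrow C (x \<otimes>\<^sub>o y) (y \<otimes>\<^sub>o x) (braid C x y) \<in> Hom C (y \<otimes>\<^sub>o x) (x \<otimes>\<^sub>o y)"
  "x \<in> Obj C \<Longrightarrow> twist C x \<in> Hom C x x"
  "x \<in> Obj C \<Longrightarrow> inv_arrow C x x (twist C x) \<in> Hom C x x"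
  using iso_arrowD(1,2)[OF asc_iso] iso_arrowD(1,2)[OF lun_iso] iso_arrowD(1,2)[OF run_iso]
    iso_arrowD(1,2)[OF braid_iso] iso_arrowD(1,2)[OF twist_iso] by simp_all

lemma inverses [simp]:
  "\<lbrakk>x \<in> Obj C; y \<in> Obj C; z \<in> Obj C\<rbrakk> \<Longrightarrow> inv_asc C x y z \<cdot> asc C x y z = idm C ((x \<otimes>\<^sub>o y) \<otimes>\<^sub>o z)"
  "\<lbrakk>x \<in> Obj C; y \<in> Obj C; z \<in> Obj C\<rbrakk> \<Longrightarrow> asc C x y z \<cdot> inv_asc C x y z = idm C (x \<otimes>\<^sub>o (y \<otimes>\<^sub>o z))"
  "x \<in> Obj C \<Longrightarrow> inv_lun C x \<cdot> lun C x = idm C (tunit C \<otimes>\<^sub>o x)"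
  "x \<in> Obj C \<Longrightarrow> lun C x \<cdot> inv_lun C x = idm C x"
  "x \<in> Obj C \<Longrightarrow> inv_run C x \<cdot> run C x = idm C (x \<otimes>\<^sub>o tunit C)"
  "x \<in> Obj C \<Longrightarrow> run C x \<cdot> inv_run C x = idm C x"
  "\<lbrakk>x \<in> Obj C; y \<in> Obj C\<rbrakk> \<Longrightarrow> inv_arrow C (x \<otimes>\<^sub>o y) (y \<otimes>\<^sub>o x) (braid C x y) \<cdot> braid C x y = idm C (x \<otimes>\<^sub>o y)"
  "x \<in> Obj C \<Longrightarrow> inv_arrow C x x (twist C x) \<cdot> twist C x = idm C x"
  using iso_arrowD(3,4)[OF asc_iso] iso_arrowD(3,4)[OF lun_iso] iso_arrowD(3,4)[OF run_iso]
    iso_arrowD(3,4)[OF braid_iso] iso_arrowD(3,4)[OF twist_iso] by simp_all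

lemma tns_Hom [simp]:
  "\<lbrakk>f \<in> Hom C x x'; g \<in> Hom C y y'; x \<in> Obj C; x' \<in> Obj C; y \<in> Obj C; y' \<in> Obj C\<rbrakk>
    \<Longrightarrow> f \<otimes>\<^sub>a g \<in> Hom C (x \<otimes>\<^sub>o y) (x' \<otimes>\<^sub>o y')"
  by (rule tns_in_Hom)

lemma arT_simps [simp]:
  "arT (x, f, y) \<longleftrightarrow> x \<in> Obj C \<and> y \<in> Obj C \<and> f \<in> Hom C x y"
  by (simp add: arT_def)

lemma arT_E:
  assumes "arT F"
  obtains x f y where "F = (x, f, y)" "x \<in> Obj C" "y \<in> Obj C" "f \<in> Hom C x y"
  using assms by (cases F) (auto simp: arT_def)

lemma catT:
  "arT F \<Longrightarrow> fst F \<in> Obj C" "arT F \<Longrightarrow> snd (snd F) \<in> Obj C"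
  "\<lbrakk>arT F; arT G; snd (snd F) = fst G\<rbrakk> \<Longrightarrow> arT (cmpT G F)"
  "\<lbrakk>arT F; arT G; snd (snd F) = fst G\<rbrakk> \<Longrightarrow> fst (cmpT G F) = fst F"
  "\<lbrakk>arT F; arT G; snd (snd F) = fst G\<rbrakk> \<Longrightarrow> snd (snd (cmpT G F)) = snd (snd G)"
  "\<lbrakk>arT F; fst F = x\<rbrakk> \<Longrightarrow> cmpT F (IT x) = F"
  "\<lbrakk>arT F; snd (snd F) = x\<rbrakk> \<Longrightarrow> cmpT (IT x) F = F"
  "\<lbrakk>arT F; arT G; arT H; snd (snd F) = fst G; snd (snd G) = fst H\<rbrakk>
    \<Longrightarrow> cmpT (cmpT H G) F = cmpT H (cmpT G F)"
  "\<lbrakk>arT F; arT G\<rbrakk> \<Longrightarrow> arT (tnsT F G)"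
  "\<lbrakk>arT F; arT G\<rbrakk> \<Longrightarrow> fst (tnsT F G) = fst F \<otimes>\<^sub>o fst G"
  "\<lbrakk>arT F; arT G\<rbrakk> \<Longrightarrow> snd (snd (tnsT F G)) = snd (snd F) \<otimes>\<^sub>o snd (snd G)"
  "\<lbrakk>arT F; arT F'; arT G; arT G'; snd (snd F) = fst F'; snd (snd G) = fst G'\<rbrakk>
    \<Longrightarrow> cmpT (tnsT F' G') (tnsT F G) = tnsT (cmpT F' F) (cmpT G' G)"
  "arT F \<Longrightarrow> arT (scT k F)" "fst (scT k F) = fst F" "snd (snd (scT k F)) = snd (snd F)"
  "\<lbrakk>arT F; arT G; snd (snd F) = fst G\<rbrakk> \<Longrightarrow> cmpT (scT k G) F = scT k (cmpT G F)"
  "\<lbrakk>arT F; arT G; snd (snd F) = fst G\<rbrakk> \<Longrightarrow> cmpT G (scT k F) = scT k (cmpT G F)"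
  "\<lbrakk>arT F; arT G\<rbrakk> \<Longrightarrow> tnsT (scT k F) G = scT k (tnsT F G)"
  "\<lbrakk>arT F; arT G\<rbrakk> \<Longrightarrow> tnsT F (scT k G) = scT k (tnsT F G)"
  "scT k (scT l F) = scT (k * l) F"
  by (auto elim!: arT_E simp: cmpT_def IT_def tnsT_def scT_def comp_Hom cmp_idm_left cmp_idm_right
      cmp_assoc cmp_scl_left cmp_scl_right tns_scl_left tns_scl_right tns_cmp scl_in_Hom split: prod.splits)

lemma IT_simps: "x \<in> Obj C \<Longrightarrow> arT (IT x)" "fst (IT x) = x" "snd (snd (IT x)) = x"
  by (simp_all add: IT_def)

lemma cmpT_simp: "cmpT (y', g, z) (x, f, y) = (x, g \<cdot> f, z)"
  by (simp add: cmpT_def)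

lemma tnsT_simp: "tnsT (x, f, y) (x', g, y') = (x \<otimes>\<^sub>o x', f \<otimes>\<^sub>a g, y \<otimes>\<^sub>o y')"
  by (simp add: tnsT_def)

lemma naturalT:
  "\<lbrakk>x \<in> Obj C; y \<in> Obj C\<rbrakk> \<Longrightarrow> tnsT (IT x) (IT y) = IT (x \<otimes>\<^sub>o y)"
  "\<lbrakk>arT F; arT G; arT H\<rbrakk> \<Longrightarrow>
    cmpT (asT (snd (snd F)) (snd (snd G)) (snd (snd H))) (tnsT (tnsT F G) H)
      = cmpT (tnsT F (tnsT G H)) (asT (fst F) (fst G) (fst H))"
  "arT F \<Longrightarrow> cmpT (luT (snd (snd F))) (tnsT (IT (tunit C)) F) = cmpT F (luT (fst F))"
  "arT F \<Longrightarrow> cmpT (ruT (snd (snd F))) (tnsT F (IT (tunit C))) = cmpT F (ruT (fst F))"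
  "\<lbrakk>arT F; arT G\<rbrakk> \<Longrightarrow>
    cmpT (brT (snd (snd F)) (snd (snd G))) (tnsT F G) = cmpT (tnsT G F) (brT (fst F) (fst G))"
  "arT F \<Longrightarrow> cmpT (twT (snd (snd F))) F = cmpT F (twT (fst F))"
  by (auto elim!: arT_E simp: cmpT_simp tnsT_simp IT_def tns_idm asc_natural lun_natural run_natural
      braid_natural twist_natural)

lemma coherenceT:
  assumes [simp]: "x \<in> Obj C" "y \<in> Obj C" "z \<in> Obj C"
  shows "w \<in> Obj C \<Longrightarrow> cmpT (tnsT (IT w) (asT x y z)) (cmpT (asT w (x \<otimes>\<^sub>o y) z) (tnsT (asT w x y) (IT z)))
      = cmpT (asT w x (y \<otimes>\<^sub>o z)) (asT (w \<otimes>\<^sub>o x) y z)"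
    and "cmpT (tnsT (IT x) (luT y)) (asT x (tunit C) y) = tnsT (ruT x) (IT y)"
    and "cmpT (asT y z x) (cmpT (brT x (y \<otimes>\<^sub>o z)) (asT x y z))
      = cmpT (tnsT (IT y) (brT x z)) (cmpT (asT y x z) (tnsT (brT x y) (IT z)))"
    and "cmpT (asT' z x y) (cmpT (brT (x \<otimes>\<^sub>o y) z) (asT' x y z))
      = cmpT (tnsT (brT x z) (IT y)) (cmpT (asT' x z y) (tnsT (IT x) (brT y z)))"
    and "twT (x \<otimes>\<^sub>o y) = cmpT (cmpT (brT y x) (brT x y)) (tnsT (twT x) (twT y))"
proof -
  show "cmpT (tnsT (IT w) (asT x y z)) (cmpT (asT w (x \<otimes>\<^sub>o y) z) (tnsT (asT w x y) (IT z)))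
      = cmpT (asT w x (y \<otimes>\<^sub>o z)) (asT (w \<otimes>\<^sub>o x) y z)" if [simp]: "w \<in> Obj C"
  proof -
    \<comment> \<open>Composition associates to the left in the axioms on \<open>C\<close> but to
      the right in \<open>mon\<close>.\<close>
    have "cmpT (cmpT (tnsT (IT w) (asT x y z)) (asT w (x \<otimes>\<^sub>o y) z)) (tnsT (asT w x y) (IT z))
      = cmpT (asT w x (y \<otimes>\<^sub>o z)) (asT (w \<otimes>\<^sub>o x) y z)"
      by (simp add: cmpT_simp tnsT_simp IT_def pentagon)
    then show ?thesis by (simp add: catT IT_simps)
  qed
  show "cmpT (tnsT (IT x) (luT y)) (asT x (tunit C) y) = tnsT (ruT x) (IT y)"
    by (simp add: cmpT_simp tnsT_simp IT_def triangle)
  show "cmpT (asT y z x) (cmpT (brT x (y \<otimes>\<^sub>o z)) (asT x y z))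
      = cmpT (tnsT (IT y) (brT x z)) (cmpT (asT y x z) (tnsT (brT x y) (IT z)))"
  proof -
    have "cmpT (cmpT (asT y z x) (brT x (y \<otimes>\<^sub>o z))) (asT x y z)
      = cmpT (cmpT (tnsT (IT y) (brT x z)) (asT y x z)) (tnsT (brT x y) (IT z))"
      by (simp add: cmpT_simp tnsT_simp IT_def hexagon1)
    then show ?thesis by (simp add: catT IT_simps)
  qed
  show "cmpT (asT' z x y) (cmpT (brT (x \<otimes>\<^sub>o y) z) (asT' x y z))
      = cmpT (tnsT (brT x z) (IT y)) (cmpT (asT' x z y) (tnsT (IT x) (brT y z)))"
  proof -
    have "cmpT (cmpT (asT' z x y) (brT (x \<otimes>\<^sub>o y) z)) (asT' x y z)
      = cmpT (cmpT (tnsT (brT x z) (IT y)) (asT' x z y)) (tnsT (IT x) (brT y z))"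
      by (simp add: cmpT_simp tnsT_simp IT_def hexagon2)
    then show ?thesis by (simp add: catT IT_simps)
  qed
  show "twT (x \<otimes>\<^sub>o y) = cmpT (cmpT (brT y x) (brT x y)) (tnsT (twT x) (twT y))"
    by (simp add: cmpT_simp tnsT_simp twist_tns)
qed

sublocale m: mon_ribbon "\<lambda>x. x \<in> Obj C" arT fst "\<lambda>F. snd (snd F)" IT cmpT "tns_obj C" tnsT scT
  "tunit C" asT asT' luT luT' ruT ruT' brT brT' twT twT'
  by unfold_locales
    (simp_all add: catT IT_simps naturalT coherenceT,
     simp_all add: cmpT_simp IT_def)

section \<open>The quantum trace\<close>

definition evT :: "'o \<Rightarrow> 'o \<times> 'm \<times> 'o" where "evT x = (dual C x \<otimes>\<^sub>o x, ev C x, tunit C)"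
definition coevT :: "'o \<Rightarrow> 'o \<times> 'm \<times> 'o" where "coevT x = (tunit C, coev C x, x \<otimes>\<^sub>o dual C x)"

lemma dual_typed [simp]:
  assumes "x \<in> Obj C"
  shows "dual C x \<in> Obj C" "ev C x \<in> Hom C (dual C x \<otimes>\<^sub>o x) (tunit C)"
    "coev C x \<in> Hom C (tunit C) (x \<otimes>\<^sub>o dual C x)"
  using left_duals[OF assms] by (auto simp: left_dual_def)

lemma mdual_dual:
  assumes [simp]: "x \<in> Obj C"
  shows "m.mdual x (dual C x) (evT x) (coevT x)"
proof -
  let ?y = "dual C x"
  have D: "run C x \<cdot> (idm C x \<otimes>\<^sub>a ev C x) \<cdot> asc C x ?y x \<cdot> (coev C x \<otimes>\<^sub>a idm C x) \<cdot> inv_lun C x = idm C x"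
    "lun C ?y \<cdot> (ev C x \<otimes>\<^sub>a idm C ?y) \<cdot> inv_asc C ?y x ?y \<cdot> (idm C ?y \<otimes>\<^sub>a coev C x) \<cdot> inv_run C ?y = idm C ?y"
    using left_duals[OF assms] by (auto simp: left_dual_def)
  have t: "arT (evT x)" "arT (coevT x)" "fst (evT x) = ?y \<otimes>\<^sub>o x" "snd (snd (evT x)) = tunit C"
    "fst (coevT x) = tunit C" "snd (snd (coevT x)) = x \<otimes>\<^sub>o ?y"
    by (simp_all add: evT_def coevT_def)
  have "cmpT (cmpT (cmpT (cmpT (ruT x) (tnsT (IT x) (evT x))) (asT x ?y x)) (tnsT (coevT x) (IT x)))
    (luT' x) = IT x"
    by (simp add: cmpT_simp tnsT_simp IT_def evT_def coevT_def D)
  moreover have "cmpT (cmpT (cmpT (cmpT (luT ?y) (tnsT (evT x) (IT ?y))) (asT' ?y x ?y))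
    (tnsT (IT ?y) (coevT x))) (ruT' ?y) = IT ?y"
    by (simp add: cmpT_simp tnsT_simp IT_def evT_def coevT_def D)
  ultimately show ?thesis
    by (simp add: m.mdual_def t m.cmp_assoc IT_simps)
qed

text \<open>The reason why the definite description in \<open>qtrace\<close> denotes a scalar: the
  unit has only scalar endomorphisms and its identity is non-zero.\<close>

lemma tunit_endo_scalar:
  assumes "f \<in> Hom C (tunit C) (tunit C)"
  shows "\<exists>!t. scl C t (idm C (tunit C)) = f"
proof -
  obtain a where "f = scl C a (idm C (tunit C))" using endo_scalar[OF simple_tunit assms] by blast
  moreover have "a = b" if "scl C a (idm C (tunit C)) = scl C b (idm C (tunit C))" for a b
    using that simple_idm_nonzero[OF simple_tunit] by (simp add: vs.scale_cancel_right)
  ultimately show ?thesis by metis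
qed

lemma scl_idm_inj: "simple_object C x \<Longrightarrow> scl C a (idm C x) = scl C b (idm C x) \<Longrightarrow> a = b"
  using simple_idm_nonzero by (simp add: vs.scale_cancel_right)

abbreviation trT :: "'o \<Rightarrow> 'm \<Rightarrow> 'o \<times> 'm \<times> 'o" where
  "trT x f \<equiv> m.mtr x (dual C x) (evT x) (coevT x) (x, f, x)"

lemma mtr_eq_qtrace:
  assumes [simp]: "x \<in> Obj C" and f [simp]: "f \<in> Hom C x x"
  shows "trT x f = scT (qtrace C x f) (IT (tunit C))"
proof -
  let ?e = "ev C x \<cdot> braid C x (dual C x) \<cdot> ((twist C x \<cdot> f) \<otimes>\<^sub>a idm C (dual C x)) \<cdot> coev C x"
  have t: "arT (evT x)" "arT (coevT x)" "fst (evT x) = dual C x \<otimes>\<^sub>o x" "snd (snd (evT x)) = tunit C"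
    "fst (coevT x) = tunit C" "snd (snd (coevT x)) = x \<otimes>\<^sub>o dual C x"
    by (simp_all add: evT_def coevT_def)
  have "trT x f = cmpT (cmpT (cmpT (evT x) (brT x (dual C x))) (tnsT (cmpT (twT x) (x, f, x))
    (IT (dual C x)))) (coevT x)"
    by (simp add: m.mtr_def m.cmp_assoc t)
  also have "\<dots> = (tunit C, ?e, tunit C)"
    by (simp add: cmpT_simp tnsT_simp IT_def evT_def coevT_def)
  finally have *: "trT x f = (tunit C, ?e, tunit C)" .
  have "arT (trT x f)" by (simp add: m.mtr_def t)
  then have "?e \<in> Hom C (tunit C) (tunit C)" unfolding * by simp
  from theI'[OF tunit_endo_scalar[OF this]] show ?thesis
    unfolding * by (simp add: qtrace_def scT_def IT_def)
qed

lemma scT_unit_inj: "scT a (IT (tunit C)) = scT b (IT (tunit C)) \<Longrightarrow> a = b"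
  using scl_idm_inj[OF simple_tunit] by (simp add: scT_def IT_def)

lemma qtrace_cyclic:
  assumes [simp]: "x \<in> Obj C" "y \<in> Obj C" and f [simp]: "f \<in> Hom C y x" and g [simp]: "g \<in> Hom C x y"
  shows "qtrace C x (f \<cdot> g) = qtrace C y (g \<cdot> f)"
proof (rule scT_unit_inj)
  have [simp]: "f \<cdot> g \<in> Hom C x x" "g \<cdot> f \<in> Hom C y y" by (auto intro: comp_Hom[OF g f] comp_Hom[OF f g])
  show "scT (qtrace C x (f \<cdot> g)) (IT (tunit C)) = scT (qtrace C y (g \<cdot> f)) (IT (tunit C))"
    using m.mtr_cyclic[OF mdual_dual[of x] mdual_dual[of y], of "(y, f, x)" "(x, g, y)"]
    by (simp add: mtr_eq_qtrace cmpT_simp)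
qed

lemma qtrace_scl:
  assumes [simp]: "x \<in> Obj C" and f [simp]: "f \<in> Hom C x x"
  shows "qtrace C x (scl C a f) = a * qtrace C x f"
proof (rule scT_unit_inj)
  have [simp]: "scl C a f \<in> Hom C x x" by (simp add: scl_in_Hom)
  have "trT x (scl C a f) = scT a (trT x f)"
    using m.mtr_sc[OF mdual_dual[of x], of "(x, f, x)" a] by (simp add: scT_def)
  then show "scT (qtrace C x (scl C a f)) (IT (tunit C)) = scT (a * qtrace C x f) (IT (tunit C))"
    by (simp add: mtr_eq_qtrace catT)
qed

text \<open>The locale \<open>mon\<close> has scalars but no sums, so additivity is checked directly
  on the composite that defines the trace.\<close>

lemma qtrace_add:
  assumes [simp]: "x \<in> Obj C" and f [simp]: "f \<in> Hom C x x" and g [simp]: "g \<in> Hom C x x"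
  shows "qtrace C x (f + g) = qtrace C x f + qtrace C x g"
proof -
  let ?e = "\<lambda>f. ev C x \<cdot> (braid C x (dual C x) \<cdot> (((twist C x \<cdot> f) \<otimes>\<^sub>a idm C (dual C x)) \<cdot> coev C x))"
  have e: "?e h = scl C (qtrace C x h) (idm C (tunit C))" if [simp]: "h \<in> Hom C x x" for h
    using mtr_eq_qtrace[of x h]
    by (simp add: m.mtr_def evT_def coevT_def cmpT_simp tnsT_simp IT_def scT_def)
  have [simp]: "f + g \<in> Hom C x x" by (simp add: add_in_Hom)
  have tf: "twist C x \<cdot> h \<in> Hom C x x" if "h \<in> Hom C x x" for h by (rule comp_Hom[OF that]) simp_all
  have 1: "(twist C x \<cdot> (f + g)) \<otimes>\<^sub>a idm C (dual C x)
      = (twist C x \<cdot> f) \<otimes>\<^sub>a idm C (dual C x) + (twist C x \<cdot> g) \<otimes>\<^sub>a idm C (dual C x)"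
    using cmp_add_right[of x x x f g "twist C x"]
      tns_add_left[of x x "dual C x" "dual C x" "twist C x \<cdot> f" "twist C x \<cdot> g" "idm C (dual C x)"] tf by simp
  have h: "(twist C x \<cdot> h) \<otimes>\<^sub>a idm C (dual C x) \<in> Hom C (x \<otimes>\<^sub>o dual C x) (x \<otimes>\<^sub>o dual C x)"
    if "h \<in> Hom C x x" for h using tf[OF that] by simp
  have h2: "((twist C x \<cdot> h) \<otimes>\<^sub>a idm C (dual C x)) \<cdot> coev C x \<in> Hom C (tunit C) (x \<otimes>\<^sub>o dual C x)"
    if "h \<in> Hom C x x" for h by (rule comp_Hom[OF _ h[OF that]]) simp_all
  have h3: "braid C x (dual C x) \<cdot> (((twist C x \<cdot> h) \<otimes>\<^sub>a idm C (dual C x)) \<cdot> coev C x) \<in>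
    Hom C (tunit C) (dual C x \<otimes>\<^sub>o x)"
    if "h \<in> Hom C x x" for h by (rule comp_Hom[OF h2[OF that]]) simp_all
  have "?e (f + g) = ?e f + ?e g"
    using cmp_add_left[OF _ _ _ _ h[OF f] h[OF g], of "tunit C" "coev C x"]
      cmp_add_right[OF _ _ _ h2[OF f] h2[OF g], of "dual C x \<otimes>\<^sub>o x" "braid C x (dual C x)"]
      cmp_add_right[OF _ _ _ h3[OF f] h3[OF g], of "tunit C" "ev C x"] by (simp add: 1)
  then have "scl C (qtrace C x (f + g)) (idm C (tunit C))
    = scl C (qtrace C x f + qtrace C x g) (idm C (tunit C))"
    by (simp add: e vs.scale_left_distrib)
  then show ?thesis by (rule scl_idm_inj[OF simple_tunit])
qed

lemma scalar_endosI:
  assumes "x \<in> Obj C" "\<And>f. f \<in> Hom C x x \<Longrightarrow> \<exists>a. f = scl C a (idm C x)"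
  shows "m.scalar_endos x"
  unfolding m.scalar_endos_def using assms(2) by (fastforce elim!: arT_E simp: scT_def IT_def)

lemma scalar_endos_simple: "simple_object C x \<Longrightarrow> m.scalar_endos x"
  using endo_scalar by (intro scalar_endosI) (simp, metis)

text \<open>The scalars \<open>a\<close> and \<open>b\<close> are the effects on \<open>y\<close> of
  loops coloured \<open>x\<close> and \<open>z\<close>. They are carried along instead of quotients
  by the dimension of \<open>y\<close>, whose non-vanishing is derived only later, from
  non-degeneracy.\<close>

lemma s_entry_tensor:
  assumes y: "simple_object C y" and [simp]: "x \<in> Obj C" "z \<in> Obj C"
  obtains a b where "s_entry C x y = a * qtrace C y (idm C y)" "s_entry C z y = b * qtrace C y (idm C y)"
    "s_entry C (x \<otimes>\<^sub>o z) y = a * b * qtrace C y (idm C y)"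
proof -
  have yO [simp]: "y \<in> Obj C" using y by simp
  have M [simp]: "braid C w y \<cdot> braid C y w \<in> Hom C (y \<otimes>\<^sub>o w) (y \<otimes>\<^sub>o w)" if "w \<in> Obj C" for w
    using that by (intro comp_Hom[of _ _ "w \<otimes>\<^sub>o y"]) simp_all
  have *: "cmpT (brT w y) (brT y w) = (y \<otimes>\<^sub>o w, braid C w y \<cdot> braid C y w, y \<otimes>\<^sub>o w)" for w
    by (simp add: cmpT_simp)
  have I: "IT y = (y, idm C y, y)" by (simp add: IT_def)
  obtain a b where "trT (y \<otimes>\<^sub>o x) (braid C x y \<cdot> braid C y x) = scT a (trT y (idm C y))"
    "trT (y \<otimes>\<^sub>o z) (braid C z y \<cdot> braid C y z) = scT b (trT y (idm C y))"
    "trT (y \<otimes>\<^sub>o (x \<otimes>\<^sub>o z)) (braid C (x \<otimes>\<^sub>o z) y \<cdot> braid C y (x \<otimes>\<^sub>o z)) = scT (a * b) (trT y (idm C y))"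
    by (rule m.mtr_loop_mult[OF scalar_endos_simple[OF y] mdual_dual[of x] mdual_dual[of z] mdual_dual[of y]
          mdual_dual[of "y \<otimes>\<^sub>o x"] mdual_dual[of "y \<otimes>\<^sub>o z"] mdual_dual[of "y \<otimes>\<^sub>o
            (x \<otimes>\<^sub>o z)"], unfolded * I]) simp_all
  then show ?thesis
    by (intro that[of a b]) (auto simp: mtr_eq_qtrace s_entry_def catT(20) intro!: scT_unit_inj)
qed

lemma monodromy_tensor:
  assumes [simp]: "g \<in> Obj C" "x \<in> Obj C" "y \<in> Obj C"
    and x: "braid C x g \<cdot> braid C g x = scl C a (idm C (g \<otimes>\<^sub>o x))"
    and y: "braid C y g \<cdot> braid C g y = scl C b (idm C (g \<otimes>\<^sub>o y))"
  shows "braid C (x \<otimes>\<^sub>o y) g \<cdot> braid C g (x \<otimes>\<^sub>o y) = scl C (a * b) (idm C (g \<otimes>\<^sub>o (x \<otimes>\<^sub>o y)))"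
  using m.monodromy_tns[of g x y a b] x y by (simp add: cmpT_simp scT_def IT_def)

lemma monodromy_tunit: "x \<in> Obj C \<Longrightarrow> braid C x (tunit C) \<cdot> braid C (tunit C) x = idm C (tunit C \<otimes>\<^sub>o x)"
  using m.monodromy_un[of x] by (simp add: cmpT_simp IT_def)

lemma qtrace_tunit: "qtrace C (tunit C) (idm C (tunit C)) = 1"
proof -
  have "trT (tunit C) (idm C (tunit C)) = IT (tunit C)"
    using m.mtr_un[OF mdual_dual[of "tunit C"]] by (simp add: IT_def)
  then have "scT (qtrace C (tunit C) (idm C (tunit C))) (IT (tunit C)) = scT 1 (IT (tunit C))"
    by (simp add: mtr_eq_qtrace) (simp add: scT_def IT_def)
  then show ?thesis by (rule scT_unit_inj)
qed

lemma dual_endo_scalar: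
  assumes x: "simple_object C x" and f: "f \<in> Hom C (dual C x) (dual C x)"
  shows "\<exists>a. f = scl C a (idm C (dual C x))"
proof -
  have xO [simp]: "x \<in> Obj C" using x by simp
  have "m.scalar_endos (dual C x)"
    by (rule m.scalar_endos_dual[OF mdual_dual[OF xO] scalar_endos_simple[OF x]])
  then have "\<exists>a. (dual C x, f, dual C x) = scT a (IT (dual C x))"
    unfolding m.scalar_endos_def using f by simp
  then show ?thesis by (simp add: scT_def IT_def)
qed

text \<open>\<open>m.adjunction\<close> freed from the tags for source and target.\<close>

lemma Hom_adjunction:
  assumes [simp]: "x \<in> Obj C" "a \<in> Obj C" "b \<in> Obj C"
  shows "\<exists>\<Phi> \<Psi>.
    (\<forall>k \<in> Hom C (dual C x \<otimes>\<^sub>o a) b. \<Phi> k \<in> Hom C a (x \<otimes>\<^sub>o b) \<and> \<Psi> (\<Phi> k) = k) \<and>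
    (\<forall>l \<in> Hom C a (x \<otimes>\<^sub>o b). \<Psi> l \<in> Hom C (dual C x \<otimes>\<^sub>o a) b \<and> \<Phi> (\<Psi> l) = l) \<and>
    (\<forall>k \<in> Hom C (dual C x \<otimes>\<^sub>o a) b. \<forall>c. \<Phi> (scl C c k) = scl C c (\<Phi> k)) \<and>
    (\<forall>l \<in> Hom C a (x \<otimes>\<^sub>o b). \<forall>c. \<Psi> (scl C c l) = scl C c (\<Psi> l))"
proof -
  let ?k = "\<lambda>k. (dual C x \<otimes>\<^sub>o a, k, b)" and ?l = "\<lambda>l. (a, l, x \<otimes>\<^sub>o b)"
  obtain P Q where P:
    "\<And>k. \<lbrakk>arT k; fst k = dual C x \<otimes>\<^sub>o a; snd (snd k) = b\<rbrakk> \<Longrightarrow>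
       arT (P k) \<and> fst (P k) = a \<and> snd (snd (P k)) = x \<otimes>\<^sub>o b \<and> Q (P k) = k"
    "\<And>l. \<lbrakk>arT l; fst l = a; snd (snd l) = x \<otimes>\<^sub>o b\<rbrakk> \<Longrightarrow>
       arT (Q l) \<and> fst (Q l) = dual C x \<otimes>\<^sub>o a \<and> snd (snd (Q l)) = b \<and> P (Q l) = l"
    "\<And>k c. \<lbrakk>arT k; fst k = dual C x \<otimes>\<^sub>o a; snd (snd k) = b\<rbrakk> \<Longrightarrow> P (scT c k) = scT c (P k)"
    "\<And>l c. \<lbrakk>arT l; fst l = a; snd (snd l) = x \<otimes>\<^sub>o b\<rbrakk> \<Longrightarrow> Q (scT c l) = scT c (Q l)"
    using m.adjunction[OF mdual_dual[of x], of a b] by auto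
  have k: "arT (?k k)" if "k \<in> Hom C (dual C x \<otimes>\<^sub>o a) b" for k using that by simp
  have l: "arT (?l l)" if "l \<in> Hom C a (x \<otimes>\<^sub>o b)" for l using that by simp
  have eP: "P (?k k) = ?l (fst (snd (P (?k k))))" if "k \<in> Hom C (dual C x \<otimes>\<^sub>o a) b" for k
    using P(1)[OF k[OF that]] by (simp add: prod_eq_iff)
  have eQ: "Q (?l l) = ?k (fst (snd (Q (?l l))))" if "l \<in> Hom C a (x \<otimes>\<^sub>o b)" for l
    using P(2)[OF l[OF that]] by (simp add: prod_eq_iff)
  show ?thesis
  proof (rule exI[of _ "\<lambda>k. fst (snd (P (?k k)))"], rule exI[of _ "\<lambda>l. fst (snd (Q (?l l)))"],
      intro conjI ballI allI)
    fix k c assume h: "k \<in> Hom C (dual C x \<otimes>\<^sub>o a) b"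
    have "arT (?l (fst (snd (P (?k k)))))" "Q (?l (fst (snd (P (?k k))))) = ?k k"
      using P(1)[OF k[OF h]] eP[OF h] by auto
    then show "fst (snd (P (?k k))) \<in> Hom C a (x \<otimes>\<^sub>o b)" "fst (snd (Q (?l (fst (snd (P (?k k)))))))
      = k" by simp_all
    have "P (?k (scl C c k)) = scT c (P (?k k))" using P(3)[OF k[OF h], of c] by (simp add: scT_def)
    then show "fst (snd (P (?k (scl C c k)))) = scl C c (fst (snd (P (?k k))))"
      by (simp add: scT_def split: prod.splits)
  next
    fix l c assume h: "l \<in> Hom C a (x \<otimes>\<^sub>o b)"
    have "arT (?k (fst (snd (Q (?l l)))))" "P (?k (fst (snd (Q (?l l))))) = ?l l"
      using P(2)[OF l[OF h]] eQ[OF h] by auto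
    then show "fst (snd (Q (?l l))) \<in> Hom C (dual C x \<otimes>\<^sub>o a) b" "fst (snd (P (?k (fst (snd (Q
      (?l l))))))) = l" by simp_all
    have "Q (?l (scl C c l)) = scT c (Q (?l l))" using P(4)[OF l[OF h], of c] by (simp add: scT_def)
    then show "fst (snd (Q (?l (scl C c l)))) = scl C c (fst (snd (Q (?l l))))"
      by (simp add: scT_def split: prod.splits)
  qed
qed

section \<open>Constituents of tensor products\<close>

text \<open>For simple \<open>z\<close>: \<open>z\<close> is a constituent of \<open>v\<close>.\<close>

definition occ :: "'o \<Rightarrow> 'o \<Rightarrow> bool" where
  "occ z v \<longleftrightarrow> (\<exists>g \<in> Hom C z v. g \<noteq> 0)"

lemma iso_cancel:
  assumes i: "inverse_arrows C x y f g" and "x \<in> Obj C" "y \<in> Obj C" "w \<in> Obj C"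
  shows "h \<in> Hom C w x \<Longrightarrow> g \<cdot> (f \<cdot> h) = h" "h \<in> Hom C y w \<Longrightarrow> (h \<cdot> f) \<cdot> g = h"
proof -
  have t: "f \<in> Hom C x y" "g \<in> Hom C y x" "g \<cdot> f = idm C x" "f \<cdot> g = idm C y"
    using i by (auto simp: inverse_arrows_def)
  show "g \<cdot> (f \<cdot> h) = h" if "h \<in> Hom C w x"
    using cmp_assoc[of w x y x h f g] t that assms cmp_idm_left by simp
  show "(h \<cdot> f) \<cdot> g = h" if "h \<in> Hom C y w"
    using cmp_assoc[of y x y w g f h] t that assms cmp_idm_right by simp
qed

lemma occ_iso_right:
  assumes "isomorphic C v v'" "z \<in> Obj C" "v \<in> Obj C" "v' \<in> Obj C"
  shows "occ z v \<longleftrightarrow> occ z v'"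
proof -
  have *: "occ z v'" if iso: "isomorphic C v v'" and o: "occ z v" and O: "v \<in> Obj C" "v' \<in> Obj C" for v v'
  proof -
    obtain f g where i: "inverse_arrows C v v' f g" using iso by (auto simp: isomorphic_def iso_arrow_def)
    obtain h where h: "h \<in> Hom C z v" "h \<noteq> 0" using o by (auto simp: occ_def)
    have t: "f \<in> Hom C v v'" "g \<in> Hom C v' v" using i by (auto simp: inverse_arrows_def)
    have "f \<cdot> h \<noteq> 0" using iso_cancel(1)[OF i O assms(2) h(1)] h(2) cmp_zero_right[OF t(2) assms(2)
      O(2) O(1)] by auto
    then show ?thesis using comp_Hom[OF h(1) t(1) assms(2) O] by (auto simp: occ_def)
  qed
  show ?thesis using *[OF assms(1) _ assms(3,4)] *[OF isomorphic_sym[OF assms(1)] _ assms(4,3)] by blast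
qed

lemma occ_iso_left:
  assumes "isomorphic C z z'" "z \<in> Obj C" "z' \<in> Obj C" "v \<in> Obj C"
  shows "occ z v \<longleftrightarrow> occ z' v"
proof -
  have *: "occ z' v" if iso: "isomorphic C z z'" and o: "occ z v" and O: "z \<in> Obj C" "z' \<in> Obj C" for z z'
  proof -
    obtain f g where i: "inverse_arrows C z' z f g"
      using isomorphic_sym[OF iso] by (auto simp: isomorphic_def iso_arrow_def)
    obtain h where h: "h \<in> Hom C z v" "h \<noteq> 0" using o by (auto simp: occ_def)
    have t: "f \<in> Hom C z' z" "g \<in> Hom C z z'" using i by (auto simp: inverse_arrows_def)
    have "h \<cdot> f \<noteq> 0" using iso_cancel(2)[OF i O(2,1) assms(4) h(1)] h(2) cmp_zero_left[OF t(2) O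
      assms(4)] by auto
    then show ?thesis using comp_Hom[OF t(1) h(1) O(2,1) assms(4)] by (auto simp: occ_def)
  qed
  show ?thesis using *[OF assms(1) _ assms(2,3)] *[OF isomorphic_sym[OF assms(1)] _ assms(3,2)] by blast
qed

lemma occ_simple:
  assumes "simple_object C z" "simple_object C w"
  shows "occ z w \<longleftrightarrow> isomorphic C z w"
proof
  assume "occ z w"
  then show "isomorphic C z w" using simple_Hom_zero[OF assms] by (auto simp: occ_def)
next
  assume "isomorphic C z w"
  moreover have "occ z z" using simple_idm_nonzero[OF assms(1)] assms(1) idm_in_Hom[of z]
    by (auto simp: occ_def)
  ultimately show "occ z w" using occ_iso_right[of z w z] assms by simp
qed

lemma occ_biproduct:
  assumes z: "z \<in> Obj C" and b: "biproduct v ws i p"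
  shows "occ z v \<longleftrightarrow> (\<exists>j < length ws. occ z (ws ! j))"
proof
  note D = biproductD[OF b]
  assume "occ z v"
  then obtain g where g: "g \<in> Hom C z v" "g \<noteq> 0" by (auto simp: occ_def)
  have "\<exists>j < length ws. p j \<cdot> g \<noteq> 0"
  proof (rule ccontr)
    assume "\<not> ?thesis"
    then have "g = 0" using biproduct_expand[OF b z g(1)] cmp_zero_right[OF D(4) z D(3) D(1)] by simp
    then show False using g by simp
  qed
  then show "\<exists>j < length ws. occ z (ws ! j)"
    using comp_Hom[OF g(1) D(5) z D(1) D(3)] by (auto simp: occ_def)
next
  note D = biproductD[OF b]
  assume "\<exists>j < length ws. occ z (ws ! j)"
  then obtain j g where g: "j < length ws" "g \<in> Hom C z (ws ! j)" "g \<noteq> 0" by (auto simp: occ_def)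
  have "p j \<cdot> (i j \<cdot> g) = g"
    using cmp_assoc[OF z D(3)[OF g(1)] D(1) D(3)[OF g(1)] g(2) D(4)[OF g(1)] D(5)[OF g(1)]]
      D(6)[OF g(1)] cmp_idm_left[OF z D(3)[OF g(1)] g(2)] by simp
  then have "i j \<cdot> g \<noteq> 0" using g(3) cmp_zero_right[OF D(5)[OF g(1)] z D(1) D(3)[OF g(1)]] by auto
  then show "occ z v" using comp_Hom[OF g(2) D(4)[OF g(1)] z D(3)[OF g(1)] D(1)] by (auto simp: occ_def)
qed

lemma multiplicity_in_nonzero_iff:
  assumes z: "simple_object C z" and v: "v \<in> Obj C"
  shows "multiplicity_in C v (iso_class C z) \<noteq> 0 \<longleftrightarrow> occ z v"
proof -
  obtain xs where xs: "\<forall>x \<in> set xs. simple_object C x" "is_direct_sum C v xs" using semisimple[OF v] by blast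
  obtain i p where b: "biproduct v xs i p" using xs(2) is_direct_sum_iff by blast
  have zO: "z \<in> Obj C" using z by simp
  have "occ z v \<longleftrightarrow> (\<exists>j < length xs. isomorphic C z (xs ! j))"
    using occ_biproduct[OF zO b] occ_simple[OF z] xs(1) by (simp cong: conj_cong)
  also have "\<dots> \<longleftrightarrow> filter (isomorphic C z) xs \<noteq> []"
    by (metis (mono_tags) filter_empty_conv in_set_conv_nth)
  finally show ?thesis using multiplicity_in_biproduct[OF z xs] by simp
qed

lemma iso_arrow_tns:
  assumes f: "inverse_arrows C x x' f f'" and g: "inverse_arrows C y y' g g'"
    and [simp]: "x \<in> Obj C" "x' \<in> Obj C" "y \<in> Obj C" "y' \<in> Obj C"
  shows "inverse_arrows C (x \<otimes>\<^sub>o y) (x' \<otimes>\<^sub>o y') (f \<otimes>\<^sub>a g) (f' \<otimes>\<^sub>a g')"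
proof -
  have t [simp]: "f \<in> Hom C x x'" "f' \<in> Hom C x' x" "g \<in> Hom C y y'" "g' \<in> Hom C y' y"
    using f g by (auto simp: inverse_arrows_def)
  show ?thesis
    using f g tns_cmp[of x x' x y y' y f f' g g'] tns_cmp[of x' x x' y' y y' f' f g' g]
    by (simp add: inverse_arrows_def tns_idm)
qed

lemma isomorphic_tns:
  "\<lbrakk>isomorphic C x x'; isomorphic C y y'; x \<in> Obj C; x' \<in> Obj C; y \<in> Obj C; y' \<in> Obj C\<rbrakk>
    \<Longrightarrow> isomorphic C (x \<otimes>\<^sub>o y) (x' \<otimes>\<^sub>o y')"
  unfolding isomorphic_def iso_arrow_def using iso_arrow_tns by blast

lemma isomorphic_comm: "\<lbrakk>x \<in> Obj C; y \<in> Obj C\<rbrakk> \<Longrightarrow> isomorphic C (x \<otimes>\<^sub>o y) (y \<otimes>\<^sub>o x)"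
  using braid_iso by (auto simp: isomorphic_def)

lemma isomorphic_asc:
  "\<lbrakk>x \<in> Obj C; y \<in> Obj C; z \<in> Obj C\<rbrakk> \<Longrightarrow> isomorphic C ((x \<otimes>\<^sub>o y) \<otimes>\<^sub>o z) (x \<otimes>\<^sub>o (y \<otimes>\<^sub>o z))"
  using asc_iso by (auto simp: isomorphic_def)

lemma isomorphic_lun: "x \<in> Obj C \<Longrightarrow> isomorphic C (tunit C \<otimes>\<^sub>o x) x"
  using lun_iso by (auto simp: isomorphic_def)

lemma biproduct_tns:
  assumes b: "biproduct v ws i p" and y [simp]: "y \<in> Obj C"
  shows "biproduct (y \<otimes>\<^sub>o v) (map (\<lambda>w. y \<otimes>\<^sub>o w) ws) (\<lambda>j. idm C y \<otimes>\<^sub>a i j) (\<lambda>j. idm C y \<otimes>\<^sub>a p j)"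
proof -
  note D = biproductD[OF b]
  note [simp] = D(1,3-5)
  have cmp: "(idm C y \<otimes>\<^sub>a g) \<cdot> (idm C y \<otimes>\<^sub>a f) = idm C y \<otimes>\<^sub>a (g \<cdot> f)"
    if "f \<in> Hom C a b" "g \<in> Hom C b c" "a \<in> Obj C" "b \<in> Obj C" "c \<in> Obj C" for f g a b c
    using tns_cmp[of y y y a b c "idm C y" "idm C y" f g] that cmp_idm_left[of y y "idm C y"] by simp
  have zero: "idm C y \<otimes>\<^sub>a 0 = 0" if "a \<in> Obj C" "b \<in> Obj C" for a b
    using tns_scl_right[OF y y that idm_in_Hom[OF y] zero_in_Hom[OF that], of 0] by simp
  have tsum: "(\<Sum>j \<in> A. idm C y \<otimes>\<^sub>a f j) = idm C y \<otimes>\<^sub>a sum f A"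
    if "finite A" "\<And>j. j \<in> A \<Longrightarrow> f j \<in> Hom C v v" for A f
    using that
  proof (induction A rule: finite_induct)
    case (insert a A)
    then show ?case
      using tns_add_right[of y y v v "idm C y" "f a" "sum f A"] sum_in_Hom[of v v A f] by simp
  qed (use zero[OF D(1) D(1)] in simp)
  have "(\<Sum>j < length ws. (idm C y \<otimes>\<^sub>a i j) \<cdot> (idm C y \<otimes>\<^sub>a p j)) = (\<Sum>j < length ws. idm C y \<otimes>\<^sub>a (i j \<cdot> p j))"
    by (intro sum.cong refl cmp[OF D(5) D(4) D(1) D(3) D(1)]) auto
  also have "\<dots> = idm C y \<otimes>\<^sub>a (\<Sum>j < length ws. i j \<cdot> p j)"
    by (rule tsum) (auto intro!: comp_Hom[OF D(5) D(4)])
  also have "\<dots> = idm C (y \<otimes>\<^sub>o v)" using D(8) by (simp add: tns_idm)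
  finally have s: "(\<Sum>j < length ws. (idm C y \<otimes>\<^sub>a i j) \<cdot> (idm C y \<otimes>\<^sub>a p j)) = idm C (y \<otimes>\<^sub>o v)" .
  have o: "(idm C y \<otimes>\<^sub>a p l) \<cdot> (idm C y \<otimes>\<^sub>a i j) = (if j = l then idm C (y \<otimes>\<^sub>o ws ! j) else 0)"
    if "j < length ws" "l < length ws" for j l
    using cmp[of "i j" "ws ! j" v "p l" "ws ! l"] that D(6)[of j] D(7)[of j l] zero[of "ws ! j" "ws ! l"]
    by (cases "j = l") (simp_all add: tns_idm)
  show ?thesis
    unfolding biproduct_def using D(2) s o by auto
qed

text \<open>One direction decomposes \<open>v\<close>. In the other, a non-zero morphism from the
  simple object \<open>u\<close> to \<open>v\<close> splits, hence so does its tensor product with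
  \<open>y\<close>, and composing with it cannot annihilate \<open>h\<close>.\<close>

lemma occ_tns:
  assumes t: "t \<in> Obj C" and [simp]: "y \<in> Obj C" "v \<in> Obj C"
  shows "occ t (y \<otimes>\<^sub>o v) \<longleftrightarrow> (\<exists>u. simple_object C u \<and> occ u v \<and> occ t (y \<otimes>\<^sub>o u))"
proof
  obtain ws where ws: "\<forall>x \<in> set ws. simple_object C x" "is_direct_sum C v ws" using semisimple[of v] by auto
  then obtain i p where b: "biproduct v ws i p" using is_direct_sum_iff by blast
  have sub: "occ u v" if "j < length ws" "u = ws ! j" for u j
    using occ_biproduct[OF _ b, of u] biproductD(3)[OF b that(1)] that occ_simple[of u u] ws(1)
      isomorphic_refl by auto
  assume "occ t (y \<otimes>\<^sub>o v)"
  then obtain j where "j < length ws" "occ t (y \<otimes>\<^sub>o ws ! j)"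
    using occ_biproduct[OF t biproduct_tns[OF b]] by auto
  moreover from this have "simple_object C (ws ! j)" using ws(1) by simp
  ultimately show "\<exists>u. simple_object C u \<and> occ u v \<and> occ t (y \<otimes>\<^sub>o u)" using sub by blast
next
  assume "\<exists>u. simple_object C u \<and> occ u v \<and> occ t (y \<otimes>\<^sub>o u)"
  then obtain u g h where u: "simple_object C u" and g: "g \<in> Hom C u v" "g \<noteq> 0"
    and h: "h \<in> Hom C t (y \<otimes>\<^sub>o u)" "h \<noteq> 0" by (auto simp: occ_def)
  have uO [simp]: "u \<in> Obj C" using u by simp
  obtain p where p: "p \<in> Hom C v u" "p \<cdot> g = idm C u" using simple_splits[OF u _ g] by auto
  have t1: "idm C y \<otimes>\<^sub>a g \<in> Hom C (y \<otimes>\<^sub>o u) (y \<otimes>\<^sub>o v)" "idm C y \<otimes>\<^sub>a p \<in> Hom C (y \<otimes>\<^sub>o v) (y \<otimes>\<^sub>o u)"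
    using g p by simp_all
  have "(idm C y \<otimes>\<^sub>a p) \<cdot> (idm C y \<otimes>\<^sub>a g) = idm C (y \<otimes>\<^sub>o u)"
    using tns_cmp[of y y y u v u "idm C y" "idm C y" g p] g p cmp_idm_left[of y y "idm C y"]
      by (simp add: tns_idm)
  then have "(idm C y \<otimes>\<^sub>a p) \<cdot> ((idm C y \<otimes>\<^sub>a g) \<cdot> h) = h"
    using cmp_assoc[OF t _ _ _ h(1) t1] cmp_idm_left[OF t _ h(1)] by simp
  then have "(idm C y \<otimes>\<^sub>a g) \<cdot> h \<noteq> 0" using h(2) cmp_zero_right[OF t1(2) t] by auto
  then show "occ t (y \<otimes>\<^sub>o v)" using comp_Hom[OF h(1) t1(1) t] by (auto simp: occ_def)
qed

lemma occ_comm: "\<lbrakk>t \<in> Obj C; x \<in> Obj C; y \<in> Obj C\<rbrakk> \<Longrightarrow> occ t (x \<otimes>\<^sub>o y) \<longleftrightarrow> occ t (y \<otimes>\<^sub>o x)"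
  using occ_iso_right[OF isomorphic_comm] by simp

text \<open>By semisimplicity, a simple object is a subobject exactly when it is a quotient: a
  morphism out of \<open>v\<close> that is non-zero is non-zero on some simple summand.\<close>

lemma occ_dom:
  assumes z: "simple_object C z" and v: "v \<in> Obj C"
  shows "occ z v \<longleftrightarrow> (\<exists>f \<in> Hom C v z. f \<noteq> 0)"
proof
  assume "occ z v"
  then obtain g where g: "g \<in> Hom C z v" "g \<noteq> 0" by (auto simp: occ_def)
  obtain p where p: "p \<in> Hom C v z" "p \<cdot> g = idm C z" using simple_splits[OF z v g] by blast
  have "p \<noteq> 0" using p cmp_zero_left[OF g(1)] z v simple_idm_nonzero[OF z] by auto
  then show "\<exists>f \<in> Hom C v z. f \<noteq> 0" using p by blast
next
  assume "\<exists>f \<in> Hom C v z. f \<noteq> 0"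
  then obtain f where f: "f \<in> Hom C v z" "f \<noteq> 0" by blast
  obtain ws where ws: "\<forall>x \<in> set ws. simple_object C x" "is_direct_sum C v ws" using semisimple[OF v] by auto
  then obtain i p where b: "biproduct v ws i p" using is_direct_sum_iff by blast
  note D = biproductD[OF b]
  have zO: "z \<in> Obj C" using z by simp
  have "\<exists>j < length ws. f \<cdot> i j \<noteq> 0"
  proof (rule ccontr)
    assume n: "\<not> ?thesis"
    have "f = f \<cdot> (\<Sum>j < length ws. i j \<cdot> p j)" using D(8) cmp_idm_right[OF v zO f(1)] by simp
    also have "\<dots> = (\<Sum>j < length ws. f \<cdot> (i j \<cdot> p j))"
      by (rule cmp_sum_right[OF v v zO _ f(1)]) (auto intro!: comp_Hom[OF D(5) D(4)] v D(3))
    also have "\<dots> = (\<Sum>j < length ws. (f \<cdot> i j) \<cdot> p j)"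
      using cmp_assoc[OF v D(3) v zO D(5) D(4) f(1)] by (intro sum.cong) auto
    also have "\<dots> = 0" using n cmp_zero_left[OF D(5) v D(3) zO] by simp
    finally show False using f by simp
  qed
  then obtain j where j: "j < length ws" "f \<cdot> i j \<noteq> 0" by blast
  have "occ (ws ! j) z" using comp_Hom[OF D(4)[OF j(1)] f(1) D(3)[OF j(1)] v zO] j(2) by (auto simp: occ_def)
  then have "isomorphic C (ws ! j) z" using occ_simple[OF _ z] ws(1) j(1) by simp
  then have "occ z (ws ! j)" using occ_simple[OF z] ws(1) j(1) isomorphic_sym by simp
  then show "occ z v" using occ_biproduct[OF zO b] j(1) by blast
qed

text \<open>Frobenius reciprocity. The adjunction concerns morphisms out of the product with the
  dual, which \<open>occ_dom\<close> turns into occurrence.\<close>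

lemma occ_frobenius:
  assumes x [simp]: "x \<in> Obj C" and a: "simple_object C a" and b: "simple_object C b"
  shows "occ b (dual C x \<otimes>\<^sub>o a) \<longleftrightarrow> occ a (x \<otimes>\<^sub>o b)"
proof -
  have aO [simp]: "a \<in> Obj C" and bO [simp]: "b \<in> Obj C" using a b by auto
  obtain \<Phi> \<Psi> where
    P: "\<forall>k \<in> Hom C (dual C x \<otimes>\<^sub>o a) b. \<Phi> k \<in> Hom C a (x \<otimes>\<^sub>o b) \<and> \<Psi> (\<Phi> k) = k"
    "\<forall>l \<in> Hom C a (x \<otimes>\<^sub>o b). \<Psi> l \<in> Hom C (dual C x \<otimes>\<^sub>o a) b \<and> \<Phi> (\<Psi> l) = l"
    "\<forall>k \<in> Hom C (dual C x \<otimes>\<^sub>o a) b. \<forall>c. \<Phi> (scl C c k) = scl C c (\<Phi> k)"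
    "\<forall>l \<in> Hom C a (x \<otimes>\<^sub>o b). \<forall>c. \<Psi> (scl C c l) = scl C c (\<Psi> l)"
    using Hom_adjunction[OF x aO bO] by blast
  have "\<Phi> (scl C 0 0) = scl C 0 (\<Phi> 0)" by (rule P(3)[rule_format]) (simp add: zero_in_Hom)
  moreover have "\<Psi> (scl C 0 0) = scl C 0 (\<Psi> 0)" by (rule P(4)[rule_format]) (simp add: zero_in_Hom)
  ultimately have "\<Phi> 0 = 0" "\<Psi> 0 = 0" by simp_all
  then show ?thesis
    unfolding occ_dom[OF b tns_in_Obj[OF dual_typed(1)[OF x] aO]] unfolding occ_def using P(1,2) by metis
qed

text \<open>The idempotent belonging to a simple summand is a scalar, and composing it with the
  projection shows that this scalar is 1; so the summand is all of \<open>v\<close>.\<close>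

lemma simple_if_scalar_endos:
  assumes v: "v \<in> Obj C" "idm C v \<noteq> 0" and sc: "\<And>f. f \<in> Hom C v v \<Longrightarrow> \<exists>a. f = scl C a (idm C v)"
  shows "simple_object C v"
proof -
  obtain ws where ws: "\<forall>x \<in> set ws. simple_object C x" "is_direct_sum C v ws"
    using semisimple[OF v(1)] by auto
  then obtain i p where b: "biproduct v ws i p" using is_direct_sum_iff by blast
  note D = biproductD[OF b]
  have "ws \<noteq> []" using D(8) v by auto
  then have 0: "0 < length ws" by simp
  let ?z = "ws ! 0"
  have z: "simple_object C ?z" using ws 0 by simp
  have zO: "?z \<in> Obj C" using z by simp
  note I = D(4)[OF 0] and P = D(5)[OF 0] and PI = D(6)[OF 0]
  obtain a where a: "i 0 \<cdot> p 0 = scl C a (idm C v)" using sc comp_Hom[OF P I] v zO by blast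
  have "p 0 = p 0 \<cdot> (i 0 \<cdot> p 0)"
    using cmp_assoc[OF v(1) zO v(1) zO P I P] PI cmp_idm_left[OF v(1) zO P] by simp
  also have "\<dots> = scl C a (p 0)"
    unfolding a using cmp_scl_right[OF v(1) v(1) zO idm_in_Hom[OF v(1)] P] cmp_idm_right[OF v(1) zO P] by simp
  finally have "scl C (1 - a) (p 0) = 0" by (simp add: vs.scale_left_diff_distrib)
  moreover have "p 0 \<noteq> 0"
    using PI simple_idm_nonzero[OF z] cmp_zero_left[OF I zO v(1) zO] by metis
  ultimately have "a = 1" by (simp add: vs.scale_eq_0_iff)
  then have "inverse_arrows C ?z v (i 0) (p 0)" using a I P PI by (simp add: inverse_arrows_def)
  then show ?thesis
    using simple_object_isomorphic[OF z v(1)] by (auto simp: isomorphic_def iso_arrow_def)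
qed

lemma idm_tns_zero:
  assumes "x \<in> Obj C" "y \<in> Obj C" "idm C x = 0"
  shows "idm C (x \<otimes>\<^sub>o y) = 0"
  using tns_scl_left[of x x y y "idm C x" "idm C y" 0] assms tns_idm[of x y] zero_in_Hom[of x x] by simp

lemma Hom_zero_if_idm_zero:
  assumes "x \<in> Obj C" "y \<in> Obj C" "idm C x = 0" "f \<in> Hom C x y"
  shows "f = 0"
  using cmp_idm_right[OF assms(1,2,4)] cmp_zero_right[OF assms(4,1,1,2)] assms(3) by simp

text \<open>The dual has only scalar endomorphisms. It is not zero, since otherwise Frobenius
  reciprocity would deny that \<open>x\<close> occurs in its product with the unit.\<close>

lemma simple_dual:
  assumes x: "simple_object C x"
  shows "simple_object C (dual C x)"
proof (rule simple_if_scalar_endos)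
  have xO [simp]: "x \<in> Obj C" using x by simp
  show "dual C x \<in> Obj C" by simp
  show "idm C (dual C x) \<noteq> 0"
  proof
    assume "idm C (dual C x) = 0"
    then have "idm C (dual C x \<otimes>\<^sub>o x) = 0" by (rule idm_tns_zero[rotated 2]) simp_all
    then have "\<not> occ (tunit C) (dual C x \<otimes>\<^sub>o x)"
      unfolding occ_dom[OF simple_tunit tns_in_Obj[OF dual_typed(1)[OF xO] xO]]
      using Hom_zero_if_idm_zero[of "dual C x \<otimes>\<^sub>o x" "tunit C"] by auto
    then have "\<not> occ x (x \<otimes>\<^sub>o tunit C)" using occ_frobenius[OF xO x simple_tunit] by simp
    moreover have "isomorphic C (x \<otimes>\<^sub>o tunit C) x" using run_iso[OF xO] by (auto simp: isomorphic_def)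
    ultimately show False using occ_iso_right[of "x \<otimes>\<^sub>o tunit C" x x] occ_simple[OF x x]
      isomorphic_refl by simp
  qed
qed (rule dual_endo_scalar[OF x])

end

section \<open>The universal grading of a commutative based ring\<close>

text \<open>Only the supports of the structure constants matter for the universal grading:
  \<open>R a b c\<close> stands for \<open>c\<close> occurring in \<open>a b\<close>.\<close>

locale fusion_support =
  fixes I :: "'b set" and R :: "'b \<Rightarrow> 'b \<Rightarrow> 'b \<Rightarrow> bool" and e :: 'b and st :: "'b \<Rightarrow> 'b"
  assumes e_in [simp]: "e \<in> I" and st_in [simp]: "a \<in> I \<Longrightarrow> st a \<in> I"
    and R_in: "R a b c \<Longrightarrow> a \<in> I \<and> b \<in> I \<and> c \<in> I"
    and R_comm: "R a b c \<Longrightarrow> R b a c"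
    and R_unit: "a \<in> I \<Longrightarrow> R e a c \<longleftrightarrow> c = a"
    and R_assoc: "R a b w \<Longrightarrow> R w c d \<Longrightarrow> \<exists>v. R b c v \<and> R a v d"
    and R_frob: "R x b a \<Longrightarrow> R (st x) a b"
begin

lemma R_assoc':
  assumes "R b c v" "R a v d"
  shows "\<exists>w. R a b w \<and> R w c d"
proof -
  obtain w where "R b a w" "R c w d" using R_assoc[OF R_comm[OF assms(1)] R_comm[OF assms(2)]] by blast
  then show ?thesis using R_comm[of b a w] R_comm[of c w d] by blast
qed

text \<open>\<open>R_frob\<close> applied to the unit rule puts \<open>e\<close> into the product of
  \<open>st x\<close> and \<open>x\<close>. Applied once more it puts \<open>a\<close> into the
  product of \<open>st (st a)\<close> and \<open>e\<close>, which forces the two to agree.\<close>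

lemma st_st: "a \<in> I \<Longrightarrow> st (st a) = a"
  and R_st: "a \<in> I \<Longrightarrow> R a (st a) e"
proof -
  assume a: "a \<in> I"
  have 1: "R (st x) x e" if x: "x \<in> I" for x
    by (rule R_frob, rule R_comm) (simp add: R_unit x)
  have "R (st (st a)) e a" using R_frob[OF 1[OF a]] .
  from R_comm[OF this] show *: "st (st a) = a" using R_unit[of "st (st a)" a] a by simp
  show "R a (st a) e" using 1[of "st a"] a * by simp
qed

text \<open>\<open>b\<close> occurs in the triple product of \<open>st a\<close>, \<open>a\<close>
  and \<open>b\<close>, so by associativity the product of \<open>a\<close> and \<open>b\<close> is
  not empty.\<close>

lemma R_total:
  assumes "a \<in> I" "b \<in> I"
  shows "\<exists>c. R a b c"
proof -
  have "R (st a) a e" "R e b b" using R_st[OF assms(1)] R_comm R_unit assms by auto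
  from R_assoc[OF this] show ?thesis by blast
qed

text \<open>The condition on a set of basis elements that lets its span take part in the
  intersection defining the adjoint subring; \<open>adjoint_condition\<close> proves the
  equivalence.\<close>

definition adj_closed :: "'b set \<Rightarrow> bool" where
  "adj_closed T \<longleftrightarrow> T \<subseteq> I \<and> e \<in> T \<and> (\<forall>a \<in> T. \<forall>b \<in> T. \<forall>c. R a b c \<longrightarrow> c \<in> T) \<and>
     (\<forall>a \<in> T. st a \<in> T) \<and> (\<forall>x \<in> I. \<forall>c. R x (st x) c \<longrightarrow> c \<in> T)"

definition Tad :: "'b set" where "Tad = \<Inter> (Collect adj_closed)"

lemma adj_closed_I: "adj_closed I"
  by (auto simp: adj_closed_def dest: R_in)

lemma adj_closedD:
  assumes "adj_closed T"
  shows "T \<subseteq> I" "e \<in> T" "\<lbrakk>a \<in> T; b \<in> T; R a b c\<rbrakk> \<Longrightarrow> c \<in> T" "a \<in> T \<Longrightarrow> st a \<in> T"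
    "R x (st x) c \<Longrightarrow> c \<in> T"
proof -
  note A = assms[unfolded adj_closed_def]
  note A3 = A[THEN conjunct2, THEN conjunct2]
  show "T \<subseteq> I" "e \<in> T" by (fact A[THEN conjunct1], fact A[THEN conjunct2, THEN conjunct1])
  show "c \<in> T" if "a \<in> T" "b \<in> T" "R a b c"
    by (rule A3[THEN conjunct1, rule_format, OF that])
  show "st a \<in> T" if "a \<in> T"
    by (rule A3[THEN conjunct2, THEN conjunct1, rule_format, OF that])
  show "c \<in> T" if "R x (st x) c"
    by (rule A3[THEN conjunct2, THEN conjunct2, rule_format, OF _ that]) (use R_in[OF that] in simp)
qed

lemma Tad_iff: "c \<in> Tad \<longleftrightarrow> (\<forall>T. adj_closed T \<longrightarrow> c \<in> T)"
  by (auto simp: Tad_def)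

lemma TadD:
  "a \<in> Tad \<Longrightarrow> a \<in> I" "e \<in> Tad" "\<lbrakk>a \<in> Tad; b \<in> Tad; R a b c\<rbrakk> \<Longrightarrow> c \<in> Tad" "a \<in> Tad \<Longrightarrow> st a \<in> Tad"
  "R x (st x) c \<Longrightarrow> c \<in> Tad"
proof -
  show "a \<in> Tad \<Longrightarrow> a \<in> I" using adj_closed_I by (simp add: Tad_iff)
  show "e \<in> Tad" using adj_closedD(2) by (simp add: Tad_iff)
  show "c \<in> Tad" if "a \<in> Tad" "b \<in> Tad" "R a b c"
    using that(1,2) adj_closedD(3)[OF _ _ _ that(3)] by (simp add: Tad_iff)
  show "a \<in> Tad \<Longrightarrow> st a \<in> Tad" using adj_closedD(4) by (simp add: Tad_iff)
  show "c \<in> Tad" if "R x (st x) c" using adj_closedD(5)[OF _ that] by (simp add: Tad_iff)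
qed

text \<open>\<open>Tad\<close> acts on the basis by taking constituents of products. The orbits will
  be the supports of the indecomposable components.\<close>

definition orb :: "'b \<Rightarrow> 'b set" where "orb x = {y. \<exists>a \<in> Tad. R a x y}"

lemma orb_in: "y \<in> orb x \<Longrightarrow> x \<in> I \<and> y \<in> I"
  by (auto simp: orb_def dest: R_in)

lemma orb_refl: "x \<in> I \<Longrightarrow> x \<in> orb x"
  using TadD(2) R_unit by (auto simp: orb_def)

text \<open>\<open>R_frob\<close> reverses a product at the price of replacing the acting element by
  its dual, and \<open>Tad\<close> is closed under duals.\<close>

lemma orb_sym: "y \<in> orb x \<Longrightarrow> x \<in> orb y"
  unfolding orb_def by (auto dest: R_frob TadD(4))

lemma orb_trans:
  assumes "y \<in> orb x" "z \<in> orb y"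
  shows "z \<in> orb x"
proof -
  obtain a b where ab: "a \<in> Tad" "R a x y" "b \<in> Tad" "R b y z" using assms by (auto simp: orb_def)
  obtain w where "R b a w" "R w x z" using R_assoc'[OF ab(2,4)] by blast
  then show ?thesis using TadD(3)[OF ab(3,1)] by (auto simp: orb_def)
qed

lemma orb_eq: "y \<in> orb x \<Longrightarrow> orb y = orb x"
  by (intro subset_antisym subsetI) (erule (1) orb_trans, erule orb_trans[OF orb_sym])

lemma orb_e: "orb e = Tad"
proof -
  have "c \<in> orb e \<longleftrightarrow> c \<in> Tad" for c
  proof
    assume "c \<in> orb e"
    then obtain a where "a \<in> Tad" "R e a c" by (auto simp: orb_def dest: R_comm)
    then show "c \<in> Tad" using R_unit[of a c] TadD(1) by simp
  next
    assume "c \<in> Tad"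
    then show "c \<in> orb e" 
      unfolding orb_def using R_comm[of e c c] R_unit[of c c] TadD(1) by auto
  qed
  then show ?thesis by auto
qed

text \<open>Two constituents of one product \<open>x y\<close> differ by a constituent of the
  product of \<open>x\<close> and \<open>st x\<close>, and these lie in \<open>Tad\<close> by its
  definition. This is the reason why the product of two components is a single component.\<close>

lemma orb_R_unique:
  assumes "R x y z" "R x y z'"
  shows "z' \<in> orb z"
proof -
  obtain w where "R x (st x) w" "R w z z'" using R_assoc'[OF R_frob[OF assms(1)] assms(2)] by blast
  then show ?thesis using TadD(5) by (auto simp: orb_def)
qed

text \<open>Each factor is moved within its orbit by an element of \<open>Tad\<close>, which
  associativity shifts to the product; then \<open>orb_R_unique\<close> applies.\<close>

lemma orb_R:
  assumes a: "a \<in> orb x" and b: "b \<in> orb y" and c: "R a b c" and d: "R x y d"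
  shows "orb c = orb d"
proof -
  have *: "\<exists>w. R x b w \<and> c \<in> orb w" if "a \<in> orb x" "R a b c" for a x b c
  proof -
    obtain s where "s \<in> Tad" "R s x a" using \<open>a \<in> orb x\<close> by (auto simp: orb_def)
    with R_assoc[OF this(2) \<open>R a b c\<close>] show ?thesis by (auto simp: orb_def)
  qed
  obtain w where w: "R x b w" "c \<in> orb w" using *[OF a c] by blast
  obtain w' where w': "R y x w'" "w \<in> orb w'" using *[OF b R_comm[OF w(1)]] by blast
  have "w' \<in> orb d" using orb_R_unique[OF d R_comm[OF w'(1)]] .
  then show ?thesis using orb_eq[OF w(2)] orb_eq[OF w'(2)] orb_eq by simp
qed

section \<open>Stable subsets of the basis\<close>

definition stable :: "'b set \<Rightarrow> bool" where
  "stable T \<longleftrightarrow> T \<subseteq> I \<and> (\<forall>a \<in> Tad. \<forall>b \<in> T. \<forall>c. R a b c \<longrightarrow> c \<in> T)"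

lemma stableI: "\<lbrakk>T \<subseteq> I; \<And>a b c. \<lbrakk>a \<in> Tad; b \<in> T; R a b c\<rbrakk> \<Longrightarrow> c \<in> T\<rbrakk> \<Longrightarrow> stable T"
  unfolding stable_def by blast

lemma stableD:
  assumes "stable T"
  shows "T \<subseteq> I" "\<lbrakk>a \<in> Tad; b \<in> T; R a b c\<rbrakk> \<Longrightarrow> c \<in> T"
  by (rule assms[unfolded stable_def, THEN conjunct1],
      rule assms[unfolded stable_def, THEN conjunct2, rule_format])

lemma stable_orb: "stable (orb x)"
proof (rule stableI)
  show "c \<in> orb x" if "a \<in> Tad" "b \<in> orb x" "R a b c" for a b c
    by (rule orb_trans[OF that(2)]) (use that in \<open>auto simp: orb_def\<close>)
qed (use orb_in in blast)

text \<open>If the new element lay in \<open>S\<close>, Frobenius reciprocity would bring the old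
  one back into \<open>S\<close>. So stable sets can be split off, and a decomposition into orbits
  is possible.\<close>

lemma stable_diff:
  assumes T: "stable T" and S: "stable S"
  shows "stable (T - S)"
proof (rule stableI)
  show "T - S \<subseteq> I" using stableD(1)[OF T] by blast
  show "c \<in> T - S" if "a \<in> Tad" "b \<in> T - S" "R a b c" for a b c
  proof
    show "c \<in> T" using stableD(2)[OF T that(1) _ that(3)] that(2) by simp
    show "c \<notin> S" using stableD(2)[OF S TadD(4)[OF that(1)] _ R_frob[OF that(3)]] that(2) by auto
  qed
qed

lemma orb_subset:
  assumes "stable T" "x \<in> T"
  shows "orb x \<subseteq> T"
proof
  fix y assume "y \<in> orb x"
  then obtain a where "a \<in> Tad" "R a x y" by (auto simp: orb_def)
  then show "y \<in> T" by (rule stableD(2)[OF assms(1) _ assms(2)])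
qed

definition orbs :: "'b set set" where "orbs = orb ` I"

lemma orbs_stable_min:
  assumes "P \<in> orbs" "stable T" "T \<subseteq> P" "T \<noteq> {}"
  shows "T = P"
proof -
  obtain x y where "P = orb x" "y \<in> T" using assms(1,4) by (auto simp: orbs_def)
  then have "orb y = P" using orb_eq[of y x] assms(3) by auto
  then show ?thesis using orb_subset[OF assms(2) \<open>y \<in> T\<close>] assms(3) by auto
qed

text \<open>The union avoids a choice of representatives: by \<open>orb_R\<close> all the orbits
  that are united coincide.\<close>

definition grading_group :: "'b set monoid" where
  "grading_group = \<lparr>carrier = orbs, monoid.mult
    = (\<lambda>P Q. \<Union>x \<in> P. \<Union>y \<in> Q. \<Union>c \<in> {c. R x y c}. orb c), one = Tad\<rparr>"

lemma grading_mult: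
  assumes "R x y d"
  shows "orb x \<otimes>\<^bsub>grading_group\<^esub> orb y = orb d"
proof -
  have "x \<in> orb x" "y \<in> orb y" using R_in[OF assms] orb_refl by auto
  then have 1: "orb d \<subseteq> (\<Union>a \<in> orb x. \<Union>b \<in> orb y. \<Union>c \<in> {c. R a b c}. orb c)"
    using assms by blast
  have 2: "(\<Union>a \<in> orb x. \<Union>b \<in> orb y. \<Union>c \<in> {c. R a b c}. orb c) \<subseteq> orb d"
  proof (intro UN_least)
    fix a b c assume "a \<in> orb x" "b \<in> orb y" "c \<in> {c. R a b c}"
    then show "orb c \<subseteq> orb d" using orb_R[OF _ _ _ assms, of a b c] by simp
  qed
  have "(\<Union>a \<in> orb x. \<Union>b \<in> orb y. \<Union>c \<in> {c. R a b c}. orb c) = orb d"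
    by (rule subset_antisym[OF 2 1])
  then show ?thesis by (simp add: grading_group_def)
qed

lemma comm_group_grading: "comm_group grading_group"
proof (rule comm_groupI)
  let ?U = grading_group
  have rep: "\<exists>x \<in> I. P = orb x" if "P \<in> carrier ?U" for P
    using that by (auto simp: grading_group_def orbs_def)
  have in_carrier: "orb x \<in> carrier ?U" if "x \<in> I" for x
    using that by (auto simp: grading_group_def orbs_def)
  have one: "\<one>\<^bsub>?U\<^esub> = orb e" by (simp add: grading_group_def orb_e)
  show "\<one>\<^bsub>?U\<^esub> \<in> carrier ?U" using in_carrier one by simp
  fix P assume P: "P \<in> carrier ?U"
  obtain x where x: "x \<in> I" "P = orb x" using rep[OF P] by blast
  show "\<one>\<^bsub>?U\<^esub> \<otimes>\<^bsub>?U\<^esub> P = P" using grading_mult[of e x x] R_unit x one by simp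
  have "orb (st x) \<otimes>\<^bsub>?U\<^esub> P = \<one>\<^bsub>?U\<^esub>" using grading_mult[OF R_comm[OF R_st]] x one by simp
  then show "\<exists>Q \<in> carrier ?U. Q \<otimes>\<^bsub>?U\<^esub> P = \<one>\<^bsub>?U\<^esub>"
    by (rule bexI) (rule in_carrier, simp add: x)
  fix Q assume Q: "Q \<in> carrier ?U"
  obtain y where y: "y \<in> I" "Q = orb y" using rep[OF Q] by blast
  obtain d where d: "R x y d" using R_total[OF x(1) y(1)] by blast
  show "P \<otimes>\<^bsub>?U\<^esub> Q \<in> carrier ?U" using grading_mult[OF d] in_carrier R_in[OF d] x y by simp
  show "P \<otimes>\<^bsub>?U\<^esub> Q = Q \<otimes>\<^bsub>?U\<^esub> P" using grading_mult[OF d] grading_mult[OF R_comm[OF d]] x y by simp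
  fix S assume S: "S \<in> carrier ?U"
  obtain z where z: "z \<in> I" "S = orb z" using rep[OF S] by blast
  obtain c where c: "R d z c" using R_total[of d z] R_in[OF d] z by blast
  obtain v where v: "R y z v" "R x v c" using R_assoc[OF d c] by blast
  show "P \<otimes>\<^bsub>?U\<^esub> Q \<otimes>\<^bsub>?U\<^esub> S = P \<otimes>\<^bsub>?U\<^esub> (Q \<otimes>\<^bsub>?U\<^esub> S)"
    unfolding x(2) y(2) z(2) grading_mult[OF d] grading_mult[OF c] grading_mult[OF v(1)]
      grading_mult[OF v(2)] ..
qed

end

section \<open>The universal grading group of a ribbon fusion category\<close>

context ribbon_fusion_category
begin

definition rep :: "'o set \<Rightarrow> 'o" where "rep b = (SOME x. x \<in> b)"

lemma rep_iso_class:
  assumes x: "x \<in> Obj C"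
  shows "rep (iso_class C x) \<in> Obj C" "isomorphic C x (rep (iso_class C x))"
proof -
  have "x \<in> iso_class C x" using x isomorphic_refl by (simp add: iso_class_def)
  then have "rep (iso_class C x) \<in> iso_class C x" unfolding rep_def by (rule someI)
  then show "rep (iso_class C x) \<in> Obj C" "isomorphic C x (rep (iso_class C x))"
    by (simp_all add: iso_class_def)
qed

lemma iso_class_in [simp]: "simple_object C x \<Longrightarrow> iso_class C x \<in> simple_classes C"
  by (simp add: simple_classes_def)

lemma simple_rep [simp]:
  assumes "b \<in> simple_classes C"
  shows "simple_object C (rep b)" "rep b \<in> Obj C" "iso_class C (rep b) = b"
proof -
  obtain x where x: "simple_object C x" "b = iso_class C x" using assms by (auto simp: simple_classes_def)
  then have xO: "x \<in> Obj C" by simp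
  show "simple_object C (rep b)"
    using simple_object_isomorphic[OF x(1) rep_iso_class[OF xO]] x(2) by simp
  then show "rep b \<in> Obj C" by simp
  then show "iso_class C (rep b) = b"
    using iso_class_eq_iff[OF xO, of "rep b"] rep_iso_class[OF xO] x(2) by simp
qed

definition Rs :: "'o set \<Rightarrow> 'o set \<Rightarrow> 'o set \<Rightarrow> bool" where
  "Rs a b c \<longleftrightarrow> a \<in> simple_classes C \<and> b \<in> simple_classes C \<and> c \<in> simple_classes C \<and>
     occ (rep c) (rep a \<otimes>\<^sub>o rep b)"

definition stc :: "'o set \<Rightarrow> 'o set" where "stc a = iso_class C (dual C (rep a))"

lemma occ_iso:
  assumes "isomorphic C x x'" "isomorphic C y y'" "isomorphic C z z'"
    "x \<in> Obj C" "x' \<in> Obj C" "y \<in> Obj C" "y' \<in> Obj C" "z \<in> Obj C" "z' \<in> Obj C"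
  shows "occ z (x \<otimes>\<^sub>o y) \<longleftrightarrow> occ z' (x' \<otimes>\<^sub>o y')"
  using occ_iso_left[OF assms(3), of "x \<otimes>\<^sub>o y"] occ_iso_right[OF isomorphic_tns[OF assms(1,2)], of
    z'] assms by simp

lemma Rs_iso_class:
  assumes "simple_object C x" "simple_object C y" "simple_object C z"
  shows "Rs (iso_class C x) (iso_class C y) (iso_class C z) \<longleftrightarrow> occ z (x \<otimes>\<^sub>o y)"
  using occ_iso[OF rep_iso_class(2) rep_iso_class(2) rep_iso_class(2), of x y z] rep_iso_class(1) assms
  by (simp add: Rs_def)

lemma occ_tunit:
  assumes "simple_object C x" "simple_object C z"
  shows "occ z (tunit C \<otimes>\<^sub>o x) \<longleftrightarrow> isomorphic C z x"
  using occ_iso_right[OF isomorphic_lun[of x], of z] occ_simple[OF assms(2,1)] assms by simp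

text \<open>Commutativity comes from the braiding, associativity from splitting a triple product at
  either pair of factors, and the Frobenius rule from duality.\<close>

sublocale F: fusion_support "simple_classes C" Rs "iso_class C (tunit C)" stc
proof
  show "iso_class C (tunit C) \<in> simple_classes C" using simple_tunit by simp
  show "stc a \<in> simple_classes C" if "a \<in> simple_classes C" for a
    using simple_dual that by (simp add: stc_def)
  show "a \<in> simple_classes C \<and> b \<in> simple_classes C \<and> c \<in> simple_classes C" if "Rs a b c" for a b c
    using that by (simp add: Rs_def)
  show "Rs b a c" if "Rs a b c" for a b c
    using that occ_comm[of "rep c" "rep a" "rep b"] by (simp add: Rs_def)
  show "Rs (iso_class C (tunit C)) a c \<longleftrightarrow> c = a" if a: "a \<in> simple_classes C" for a c
  proof (cases "c \<in> simple_classes C")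
    case True
    have "Rs (iso_class C (tunit C)) a c \<longleftrightarrow> occ (rep c) (tunit C \<otimes>\<^sub>o rep a)"
      using Rs_iso_class[OF simple_tunit, of "rep a" "rep c"] a True by simp
    also have "\<dots> \<longleftrightarrow> iso_class C (rep c) = iso_class C (rep a)"
      using occ_tunit[of "rep a" "rep c"] iso_class_eq_iff[of "rep c" "rep a"] a True
      by (simp del: simple_rep(3))
    finally show ?thesis using a True by simp
  qed (use a in \<open>auto simp: Rs_def\<close>)
  show "\<exists>v. Rs b c v \<and> Rs a v d" if ab: "Rs a b w" and wc: "Rs w c d" for a b w c d
  proof -
    have [simp]: "a \<in> simple_classes C" "b \<in> simple_classes C" "c \<in> simple_classes C"
      "d \<in> simple_classes C" "w \<in> simple_classes C"
      using ab wc by (auto simp: Rs_def)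
    have o: "occ (rep w) (rep a \<otimes>\<^sub>o rep b)" "occ (rep d) (rep c \<otimes>\<^sub>o rep w)"
      using ab wc occ_comm[of "rep d" "rep w" "rep c"] by (simp_all add: Rs_def)
    have "occ (rep d) (rep c \<otimes>\<^sub>o (rep a \<otimes>\<^sub>o rep b))"
      by (subst occ_tns) (use o in \<open>auto intro!: exI[of _ "rep w"]\<close>)
    then have "occ (rep d) ((rep a \<otimes>\<^sub>o rep b) \<otimes>\<^sub>o rep c)" using occ_comm by simp
    then have "occ (rep d) (rep a \<otimes>\<^sub>o (rep b \<otimes>\<^sub>o rep c))"
      using occ_iso_right[OF isomorphic_asc[of "rep a" "rep b" "rep c"], of "rep d"] by simp
    then obtain u where u: "simple_object C u" "occ u (rep b \<otimes>\<^sub>o rep c)" "occ (rep d) (rep a \<otimes>\<^sub>o u)"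
      using occ_tns[of "rep d" "rep a" "rep b \<otimes>\<^sub>o rep c"] by auto
    have "Rs b c (iso_class C u)" using Rs_iso_class[of "rep b" "rep c" u] u by simp
    moreover have "Rs a (iso_class C u) d" using Rs_iso_class[of "rep a" u "rep d"] u by simp
    ultimately show ?thesis by blast
  qed
  show "Rs (stc x) a b" if "Rs x b a" for x a b
  proof -
    have x: "x \<in> simple_classes C" "a \<in> simple_classes C" "b \<in> simple_classes C"
      and o: "occ (rep a) (rep x \<otimes>\<^sub>o rep b)"
      using that by (auto simp: Rs_def)
    have "occ (rep b) (dual C (rep x) \<otimes>\<^sub>o rep a)"
      using occ_frobenius[of "rep x" "rep a" "rep b"] o x by simp
    then show ?thesis
      using Rs_iso_class[OF simple_dual[of "rep x"], of "rep a" "rep b"] x by (simp add: stc_def)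
  qed
qed

text \<open>Frobenius reciprocity moves \<open>a\<close> to the other side, where the product of
  \<open>stc a\<close> with the unit leaves only one possibility.\<close>

lemma stc_unique: "Rs a b (iso_class C (tunit C)) \<Longrightarrow> b = stc a"
  using F.R_unit[of "stc a" b] F.R_comm[OF F.R_frob] F.R_in by blast

text \<open>Duals are chosen object by object. Characterising the class of the dual by
  \<open>stc_unique\<close> spares transporting duals along isomorphisms.\<close>

lemma stc_iso_class:
  assumes x: "simple_object C x"
  shows "stc (iso_class C x) = iso_class C (dual C x)"
proof -
  have xO [simp]: "x \<in> Obj C" using x by simp
  have d: "simple_object C (dual C x)" by (rule simple_dual[OF x])
  have "isomorphic C (dual C x \<otimes>\<^sub>o tunit C) (dual C x)"
    using run_iso[OF dual_typed(1)[OF xO]] by (auto simp: isomorphic_def)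
  then have "occ (dual C x) (dual C x \<otimes>\<^sub>o tunit C)"
    using occ_iso_right[of "dual C x \<otimes>\<^sub>o tunit C" "dual C x"
      "dual C x"] occ_simple[OF d d] isomorphic_refl by simp
  then have "occ (tunit C) (x \<otimes>\<^sub>o dual C x)" using occ_frobenius[OF xO simple_tunit d] by simp
  then have "Rs (iso_class C x) (iso_class C (dual C x)) (iso_class C (tunit C))"
    using Rs_iso_class[OF x d simple_tunit] by simp
  then show ?thesis using stc_unique by simp
qed

section \<open>Coordinates in the Grothendieck ring\<close>

definition unit_vec :: "'o set \<Rightarrow> 'o set \<Rightarrow> int" where "unit_vec b = (\<lambda>d. if d = b then 1 else 0)"

lemma is_direct_sum_single: "x \<in> Obj C \<Longrightarrow> is_direct_sum C x [x]"
  unfolding is_direct_sum_def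
  by (auto intro!: exI[of _ "\<lambda>_. idm C x"] simp: cmp_idm_left)

lemma K0_class_simple:
  assumes x: "simple_object C x"
  shows "K0_class C x = unit_vec (iso_class C x)"
proof
  fix b
  show "K0_class C x b = unit_vec (iso_class C x) b"
  proof (cases "b \<in> simple_classes C")
    case True
    have "multiplicity_in C x b = length (filter (isomorphic C (rep b)) [x])"
      using multiplicity_in_biproduct[of "rep b" "[x]" x] True x is_direct_sum_single by simp
    moreover have "isomorphic C (rep b) x \<longleftrightarrow> b = iso_class C x"
      using iso_class_eq_iff[of "rep b" x] x True by simp
    ultimately show ?thesis using True by (simp add: K0_class_def unit_vec_def)
  next
    case False
    then show ?thesis using x by (auto simp: K0_class_def unit_vec_def)
  qed
qed

definition Nc :: "'o set \<Rightarrow> 'o set \<Rightarrow> 'o set \<Rightarrow> int" where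
  "Nc b c = K0_class C (rep b \<otimes>\<^sub>o rep c)"

lemma Nc_nonzero:
  assumes "b \<in> simple_classes C" "c \<in> simple_classes C"
  shows "Nc b c d \<noteq> 0 \<longleftrightarrow> Rs b c d"
  using multiplicity_in_nonzero_iff[of "rep d" "rep b \<otimes>\<^sub>o rep c"] assms
  by (auto simp: Nc_def K0_class_def Rs_def)

lemma K0_simps:
  "carrier (K0 C) = {f. \<forall>b. f b \<noteq> 0 \<longrightarrow> b \<in> simple_classes C}"
  "f \<otimes>\<^bsub>K0 C\<^esub> g = (\<lambda>d. \<Sum>b \<in> simple_classes C. \<Sum>c \<in> simple_classes C. f b * g c * Nc b c d)"
  "\<one>\<^bsub>K0 C\<^esub> = unit_vec (iso_class C (tunit C))"
  "\<zero>\<^bsub>K0 C\<^esub> = (\<lambda>_. 0)" "f \<oplus>\<^bsub>K0 C\<^esub> g = (\<lambda>b. f b + g b)"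
  using K0_class_simple[OF simple_tunit] by (simp_all add: K0_def Nc_def rep_def)

lemma basis_span_iff:
  assumes "T \<subseteq> simple_classes C"
  shows "f \<in> basis_span C T \<longleftrightarrow> (\<forall>b. f b \<noteq> 0 \<longrightarrow> b \<in> T)"
  using assms by (auto simp: basis_span_def K0_simps)

lemma unit_vec_span: "T \<subseteq> simple_classes C \<Longrightarrow> unit_vec b \<in> basis_span C T \<longleftrightarrow> b \<in> T"
  by (auto simp: basis_span_iff unit_vec_def)

text \<open>With its converse \<open>unit_vec_mult_span\<close> this translates closure under
  multiplication in \<open>K0 C\<close> into closure under \<open>Rs\<close>.\<close>

lemma mult_span:
  assumes T: "T \<subseteq> simple_classes C" and S: "S \<subseteq> simple_classes C" and P: "P \<subseteq> simple_classes C"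
    and R: "\<And>a b c. \<lbrakk>a \<in> T; b \<in> S; Rs a b c\<rbrakk> \<Longrightarrow> c \<in> P"
    and f: "f \<in> basis_span C T" and g: "g \<in> basis_span C S"
  shows "f \<otimes>\<^bsub>K0 C\<^esub> g \<in> basis_span C P"
proof -
  have "d \<in> P" if d: "(f \<otimes>\<^bsub>K0 C\<^esub> g) d \<noteq> 0" for d
  proof -
    have "\<exists>b \<in> simple_classes C. \<exists>c \<in> simple_classes C. f b * g c * Nc b c d \<noteq> 0"
    proof (rule ccontr)
      assume "\<not> ?thesis"
      then have "(f \<otimes>\<^bsub>K0 C\<^esub> g) d = 0" unfolding K0_simps by (intro sum.neutral ballI) auto
      then show False using d by simp
    qed
    then obtain b c where bc: "b \<in> simple_classes C" "c \<in> simple_classes C" "f b \<noteq> 0" "g c \<noteq> 0" "Nc b c d \<noteq> 0"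
      by auto
    have "b \<in> T" "c \<in> S" using f g bc basis_span_iff[OF T] basis_span_iff[OF S] by auto
    then show ?thesis using R Nc_nonzero[OF bc(1,2)] bc(5) by blast
  qed
  then show ?thesis by (simp add: basis_span_iff[OF P])
qed

lemma unit_vec_mult:
  assumes a: "a \<in> simple_classes C" and b: "b \<in> simple_classes C"
  shows "unit_vec a \<otimes>\<^bsub>K0 C\<^esub> unit_vec b = Nc a b"
proof
  fix d
  have "(unit_vec a \<otimes>\<^bsub>K0 C\<^esub> unit_vec b) d
      = (\<Sum>x \<in> simple_classes C. if x = a then (\<Sum>c \<in> simple_classes C. if c = b then Nc a b d else 0) else 0)"
    unfolding K0_simps by (intro sum.cong refl) (auto simp: unit_vec_def intro!: sum.cong)
  also have "\<dots> = Nc a b d" using a b finite_simple_classes by (simp add: sum.delta)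
  finally show "(unit_vec a \<otimes>\<^bsub>K0 C\<^esub> unit_vec b) d = Nc a b d" .
qed

lemma unit_vec_mult_span:
  assumes "P \<subseteq> simple_classes C" "a \<in> simple_classes C" "b \<in> simple_classes C"
    "unit_vec a \<otimes>\<^bsub>K0 C\<^esub> unit_vec b \<in> basis_span C P" "Rs a b c"
  shows "c \<in> P"
  using assms unit_vec_mult[of a b] basis_span_iff[of P] Nc_nonzero[of a b c] by simp

text \<open>On spans of subsets of the basis this is the inverse of
  \<open>basis_span C\<close>.\<close>

definition supp :: "('o set \<Rightarrow> int) set \<Rightarrow> 'o set set" where "supp M = {b. unit_vec b \<in> M}"

lemma supp_span: "T \<subseteq> simple_classes C \<Longrightarrow> supp (basis_span C T) = T"
  by (simp add: supp_def unit_vec_span)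

lemma basis_span_inj: "T \<subseteq> simple_classes C \<Longrightarrow> S \<subseteq> simple_classes C \<Longrightarrow> basis_span C T = basis_span C S \<longleftrightarrow> T = S"
  using supp_span by metis

lemma basis_span_zero: "T \<subseteq> simple_classes C \<Longrightarrow> basis_span C T = {\<zero>\<^bsub>K0 C\<^esub>} \<longleftrightarrow> T = {}"
proof -
  have "basis_span C {} = {\<zero>\<^bsub>K0 C\<^esub>}" by (auto simp: basis_span_iff K0_simps)
  then show "T \<subseteq> simple_classes C \<Longrightarrow> ?thesis" using basis_span_inj[of T "{}"] by simp
qed

lemma zero_in_span: "\<zero>\<^bsub>K0 C\<^esub> \<in> basis_span C T"
  by (simp add: basis_span_def K0_simps)

lemma subring_span:
  assumes T: "F.adj_closed T"
  shows "subring (basis_span C T) (K0 C)"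
proof -
  note D = F.adj_closedD[OF T]
  note iff = basis_span_iff[OF D(1)]
  \<comment> \<open>\<open>K0 C\<close> has not been shown to be a ring, so the additive inverse is
    evaluated from its definite description.\<close>
  have inv: "inv\<^bsub>add_monoid (K0 C)\<^esub> f = (\<lambda>b. - f b)" if f: "f \<in> basis_span C T" for f
    unfolding m_inv_def
  proof (rule the_equality)
    show "(\<lambda>b. - f b) \<in> carrier (add_monoid (K0 C)) \<and>
      f \<otimes>\<^bsub>add_monoid (K0 C)\<^esub> (\<lambda>b. - f b) = \<one>\<^bsub>add_monoid (K0 C)\<^esub> \<and>
      (\<lambda>b. - f b) \<otimes>\<^bsub>add_monoid (K0 C)\<^esub> f = \<one>\<^bsub>add_monoid (K0 C)\<^esub>"
      using f by (simp add: K0_simps basis_span_def)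
    fix g assume "g \<in> carrier (add_monoid (K0 C)) \<and> f \<otimes>\<^bsub>add_monoid (K0 C)\<^esub> g = \<one>\<^bsub>add_monoid (K0 C)\<^esub> \<and>
      g \<otimes>\<^bsub>add_monoid (K0 C)\<^esub> f = \<one>\<^bsub>add_monoid (K0 C)\<^esub>"
    then have "(\<lambda>b. f b + g b) = (\<lambda>b. 0)" by (simp add: K0_simps)
    then have "f b + g b = 0" for b by metis
    then have "g b = - f b" for b by (metis add.commute add_eq_0_iff)
    then show "g = (\<lambda>b. - f b)" by auto
  qed
  have "subgroup (basis_span C T) (add_monoid (K0 C))"
  proof
    show "basis_span C T \<subseteq> carrier (add_monoid (K0 C))" by (auto simp: basis_span_def)
    show "x \<otimes>\<^bsub>add_monoid (K0 C)\<^esub> y \<in> basis_span C T" if "x \<in> basis_span C T" "y \<in> basis_span C T" for x y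
      using that unfolding iff by (auto simp: K0_simps) (metis add_0)
    show "\<one>\<^bsub>add_monoid (K0 C)\<^esub> \<in> basis_span C T" using zero_in_span by simp
    show "inv\<^bsub>add_monoid (K0 C)\<^esub> x \<in> basis_span C T" if "x \<in> basis_span C T" for x
      using that inv[OF that] unfolding iff by simp
  qed
  moreover have "submonoid (basis_span C T) (K0 C)"
  proof
    show "basis_span C T \<subseteq> carrier (K0 C)" by (auto simp: basis_span_def)
    show "x \<otimes>\<^bsub>K0 C\<^esub> y \<in> basis_span C T" if "x \<in> basis_span C T" "y \<in> basis_span C T" for x y
      by (rule mult_span[OF D(1) D(1) D(1) D(3) that])
    show "\<one>\<^bsub>K0 C\<^esub> \<in> basis_span C T" using unit_vec_span[OF D(1)] D(2) by (simp add: K0_simps)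
  qed
  ultimately show ?thesis by (simp add: subring_def)
qed

lemma adjoint_condition:
  assumes T: "T \<subseteq> simple_classes C"
  shows "subring (basis_span C T) (K0 C) \<and>
     (\<forall>x. simple_object C x \<and> K0_class C x \<in> basis_span C T \<longrightarrow> K0_class C (dual C x) \<in> basis_span C T) \<and>
     (\<forall>x. simple_object C x \<longrightarrow> K0_class C x \<otimes>\<^bsub>K0 C\<^esub> K0_class C (dual C x) \<in> basis_span C T)
    \<longleftrightarrow> F.adj_closed T" (is "?A \<and> ?B \<and> ?D \<longleftrightarrow> _")
proof
  assume *: "?A \<and> ?B \<and> ?D"
  then have sub: "submonoid (basis_span C T) (K0 C)" by (simp add: subring_def)
  show "F.adj_closed T"
    unfolding F.adj_closed_def
  proof (intro conjI ballI allI impI)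
    show "iso_class C (tunit C) \<in> T"
      using submonoid.one_closed[OF sub] unit_vec_span[OF T] by (simp add: K0_simps)
    show "c \<in> T" if "a \<in> T" "b \<in> T" "Rs a b c" for a b c
      by (rule unit_vec_mult_span[OF T _ _ submonoid.m_closed[OF sub] that(3)])
        (use that(1,2) T unit_vec_span[OF T] in auto)
    show "stc a \<in> T" if a: "a \<in> T" for a
    proof -
      have a': "a \<in> simple_classes C" using a T by blast
      have "K0_class C (rep a) \<in> basis_span C T"
        using K0_class_simple[of "rep a"] a' a unit_vec_span[OF T] by simp
      then have "K0_class C (dual C (rep a)) \<in> basis_span C T" using * a' by simp
      then show ?thesis
        using K0_class_simple[OF simple_dual[of "rep a"]] a' unit_vec_span[OF T] by (simp add: stc_def)
    qed
    show "c \<in> T" if a: "a \<in> simple_classes C" and c: "Rs a (stc a) c" for a c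
    proof (rule unit_vec_mult_span[OF T a _ _ c])
      show "stc a \<in> simple_classes C" using a by simp
      have "K0_class C (rep a) \<otimes>\<^bsub>K0 C\<^esub> K0_class C (dual C (rep a)) \<in> basis_span C T" using * a by simp
      then show "unit_vec a \<otimes>\<^bsub>K0 C\<^esub> unit_vec (stc a) \<in> basis_span C T"
        using K0_class_simple[of "rep a"] K0_class_simple[OF simple_dual[of "rep a"]] a by (simp add: stc_def)
    qed
  qed (fact T)
next
  assume a: "F.adj_closed T"
  note D = F.adj_closedD[OF a]
  show "?A \<and> ?B \<and> ?D"
  proof (intro conjI allI impI)
    show ?A by (rule subring_span[OF a])
    fix x
    show "K0_class C (dual C x) \<in> basis_span C T" if "simple_object C x \<and> K0_class C x \<in> basis_span C T"
      using that D(4)[of "iso_class C x"] K0_class_simple[of x] K0_class_simple[OF simple_dual[of x]]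
        unit_vec_span[OF T] by (simp add: stc_iso_class)
    assume x: "simple_object C x"
    have "Nc (iso_class C x) (stc (iso_class C x)) \<in> basis_span C T"
      using D(5)[of "iso_class C x"] Nc_nonzero[of "iso_class C x" "stc (iso_class C x)"] x
      unfolding basis_span_iff[OF T] by simp
    then show "K0_class C x \<otimes>\<^bsub>K0 C\<^esub> K0_class C (dual C x) \<in> basis_span C T"
      using K0_class_simple[OF x] K0_class_simple[OF simple_dual[OF x]] x
        unit_vec_mult[of "iso_class C x" "stc (iso_class C x)"] by (simp add: stc_iso_class simple_dual)
  qed
qed

lemma Tad_subset: "F.Tad \<subseteq> simple_classes C"
  using F.TadD(1) by blast

text \<open>Membership in a span is a condition on the support, so an intersection of spans is the
  span of the intersection.\<close>

lemma adjoint_subring_eq: "adjoint_subring C = basis_span C F.Tad"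
proof -
  have "{M. (\<exists>T \<subseteq> simple_classes C. M = basis_span C T) \<and> subring M (K0 C) \<and>
     (\<forall>x. simple_object C x \<and> K0_class C x \<in> M \<longrightarrow> K0_class C (dual C x) \<in> M) \<and>
     (\<forall>x. simple_object C x \<longrightarrow> K0_class C x \<otimes>\<^bsub>K0 C\<^esub> K0_class C (dual C x) \<in> M)}
    = basis_span C ` Collect F.adj_closed" (is "?L = ?R")
  proof (intro subset_antisym subsetI)
    fix M assume "M \<in> ?L"
    then obtain T where "T \<subseteq> simple_classes C" "M = basis_span C T" "F.adj_closed T"
      using adjoint_condition by auto
    then show "M \<in> ?R" by blast
  next
    fix M assume "M \<in> ?R"
    then obtain T where T: "M = basis_span C T" "F.adj_closed T" by blast
    then show "M \<in> ?L" using adjoint_condition[OF F.adj_closedD(1)[OF T(2)]] F.adj_closedD(1)[OF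
      T(2)] by blast
  qed
  then have eq: "adjoint_subring C = (\<Inter>T \<in> Collect F.adj_closed. basis_span C T)"
    by (simp add: adjoint_subring_def)
  have iff: "f \<in> basis_span C T \<longleftrightarrow> (\<forall>b. f b \<noteq> 0 \<longrightarrow> b \<in> T)" if "F.adj_closed T" for f T
    using basis_span_iff[OF F.adj_closedD(1)[OF that]] .
  show ?thesis
  proof (intro subset_antisym subsetI)
    fix f assume "f \<in> adjoint_subring C"
    then have "\<forall>T. F.adj_closed T \<longrightarrow> (\<forall>b. f b \<noteq> 0 \<longrightarrow> b \<in> T)" using eq iff by auto
    then show "f \<in> basis_span C F.Tad" unfolding basis_span_iff[OF Tad_subset] F.Tad_iff by blast
  next
    fix f assume "f \<in> basis_span C F.Tad"
    then have "\<forall>b. f b \<noteq> 0 \<longrightarrow> b \<in> F.Tad" unfolding basis_span_iff[OF Tad_subset] .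
    then show "f \<in> adjoint_subring C" unfolding eq F.Tad_iff using iff by blast
  qed
qed

text \<open>Testing stability on unit vectors suffices for one direction; for the other,
  commutativity of \<open>Rs\<close> converts between left and right multiplication.\<close>

lemma based_subbimodule_iff: "based_subbimodule C M \<longleftrightarrow> (\<exists>T. F.stable T \<and> M = basis_span C T)"
proof
  assume M: "based_subbimodule C M"
  then obtain T where T: "T \<subseteq> simple_classes C" "M = basis_span C T"
    and mult: "\<And>r m. r \<in> adjoint_subring C \<Longrightarrow> m \<in> M \<Longrightarrow> r \<otimes>\<^bsub>K0 C\<^esub> m \<in> M"
    by (auto simp: based_subbimodule_def)
  have "F.stable T"
  proof (rule F.stableI[OF T(1)])
    fix a b c assume h: "a \<in> F.Tad" "b \<in> T" "Rs a b c"
    have a: "unit_vec a \<in> adjoint_subring C" using h(1) unit_vec_span[OF Tad_subset]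
      by (simp add: adjoint_subring_eq)
    have b: "unit_vec b \<in> M" using h(2) unit_vec_span[OF T(1)] T(2) by simp
    show "c \<in> T"
      by (rule unit_vec_mult_span[OF T(1) _ _ mult[OF a b, unfolded T(2)] h(3)]) (use F.R_in[OF h(3)] in auto)
  qed
  then show "\<exists>T. F.stable T \<and> M = basis_span C T" using T(2) by blast
next
  assume "\<exists>T. F.stable T \<and> M = basis_span C T"
  then obtain T where T: "F.stable T" "M = basis_span C T" by blast
  note sub = F.stableD(1)[OF T(1)]
  have l: "r \<otimes>\<^bsub>K0 C\<^esub> m \<in> M" if "r \<in> adjoint_subring C" "m \<in> M" for r m
    using mult_span[OF Tad_subset sub sub F.stableD(2)[OF T(1)]] that by (simp add: adjoint_subring_eq T(2))
  have r: "m \<otimes>\<^bsub>K0 C\<^esub> r \<in> M" if "r \<in> adjoint_subring C" "m \<in> M" for r m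
    using mult_span[OF sub Tad_subset sub F.stableD(2)[OF T(1) _ _ F.R_comm]] that
    by (simp add: adjoint_subring_eq T(2))
  show "based_subbimodule C M" unfolding based_subbimodule_def using sub T(2) l r by blast
qed

section \<open>Decomposition into indecomposable components\<close>

lemma orbs_subset: "P \<in> F.orbs \<Longrightarrow> P \<subseteq> simple_classes C"
  using F.orb_in by (auto simp: F.orbs_def)

lemma orbs_stable: "P \<in> F.orbs \<Longrightarrow> F.stable P"
  using F.stable_orb by (auto simp: F.orbs_def)

lemma orbs_nonempty: "P \<in> F.orbs \<Longrightarrow> P \<noteq> {}"
  using F.orb_refl by (auto simp: F.orbs_def)

lemma orbs_eq_orb: "\<lbrakk>P \<in> F.orbs; x \<in> P\<rbrakk> \<Longrightarrow> P = F.orb x"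
  using F.orb_eq[of x] by (auto simp: F.orbs_def)

lemma orbs_disjoint: "\<lbrakk>P \<in> F.orbs; Q \<in> F.orbs; x \<in> P; x \<in> Q\<rbrakk> \<Longrightarrow> P = Q"
  using orbs_eq_orb[of P x] orbs_eq_orb[of Q x] by simp

text \<open>A stable set contains the orbit of each of its elements, and the complement of the orbit
  is again stable; restricting functions to the two parts splits the span, so indecomposability
  leaves only the orbit. Conversely, two non-zero summands of the span of an orbit would be spans of
  stable subsets of it, hence both equal to the whole, and could not meet in zero.\<close>

lemma indecomposable_iff: "indecomposable_subbimodule C M \<longleftrightarrow> M \<in> basis_span C ` F.orbs"
proof
  assume M: "indecomposable_subbimodule C M"
  then obtain T where T: "F.stable T" "M = basis_span C T" and ne: "M \<noteq> {\<zero>\<^bsub>K0 C\<^esub>}"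
    and ind: "\<And>M1 M2. \<lbrakk>based_subbimodule C M1; based_subbimodule C M2; M1 \<noteq> {\<zero>\<^bsub>K0 C\<^esub>}; M2 \<noteq> {\<zero>\<^bsub>K0 C\<^esub>};
      M1 \<inter> M2 = {\<zero>\<^bsub>K0 C\<^esub>}; M = M1 <+>\<^bsub>K0 C\<^esub> M2\<rbrakk> \<Longrightarrow> False"
    unfolding indecomposable_subbimodule_def based_subbimodule_iff by metis
  note sub = F.stableD(1)[OF T(1)]
  obtain x where x: "x \<in> T" using ne basis_span_zero[OF sub] T(2) by auto
  have O: "F.orb x \<subseteq> T" "x \<in> F.orb x" using F.orb_subset[OF T(1) x] F.orb_refl x sub by auto
  let ?A = "F.orb x" and ?B = "T - F.orb x"
  have A: "?A \<subseteq> simple_classes C" and B: "?B \<subseteq> simple_classes C" using O sub by auto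
  have "?B = {}"
  proof (rule ccontr)
    assume B0: "?B \<noteq> {}"
    have split: "basis_span C T = basis_span C ?A <+>\<^bsub>K0 C\<^esub> basis_span C ?B"
    proof (intro subset_antisym subsetI)
      fix f assume f: "f \<in> basis_span C T"
      let ?g = "\<lambda>b. if b \<in> ?A then f b else 0" and ?h = "\<lambda>b. if b \<in> ?A then 0 else f b"
      have "?g \<in> basis_span C ?A" "?h \<in> basis_span C ?B"
        using f unfolding basis_span_iff[OF A] basis_span_iff[OF B] basis_span_iff[OF sub] by auto
      moreover have "f = ?g \<oplus>\<^bsub>K0 C\<^esub> ?h" by (auto simp: K0_simps)
      ultimately show "f \<in> basis_span C ?A <+>\<^bsub>K0 C\<^esub> basis_span C ?B" unfolding set_add_def' by blast
    next
      fix f assume "f \<in> basis_span C ?A <+>\<^bsub>K0 C\<^esub> basis_span C ?B"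
      then obtain g h where gh: "g \<in> basis_span C ?A" "h \<in> basis_span C ?B" "f = g \<oplus>\<^bsub>K0 C\<^esub> h"
        unfolding set_add_def' by blast
      have "b \<in> T" if "f b \<noteq> 0" for b
      proof -
        have "g b \<noteq> 0 \<or> h b \<noteq> 0" using that gh(3) by (auto simp: K0_simps)
        then show ?thesis using gh(1,2) O(1) unfolding basis_span_iff[OF A] basis_span_iff[OF B] by blast
      qed
      then show "f \<in> basis_span C T" unfolding basis_span_iff[OF sub] by blast
    qed
    show False
    proof (rule ind)
      show "based_subbimodule C (basis_span C ?A)" "based_subbimodule C (basis_span C ?B)"
        using F.stable_orb F.stable_diff[OF T(1) F.stable_orb] by (auto simp: based_subbimodule_iff)
      show "basis_span C ?A \<noteq> {\<zero>\<^bsub>K0 C\<^esub>}" "basis_span C ?B \<noteq> {\<zero>\<^bsub>K0 C\<^esub>}"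
        using basis_span_zero[OF A] basis_span_zero[OF B] O(2) B0 by auto
      show "basis_span C ?A \<inter> basis_span C ?B = {\<zero>\<^bsub>K0 C\<^esub>}"
      proof (intro subset_antisym subsetI)
        fix f assume f: "f \<in> basis_span C ?A \<inter> basis_span C ?B"
        have "f b = 0" for b using f unfolding Int_iff basis_span_iff[OF A] basis_span_iff[OF B] by blast
        then show "f \<in> {\<zero>\<^bsub>K0 C\<^esub>}" by (auto simp: K0_simps)
      qed (use zero_in_span in auto)
      show "M = basis_span C ?A <+>\<^bsub>K0 C\<^esub> basis_span C ?B" using split T(2) by simp
    qed
  qed
  then have "T = F.orb x" using O(1) by blast
  then show "M \<in> basis_span C ` F.orbs" using T(2) x sub by (auto simp: F.orbs_def)
next
  assume "M \<in> basis_span C ` F.orbs"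
  then obtain P where P: "P \<in> F.orbs" "M = basis_span C P" by blast
  have "based_subbimodule C M" using orbs_stable[OF P(1)] P(2) by (auto simp: based_subbimodule_iff)
  moreover have "M \<noteq> {\<zero>\<^bsub>K0 C\<^esub>}"
    using basis_span_zero[OF orbs_subset[OF P(1)]] orbs_nonempty[OF P(1)] P(2) by simp
  moreover have False if h: "based_subbimodule C M1" "based_subbimodule C M2" "M1 \<noteq> {\<zero>\<^bsub>K0 C\<^esub>}" "M2 \<noteq> {\<zero>\<^bsub>K0 C\<^esub>}"
    "M1 \<inter> M2 = {\<zero>\<^bsub>K0 C\<^esub>}" "M = M1 <+>\<^bsub>K0 C\<^esub> M2" for M1 M2
  proof -
    obtain S T where S: "F.stable S" "M1 = basis_span C S" and T: "F.stable T" "M2 = basis_span C T"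
      using h(1,2) by (auto simp: based_subbimodule_iff)
    note sS = F.stableD(1)[OF S(1)] and sT = F.stableD(1)[OF T(1)]
    have S0: "S \<noteq> {}" and T0: "T \<noteq> {}" using h(3,4) basis_span_zero[OF sS] basis_span_zero[OF sT]
      S(2) T(2) by auto
    have "S \<subseteq> P"
    proof
      fix b assume "b \<in> S"
      then have "unit_vec b \<oplus>\<^bsub>K0 C\<^esub> \<zero>\<^bsub>K0 C\<^esub> \<in> M"
        unfolding h(6) set_add_def' S(2) T(2) using unit_vec_span[OF sS] zero_in_span by blast
      then show "b \<in> P" using unit_vec_span[OF orbs_subset[OF P(1)]] by (simp add: P(2) K0_simps)
    qed
    moreover have "T \<subseteq> P"
    proof
      fix b assume "b \<in> T"
      then have "\<zero>\<^bsub>K0 C\<^esub> \<oplus>\<^bsub>K0 C\<^esub> unit_vec b \<in> M"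
        unfolding h(6) set_add_def' S(2) T(2) using unit_vec_span[OF sT] zero_in_span by blast
      then show "b \<in> P" using unit_vec_span[OF orbs_subset[OF P(1)]] by (simp add: P(2) K0_simps)
    qed
    ultimately have "S = P" "T = P"
      using F.orbs_stable_min[OF P(1) S(1) _ S0] F.orbs_stable_min[OF P(1) T(1) _ T0] by auto
    then have "basis_span C P = {\<zero>\<^bsub>K0 C\<^esub>}" using h(5) S(2) T(2) by simp
    then show False using \<open>M \<noteq> {\<zero>\<^bsub>K0 C\<^esub>}\<close> P(2) by simp
  qed
  ultimately show "indecomposable_subbimodule C M" unfolding indecomposable_subbimodule_def by metis
qed

lemma abelian_monoid_K0: "abelian_monoid (K0 C)"
  by (rule abelian_monoidI) (auto simp: K0_simps algebra_simps, metis add_0)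

lemma finsum_K0:
  assumes "finite A" "\<And>M. M \<in> A \<Longrightarrow> m M \<in> carrier (K0 C)"
  shows "(\<Oplus>\<^bsub>K0 C\<^esub>M \<in> A. m M) b = (\<Sum>M \<in> A. m M b)"
proof -
  interpret K: abelian_monoid "K0 C" by (rule abelian_monoid_K0)
  show ?thesis using assms
  proof (induction A rule: finite_induct)
    case (insert M A)
    then have "(\<Oplus>\<^bsub>K0 C\<^esub>M \<in> insert M A. m M) = m M \<oplus>\<^bsub>K0 C\<^esub> (\<Oplus>\<^bsub>K0 C\<^esub>M \<in> A. m M)"
      by (intro K.finsum_insert) auto
    moreover have "(\<Oplus>\<^bsub>K0 C\<^esub>M \<in> A. m M) b = (\<Sum>M \<in> A. m M b)"
      by (rule insert.IH) (rule insert.prems, simp)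
    ultimately show ?case using insert.hyps by (simp add: K0_simps)
  qed (simp add: K0_simps)
qed

lemma finite_orbs: "finite F.orbs"
  using finite_simple_classes by (simp add: F.orbs_def)

text \<open>The orbits partition the basis, so the components of \<open>f\<close> are its
  restrictions to the orbits.\<close>

lemma orbs_decomposition: "bimodule_decomposition C (basis_span C ` F.orbs)"
  unfolding bimodule_decomposition_def
proof (intro conjI ballI)
  let ?A = "basis_span C ` F.orbs"
  show fin: "finite ?A" using finite_orbs by simp
  show "indecomposable_subbimodule C M" if "M \<in> ?A" for M using that indecomposable_iff by blast
  fix f assume f: "f \<in> carrier (K0 C)"
  have supp: "supp M \<in> F.orbs" "M = basis_span C (supp M)" if "M \<in> ?A" for M
    using that supp_span[OF orbs_subset] by auto
  have car: "m \<in> carrier (K0 C)" if "m \<in> M" "M \<in> ?A" for m M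
    using that by (auto simp: basis_span_def)
  have vanish: "m b = 0" if "M \<in> ?A" "m \<in> M" "b \<notin> supp M" for m M b
    using that basis_span_iff[OF orbs_subset[OF supp(1)[OF that(1)]], of m] supp(2)[OF that(1)] by blast
  \<comment> \<open>Orbits are disjoint: only the component whose support contains \<open>b\<close>
    contributes at \<open>b\<close>.\<close>
  have eval: "(\<Oplus>\<^bsub>K0 C\<^esub>M \<in> ?A. m M) b = m M b"
    if m: "m \<in> (\<Pi>\<^sub>E M \<in> ?A. M)" and M: "M \<in> ?A" "b \<in> supp M" for m M b
  proof -
    have mM: "m N \<in> N" if "N \<in> ?A" for N using m that by (auto simp: PiE_iff)
    have "(\<Oplus>\<^bsub>K0 C\<^esub>M \<in> ?A. m M) b = (\<Sum>N \<in> ?A. m N b)"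
      by (rule finsum_K0[OF fin car[OF mM]])
    also have "\<dots> = (\<Sum>N \<in> {M}. m N b)"
    proof (rule sum.mono_neutral_right[OF fin])
      show "{M} \<subseteq> ?A" using M by simp
      show "\<forall>N \<in> ?A - {M}. m N b = 0"
      proof
        fix N assume N: "N \<in> ?A - {M}"
        have "b \<notin> supp N"
          using orbs_disjoint[OF supp(1) supp(1), of N M b] supp(2)[of N] supp(2)[of M] N M by auto
        then show "m N b = 0" using vanish[OF _ mM] N by blast
      qed
    qed
    finally show ?thesis by simp
  qed
  have cover: "\<exists>M \<in> ?A. b \<in> supp M" if "b \<in> simple_classes C" for b
  proof
    show "basis_span C (F.orb b) \<in> ?A" using that by (auto simp: F.orbs_def)
    show "b \<in> supp (basis_span C (F.orb b))"
      using that F.orb_refl supp_span[OF orbs_subset, of "F.orb b"] by (auto simp: F.orbs_def)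
  qed
  define m0 where "m0 = (\<lambda>M \<in> ?A. \<lambda>b. if b \<in> supp M then f b else 0)"
  have m0: "m0 \<in> (\<Pi>\<^sub>E M \<in> ?A. M)"
  proof (rule PiE_I)
    fix M assume M: "M \<in> ?A"
    have "m0 M \<in> basis_span C (supp M)"
      using M unfolding basis_span_iff[OF orbs_subset[OF supp(1)[OF M]]] by (simp add: m0_def)
    then show "m0 M \<in> M" using supp(2)[OF M] by simp
  qed (auto simp: m0_def)
  show "\<exists>!m. m \<in> (\<Pi>\<^sub>E M \<in> ?A. M) \<and> f = (\<Oplus>\<^bsub>K0 C\<^esub>M \<in> ?A. m M)"
  proof (rule ex1I[of _ m0])
    have "f b = (\<Oplus>\<^bsub>K0 C\<^esub>M \<in> ?A. m0 M) b" for b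
    proof (cases "b \<in> simple_classes C")
      case True
      then obtain M where M: "M \<in> ?A" "b \<in> supp M" using cover by blast
      then show ?thesis using eval[OF m0 M] by (simp add: m0_def)
    next
      case False
      have "(\<Oplus>\<^bsub>K0 C\<^esub>M \<in> ?A. m0 M) b = (\<Sum>N \<in> ?A. m0 N b)"
        by (rule finsum_K0[OF fin car]) (use m0 in \<open>auto simp: PiE_iff\<close>)
      also have "\<dots> = 0"
      proof (rule sum.neutral, rule ballI)
        fix N assume N: "N \<in> ?A"
        have "b \<notin> supp N" using False orbs_subset[OF supp(1)[OF N]] by blast
        then show "m0 N b = 0" using N by (simp add: m0_def)
      qed
      finally show ?thesis using False f by (auto simp: K0_simps)
    qed
    then show "m0 \<in> (\<Pi>\<^sub>E M \<in> ?A. M) \<and> f = (\<Oplus>\<^bsub>K0 C\<^esub>M \<in> ?A. m0 M)" using m0 by auto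
  next
    fix m assume m: "m \<in> (\<Pi>\<^sub>E M \<in> ?A. M) \<and> f = (\<Oplus>\<^bsub>K0 C\<^esub>M \<in> ?A. m M)"
    show "m = m0"
    proof (rule PiE_ext[OF conjunct1[OF m] m0])
      fix M assume M: "M \<in> ?A"
      show "m M = m0 M"
      proof
        fix b
        show "m M b = m0 M b"
        proof (cases "b \<in> supp M")
          case True
          then show ?thesis using eval[OF conjunct1[OF m] M True] conjunct2[OF m] M by (simp add: m0_def)
        next
          case False
          have "m M \<in> M" using m M by (auto simp: PiE_iff)
          then show ?thesis using vanish[OF M _ False] False M by (simp add: m0_def)
        qed
      qed
    qed
  qed
qed

text \<open>The uniqueness behind the definite description: the members of any decomposition are
  spans of orbits by \<open>indecomposable_iff\<close>, and no orbit can be missing, since its unit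
  vectors have to be represented.\<close>

lemma bimodule_components_eq: "bimodule_components C = basis_span C ` F.orbs"
  unfolding bimodule_components_def
proof (rule the_equality[of _ "basis_span C ` F.orbs"])
  show "bimodule_decomposition C (basis_span C ` F.orbs)" by (rule orbs_decomposition)
  fix A assume A: "bimodule_decomposition C A"
  then have fin: "finite A" and ind: "\<And>M. M \<in> A \<Longrightarrow> M \<in> basis_span C ` F.orbs"
    using indecomposable_iff by (auto simp: bimodule_decomposition_def)
  show "A = basis_span C ` F.orbs"
  proof (intro subset_antisym subsetI)
    show "M \<in> basis_span C ` F.orbs" if "M \<in> A" for M using ind that .
    fix M assume "M \<in> basis_span C ` F.orbs"
    then obtain x where x: "x \<in> simple_classes C" "M = basis_span C (F.orb x)" by (auto simp: F.orbs_def)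
    have "unit_vec x \<in> carrier (K0 C)" using x by (simp add: K0_simps unit_vec_def)
    then obtain m where m: "m \<in> (\<Pi>\<^sub>E M \<in> A. M)" "unit_vec x = (\<Oplus>\<^bsub>K0 C\<^esub>M \<in> A. m M)"
      using A unfolding bimodule_decomposition_def by blast
    have mN: "m N \<in> N" if "N \<in> A" for N using m(1) that by (auto simp: PiE_iff)
    have car: "m N \<in> carrier (K0 C)" if "N \<in> A" for N
      using mN[OF that] ind[OF that] by (auto simp: basis_span_def)
    \<comment> \<open>The coefficients at \<open>x\<close> of the components of
      \<open>unit_vec x\<close> add up to 1, so one component has \<open>x\<close> in its
      support.\<close>
    have "(\<Sum>N \<in> A. m N x) = 1" using finsum_K0[of A m x, OF fin car] fun_cong[OF m(2), of x]
      by (simp add: unit_vec_def)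
    then obtain N where N: "N \<in> A" "m N x \<noteq> 0" by (metis sum.neutral zero_neq_one)
    obtain Q where Q: "Q \<in> F.orbs" "N = basis_span C Q" using ind[OF N(1)] by blast
    have "x \<in> Q" using mN[OF N(1)] N(2) basis_span_iff[OF orbs_subset[OF Q(1)]] Q(2) by blast
    then have "Q = F.orb x"
      using orbs_disjoint[OF Q(1), of "F.orb x" x] F.orb_refl[OF x(1)] x(1) by (auto simp: F.orbs_def)
    then show "M \<in> A" using N(1) Q(2) x(2) by simp
  qed
qed

text \<open>The product of the unit vectors at \<open>x\<close> and \<open>y\<close> involves
  \<open>d\<close>, and orbits are disjoint; so only the span of the orbit of \<open>d\<close>
  satisfies the definite description of the product.\<close>

lemma universal_grading_mult:
  assumes d: "Rs x y d"
  shows "basis_span C (F.orb x) \<otimes>\<^bsub>universal_grading_group C\<^esub> basis_span C (F.orb y) = basis_span C (F.orb d)"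
proof -
  have x: "x \<in> simple_classes C" and y: "y \<in> simple_classes C" and d': "d \<in> simple_classes C"
    using F.R_in[OF d] by auto
  have o: "F.orb z \<in> F.orbs" if "z \<in> simple_classes C" for z using that by (simp add: F.orbs_def)
  have c: "c \<in> F.orb d" if "a \<in> F.orb x" "b \<in> F.orb y" "Rs a b c" for a b c
  proof -
    have "c \<in> F.orb c" using F.orb_refl F.R_in[OF that(3)] by blast
    then show ?thesis using F.orb_R[OF that d] by simp
  qed
  have "(THE P. P \<in> bimodule_components C \<and>
      (\<forall>f \<in> basis_span C (F.orb x). \<forall>g \<in> basis_span C (F.orb y). f \<otimes>\<^bsub>K0 C\<^esub> g \<in> P)) = basis_span C (F.orb d)"
  proof (rule the_equality, intro conjI ballI)
    show "basis_span C (F.orb d) \<in> bimodule_components C" using o[OF d'] by (simp add: bimodule_components_eq)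
    show "f \<otimes>\<^bsub>K0 C\<^esub> g \<in> basis_span C (F.orb d)" if "f \<in> basis_span C (F.orb x)" "g \<in> basis_span C
      (F.orb y)" for f g
      by (rule mult_span[OF orbs_subset[OF o[OF x]] orbs_subset[OF o[OF y]] orbs_subset[OF o[OF d']] c that])
  next
    fix P assume P: "P \<in> bimodule_components C \<and>
      (\<forall>f \<in> basis_span C (F.orb x). \<forall>g \<in> basis_span C (F.orb y). f \<otimes>\<^bsub>K0 C\<^esub> g \<in> P)"
    then obtain Q where Q: "Q \<in> F.orbs" "P = basis_span C Q" by (auto simp: bimodule_components_eq)
    have "unit_vec x \<otimes>\<^bsub>K0 C\<^esub> unit_vec y \<in> basis_span C Q"
      using P Q(2) unit_vec_span[OF orbs_subset[OF o[OF x]]] unit_vec_span[OF orbs_subset[OF o[OF y]]]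
        F.orb_refl x y by blast
    then have "d \<in> Q" by (rule unit_vec_mult_span[OF orbs_subset[OF Q(1)] x y _ d])
    then have "Q = F.orb d" using orbs_disjoint[OF Q(1) o[OF d']] F.orb_refl[OF d'] by blast
    then show "P = basis_span C (F.orb d)" using Q(2) by simp
  qed
  then show ?thesis by (simp add: universal_grading_group_def)
qed

lemma universal_grading_iso: "supp \<in> iso (universal_grading_group C) F.grading_group"
proof -
  let ?U = "universal_grading_group C"
  have rep: "\<exists>x \<in> simple_classes C. M = basis_span C (F.orb x) \<and> supp M = F.orb x" if "M \<in> carrier ?U" for M
    using that supp_span[OF orbs_subset] by (auto simp: universal_grading_group_def
      bimodule_components_eq F.orbs_def)
  have "supp \<in> hom ?U F.grading_group"
  proof (rule homI)
    fix M assume "M \<in> carrier ?U"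
    then show "supp M \<in> carrier F.grading_group" using rep by (auto simp: F.grading_group_def F.orbs_def)
  next
    fix M N assume M: "M \<in> carrier ?U" and N: "N \<in> carrier ?U"
    obtain x y where x: "x \<in> simple_classes C" "M = basis_span C (F.orb x)" "supp M = F.orb x"
      and y: "y \<in> simple_classes C" "N = basis_span C (F.orb y)" "supp N = F.orb y"
      using rep[OF M] rep[OF N] by blast
    obtain d where d: "Rs x y d" using F.R_total[OF x(1) y(1)] by blast
    have "F.orb d \<in> F.orbs" using F.R_in[OF d] by (simp add: F.orbs_def)
    then have "supp (M \<otimes>\<^bsub>?U\<^esub> N) = F.orb d"
      unfolding x(2) y(2) universal_grading_mult[OF d] by (rule supp_span[OF orbs_subset])
    then show "supp (M \<otimes>\<^bsub>?U\<^esub> N) = supp M \<otimes>\<^bsub>F.grading_group\<^esub> supp N"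
      unfolding x(3) y(3) F.grading_mult[OF d] .
  qed
  moreover have "bij_betw supp (carrier ?U) (carrier F.grading_group)"
    unfolding bij_betw_def
  proof
    show "inj_on supp (carrier ?U)" by (rule inj_onI) (use rep in metis)
    have "supp ` basis_span C ` F.orbs = F.orbs" using supp_span[OF orbs_subset] by force
    then show "supp ` carrier ?U = carrier F.grading_group"
      by (simp add: universal_grading_group_def bimodule_components_eq F.grading_group_def)
  qed
  ultimately show ?thesis by (simp add: iso_def)
qed

lemma group_universal_grading: "group (universal_grading_group C)"
proof (rule groupI)
  let ?U = "universal_grading_group C"
  interpret G: comm_group F.grading_group by (rule F.comm_group_grading)
  have rep: "\<exists>x \<in> simple_classes C. M = basis_span C (F.orb x)" if "M \<in> carrier ?U" for M
    using that by (auto simp: universal_grading_group_def bimodule_components_eq F.orbs_def)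
  have car: "basis_span C (F.orb x) \<in> carrier ?U" if "x \<in> simple_classes C" for x
    using that by (auto simp: universal_grading_group_def bimodule_components_eq F.orbs_def)
  have one: "\<one>\<^bsub>?U\<^esub> = basis_span C (F.orb (iso_class C (tunit C)))"
    by (simp add: universal_grading_group_def adjoint_subring_eq F.orb_e)
  show "\<one>\<^bsub>?U\<^esub> \<in> carrier ?U" using one car F.e_in by simp
  fix P assume P: "P \<in> carrier ?U"
  obtain x where x: "x \<in> simple_classes C" "P = basis_span C (F.orb x)" using rep[OF P] by blast
  show "\<one>\<^bsub>?U\<^esub> \<otimes>\<^bsub>?U\<^esub> P = P"
    unfolding one x(2) by (rule universal_grading_mult) (simp add: F.R_unit x(1))
  have "basis_span C (F.orb (stc x)) \<otimes>\<^bsub>?U\<^esub> P = \<one>\<^bsub>?U\<^esub>"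
    unfolding one x(2) by (rule universal_grading_mult[OF F.R_comm[OF F.R_st[OF x(1)]]])
  then show "\<exists>Q \<in> carrier ?U. Q \<otimes>\<^bsub>?U\<^esub> P = \<one>\<^bsub>?U\<^esub>"
    by (rule bexI) (rule car, simp add: x(1))
  fix Q assume Q: "Q \<in> carrier ?U"
  obtain y where y: "y \<in> simple_classes C" "Q = basis_span C (F.orb y)" using rep[OF Q] by blast
  obtain d where d: "Rs x y d" using F.R_total[OF x(1) y(1)] by blast
  have d': "d \<in> simple_classes C" using F.R_in[OF d] by simp
  show "P \<otimes>\<^bsub>?U\<^esub> Q \<in> carrier ?U" unfolding x(2) y(2) universal_grading_mult[OF d] by (rule car[OF d'])
  fix S assume S: "S \<in> carrier ?U"
  obtain z where z: "z \<in> simple_classes C" "S = basis_span C (F.orb z)" using rep[OF S] by blast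
  obtain c where c: "Rs d z c" using F.R_total[OF d' z(1)] by blast
  obtain v where v: "Rs y z v" "Rs x v c" using F.R_assoc[OF d c] by blast
  show "P \<otimes>\<^bsub>?U\<^esub> Q \<otimes>\<^bsub>?U\<^esub> S = P \<otimes>\<^bsub>?U\<^esub> (Q \<otimes>\<^bsub>?U\<^esub> S)"
    unfolding x(2) y(2) z(2) universal_grading_mult[OF d] universal_grading_mult[OF c]
      universal_grading_mult[OF v(1)] universal_grading_mult[OF v(2)] ..
qed

end

section \<open>Invertible objects\<close>

context ribbon_fusion_category
begin

lemma biproduct_single_iso:
  assumes b: "biproduct v [w] i p"
  shows "isomorphic C v w"
proof -
  note D = biproductD[OF b]
  have "i 0 \<in> Hom C w v" "p 0 \<in> Hom C v w" "p 0 \<cdot> i 0 = idm C w" "i 0 \<cdot> p 0 = idm C v"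
    using D(4)[of 0] D(5)[of 0] D(6)[of 0] D(8) by simp_all
  then show ?thesis unfolding isomorphic_def iso_arrow_def inverse_arrows_def by blast
qed

lemma biproduct_iso:
  assumes "inverse_arrows C x x' f g" "x \<in> Obj C" "x' \<in> Obj C"
  shows "biproduct x [x'] (\<lambda>_. g) (\<lambda>_. f)"
  using assms by (auto simp: biproduct_def inverse_arrows_def)

text \<open>The idempotents of the summands are scalars, non-zero because the summands are. Two of
  them would be orthogonal, but a product of non-zero scalars does not vanish.\<close>

lemma simple_biproduct_length:
  assumes s: "simple_object C s" and b: "biproduct s us i p"
    and nz: "\<And>j. j < length us \<Longrightarrow> idm C (us ! j) \<noteq> 0"
  shows "length us = 1"
proof -
  note D = biproductD[OF b]
  have sO [simp]: "s \<in> Obj C" using s by simp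
  have e: "i j \<cdot> p j \<in> Hom C s s" if "j < length us" for j
    using comp_Hom[OF D(5)[OF that] D(4)[OF that]] D(3)[OF that] by simp
  have sc: "\<exists>a. a \<noteq> 0 \<and> i j \<cdot> p j = scl C a (idm C s)" if j: "j < length us" for j
  proof -
    obtain a where a: "i j \<cdot> p j = scl C a (idm C s)" using endo_scalar[OF s e[OF j]] by blast
    have "a \<noteq> 0"
    proof
      assume "a = 0"
      then have "i j \<cdot> p j = 0" using a by simp
      then have "0 = p j \<cdot> (i j \<cdot> p j)" using cmp_zero_right[OF D(5)[OF j] sO sO D(3)[OF j]] by simp
      also have "\<dots> = p j"
        using cmp_assoc[OF sO D(3)[OF j] sO D(3)[OF j] D(5)[OF j] D(4)[OF j] D(5)[OF j]] D(6)[OF j]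
          cmp_idm_left[OF sO D(3)[OF j] D(5)[OF j]] by simp
      finally have "idm C (us ! j) = 0"
        using D(6)[OF j] cmp_zero_left[OF D(4)[OF j] D(3)[OF j] sO D(3)[OF j]] by simp
      then show False using nz[OF j] by simp
    qed
    then show ?thesis using a by blast
  qed
  have "us \<noteq> []" using D(8) simple_idm_nonzero[OF s] by auto
  moreover have "\<not> 1 < length us"
  proof
    assume 1: "1 < length us"
    then have 0: "0 < length us" by linarith
    obtain a c where a: "a \<noteq> 0" "i 0 \<cdot> p 0 = scl C a (idm C s)" and c: "c \<noteq> 0" "i 1 \<cdot> p 1 = scl C c (idm C s)"
      using sc[OF 0] sc[OF 1] by blast
    have "(i 0 \<cdot> p 0) \<cdot> (i 1 \<cdot> p 1) = i 0 \<cdot> (p 0 \<cdot> (i 1 \<cdot> p 1))"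
      using cmp_assoc[OF sO sO D(3)[OF 0] sO e[OF 1] D(5)[OF 0] D(4)[OF 0]] by simp
    also have "p 0 \<cdot> (i 1 \<cdot> p 1) = (p 0 \<cdot> i 1) \<cdot> p 1"
      using cmp_assoc[OF sO D(3)[OF 1] sO D(3)[OF 0] D(5)[OF 1] D(4)[OF 1] D(5)[OF 0]] by simp
    also have "\<dots> = 0" using D(7)[OF 1 0] cmp_zero_left[OF D(5)[OF 1] sO D(3)[OF 1] D(3)[OF 0]] by simp
    also have "i 0 \<cdot> 0 = 0" using cmp_zero_right[OF D(4)[OF 0] sO D(3)[OF 0] sO] .
    finally have "scl C a (idm C s) \<cdot> scl C c (idm C s) = 0" unfolding a c .
    moreover have "scl C a (idm C s) \<cdot> scl C c (idm C s) = scl C (a * c) (idm C s)"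
      using cmp_scl_left[OF sO sO sO scl_in_Hom[OF sO sO idm_in_Hom[OF sO]] idm_in_Hom[OF sO]]
        cmp_idm_left[OF sO sO scl_in_Hom[OF sO sO idm_in_Hom[OF sO]]] by simp
    ultimately show False using a c simple_idm_nonzero[OF s] by (simp add: vs.scale_eq_0_iff)
  qed
  ultimately show ?thesis by (cases us) auto
qed

lemma idm_zero_isomorphic:
  assumes "isomorphic C x y" "x \<in> Obj C" "y \<in> Obj C" "idm C x = 0"
  shows "idm C y = 0"
  using zero_object_isomorphic[OF assms(1-3)] assms zero_object_iff_idm by simp

lemma inverse_tensor:
  assumes "isomorphic C (h \<otimes>\<^sub>o g) (tunit C)" and [simp]: "g \<in> Obj C" "h \<in> Obj C" "x \<in> Obj C"
  shows "isomorphic C (h \<otimes>\<^sub>o (g \<otimes>\<^sub>o x)) x"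
proof -
  have "isomorphic C ((h \<otimes>\<^sub>o g) \<otimes>\<^sub>o x) (tunit C \<otimes>\<^sub>o x)"
    by (rule isomorphic_tns[OF assms(1) isomorphic_refl]) simp_all
  then have 1: "isomorphic C ((h \<otimes>\<^sub>o g) \<otimes>\<^sub>o x) x"
    by (rule isomorphic_trans[OF _ isomorphic_lun]) simp_all
  show ?thesis
    by (rule isomorphic_trans[OF isomorphic_sym[OF isomorphic_asc] 1]) simp_all
qed

text \<open>Tensoring with \<open>h\<close> recovers \<open>x\<close>, which would vanish together
  with the product.\<close>

lemma inverse_tensor_nonzero:
  assumes "isomorphic C (h \<otimes>\<^sub>o g) (tunit C)" and [simp]: "g \<in> Obj C" "h \<in> Obj C" "x \<in> Obj C"
    and x: "idm C x \<noteq> 0"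
  shows "idm C (g \<otimes>\<^sub>o x) \<noteq> 0"
proof
  assume "idm C (g \<otimes>\<^sub>o x) = 0"
  then have "idm C ((g \<otimes>\<^sub>o x) \<otimes>\<^sub>o h) = 0" by (rule idm_tns_zero[rotated 2]) simp_all
  moreover have "isomorphic C ((g \<otimes>\<^sub>o x) \<otimes>\<^sub>o h) x"
    by (rule isomorphic_trans[OF isomorphic_comm inverse_tensor[OF assms(1)]]) simp_all
  ultimately show False using idm_zero_isomorphic[of "(g \<otimes>\<^sub>o x) \<otimes>\<^sub>o h" x] x by simp
qed

text \<open>Tensoring a decomposition of the product with an inverse \<open>h\<close> of
  \<open>g\<close> decomposes an object isomorphic to \<open>x\<close> into equally many non-zero
  pieces, of which there can be only one.\<close>

lemma invertible_tensor_simple: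
  assumes g: "invertible_object C g" and x: "simple_object C x"
  shows "simple_object C (g \<otimes>\<^sub>o x)"
proof -
  obtain h where h [simp]: "h \<in> Obj C" and gh: "isomorphic C (g \<otimes>\<^sub>o h) (tunit C)" "isomorphic C
    (h \<otimes>\<^sub>o g) (tunit C)"
    and gO [simp]: "g \<in> Obj C"
    using g by (auto simp: invertible_object_def)
  have xO [simp]: "x \<in> Obj C" using x by simp
  obtain ws where ws: "\<forall>w \<in> set ws. simple_object C w" "is_direct_sum C (g \<otimes>\<^sub>o x) ws"
    using semisimple[of "g \<otimes>\<^sub>o x"] by auto
  then obtain i p where b: "biproduct (g \<otimes>\<^sub>o x) ws i p" using is_direct_sum_iff by blast
  have s: "simple_object C (h \<otimes>\<^sub>o (g \<otimes>\<^sub>o x))"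
    by (rule simple_object_isomorphic[OF x _ isomorphic_sym[OF inverse_tensor[OF gh(2)]]]) simp_all
  have "length (map (\<lambda>w. h \<otimes>\<^sub>o w) ws) = 1"
  proof (rule simple_biproduct_length[OF s biproduct_tns[OF b h]])
    fix j assume "j < length (map (\<lambda>w. h \<otimes>\<^sub>o w) ws)"
    then have "simple_object C (ws ! j)" using ws(1) by simp
    then show "idm C (map (\<lambda>w. h \<otimes>\<^sub>o w) ws ! j) \<noteq> 0"
      using inverse_tensor_nonzero[OF gh(1), of "ws ! j"] simple_idm_nonzero \<open>j < _\<close> by simp
  qed
  then obtain w where w: "ws = [w]" by (cases ws) auto
  have "isomorphic C (g \<otimes>\<^sub>o x) w" using biproduct_single_iso b w by blast
  then show ?thesis using simple_object_isomorphic[of w "g \<otimes>\<^sub>o x"] isomorphic_sym ws(1) w by simp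
qed

lemma isomorphic_run: "x \<in> Obj C \<Longrightarrow> isomorphic C (x \<otimes>\<^sub>o tunit C) x"
  using run_iso by (auto simp: isomorphic_def)

lemma invertible_simple:
  assumes g: "invertible_object C g"
  shows "simple_object C g"
proof -
  have "g \<in> Obj C" using g by (simp add: invertible_object_def)
  then show ?thesis
    using simple_object_isomorphic[OF invertible_tensor_simple[OF g simple_tunit] _ isomorphic_run] by simp
qed

lemma invertibleI:
  assumes "isomorphic C (x \<otimes>\<^sub>o y) (tunit C)" "x \<in> Obj C" "y \<in> Obj C"
  shows "invertible_object C x"
  using isomorphic_trans[OF isomorphic_comm[of y x] assms(1)] assms by (auto simp: invertible_object_def)

lemma invertible_isomorphic:
  assumes "invertible_object C g" "isomorphic C g g'" "g' \<in> Obj C"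
  shows "invertible_object C g'"
proof -
  obtain h where h [simp]: "h \<in> Obj C" "g \<in> Obj C" and gh: "isomorphic C (g \<otimes>\<^sub>o h) (tunit C)"
    using assms by (auto simp: invertible_object_def)
  have "isomorphic C (g' \<otimes>\<^sub>o h) (g \<otimes>\<^sub>o h)"
    by (rule isomorphic_tns[OF isomorphic_sym[OF assms(2)] isomorphic_refl]) (simp_all add: assms(3))
  then have "isomorphic C (g' \<otimes>\<^sub>o h) (tunit C)"
    by (rule isomorphic_trans[OF _ gh]) (simp_all add: assms(3))
  then show ?thesis by (rule invertibleI) (simp_all add: assms(3))
qed

lemma invertible_tunit: "invertible_object C (tunit C)"
  by (rule invertibleI[OF isomorphic_lun]) simp_all

lemma invertible_tns:
  assumes "invertible_object C g" "invertible_object C h"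
  shows "invertible_object C (g \<otimes>\<^sub>o h)"
proof -
  obtain g' where [simp]: "g \<in> Obj C" "g' \<in> Obj C" and g: "isomorphic C (g \<otimes>\<^sub>o g') (tunit C)"
    using assms(1) by (auto simp: invertible_object_def)
  obtain h' where [simp]: "h \<in> Obj C" "h' \<in> Obj C" and h: "isomorphic C (h \<otimes>\<^sub>o h') (tunit C)"
    using assms(2) by (auto simp: invertible_object_def)
  have "isomorphic C (g \<otimes>\<^sub>o (h \<otimes>\<^sub>o (h' \<otimes>\<^sub>o g'))) (g \<otimes>\<^sub>o g')"
    by (rule isomorphic_tns[OF isomorphic_refl inverse_tensor[OF h]]) simp_all
  then have 1: "isomorphic C (g \<otimes>\<^sub>o (h \<otimes>\<^sub>o (h' \<otimes>\<^sub>o g'))) (tunit C)"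
    by (rule isomorphic_trans[OF _ g]) simp_all
  have "isomorphic C ((g \<otimes>\<^sub>o h) \<otimes>\<^sub>o (h' \<otimes>\<^sub>o g')) (tunit C)"
    by (rule isomorphic_trans[OF isomorphic_asc 1]) simp_all
  then show ?thesis by (rule invertibleI) simp_all
qed

lemma iso_class_mult:
  assumes "g \<in> Obj C" "h \<in> Obj C"
  shows "iso_class C g \<otimes>\<^bsub>invertible_group C\<^esub> iso_class C h = iso_class C (g \<otimes>\<^sub>o h)"
proof -
  let ?I = "iso_class C (g \<otimes>\<^sub>o h)"
  have 1: "iso_class C (x \<otimes>\<^sub>o y) \<subseteq> ?I" if "x \<in> iso_class C g" "y \<in> iso_class C h" for x y
  proof -
    have "iso_class C (x \<otimes>\<^sub>o y) = ?I"
      using that assms isomorphic_tns[of x g y h] isomorphic_sym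
      by (subst iso_class_eq_iff) (auto simp: iso_class_def)
    then show ?thesis by simp
  qed
  have "g \<in> iso_class C g" "h \<in> iso_class C h"
    using assms isomorphic_refl by (auto simp: iso_class_def)
  then have "?I \<subseteq> (\<Union>x \<in> iso_class C g. \<Union>y \<in> iso_class C h. iso_class C (x \<otimes>\<^sub>o y))" by blast
  moreover have "(\<Union>x \<in> iso_class C g. \<Union>y \<in> iso_class C h. iso_class C (x \<otimes>\<^sub>o y)) \<subseteq> ?I"
    by (intro UN_least 1)
  ultimately show ?thesis by (simp add: invertible_group_def subset_antisym)
qed

lemma invertible_carrier: "a \<in> carrier (invertible_group C)
  \<Longrightarrow> a \<in> simple_classes C \<and> invertible_object C (rep a)"
proof -
  assume "a \<in> carrier (invertible_group C)"
  then obtain g where g: "invertible_object C g" "a = iso_class C g" by (auto simp: invertible_group_def)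
  then have gO: "g \<in> Obj C" by (simp add: invertible_object_def)
  show ?thesis
    using invertible_simple[OF g(1)] invertible_isomorphic[OF g(1) rep_iso_class(2,1)[OF gO]] g(2) by simp
qed

lemma group_invertible: "group (invertible_group C)"
proof (rule groupI)
  let ?G = "invertible_group C"
  have car: "iso_class C g \<in> carrier ?G" if "invertible_object C g" for g
    using that by (auto simp: invertible_group_def)
  have one: "\<one>\<^bsub>?G\<^esub> = iso_class C (tunit C)" by (simp add: invertible_group_def)
  have rep: "\<exists>g. invertible_object C g \<and> g \<in> Obj C \<and> a = iso_class C g" if "a \<in> carrier ?G" for a
    using that by (auto simp: invertible_group_def invertible_object_def)
  show "\<one>\<^bsub>?G\<^esub> \<in> carrier ?G" using car invertible_tunit one by simp
  fix a assume "a \<in> carrier ?G"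
  then obtain g where g: "invertible_object C g" "a = iso_class C g" and gO [simp]: "g \<in> Obj C"
    using rep by blast
  show "\<one>\<^bsub>?G\<^esub> \<otimes>\<^bsub>?G\<^esub> a = a"
    unfolding one g(2) by (subst iso_class_mult) (simp_all add: iso_class_eq_iff isomorphic_lun)
  obtain g' where g': "g' \<in> Obj C" "isomorphic C (g \<otimes>\<^sub>o g') (tunit C)" "isomorphic C (g' \<otimes>\<^sub>o g) (tunit C)"
    using g(1) by (auto simp: invertible_object_def)
  have "iso_class C g' \<otimes>\<^bsub>?G\<^esub> a = \<one>\<^bsub>?G\<^esub>"
    unfolding one g(2) by (subst iso_class_mult) (simp_all add: iso_class_eq_iff g')
  then show "\<exists>b \<in> carrier ?G. b \<otimes>\<^bsub>?G\<^esub> a = \<one>\<^bsub>?G\<^esub>"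
    by (rule bexI) (rule car[OF invertibleI[OF g'(3,1) gO]])
  fix b assume "b \<in> carrier ?G"
  then obtain h where h: "invertible_object C h" "b = iso_class C h" and hO [simp]: "h \<in> Obj C"
    using rep by blast
  show "a \<otimes>\<^bsub>?G\<^esub> b \<in> carrier ?G"
    unfolding g(2) h(2) by (subst iso_class_mult) (simp_all add: car invertible_tns g h)
  fix c assume "c \<in> carrier ?G"
  then obtain k where k: "c = iso_class C k" and kO [simp]: "k \<in> Obj C" using rep by blast
  show "a \<otimes>\<^bsub>?G\<^esub> b \<otimes>\<^bsub>?G\<^esub> c = a \<otimes>\<^bsub>?G\<^esub> (b \<otimes>\<^bsub>?G\<^esub> c)"
    unfolding g(2) h(2) k by (simp add: iso_class_mult iso_class_eq_iff isomorphic_asc)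
qed

section \<open>Scalar double braidings\<close>

definition mon_scalar :: "'o \<Rightarrow> 'o \<Rightarrow> 'k \<Rightarrow> bool" where
  "mon_scalar g x a \<longleftrightarrow> braid C x g \<cdot> braid C g x = scl C a (idm C (g \<otimes>\<^sub>o x))"

lemma monodromy_Hom [simp]:
  "\<lbrakk>g \<in> Obj C; x \<in> Obj C\<rbrakk> \<Longrightarrow> braid C x g \<cdot> braid C g x \<in> Hom C (g \<otimes>\<^sub>o x) (g \<otimes>\<^sub>o x)"
  by (rule comp_Hom[of _ _ "x \<otimes>\<^sub>o g"]) simp_all

lemma tns_cmp_right:
  assumes "y \<in> Obj C" "a \<in> Obj C" "b \<in> Obj C" "c \<in> Obj C" "f \<in> Hom C a b" "g \<in> Hom C b c"
  shows "(idm C y \<otimes>\<^sub>a g) \<cdot> (idm C y \<otimes>\<^sub>a f) = idm C y \<otimes>\<^sub>a (g \<cdot> f)"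
  using tns_cmp[of y y y a b c "idm C y" "idm C y" f g] assms cmp_idm_left[of y y "idm C y"] by simp

lemma monodromy_natural:
  assumes [simp]: "y \<in> Obj C" "x \<in> Obj C" "v \<in> Obj C" and f [simp]: "f \<in> Hom C x v"
  shows "(braid C v y \<cdot> braid C y v) \<cdot> (idm C y \<otimes>\<^sub>a f) = (idm C y \<otimes>\<^sub>a f) \<cdot> (braid C x y \<cdot> braid C y x)"
proof -
  have t: "idm C y \<otimes>\<^sub>a f \<in> Hom C (y \<otimes>\<^sub>o x) (y \<otimes>\<^sub>o v)" "f \<otimes>\<^sub>a idm C y \<in> Hom C (x \<otimes>\<^sub>o y) (v \<otimes>\<^sub>o y)" by simp_all
  have "(braid C v y \<cdot> braid C y v) \<cdot> (idm C y \<otimes>\<^sub>a f) = braid C v y \<cdot> (braid C y v \<cdot> (idm C y \<otimes>\<^sub>a f))"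
    by (rule cmp_assoc[symmetric, of "y \<otimes>\<^sub>o x" "y \<otimes>\<^sub>o v" "v \<otimes>\<^sub>o y" "y \<otimes>\<^sub>o v"]) (use t in simp_all)
  also have "braid C y v \<cdot> (idm C y \<otimes>\<^sub>a f) = (f \<otimes>\<^sub>a idm C y) \<cdot> braid C y x"
    using braid_natural[of y y x v "idm C y" f] by simp
  also have "braid C v y \<cdot> ((f \<otimes>\<^sub>a idm C y) \<cdot> braid C y x) = (braid C v y \<cdot> (f \<otimes>\<^sub>a idm C y)) \<cdot> braid C y x"
    by (rule cmp_assoc[of "y \<otimes>\<^sub>o x" "x \<otimes>\<^sub>o y" "v \<otimes>\<^sub>o y" "y \<otimes>\<^sub>o v"]) (use t in simp_all)
  also have "braid C v y \<cdot> (f \<otimes>\<^sub>a idm C y) = (idm C y \<otimes>\<^sub>a f) \<cdot> braid C x y"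
    using braid_natural[of x v y y f "idm C y"] by simp
  also have "((idm C y \<otimes>\<^sub>a f) \<cdot> braid C x y) \<cdot> braid C y x = (idm C y \<otimes>\<^sub>a f) \<cdot> (braid C x y \<cdot> braid C y x)"
    by (rule cmp_assoc[symmetric, of "y \<otimes>\<^sub>o x" "x \<otimes>\<^sub>o y" "y \<otimes>\<^sub>o x" "y \<otimes>\<^sub>o v"]) (use t in simp_all)
  finally show ?thesis .
qed

text \<open>By naturality a retract inherits the scalar. As simple constituents are retracts, this
  is what carries multiplicativity from tensor products to their constituents.\<close>

lemma mon_scalar_sub:
  assumes v: "mon_scalar g v a" and [simp]: "g \<in> Obj C" "x \<in> Obj C" "v \<in> Obj C"
    and f [simp]: "f \<in> Hom C x v" and p [simp]: "p \<in> Hom C v x" and pf: "p \<cdot> f = idm C x"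
  shows "mon_scalar g x a"
proof -
  let ?F = "idm C g \<otimes>\<^sub>a f" and ?P = "idm C g \<otimes>\<^sub>a p" and ?M = "braid C x g \<cdot> braid C g x"
  have t [simp]: "?F \<in> Hom C (g \<otimes>\<^sub>o x) (g \<otimes>\<^sub>o v)" "?P \<in> Hom C (g \<otimes>\<^sub>o v) (g \<otimes>\<^sub>o x)" by simp_all
  have PF: "?P \<cdot> ?F = idm C (g \<otimes>\<^sub>o x)" using tns_cmp_right[of g x v x f p] pf by (simp add: tns_idm)
  have "?M = (?P \<cdot> ?F) \<cdot> ?M" using cmp_idm_left[of "g \<otimes>\<^sub>o x" "g \<otimes>\<^sub>o x" ?M] PF by simp
  also have "\<dots> = ?P \<cdot> (?F \<cdot> ?M)" by (rule cmp_assoc[symmetric, of "g \<otimes>\<^sub>o x" "g \<otimes>\<^sub>o x" "g \<otimes>\<^sub>o v"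
    "g \<otimes>\<^sub>o x"]) simp_all
  also have "?F \<cdot> ?M = scl C a (idm C (g \<otimes>\<^sub>o v)) \<cdot> ?F"
    using monodromy_natural[of g x v f] v by (simp add: mon_scalar_def)
  also have "\<dots> = scl C a ?F"
    using cmp_scl_left[of "g \<otimes>\<^sub>o x" "g \<otimes>\<^sub>o v" "g \<otimes>\<^sub>o v" ?F "idm C (g \<otimes>\<^sub>o v)" a]
      cmp_idm_left[of "g \<otimes>\<^sub>o x" "g \<otimes>\<^sub>o v" ?F] by simp
  also have "?P \<cdot> scl C a ?F = scl C a (idm C (g \<otimes>\<^sub>o x))"
    using cmp_scl_right[of "g \<otimes>\<^sub>o x" "g \<otimes>\<^sub>o v" "g \<otimes>\<^sub>o x" ?F ?P a] PF by simp
  finally show ?thesis by (simp add: mon_scalar_def)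
qed

lemma mon_scalar_iso:
  assumes m: "mon_scalar g v a" and iso: "isomorphic C x v" and O: "g \<in> Obj C" "x \<in> Obj C" "v \<in> Obj C"
  shows "mon_scalar g x a"
proof -
  obtain f p where "f \<in> Hom C x v" "p \<in> Hom C v x" "p \<cdot> f = idm C x"
    using iso by (auto simp: isomorphic_def iso_arrow_def inverse_arrows_def)
  then show ?thesis by (rule mon_scalar_sub[OF m O])
qed

text \<open>The double braidings of \<open>g\<close> with \<open>x\<close> and of \<open>x\<close>
  with \<open>g\<close> are conjugate by \<open>braid C g x\<close>.\<close>

lemma mon_scalar_sym:
  assumes m: "mon_scalar g x a" and [simp]: "g \<in> Obj C" "x \<in> Obj C"
  shows "mon_scalar x g a"
proof -
  let ?b = "braid C g x" and ?b' = "inv_arrow C (g \<otimes>\<^sub>o x) (x \<otimes>\<^sub>o g) (braid C g x)" and ?c = "braid C x g"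
  have bb: "?b \<cdot> ?b' = idm C (x \<otimes>\<^sub>o g)" using iso_arrowD(4)[OF braid_iso[of g x]] by simp
  have bc [simp]: "?b \<cdot> ?c \<in> Hom C (x \<otimes>\<^sub>o g) (x \<otimes>\<^sub>o g)" by simp
  have "?b \<cdot> ?c = (?b \<cdot> ?c) \<cdot> (?b \<cdot> ?b')" using bb cmp_idm_right[of "x \<otimes>\<^sub>o g" "x \<otimes>\<^sub>o g" "?b \<cdot> ?c"] by simp
  also have "\<dots> = ((?b \<cdot> ?c) \<cdot> ?b) \<cdot> ?b'" by (rule cmp_assoc[of "x \<otimes>\<^sub>o g" "g \<otimes>\<^sub>o x" "x \<otimes>\<^sub>o g" "x \<otimes>\<^sub>o g"]) simp_all
  also have "(?b \<cdot> ?c) \<cdot> ?b = ?b \<cdot> (?c \<cdot> ?b)"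
    by (rule cmp_assoc[symmetric, of "g \<otimes>\<^sub>o x" "x \<otimes>\<^sub>o g" "g \<otimes>\<^sub>o x" "x \<otimes>\<^sub>o g"]) simp_all
  also have "\<dots> = scl C a ?b"
    using m cmp_scl_right[of "g \<otimes>\<^sub>o x" "g \<otimes>\<^sub>o x" "x \<otimes>\<^sub>o g" "idm C (g \<otimes>\<^sub>o x)" ?b a]
      cmp_idm_right[of "g \<otimes>\<^sub>o x" "x \<otimes>\<^sub>o g" ?b] by (simp add: mon_scalar_def)
  also have "scl C a ?b \<cdot> ?b' = scl C a (idm C (x \<otimes>\<^sub>o g))"
    using cmp_scl_left[of "x \<otimes>\<^sub>o g" "g \<otimes>\<^sub>o x" "x \<otimes>\<^sub>o g" ?b' ?b a] bb by simp
  finally show ?thesis by (simp add: mon_scalar_def)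
qed

lemma mon_scalar_tns:
  "\<lbrakk>mon_scalar g x a; mon_scalar g y b; g \<in> Obj C; x \<in> Obj C; y \<in> Obj C\<rbrakk> \<Longrightarrow> mon_scalar g (x \<otimes>\<^sub>o y) (a * b)"
  unfolding mon_scalar_def using monodromy_tensor by simp

definition mu :: "'o \<Rightarrow> 'o \<Rightarrow> 'k" where "mu g x = (THE a. mon_scalar g x a)"

lemma mon_scalar_unique:
  assumes g: "invertible_object C g" and x: "simple_object C x" and "mon_scalar g x a" "mon_scalar g x b"
  shows "a = b"
  using scl_idm_inj[OF invertible_tensor_simple[OF g x]] assms(3,4) by (simp add: mon_scalar_def)

text \<open>The product of an invertible and a simple object is simple, so the double braiding is a
  unique scalar by Schur.\<close>

lemma mon_scalar_mu:
  assumes g: "invertible_object C g" and x: "simple_object C x"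
  shows "mon_scalar g x (mu g x)"
proof -
  have "g \<in> Obj C" "x \<in> Obj C" using g x by (auto simp: invertible_object_def)
  then obtain a where a: "mon_scalar g x a"
    using endo_scalar[OF invertible_tensor_simple[OF g x] monodromy_Hom] by (auto simp: mon_scalar_def)
  show ?thesis unfolding mu_def by (rule theI[of "mon_scalar g x", OF a]) (rule mon_scalar_unique[OF g x _ a])
qed

lemma mu_eqI:
  "\<lbrakk>mon_scalar g x a; invertible_object C g; simple_object C x\<rbrakk> \<Longrightarrow> mu g x = a"
  by (rule mon_scalar_unique[OF _ _ mon_scalar_mu])

lemma mu_tns_right:
  assumes g: "invertible_object C g" and x: "simple_object C x" and y: "simple_object C y"
    and z: "simple_object C z" and o: "occ z (x \<otimes>\<^sub>o y)"
  shows "mu g z = mu g x * mu g y"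
proof (rule mu_eqI[OF _ g z])
  have [simp]: "g \<in> Obj C" "x \<in> Obj C" "y \<in> Obj C" "z \<in> Obj C"
    using g x y z by (auto simp: invertible_object_def)
  obtain f where f: "f \<in> Hom C z (x \<otimes>\<^sub>o y)" "f \<noteq> 0" using o by (auto simp: occ_def)
  obtain p where p: "p \<in> Hom C (x \<otimes>\<^sub>o y) z" "p \<cdot> f = idm C z" using simple_splits[OF z _ f] by auto
  have "mon_scalar g (x \<otimes>\<^sub>o y) (mu g x * mu g y)"
    using mon_scalar_tns[OF mon_scalar_mu[OF g x] mon_scalar_mu[OF g y]] by simp
  then show "mon_scalar g z (mu g x * mu g y)" by (rule mon_scalar_sub[OF _ _ _ _ f(1) p]) simp_all
qed

text \<open>The hexagon computation was carried out for a tensor product in the second argument;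
  \<open>mon_scalar_sym\<close> exchanges the arguments.\<close>

lemma mu_tns_left:
  assumes g: "invertible_object C g" and h: "invertible_object C h" and x: "simple_object C x"
  shows "mu (g \<otimes>\<^sub>o h) x = mu g x * mu h x"
proof (rule mu_eqI[OF _ invertible_tns[OF g h] x])
  have [simp]: "g \<in> Obj C" "h \<in> Obj C" "x \<in> Obj C"
    using g h x by (auto simp: invertible_object_def)
  have "mon_scalar x (g \<otimes>\<^sub>o h) (mu g x * mu h x)"
    by (rule mon_scalar_tns) (simp_all add: mon_scalar_sym mon_scalar_mu g h x)
  then show "mon_scalar (g \<otimes>\<^sub>o h) x (mu g x * mu h x)" by (rule mon_scalar_sym) simp_all
qed

lemma mu_iso:
  assumes g: "invertible_object C g" and "isomorphic C g g'" "g' \<in> Obj C"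
    and x: "simple_object C x" and "isomorphic C x x'" "x' \<in> Obj C"
  shows "mu g' x' = mu g x"
proof (rule mu_eqI)
  have [simp]: "g \<in> Obj C" "x \<in> Obj C" using g x by (auto simp: invertible_object_def)
  note [simp] = assms(3,6)
  have "mon_scalar g x' (mu g x)"
    by (rule mon_scalar_iso[OF mon_scalar_mu[OF g x] isomorphic_sym[OF assms(5)]]) simp_all
  then have "mon_scalar x' g (mu g x)" by (rule mon_scalar_sym) simp_all
  then have "mon_scalar x' g' (mu g x)" by (rule mon_scalar_iso[OF _ isomorphic_sym[OF assms(2)]]) simp_all
  then show "mon_scalar g' x' (mu g x)" by (rule mon_scalar_sym) simp_all
qed (use invertible_isomorphic[OF assms(1-3)] simple_object_isomorphic[OF x assms(6,5)] in simp_all)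

lemma mu_nonzero:
  assumes g: "invertible_object C g" and x: "simple_object C x"
  shows "mu g x \<noteq> 0"
proof
  have [simp]: "g \<in> Obj C" "x \<in> Obj C" using g x by (auto simp: invertible_object_def)
  obtain u v where i: "inverse_arrows C (g \<otimes>\<^sub>o x) (x \<otimes>\<^sub>o g) (braid C g x) u"
    "inverse_arrows C (x \<otimes>\<^sub>o g) (g \<otimes>\<^sub>o x) (braid C x g) v"
    using braid_iso[of g x] braid_iso[of x g] by (auto simp: iso_arrow_def)
  from inverse_arrows_comp[OF i] have c: "inverse_arrows C (g \<otimes>\<^sub>o x) (g \<otimes>\<^sub>o x)
    (braid C x g \<cdot> braid C g x) (u \<cdot> v)"
    by simp
  assume "mu g x = 0"
  then have "braid C x g \<cdot> braid C g x = 0" using mon_scalar_mu[OF g x] by (simp add: mon_scalar_def)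
  then have "idm C (g \<otimes>\<^sub>o x) = 0"
    using c cmp_zero_right[of "u \<cdot> v" "g \<otimes>\<^sub>o x" "g \<otimes>\<^sub>o x" "g \<otimes>\<^sub>o x"] by (simp add: inverse_arrows_def)
  then show False using simple_idm_nonzero[OF invertible_tensor_simple[OF g x]] by simp
qed

end

section \<open>The S-matrix\<close>

text \<open>Multiplying by the inverse matrix \<open>B\<close> on the right of \<open>v S\<close>
  recovers \<open>v\<close>, and \<open>w B\<close> is a preimage of \<open>w\<close>. The bijection
  \<open>f\<close> turns statements on indices into statements on the set \<open>I\<close>.\<close>

lemma matrix_nondegenerate:
  fixes S :: "'b \<Rightarrow> 'b \<Rightarrow> 'k::field"
  assumes f: "bij_betw f {..<n} I" and det: "det (mat n n (\<lambda>(i, j). S (f i) (f j))) \<noteq> 0"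
  shows "\<lbrakk>\<And>c. c \<in> I \<Longrightarrow> (\<Sum>b \<in> I. v b * S b c) = 0; a \<in> I\<rbrakk> \<Longrightarrow> v a = 0"
    and "\<exists>v. \<forall>c \<in> I. w c = (\<Sum>b \<in> I. v b * S b c)"
proof -
  let ?A = "mat n n (\<lambda>(i, j). S (f i) (f j))"
  have A: "?A \<in> carrier_mat n n" by simp
  from det_non_zero_imp_unit[OF A det, of undefined] obtain B where
    B: "B \<in> carrier_mat n n" "B * ?A = 1\<^sub>m n" "?A * B = 1\<^sub>m n"
    by (auto simp: Units_def ring_mat_def)
  have l: "(\<Sum>k<n. S (f i) (f k) * B $$ (k, j)) = (if i = j then 1 else 0)" if "i < n" "j < n" for i j
  proof -
    have "(?A * B) $$ (i, j) = (\<Sum>k<n. S (f i) (f k) * B $$ (k, j))"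
      using that B(1) by (simp add: scalar_prod_def lessThan_atLeast0)
    then show ?thesis using B(3) that by simp
  qed
  have r: "(\<Sum>k<n. B $$ (i, k) * S (f k) (f j)) = (if i = j then 1 else 0)" if "i < n" "j < n" for i j
  proof -
    have "(B * ?A) $$ (i, j) = (\<Sum>k<n. B $$ (i, k) * S (f k) (f j))"
      using that B(1) by (simp add: scalar_prod_def lessThan_atLeast0)
    then show ?thesis using B(2) that by simp
  qed
  have re: "sum h I = (\<Sum>k<n. h (f k))" for h :: "'b \<Rightarrow> 'k" using sum.reindex_bij_betw[OF f, of h] by simp
  have I: "\<exists>i<n. a = f i" if "a \<in> I" for a using that f by (auto simp: bij_betw_def)
  have fI: "f i \<in> I" if "i < n" for i using that f by (auto simp: bij_betw_def)
  show "v a = 0" if v: "\<And>c. c \<in> I \<Longrightarrow> (\<Sum>b \<in> I. v b * S b c) = 0" and a: "a \<in> I"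
  proof -
    obtain i where i: "i < n" "a = f i" using I[OF a] by blast
    have "0 = (\<Sum>k<n. (\<Sum>j<n. v (f j) * S (f j) (f k)) * B $$ (k, i))" using v[OF fI] re by simp
    also have "\<dots> = (\<Sum>k<n. \<Sum>j<n. v (f j) * (S (f j) (f k) * B $$ (k, i)))"
      by (simp add: sum_distrib_right mult.assoc)
    also have "\<dots> = (\<Sum>j<n. v (f j) * (\<Sum>k<n. S (f j) (f k) * B $$ (k, i)))"
      by (subst sum.swap) (simp add: sum_distrib_left)
    also have "\<dots> = (\<Sum>j<n. v (f j) * (if j = i then 1 else 0))" using l i by simp
    also have "\<dots> = (\<Sum>j<n. if j = i then v (f j) else 0)" by (rule sum.cong) auto
    also have "\<dots> = v a" using i by (simp add: sum.delta)
    finally show ?thesis by simp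
  qed
  define v where "v b = (\<Sum>k<n. w (f k) * B $$ (k, inv_into {..<n} f b))" for b
  have vf: "v (f j) = (\<Sum>k<n. w (f k) * B $$ (k, j))" if "j < n" for j
    using that f by (simp add: v_def bij_betw_def)
  have "w c = (\<Sum>b \<in> I. v b * S b c)" if c: "c \<in> I" for c
  proof -
    obtain i where i: "i < n" "c = f i" using I[OF c] by blast
    have "(\<Sum>b \<in> I. v b * S b c) = (\<Sum>j<n. \<Sum>k<n. w (f k) * (B $$ (k, j) * S (f j) (f i)))"
      unfolding re i(2) by (rule sum.cong) (simp_all add: vf sum_distrib_right mult.assoc)
    also have "\<dots> = (\<Sum>k<n. w (f k) * (\<Sum>j<n. B $$ (k, j) * S (f j) (f i)))"
      by (subst sum.swap) (simp add: sum_distrib_left)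
    also have "\<dots> = (\<Sum>k<n. w (f k) * (if k = i then 1 else 0))" using r i by simp
    also have "\<dots> = (\<Sum>k<n. if k = i then w (f k) else 0)" by (rule sum.cong) auto
    also have "\<dots> = w c" using i by (simp add: sum.delta)
    finally show ?thesis by simp
  qed
  then show "\<exists>v. \<forall>c \<in> I. w c = (\<Sum>b \<in> I. v b * S b c)" by blast
qed

section \<open>Dimensions and entries of the S-matrix\<close>

context ribbon_fusion_category
begin

definition qdim :: "'o \<Rightarrow> 'k" where "qdim x = qtrace C x (idm C x)"

lemma qtrace_sum:
  assumes "finite A" "x \<in> Obj C" "\<And>j. j \<in> A \<Longrightarrow> f j \<in> Hom C x x"
  shows "qtrace C x (sum f A) = (\<Sum>j \<in> A. qtrace C x (f j))"
  using assms(1,3)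
proof (induction A)
  case empty
  show ?case using qtrace_scl[OF assms(2), of "idm C x" 0] assms(2) by simp
next
  case (insert a A)
  have "sum f A \<in> Hom C x x" using insert.prems assms(2) by (intro sum_in_Hom) auto
  then show ?case using insert assms(2) by (simp add: qtrace_add)
qed

lemma qdim_iso: "\<lbrakk>isomorphic C x y; x \<in> Obj C; y \<in> Obj C\<rbrakk> \<Longrightarrow> qdim x = qdim y"
  using qtrace_cyclic[of x y] unfolding qdim_def isomorphic_def iso_arrow_def inverse_arrows_def by metis

lemma s_entry_sym: "\<lbrakk>x \<in> Obj C; y \<in> Obj C\<rbrakk> \<Longrightarrow> s_entry C x y = s_entry C y x"
  unfolding s_entry_def by (rule qtrace_cyclic) simp_all

lemma s_entry_tunit: "x \<in> Obj C \<Longrightarrow> s_entry C x (tunit C) = qdim x"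
  unfolding s_entry_def by (simp add: monodromy_tunit qdim_iso[OF isomorphic_lun, symmetric] flip: qdim_def)
  
text \<open>A loop around the unit strand has its dimension as effect, and the unit has dimension 1;
  so this is \<open>s_entry_tensor\<close> at the unit.\<close>

lemma qdim_tns:
  assumes "x \<in> Obj C" "z \<in> Obj C"
  shows "qdim (x \<otimes>\<^sub>o z) = qdim x * qdim z"
proof -
  obtain a b where "s_entry C x (tunit C) = a" "s_entry C z (tunit C)
    = b" "s_entry C (x \<otimes>\<^sub>o z) (tunit C) = a * b"
    using s_entry_tensor[OF simple_tunit assms] by (auto simp: qtrace_tunit)
  then show ?thesis using s_entry_tunit assms by simp
qed

text \<open>The identity of the product of \<open>y\<close> with \<open>v\<close> is inserted as the
  sum over the summands; naturality of the double braiding and cyclicity of the trace then move each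
  term to its summand.\<close>

lemma s_entry_biproduct:
  assumes b: "biproduct v xs i p" and y [simp]: "y \<in> Obj C"
  shows "s_entry C v y = (\<Sum>j < length xs. s_entry C (xs ! j) y)"
proof -
  note D = biproductD[OF b]
  note [simp] = D(1,3)
  let ?M = "\<lambda>x. braid C x y \<cdot> braid C y x" and ?I = "\<lambda>j. idm C y \<otimes>\<^sub>a i j" and ?P = "\<lambda>j. idm C y \<otimes>\<^sub>a p j"
  have t: "?I j \<in> Hom C (y \<otimes>\<^sub>o xs ! j) (y \<otimes>\<^sub>o v)" "?P j \<in> Hom C (y \<otimes>\<^sub>o v) (y \<otimes>\<^sub>o xs ! j)" if "j < length xs" for j
    using that D(4,5) by simp_all
  have ip: "?I j \<cdot> ?P j \<in> Hom C (y \<otimes>\<^sub>o v) (y \<otimes>\<^sub>o v)" if "j < length xs" for j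
    using comp_Hom[OF t(2)[OF that] t(1)[OF that]] that by simp
  have one: "(\<Sum>j < length xs. ?I j \<cdot> ?P j) = idm C (y \<otimes>\<^sub>o v)"
    using biproductD(8)[OF biproduct_tns[OF b y]] by simp
  have "?M v = ?M v \<cdot> (\<Sum>j < length xs. ?I j \<cdot> ?P j)"
    using cmp_idm_right[of "y \<otimes>\<^sub>o v" "y \<otimes>\<^sub>o v" "?M v"] one by simp
  also have "\<dots> = (\<Sum>j < length xs. ?M v \<cdot> (?I j \<cdot> ?P j))"
    by (rule cmp_sum_right[of "y \<otimes>\<^sub>o v" "y \<otimes>\<^sub>o v" "y \<otimes>\<^sub>o v"]) (simp_all add: ip)
  finally have M: "?M v = (\<Sum>j < length xs. ?M v \<cdot> (?I j \<cdot> ?P j))" .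
  have "qtrace C (y \<otimes>\<^sub>o v) (?M v \<cdot> (?I j \<cdot> ?P j)) = s_entry C (xs ! j) y" if j: "j < length xs" for j
  proof -
    note tj [simp] = t[OF j]
    have [simp]: "xs ! j \<in> Obj C" using j by simp
    have ij: "i j \<in> Hom C (xs ! j) v" using D(4) j by simp
    have MI [simp]: "?I j \<cdot> ?M (xs ! j) \<in> Hom C (y \<otimes>\<^sub>o xs ! j) (y \<otimes>\<^sub>o v)"
      by (rule comp_Hom[of _ _ "y \<otimes>\<^sub>o xs ! j"]) simp_all
    have "?M v \<cdot> (?I j \<cdot> ?P j) = (?M v \<cdot> ?I j) \<cdot> ?P j"
      by (rule cmp_assoc[of "y \<otimes>\<^sub>o v" "y \<otimes>\<^sub>o xs ! j" "y \<otimes>\<^sub>o v" "y \<otimes>\<^sub>o v"]) simp_all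
    also have "?M v \<cdot> ?I j = ?I j \<cdot> ?M (xs ! j)" by (rule monodromy_natural) (simp_all add: ij)
    finally have "qtrace C (y \<otimes>\<^sub>o v) (?M v \<cdot> (?I j \<cdot> ?P j))
      = qtrace C (y \<otimes>\<^sub>o xs ! j) (?P j \<cdot> (?I j \<cdot> ?M (xs ! j)))"
      using qtrace_cyclic[of "y \<otimes>\<^sub>o v" "y \<otimes>\<^sub>o xs ! j" "?I j \<cdot> ?M (xs ! j)" "?P j"] by simp
    also have "?P j \<cdot> (?I j \<cdot> ?M (xs ! j)) = (?P j \<cdot> ?I j) \<cdot> ?M (xs ! j)"
      by (rule cmp_assoc[of "y \<otimes>\<^sub>o xs ! j" "y \<otimes>\<^sub>o xs ! j" "y \<otimes>\<^sub>o v" "y \<otimes>\<^sub>o xs ! j"]) simp_all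
    also have "?P j \<cdot> ?I j = idm C (y \<otimes>\<^sub>o xs ! j)"
      using biproductD(6)[OF biproduct_tns[OF b y], of j] j by simp
    also have "idm C (y \<otimes>\<^sub>o xs ! j) \<cdot> ?M (xs ! j) = ?M (xs ! j)"
      by (rule cmp_idm_left[of "y \<otimes>\<^sub>o xs ! j"]) simp_all
    finally show ?thesis by (simp add: s_entry_def)
  qed
  moreover have "?M v \<cdot> (?I j \<cdot> ?P j) \<in> Hom C (y \<otimes>\<^sub>o v) (y \<otimes>\<^sub>o v)" if "j < length xs" for j
    by (rule comp_Hom[of _ _ "y \<otimes>\<^sub>o v"]) (simp_all add: ip[OF that])
  moreover have "s_entry C v y = qtrace C (y \<otimes>\<^sub>o v) (\<Sum>j < length xs. ?M v \<cdot> (?I j \<cdot> ?P j))"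
    unfolding s_entry_def by (rule arg_cong[OF M])
  ultimately show ?thesis by (subst (asm) qtrace_sum) simp_all
qed

text \<open>An isomorphism is a biproduct decomposition with one term.\<close>

lemma s_entry_iso_left:
  assumes "isomorphic C x x'" "x \<in> Obj C" "x' \<in> Obj C" "y \<in> Obj C"
  shows "s_entry C x y = s_entry C x' y"
proof -
  obtain f g where "inverse_arrows C x x' f g" using assms(1) by (auto simp: isomorphic_def iso_arrow_def)
  from s_entry_biproduct[OF biproduct_iso[OF this assms(2,3)] assms(4)] show ?thesis by simp
qed

lemma s_entry_iso:
  assumes "isomorphic C x x'" "isomorphic C y y'" and [simp]: "x \<in> Obj C" "x' \<in> Obj C"
    "y \<in> Obj C" "y' \<in> Obj C"
  shows "s_entry C x y = s_entry C x' y'"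
proof -
  have "s_entry C x y = s_entry C y x'" using s_entry_iso_left[OF assms(1)] s_entry_sym[of x' y] by simp
  also have "\<dots> = s_entry C x' y'" using s_entry_iso_left[OF assms(2)] s_entry_sym[of y' x'] by simp
  finally show ?thesis .
qed

text \<open>Summands are grouped by isomorphism class. The entry thus depends on \<open>v\<close>
  only through its class in \<open>K0 C\<close>, which turns \<open>s_entry_tensor\<close> into a
  relation between structure constants.\<close>

lemma s_entry_K0_class:
  assumes v: "v \<in> Obj C" and y: "y \<in> Obj C"
  shows "s_entry C v y = (\<Sum>b \<in> simple_classes C. of_int (K0_class C v b) * s_entry C (rep b) y)"
proof -
  obtain ws where ws: "\<forall>w \<in> set ws. simple_object C w" and d: "is_direct_sum C v ws"
    using semisimple[OF v] by auto
  then obtain i p where b: "biproduct v ws i p" using is_direct_sum_iff by blast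
  let ?n = "length ws" and ?c = "\<lambda>j. iso_class C (ws ! j)"
  have s: "simple_object C (ws ! j)" if "j < ?n" for j using ws that by simp
  have r: "s_entry C (ws ! j) y = s_entry C (rep (?c j)) y" if "j < ?n" for j
    by (rule s_entry_iso_left[OF rep_iso_class(2) _ rep_iso_class(1) y]) (simp_all add: s[OF that])
  have "s_entry C v y = (\<Sum>j<?n. s_entry C (rep (?c j)) y)"
    unfolding s_entry_biproduct[OF b y] by (rule sum.cong[OF refl], rule r) simp
  also have "\<dots> = (\<Sum>b \<in> simple_classes C. \<Sum>j \<in> {j \<in> {..<?n}. ?c j = b}. s_entry C (rep (?c j)) y)"
    by (rule sum.group[symmetric]) (use s finite_simple_classes in auto)
  also have "\<dots> = (\<Sum>b \<in> simple_classes C. of_int (K0_class C v b) * s_entry C (rep b) y)"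
  proof (rule sum.cong[OF refl])
    fix b assume b: "b \<in> simple_classes C"
    have "?c j = b \<longleftrightarrow> isomorphic C (rep b) (ws ! j)" if "j < ?n" for j
      using iso_class_eq_iff[of "rep b" "ws ! j"] b s[OF that] by auto
    then have e: "{j \<in> {..<?n}. ?c j = b} = {j. j < ?n \<and> isomorphic C (rep b) (ws ! j)}" by auto
    have "multiplicity_in C v b = card {j \<in> {..<?n}. ?c j = b}"
      using multiplicity_in_biproduct[OF simple_rep(1)[OF b] ws d] b e by (simp add: length_filter_conv_card)
    then show "(\<Sum>j \<in> {j \<in> {..<?n}. ?c j = b}. s_entry C (rep (?c j)) y)
        = of_int (K0_class C v b) * s_entry C (rep b) y"
      using b by (simp add: K0_class_def)
  qed
  finally show ?thesis .
qed

lemma monodromy_s_entry: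
  assumes g: "invertible_object C g" and x: "simple_object C x"
  shows "s_entry C g x = mu g x * (qdim g * qdim x)"
proof -
  have [simp]: "g \<in> Obj C" "x \<in> Obj C" using g x by (auto simp: invertible_object_def)
  have "s_entry C g x = s_entry C x g" by (rule s_entry_sym) simp_all
  also have "\<dots> = qtrace C (g \<otimes>\<^sub>o x) (scl C (mu g x) (idm C (g \<otimes>\<^sub>o x)))"
    using mon_scalar_mu[OF g x] by (simp add: s_entry_def mon_scalar_def)
  also have "\<dots> = mu g x * qdim (g \<otimes>\<^sub>o x)" by (simp add: qtrace_scl qdim_def)
  finally show ?thesis by (simp add: qdim_tns)
qed

text \<open>The adjunction matches these morphisms with morphisms between two simple objects, which
  are proportional by Schur.\<close>

lemma Hom_tunit_proportional:
  assumes x: "simple_object C x" and y: "simple_object C y"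
    and f: "f \<in> Hom C (tunit C) (x \<otimes>\<^sub>o y)" "f \<noteq> 0" and g: "g \<in> Hom C (tunit C) (x \<otimes>\<^sub>o y)"
  shows "\<exists>a. g = scl C a f"
proof -
  have [simp]: "x \<in> Obj C" "y \<in> Obj C" using x y by simp_all
  let ?d = "dual C x \<otimes>\<^sub>o tunit C"
  obtain \<Phi> \<Psi> where A: "(\<forall>k \<in> Hom C ?d y. \<Phi> k \<in> Hom C (tunit C) (x \<otimes>\<^sub>o y) \<and> \<Psi> (\<Phi> k) = k) \<and>
    (\<forall>l \<in> Hom C (tunit C) (x \<otimes>\<^sub>o y). \<Psi> l \<in> Hom C ?d y \<and> \<Phi> (\<Psi> l) = l) \<and>
    (\<forall>k \<in> Hom C ?d y. \<forall>c. \<Phi> (scl C c k) = scl C c (\<Phi> k)) \<and>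
    (\<forall>l \<in> Hom C (tunit C) (x \<otimes>\<^sub>o y). \<forall>c. \<Psi> (scl C c l) = scl C c (\<Psi> l))"
    using Hom_adjunction[OF \<open>x \<in> Obj C\<close> tunit_in_Obj \<open>y \<in> Obj C\<close>] by (elim exE) (rule that)
  have 2: "\<Psi> l \<in> Hom C ?d y \<and> \<Phi> (\<Psi> l) = l" if "l \<in> Hom C (tunit C) (x \<otimes>\<^sub>o y)" for l using A that by blast
  have 3: "\<Phi> (scl C c k) = scl C c (\<Phi> k)" if "k \<in> Hom C ?d y" for k c using A that by blast
  have d: "simple_object C ?d"
    by (rule simple_object_isomorphic[OF simple_dual[OF x] _ isomorphic_sym[OF isomorphic_run]]) simp_all
  have "\<Phi> 0 = 0" using 3[OF zero_in_Hom[of ?d y], of 0] by simp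
  then have "\<Psi> f \<noteq> 0" using 2[OF f(1)] f(2) by auto
  then have i: "iso_arrow C ?d y (\<Psi> f)" using schur[OF d y] 2[OF f(1)] by blast
  have "\<Psi> g \<in> Hom C ?d y" using 2[OF g] by blast
  then obtain a where a: "\<Psi> g = scl C a (\<Psi> f)" using Hom_simple_proportional[OF d _ i] by auto
  have "g = \<Phi> (scl C a (\<Psi> f))" using 2[OF g] a by simp
  also have "\<dots> = scl C a f" using 3[of "\<Psi> f" a] 2[OF f(1)] by simp
  finally show ?thesis by blast
qed

text \<open>Two summands would give two independent morphisms from the unit into the product,
  contrary to \<open>Hom_tunit_proportional\<close>; so there is exactly one.\<close>

lemma tensor_of_units:
  assumes x: "simple_object C x" and y: "simple_object C y" and b: "biproduct (x \<otimes>\<^sub>o y) ws i p"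
    and ws: "\<And>w. w \<in> set ws \<Longrightarrow> isomorphic C (tunit C) w" and ne: "ws \<noteq> []"
  shows "isomorphic C (x \<otimes>\<^sub>o y) (tunit C)"
proof -
  have [simp]: "x \<in> Obj C" "y \<in> Obj C" using x y by simp_all
  note D = biproductD[OF b]
  note One_nat_def [simp del]
  have "length ws \<le> 1"
  proof (rule ccontr)
    assume "\<not> length ws \<le> 1"
    then have l: "0 < length ws" "1 < length ws" by auto
    have o [simp]: "ws ! 0 \<in> Obj C" "ws ! 1 \<in> Obj C" using D(3) l by blast+
    have "isomorphic C (tunit C) (ws ! 0)" "isomorphic C (tunit C) (ws ! 1)" using ws l by simp_all
    then obtain f0 g0 f1 g1 where i0: "inverse_arrows C (tunit C) (ws ! 0) f0 g0"
      and i1: "inverse_arrows C (tunit C) (ws ! 1) f1 g1"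
      by (auto simp: isomorphic_def iso_arrow_def)
    have f: "f0 \<in> Hom C (tunit C) (ws ! 0)" "f1 \<in> Hom C (tunit C) (ws ! 1)"
      "g0 \<in> Hom C (ws ! 0) (tunit C)" "g1 \<in> Hom C (ws ! 1) (tunit C)"
      "g0 \<cdot> f0 = idm C (tunit C)" "g1 \<cdot> f1 = idm C (tunit C)"
      using i0 i1 by (auto simp: inverse_arrows_def)
    have ii: "i 0 \<in> Hom C (ws ! 0) (x \<otimes>\<^sub>o y)" "i 1 \<in> Hom C (ws ! 1) (x \<otimes>\<^sub>o y)"
      "p 0 \<in> Hom C (x \<otimes>\<^sub>o y) (ws ! 0)" "p 1 \<in> Hom C (x \<otimes>\<^sub>o y) (ws ! 1)"
      using D(4,5) l by blast+
    have h: "i 0 \<cdot> f0 \<in> Hom C (tunit C) (x \<otimes>\<^sub>o y)" "i 1 \<cdot> f1 \<in> Hom C (tunit C) (x \<otimes>\<^sub>o y)"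
      using comp_Hom[OF f(1) ii(1)] comp_Hom[OF f(2) ii(2)] by simp_all
    have nz: "f0 \<noteq> 0" "f1 \<noteq> 0"
      using f(5,6) cmp_zero_right[OF f(3) tunit_in_Obj] cmp_zero_right[OF f(4) tunit_in_Obj]
        simple_idm_nonzero[OF simple_tunit] by auto
    have p0: "p 0 \<cdot> (i 0 \<cdot> f0) = f0" "p 0 \<cdot> (i 1 \<cdot> f1) = 0" "p 1 \<cdot> (i 1 \<cdot> f1) = f1"
    proof -
      have "p 0 \<cdot> (i 0 \<cdot> f0) = (p 0 \<cdot> i 0) \<cdot> f0"
        by (rule cmp_assoc[of "tunit C" "ws ! 0" "x \<otimes>\<^sub>o y" "ws ! 0"]) (use f ii in simp_all)
      then show "p 0 \<cdot> (i 0 \<cdot> f0) = f0" using D(6)[OF l(1)] cmp_idm_left[OF _ _ f(1)] by simp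
      have "p 0 \<cdot> (i 1 \<cdot> f1) = (p 0 \<cdot> i 1) \<cdot> f1"
        by (rule cmp_assoc[of "tunit C" "ws ! 1" "x \<otimes>\<^sub>o y" "ws ! 0"]) (use f ii in simp_all)
      then show "p 0 \<cdot> (i 1 \<cdot> f1) = 0" using D(7)[OF l(2,1)] cmp_zero_left[OF f(2) tunit_in_Obj o(2)
        o(1)] by simp
      have "p 1 \<cdot> (i 1 \<cdot> f1) = (p 1 \<cdot> i 1) \<cdot> f1"
        by (rule cmp_assoc[of "tunit C" "ws ! 1" "x \<otimes>\<^sub>o y" "ws ! 1"]) (use f ii in simp_all)
      then show "p 1 \<cdot> (i 1 \<cdot> f1) = f1" using D(6)[OF l(2)] cmp_idm_left[OF _ _ f(2)] by simp
    qed
    have "i 1 \<cdot> f1 \<noteq> 0" using p0(3) nz(2) cmp_zero_right[OF ii(4) tunit_in_Obj _ o(2)] by auto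
    then obtain a where "i 0 \<cdot> f0 = scl C a (i 1 \<cdot> f1)"
      using Hom_tunit_proportional[OF x y h(2) _ h(1)] by blast
    then have "f0 = p 0 \<cdot> scl C a (i 1 \<cdot> f1)" using p0(1) by simp
    also have "\<dots> = scl C a (p 0 \<cdot> (i 1 \<cdot> f1))"
      by (rule cmp_scl_right[of "tunit C" "x \<otimes>\<^sub>o y" "ws ! 0"]) (use h ii in simp_all)
    finally show False using p0(2) nz(1) by simp
  qed
  then obtain w where w: "ws = [w]" using ne by (cases ws) auto
  have "isomorphic C (x \<otimes>\<^sub>o y) w" using biproduct_single_iso b w by blast
  moreover have "isomorphic C w (tunit C)" using ws w by (simp add: isomorphic_sym)
  moreover have "w \<in> Obj C" using D(2) w by simp
  ultimately show ?thesis by (meson isomorphic_trans tns_in_Obj tunit_in_Obj \<open>x \<in> Obj C\<close> \<open>y \<in> Obj C\<close>)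
qed

text \<open>Every simple summand is a constituent and hence a unit, and \<open>F.R_total\<close>
  guarantees that there is a summand at all.\<close>

lemma tensor_unit_if_only_unit:
  assumes a: "a \<in> simple_classes C" and b: "b \<in> simple_classes C"
    and only: "\<And>c. Rs a b c \<Longrightarrow> c = iso_class C (tunit C)"
  shows "isomorphic C (rep a \<otimes>\<^sub>o rep b) (tunit C)"
proof -
  let ?v = "rep a \<otimes>\<^sub>o rep b"
  have O: "rep a \<in> Obj C" "rep b \<in> Obj C" using a b by simp_all
  then have vO: "?v \<in> Obj C" by simp
  obtain ws where ws: "\<forall>w \<in> set ws. simple_object C w" and d: "is_direct_sum C ?v ws"
    using semisimple[OF vO] by auto
  then obtain i p where bp: "biproduct ?v ws i p" using is_direct_sum_iff by blast
  have occw: "occ w ?v" if w: "w \<in> set ws" for w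
  proof -
    obtain j where j: "j < length ws" "w = ws ! j" using w by (auto simp: in_set_conv_nth)
    have s: "simple_object C w" using ws w by blast
    then have "occ w (ws ! j)" using occ_simple[OF s s] isomorphic_refl j by simp
    then show ?thesis using occ_biproduct[OF _ bp] s j by auto
  qed
  have iso: "isomorphic C (tunit C) w" if w: "w \<in> set ws" for w
  proof -
    have s: "simple_object C w" using ws w by blast
    have "Rs (iso_class C (rep a)) (iso_class C (rep b)) (iso_class C w)"
      using Rs_iso_class[of "rep a" "rep b" w] occw[OF w] s a b by simp
    then have "iso_class C w = iso_class C (tunit C)" using only a b by simp
    then show ?thesis using iso_class_eq_iff s isomorphic_sym by simp
  qed
  have ne: "ws \<noteq> []"
  proof
    assume e: "ws = []"
    obtain c where c: "Rs a b c" using F.R_total[OF a b] by blast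
    then have "occ (rep c) ?v" by (simp add: Rs_def)
    then show False using occ_biproduct[OF _ bp, of "rep c"] c e by (auto simp: Rs_def)
  qed
  show ?thesis by (rule tensor_of_units[OF _ _ bp iso ne]) (simp_all add: a b)
qed

end

text \<open>The linear algebra of the S-matrix, detached from the category: \<open>N\<close> are the
  structure constants and \<open>D\<close> the dimensions. The axioms \<open>S_factor\<close> and
  \<open>verlinde\<close> are free of division because \<open>D y \<noteq> 0\<close> is a
  consequence, not an assumption.\<close>

locale nondegenerate_fusion =
  fixes I :: "'b set" and S :: "'b \<Rightarrow> 'b \<Rightarrow> 'k::field_char_0" and D :: "'b \<Rightarrow> 'k" and N :: "'b \<Rightarrow> 'b \<Rightarrow>
    'b \<Rightarrow> 'k" and e :: 'b
  assumes fin: "finite I" and e_I: "e \<in> I"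
    and inj: "\<lbrakk>\<And>c. c \<in> I \<Longrightarrow> (\<Sum>b \<in> I. v b * S b c) = 0; a \<in> I\<rbrakk> \<Longrightarrow> v a = 0"
    and surj: "\<exists>v. \<forall>c \<in> I. w c = (\<Sum>b \<in> I. v b * S b c)"
    and S_sym: "\<lbrakk>a \<in> I; b \<in> I\<rbrakk> \<Longrightarrow> S a b = S b a"
    and S_e: "a \<in> I \<Longrightarrow> S a e = D a"
    and S_factor: "\<lbrakk>x \<in> I; y \<in> I\<rbrakk> \<Longrightarrow> \<exists>a. S x y = a * D y"
    and verlinde: "\<lbrakk>x \<in> I; y \<in> I; z \<in> I\<rbrakk> \<Longrightarrow> (\<Sum>w \<in> I. N x z w * S w y) * D y = S x y * S z y"
    and D_e: "D e = 1"
begin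

text \<open>If \<open>D y\<close> vanished, so would the column of S at \<open>y\<close> by
  \<open>S_factor\<close>, and by symmetry the row, against injectivity.\<close>

lemma D_nonzero:
  assumes y: "y \<in> I"
  shows "D y \<noteq> 0"
proof
  assume "D y = 0"
  then have "S y c = 0" if "c \<in> I" for c using S_factor[OF that y] S_sym[OF y that] by auto
  moreover have "(\<Sum>b \<in> I. (if b = y then 1 else 0) * S b c) = S y c" for c
  proof -
    have "(\<Sum>b \<in> I. (if b = y then 1 else 0) * S b c) = (\<Sum>b \<in> I. if b = y then S b c else 0)"
      by (rule sum.cong) auto
    then show ?thesis using fin y by (simp add: sum.delta)
  qed
  ultimately have "(if y = y then 1 else 0 :: 'k) = 0" by (intro inj[of "\<lambda>b. if b
    = y then 1 else 0"]) (use y in simp_all)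
  then show False by simp
qed

lemma sum_D: "\<lbrakk>x \<in> I; z \<in> I\<rbrakk> \<Longrightarrow> (\<Sum>w \<in> I. N x z w * D w) = D x * D z"
  using verlinde[of x e z] S_e D_e e_I by simp

text \<open>An eigenvector argument. Multiplication by \<open>z\<close> acts on the character
  \<open>x \<mapsto> S x b / D b\<close> with eigenvalue \<open>S z b / D b\<close>, and on
  \<open>\<theta>\<close> with eigenvalue \<open>\<theta> z\<close>. In an expansion of
  \<open>\<theta>\<close> by the rows of S only those \<open>b\<close> can have a non-zero
  coefficient whose eigenvalues agree with those of \<open>\<theta>\<close> for all
  \<open>z\<close>, and some coefficient is non-zero.\<close>

lemma characters:
  assumes mult: "\<And>x z. \<lbrakk>x \<in> I; z \<in> I\<rbrakk> \<Longrightarrow> \<theta> x * \<theta> z = (\<Sum>w \<in> I. N x z w * \<theta> w)" and one: "\<theta> e = 1"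
  shows "\<exists>y \<in> I. \<forall>x \<in> I. S x y = \<theta> x * D y"
proof -
  obtain v where v: "\<And>c. c \<in> I \<Longrightarrow> \<theta> c = (\<Sum>b \<in> I. v b * S b c)" using surj[of \<theta>] by blast
  \<comment> \<open>Both expansions of \<open>\<theta> z * \<theta> x\<close> in the rows of S are
    compared: one multiplies each coefficient by its eigenvalue, the other by
    \<open>\<theta> z\<close>.\<close>
  have key: "v y * (S z y / D y - \<theta> z) = 0" if z: "z \<in> I" and y: "y \<in> I" for y z
  proof (rule inj[of "\<lambda>y. v y * (S z y / D y - \<theta> z)", OF _ y])
    fix x assume x: "x \<in> I"
    have "\<theta> z * \<theta> x = (\<Sum>w \<in> I. N z x w * (\<Sum>b \<in> I. v b * S b w))" using mult[OF z x] v by simp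
    also have "\<dots> = (\<Sum>w \<in> I. \<Sum>b \<in> I. v b * (N z x w * S w b))"
      by (rule sum.cong[OF refl]) (simp add: sum_distrib_left S_sym mult.left_commute)
    also have "\<dots> = (\<Sum>b \<in> I. v b * (\<Sum>w \<in> I. N z x w * S w b))"
      by (subst sum.swap) (simp add: sum_distrib_left)
    also have "\<dots> = (\<Sum>b \<in> I. v b * (S z b / D b) * S b x)"
    proof (rule sum.cong[OF refl])
      fix b assume b: "b \<in> I"
      have "(\<Sum>w \<in> I. N z x w * S w b) = S z b * S b x / D b"
        using verlinde[OF z b x] D_nonzero[OF b] S_sym[OF x b] by (simp add: field_simps)
      then show "v b * (\<Sum>w \<in> I. N z x w * S w b) = v b * (S z b / D b) * S b x" by simp
    qed
    finally have 1: "\<theta> z * \<theta> x = (\<Sum>b \<in> I. v b * (S z b / D b) * S b x)" .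
    have "(\<Sum>b \<in> I. v b * (S z b / D b - \<theta> z) * S b x)
      = (\<Sum>b \<in> I. v b * (S z b / D b) * S b x) - \<theta> z * (\<Sum>b \<in> I. v b * S b x)"
      by (simp add: sum_distrib_left sum_subtractf[symmetric] algebra_simps)
    then show "(\<Sum>b \<in> I. v b * (S z b / D b - \<theta> z) * S b x) = 0" using 1 v[OF x] by simp
  qed
  \<comment> \<open>All coefficients cannot vanish, since \<open>\<theta> e = 1\<close>.\<close>
  obtain y where y: "y \<in> I" "v y \<noteq> 0"
  proof -
    have "\<exists>y \<in> I. v y \<noteq> 0"
    proof (rule ccontr)
      assume "\<not> ?thesis"
      then show False using v[OF e_I] one by simp
    qed
    then show ?thesis using that by blast
  qed
  have "S z y = \<theta> z * D y" if "z \<in> I" for z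
    using key[OF that y(1)] y D_nonzero[OF y(1)] by (auto simp: field_simps)
  then show ?thesis using y(1) by blast
qed

lemma character_of_support:
  assumes \<psi>: "\<And>a b c. \<lbrakk>a \<in> I; b \<in> I; c \<in> I; N a b c \<noteq> 0\<rbrakk> \<Longrightarrow> \<psi> c = \<psi> a * \<psi> b" and one: "\<psi> e = 1"
  shows "\<exists>y \<in> I. \<forall>x \<in> I. S x y = \<psi> x * D x * D y"
proof (rule characters[of "\<lambda>x. \<psi> x * D x"])
  fix x z assume x: "x \<in> I" and z: "z \<in> I"
  have "(\<Sum>w \<in> I. N x z w * (\<psi> w * D w)) = (\<Sum>w \<in> I. \<psi> x * \<psi> z * (N x z w * D w))"
  proof (rule sum.cong[OF refl])
    fix w assume w: "w \<in> I"
    show "N x z w * (\<psi> w * D w) = \<psi> x * \<psi> z * (N x z w * D w)"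
      using \<psi>[OF x z w] by (cases "N x z w = 0") (simp_all add: mult_ac)
  qed
  also have "\<dots> = \<psi> x * \<psi> z * (D x * D z)" using sum_D[OF x z] by (simp add: sum_distrib_left[symmetric])
  finally show "\<psi> x * D x * (\<psi> z * D z) = (\<Sum>w \<in> I. N x z w * (\<psi> w * D w))" by (simp add: mult_ac)
qed (simp add: one D_e)

text \<open>The elements of \<open>I\<close> attached to \<open>\<psi>\<close> and to its inverse are inverse to each other.\<close>

lemma character_of_support_inverse:
  assumes \<psi>: "\<And>a b c. \<lbrakk>a \<in> I; b \<in> I; c \<in> I; N a b c \<noteq> 0\<rbrakk> \<Longrightarrow> \<psi> c = \<psi> a * \<psi> b" and one: "\<psi> e = 1"
    and nz: "\<And>a. a \<in> I \<Longrightarrow> \<psi> a \<noteq> 0"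
  shows "\<exists>x \<in> I. \<exists>x' \<in> I. (\<forall>y \<in> I. S x y = \<psi> y * D x * D y) \<and> (\<forall>w \<in> I. w \<noteq> e \<longrightarrow> N x x' w = 0)"
proof -
  obtain x where x: "x \<in> I" and Sx: "\<And>y. y \<in> I \<Longrightarrow> S y x = \<psi> y * D y * D x"
    using character_of_support[of \<psi>] \<psi> one by blast
  have \<psi>': "inverse (\<psi> c) = inverse (\<psi> a) * inverse (\<psi> b)" if "a \<in> I" "b \<in> I" "c \<in> I" "N a b c \<noteq> 0" for a b c
    using \<psi>[OF that] by (simp add: mult.commute)
  obtain x' where x': "x' \<in> I" and Sx': "\<And>y. y \<in> I \<Longrightarrow> S y x' = inverse (\<psi> y) * D y * D x'"
    using character_of_support[of "\<lambda>a. inverse (\<psi> a)", OF \<psi>'] one by auto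
  have "N x x' w - (if w = e then D x * D x' else 0) = 0" if w: "w \<in> I" for w
  proof (rule inj[of "\<lambda>w. N x x' w - (if w = e then D x * D x' else 0)", OF _ w])
    fix y assume y: "y \<in> I"
    \<comment> \<open>The value \<open>\<psi> y\<close> cancels against its inverse in the product
      of the two entries.\<close>
    have "(\<Sum>w \<in> I. N x x' w * S w y) * D y = (D x * D x' * D y) * D y"
      using verlinde[OF x y x'] Sx[OF y] Sx'[OF y] S_sym[OF x y] S_sym[OF x' y] nz[OF y]
        by (simp add: field_simps)
    then have 1: "(\<Sum>w \<in> I. N x x' w * S w y) = D x * D x' * D y" using D_nonzero[OF y] by simp
    have "(\<Sum>w \<in> I. (if w = e then D x * D x' else 0) * S w y) = (\<Sum>w \<in> I. if w
      = e then D x * D x' * S w y else 0)"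
      by (rule sum.cong) auto
    also have "\<dots> = D x * D x' * D y" using fin e_I S_sym[OF e_I y] S_e[OF y] by (simp add: sum.delta)
    finally show "(\<Sum>w \<in> I. (N x x' w - (if w = e then D x * D x' else 0)) * S w y) = 0"
      using 1 by (simp add: left_diff_distrib sum_subtractf)
  qed
  then have "\<forall>w \<in> I. w \<noteq> e \<longrightarrow> N x x' w = 0" by fastforce
  moreover have "\<forall>y \<in> I. S x y = \<psi> y * D x * D y" using Sx S_sym[OF x] by (simp add: mult_ac)
  ultimately show ?thesis using x x' by blast
qed

end

section \<open>The pairing between invertible objects and the universal grading\<close>

context modular_category
begin

text \<open>The determinant is given for one list of representatives; entries are invariant under
  isomorphism, so it is the same for \<open>rep\<close>.\<close>

lemma s_matrix_bij:
  obtains f n where "bij_betw f {..<n::nat} (simple_classes C)"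
    "det (mat n n (\<lambda>(i, j). s_entry C (rep (f i)) (rep (f j)))) \<noteq> 0"
proof -
  obtain xs where s: "\<forall>x \<in> set xs. simple_object C x" and dist: "distinct (map (iso_class C) xs)"
    and im: "iso_class C ` set xs = simple_classes C"
    and det: "det (mat (length xs) (length xs) (\<lambda>(i, j). s_entry C (xs ! i) (xs ! j))) \<noteq> 0"
    using s_matrix_nondegenerate by blast
  let ?f = "\<lambda>j. iso_class C (xs ! j)"
  have "bij_betw (\<lambda>j. map (iso_class C) xs ! j) {..<length xs} (simple_classes C)"
    using bij_betw_nth[OF dist, of "{..<length xs}"] im by simp
  then have bij: "bij_betw ?f {..<length xs} (simple_classes C)"
    by (rule bij_betw_cong[THEN iffD1, rotated]) simp
  have O: "xs ! j \<in> Obj C" if "j < length xs" for j using s that by simp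
  have "mat (length xs) (length xs) (\<lambda>(i, j). s_entry C (rep (?f i)) (rep (?f j)))
      = mat (length xs) (length xs) (\<lambda>(i, j). s_entry C (xs ! i) (xs ! j))"
    by (rule eq_matI) (use O in \<open>auto intro!: s_entry_iso isomorphic_sym[OF rep_iso_class(2)]
      rep_iso_class(1)\<close>)
  then show ?thesis using that[OF bij] det by simp
qed

sublocale M: nondegenerate_fusion "simple_classes C" "\<lambda>b c. s_entry C (rep b) (rep c)" "\<lambda>b. qdim (rep b)"
  "\<lambda>a b c. of_int (Nc a b c)" "iso_class C (tunit C)"
proof
  let ?e = "iso_class C (tunit C)"
  note [simp] = simple_tunit
  have e: "isomorphic C (tunit C) (rep ?e)" "rep ?e \<in> Obj C" using rep_iso_class[of "tunit C"] by simp_all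
  obtain f n where f: "bij_betw f {..<n::nat} (simple_classes C)"
    "det (mat n n (\<lambda>(i, j). s_entry C (rep (f i)) (rep (f j)))) \<noteq> 0"
    by (rule s_matrix_bij)
  show "v a = 0" if "\<And>c. c \<in> simple_classes C \<Longrightarrow> (\<Sum>b \<in> simple_classes C. v b * s_entry C (rep b) (rep c)) = 0"
    "a \<in> simple_classes C" for v a
    by (rule matrix_nondegenerate(1)[OF f that])
  show "\<exists>v. \<forall>c \<in> simple_classes C. w c = (\<Sum>b \<in> simple_classes C. v b * s_entry C (rep b) (rep c))" for w
    by (rule matrix_nondegenerate(2)[OF f])
  show "s_entry C (rep a) (rep b) = s_entry C (rep b) (rep a)"
    if "a \<in> simple_classes C" "b \<in> simple_classes C" for a b
    by (rule s_entry_sym) (simp_all add: that)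
  show "s_entry C (rep a) (rep ?e) = qdim (rep a)" if a: "a \<in> simple_classes C" for a
  proof -
    have "s_entry C (rep a) (rep ?e) = s_entry C (rep a) (tunit C)"
      by (rule s_entry_iso[OF isomorphic_refl isomorphic_sym[OF e(1)]]) (simp_all add: a e)
    then show ?thesis using a by (simp add: s_entry_tunit)
  qed
  show "\<exists>c. s_entry C (rep x) (rep y) = c * qdim (rep y)"
    if "x \<in> simple_classes C" "y \<in> simple_classes C" for x y
    by (rule s_entry_tensor[of "rep y" "rep x" "rep x"]) (use that in \<open>auto simp: qdim_def\<close>)
  show "(\<Sum>w \<in> simple_classes C. of_int (Nc x z w) * s_entry C (rep w) (rep y)) * qdim (rep y)
      = s_entry C (rep x) (rep y) * s_entry C (rep z) (rep y)"
    if x: "x \<in> simple_classes C" and y: "y \<in> simple_classes C" and z: "z \<in> simple_classes C" for x y z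
  proof -
    have [simp]: "rep x \<in> Obj C" "rep y \<in> Obj C" "rep z \<in> Obj C" using x y z by simp_all
    have "(\<Sum>w \<in> simple_classes C. of_int (Nc x z w) * s_entry C (rep w) (rep y))
      = s_entry C (rep x \<otimes>\<^sub>o rep z) (rep y)"
      unfolding Nc_def by (rule s_entry_K0_class[symmetric]) simp_all
    moreover obtain a b where "s_entry C (rep x) (rep y)
      = a * qdim (rep y)" "s_entry C (rep z) (rep y) = b * qdim (rep y)"
      "s_entry C (rep x \<otimes>\<^sub>o rep z) (rep y) = a * b * qdim (rep y)"
      using s_entry_tensor[of "rep y" "rep x" "rep z"] y by (auto simp: qdim_def)
    ultimately show ?thesis by (simp add: mult_ac)
  qed
  show "qdim (rep ?e) = 1" using qdim_iso[OF e(1)] e(2) qtrace_tunit by (simp add: qdim_def)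
qed (simp_all add: finite_simple_classes simple_tunit)

lemma invertible_of_character:
  assumes \<psi>: "\<And>a b c. Rs a b c \<Longrightarrow> \<psi> c = \<psi> a * \<psi> b" and nz: "\<And>a. a \<in> simple_classes C \<Longrightarrow> \<psi> a \<noteq> (0::'k)"
  shows "\<exists>x \<in> simple_classes C. invertible_object C (rep x) \<and> (\<forall>y \<in> simple_classes C. \<psi> y
    = mu (rep x) (rep y))"
proof -
  let ?e = "iso_class C (tunit C)"
  have "Rs ?e ?e ?e" using F.R_unit[of ?e ?e] by simp
  then have "\<psi> ?e = \<psi> ?e * \<psi> ?e" by (rule \<psi>)
  then have one: "\<psi> ?e = 1" using nz[of ?e] by simp
  have \<psi>': "\<psi> c = \<psi> a * \<psi> b" if "a \<in> simple_classes C" "b \<in> simple_classes C" "of_int (Nc a b c) \<noteq>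
    (0::'k)" for a b c
    using \<psi>[of a b c] Nc_nonzero[OF that(1,2), of c] that(3) by auto
  obtain x x' where x: "x \<in> simple_classes C" and x': "x' \<in> simple_classes C"
    and S: "\<And>y. y \<in> simple_classes C \<Longrightarrow> s_entry C (rep x) (rep y) = \<psi> y * qdim (rep x) * qdim (rep y)"
    and N: "\<And>w. \<lbrakk>w \<in> simple_classes C; w \<noteq> ?e\<rbrakk> \<Longrightarrow> of_int (Nc x x' w) = (0::'k)"
  proof -
    have "\<exists>x \<in> simple_classes C. \<exists>x' \<in> simple_classes C.
      (\<forall>y \<in> simple_classes C. s_entry C (rep x) (rep y) = \<psi> y * qdim (rep x) * qdim (rep y)) \<and>
      (\<forall>w \<in> simple_classes C. w \<noteq> ?e \<longrightarrow> of_int (Nc x x' w) = (0::'k))"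
      by (rule M.character_of_support_inverse[of \<psi>, OF \<psi>' one nz])
    then show thesis by (elim bexE conjE) (rule that; blast)
  qed
  have "c = ?e" if "Rs x x' c" for c
  proof (rule ccontr)
    assume "c \<noteq> ?e"
    then have "Nc x x' c = 0" using N[of c] F.R_in[OF that] by simp
    then show False using Nc_nonzero[OF x x', of c] that by simp
  qed
  then have "isomorphic C (rep x \<otimes>\<^sub>o rep x') (tunit C)" by (rule tensor_unit_if_only_unit[OF x x'])
  then have inv: "invertible_object C (rep x)" by (rule invertibleI) (simp_all add: x x')
  \<comment> \<open>The entry of S at \<open>x\<close> and \<open>y\<close> is now known in two
    ways, and the dimensions cancel.\<close>
  have "\<psi> y = mu (rep x) (rep y)" if y: "y \<in> simple_classes C" for y
    using monodromy_s_entry[OF inv simple_rep(1)[OF y]] S[OF y] M.D_nonzero[OF x] M.D_nonzero[OF y] by simp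
  then show ?thesis using x inv by blast
qed

lemma mu_faithful:
  assumes a: "a \<in> carrier (invertible_group C)" and b: "b \<in> carrier (invertible_group C)"
    and eq: "\<And>y. y \<in> simple_classes C \<Longrightarrow> mu (rep a) (rep y) = mu (rep b) (rep y)"
  shows "a = b"
proof (rule ccontr)
  assume ne: "a \<noteq> b"
  have A: "a \<in> simple_classes C" "invertible_object C (rep a)"
    and B: "b \<in> simple_classes C" "invertible_object C (rep b)"
    using invertible_carrier a b by blast+
  \<comment> \<open>The rows of S at \<open>a\<close> and \<open>b\<close> are proportional to the
    dimensions of \<open>a\<close> and \<open>b\<close>; \<open>?v\<close> is the combination in
    which they cancel.\<close>
  let ?v = "\<lambda>c. if c = a then qdim (rep b) else if c = b then - qdim (rep a) else 0"
  have "?v a = 0"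
  proof (rule M.inj[of ?v, OF _ A(1)])
    fix y assume y: "y \<in> simple_classes C"
    have "(\<Sum>c \<in> simple_classes C. ?v c * s_entry C (rep c) (rep y))
      = (\<Sum>c \<in> {a, b}. ?v c * s_entry C (rep c) (rep y))"
      by (rule sum.mono_neutral_right) (use A B finite_simple_classes in auto)
    also have "\<dots> = 0" using ne eq[OF y] monodromy_s_entry[OF A(2) simple_rep(1)[OF y]]
        monodromy_s_entry[OF B(2) simple_rep(1)[OF y]] by simp
    finally show "(\<Sum>c \<in> simple_classes C. ?v c * s_entry C (rep c) (rep y)) = 0" .
  qed
  then show False using M.D_nonzero[OF B(1)] by simp
qed

lemma mu_Rs:
  assumes g: "invertible_object C g" and R: "Rs a b c"
  shows "mu g (rep c) = mu g (rep a) * mu g (rep b)"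
  using R by (intro mu_tns_right[OF g]) (simp_all add: Rs_def)

text \<open>The classes on which \<open>mu g\<close> is 1 form a set satisfying
  \<open>F.adj_closed\<close>, because \<open>mu g\<close> takes inverse values on a class and its
  dual.\<close>

lemma mu_Tad:
  assumes g: "invertible_object C g" and c: "c \<in> F.Tad"
  shows "mu g (rep c) = 1"
proof -
  let ?e = "iso_class C (tunit C)"
  note nz = mu_nonzero[OF g simple_rep(1)]
  have one: "mu g (rep ?e) = 1"
  proof -
    have "Rs ?e ?e ?e" using F.R_unit[of ?e ?e] by simp
    then have "mu g (rep ?e) = mu g (rep ?e) * mu g (rep ?e)" by (rule mu_Rs[OF g])
    then show ?thesis using nz[of ?e] by simp
  qed
  have st: "mu g (rep a) * mu g (rep (stc a)) = 1" if a: "a \<in> simple_classes C" for a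
    using mu_Rs[OF g F.R_st[OF a]] one by simp
  have "F.adj_closed {c \<in> simple_classes C. mu g (rep c) = 1}"
    unfolding F.adj_closed_def
  proof (intro conjI ballI allI impI)
    show "stc a \<in> {c \<in> simple_classes C. mu g (rep c) = 1}"
      if "a \<in> {c \<in> simple_classes C. mu g (rep c) = 1}" for a
      using that st[of a] F.st_in[of a] by simp
    show "c \<in> {c \<in> simple_classes C. mu g (rep c) = 1}" if "a \<in> {c \<in> simple_classes C. mu g (rep c) = 1}"
      "b \<in> {c \<in> simple_classes C. mu g (rep c) = 1}" "Rs a b c" for a b c
      using mu_Rs[OF g that(3)] that F.R_in[OF that(3)] by simp
    show "c \<in> {c \<in> simple_classes C. mu g (rep c) = 1}" if "x \<in> simple_classes C" "Rs x (stc x) c" for x c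
      using mu_Rs[OF g that(2)] st[OF that(1)] F.R_in[OF that(2)] by simp
  qed (use one simple_tunit in auto)
  then show ?thesis using c F.Tad_iff by blast
qed

lemma mu_orb:
  assumes g: "invertible_object C g" and y: "y \<in> F.orb x"
  shows "mu g (rep y) = mu g (rep x)"
proof -
  obtain a where a: "a \<in> F.Tad" "Rs a x y" using y by (auto simp: F.orb_def)
  show ?thesis using mu_Rs[OF g a(2)] mu_Tad[OF g a(1)] by simp
qed

text \<open>The choice of an element of \<open>P\<close> is harmless for invertible classes
  \<open>a\<close> and orbits \<open>P\<close>, as \<open>mu_orb\<close> shows.\<close>

definition pairing :: "'o set \<Rightarrow> 'o set set \<Rightarrow> 'k" where
  "pairing a P = mu (rep a) (rep (SOME x. x \<in> P))"

lemma pairing_orb: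
  assumes g: "invertible_object C (rep a)" and x: "x \<in> simple_classes C"
  shows "pairing a (F.orb x) = mu (rep a) (rep x)"
  unfolding pairing_def by (rule mu_orb[OF g]) (rule someI[of "\<lambda>y. y \<in> F.orb x", OF F.orb_refl[OF x]])

text \<open>\<open>mu_faithful\<close> and \<open>invertible_of_character\<close> are the
  injectivity and surjectivity that \<open>perfect_pairing_iso\<close> asks for.\<close>

lemma pairing_iso:
  "(\<lambda>P. \<lambda>a \<in> carrier (invertible_group C). pairing a P) \<in> iso F.grading_group (character_group
    (invertible_group C))"
proof (rule perfect_pairing_iso)
  let ?G = "invertible_group C" and ?U = "F.grading_group"
  have inv: "invertible_object C (rep a)" if "a \<in> carrier ?G" for a using invertible_carrier[OF that] by blast
  have car: "carrier ?U = F.orb ` simple_classes C" by (simp add: F.grading_group_def F.orbs_def)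
  show "group ?G" by (rule group_invertible)
  have "carrier ?G \<subseteq> simple_classes C" using invertible_carrier by blast
  then show "finite (carrier ?G)" using finite_simple_classes by (rule finite_subset)
  show "comm_group ?U" by (rule F.comm_group_grading)
  show "finite (carrier ?U)" using finite_simple_classes car by simp
  show "(\<lambda>a. pairing a P) \<in> hom ?G unit_group" if P: "P \<in> carrier ?U" for P
  proof (rule hom_unit_groupI)
    obtain x where x: "x \<in> simple_classes C" "P = F.orb x" using P car by blast
    show "pairing a P \<noteq> 0" if a: "a \<in> carrier ?G" for a
      using mu_nonzero[OF inv[OF a] simple_rep(1)[OF x(1)]] pairing_orb[OF inv[OF a] x(1)] x(2) by simp
    show "pairing (a \<otimes>\<^bsub>?G\<^esub> b) P = pairing a P * pairing b P" if a: "a \<in> carrier ?G"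
      and b: "b \<in> carrier ?G" for a b
    proof -
      have ab: "a \<otimes>\<^bsub>?G\<^esub> b \<in> carrier ?G" using group.is_monoid[OF group_invertible] a b by (rule monoid.m_closed)
      have [simp]: "rep a \<in> Obj C" "rep b \<in> Obj C" using invertible_carrier a b by auto
      have e: "a \<otimes>\<^bsub>?G\<^esub> b = iso_class C (rep a \<otimes>\<^sub>o rep b)"
        using iso_class_mult[of "rep a" "rep b"] invertible_carrier a b by simp
      have "mu (rep (a \<otimes>\<^bsub>?G\<^esub> b)) (rep x) = mu (rep a \<otimes>\<^sub>o rep b) (rep x)"
        unfolding e by (rule mu_iso[OF invertible_tns[OF inv[OF a] inv[OF b]] rep_iso_class(2,1) _
          isomorphic_refl])
          (simp_all add: x(1))
      then show ?thesis
        using mu_tns_left[OF inv[OF a] inv[OF b] simple_rep(1)[OF x(1)]] pairing_orb[OF inv x(1)] a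
          b ab x(2) by simp
    qed
  qed
  show "pairing a \<in> hom ?U unit_group" if a: "a \<in> carrier ?G" for a
  proof (rule hom_unit_groupI)
    fix P assume "P \<in> carrier ?U"
    then obtain x where x: "x \<in> simple_classes C" "P = F.orb x" using car by blast
    show "pairing a P \<noteq> 0"
      using mu_nonzero[OF inv[OF a] simple_rep(1)[OF x(1)]] pairing_orb[OF inv[OF a] x(1)] x(2) by simp
    fix Q assume "Q \<in> carrier ?U"
    then obtain y where y: "y \<in> simple_classes C" "Q = F.orb y" using car by blast
    obtain z where z: "Rs x y z" using F.R_total[OF x(1) y(1)] by blast
    have zI: "z \<in> simple_classes C" using F.R_in[OF z] by simp
    show "pairing a (P \<otimes>\<^bsub>?U\<^esub> Q) = pairing a P * pairing a Q"
      using F.grading_mult[OF z] mu_Rs[OF inv[OF a] z] x y zI pairing_orb[OF inv[OF a]] by simp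
  qed
  show "a = b" if a: "a \<in> carrier ?G" and b: "b \<in> carrier ?G"
    and eq: "\<And>P. P \<in> carrier ?U \<Longrightarrow> pairing a P = pairing b P" for a b
  proof (rule mu_faithful[OF a b])
    fix y assume y: "y \<in> simple_classes C"
    then have "F.orb y \<in> carrier ?U" using car by simp
    from eq[OF this] show "mu (rep a) (rep y) = mu (rep b) (rep y)" using pairing_orb[OF inv y] a b by simp
  qed
  show "\<exists>a \<in> carrier ?G. \<forall>P \<in> carrier ?U. \<psi> P = pairing a P" if \<psi>: "\<psi> \<in> hom ?U
    (unit_group :: 'k monoid)" for \<psi>
  proof -
    have o: "F.orb y \<in> carrier ?U" if "y \<in> simple_classes C" for y using that car by simp
    have "\<psi> (F.orb c) = \<psi> (F.orb a) * \<psi> (F.orb b)" if R: "Rs a b c" for a b c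
      using hom_unit_groupD(2)[OF \<psi> o o] F.grading_mult[OF R] F.R_in[OF R] by metis
    moreover have "\<psi> (F.orb a) \<noteq> 0" if "a \<in> simple_classes C" for a
      using hom_unit_groupD(1)[OF \<psi> o[OF that]] .
    ultimately obtain x where x: "x \<in> simple_classes C" "invertible_object C (rep x)"
      "\<And>y. y \<in> simple_classes C \<Longrightarrow> \<psi> (F.orb y) = mu (rep x) (rep y)"
      using invertible_of_character[of "\<lambda>a. \<psi> (F.orb a)"] by blast
    have "iso_class C (rep x) \<in> carrier ?G" using x(2) by (auto simp: invertible_group_def)
    then have "x \<in> carrier ?G" using x(1) by simp
    moreover have "\<psi> P = pairing x P" if "P \<in> carrier ?U" for P
      using that car x(3) pairing_orb[OF x(2)] by auto
    ultimately show ?thesis by blast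
  qed
qed

text \<open>This expresses that the isomorphism is canonical: its values are double braidings with
  arbitrary simple objects of degree \<open>M\<close>, without reference to the representatives
  chosen in \<open>rep\<close> and \<open>pairing\<close>.\<close>

lemma pairing_formula:
  assumes M: "M \<in> carrier (universal_grading_group C)" and x: "simple_object C x" and xM: "K0_class C x \<in> M"
    and g: "invertible_object C g"
  shows "braid C x g \<cdot> braid C g x = scl C (pairing (iso_class C g) (supp M)) (idm C (g \<otimes>\<^sub>o x))"
proof -
  let ?x = "iso_class C x" and ?g = "iso_class C g"
  have gO: "g \<in> Obj C" using g by (simp add: invertible_object_def)
  have "supp M \<in> carrier F.grading_group"
    using universal_grading_iso M by (auto simp: iso_def hom_def)
  then have "supp M \<in> F.orbs" by (simp add: F.grading_group_def)
  moreover have "?x \<in> supp M" using xM K0_class_simple[OF x] by (simp add: supp_def)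
  ultimately have s: "supp M = F.orb ?x" by (rule orbs_eq_orb)
  have ig: "invertible_object C (rep ?g)" by (rule invertible_isomorphic[OF g rep_iso_class(2,1)])
    (simp_all add: gO)
  have "pairing ?g (supp M) = mu (rep ?g) (rep ?x)" unfolding s by (rule pairing_orb[OF ig]) (simp add: x)
  also have "\<dots> = mu g x"
    by (rule mu_iso[OF g rep_iso_class(2,1) x rep_iso_class(2,1)]) (simp_all add: gO x)
  finally show ?thesis using mon_scalar_mu[OF g x] by (simp add: mon_scalar_def)
qed

end

theorem theorem6p3:
  fixes C :: "('o, 'm::ab_group_add, 'k::{alg_closed_field, field_char_0}, 'z) ribbon_cat_scheme"
  assumes "modular_category C"
  shows "group (universal_grading_group C) \<and>
    group (character_group (invertible_group C) :: ('o set \<Rightarrow> 'k) monoid) \<and>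
    (\<exists>\<phi> \<in> iso (universal_grading_group C) (character_group (invertible_group C)).
      \<forall>M \<in> carrier (universal_grading_group C). \<forall>x g.
        simple_object C x \<and> K0_class C x \<in> M \<and> invertible_object C g \<longrightarrow>
          braid C x g \<cdot>\<^bsub>C\<^esub> braid C g x
            = scl C (\<phi> M (iso_class C g)) (idm C (g \<otimes>\<^sub>o\<^bsub>C\<^esub> x)))"
proof -
  interpret modular_category C by fact
  let ?U = "universal_grading_group C" and ?G = "invertible_group C"
  \<comment> \<open>\<open>supp\<close> passes from components of the Grothendieck ring to sets of
    classes, on which the pairing is defined.\<close>
  define \<phi> where "\<phi> = (\<lambda>P. \<lambda>a \<in> carrier ?G. pairing a P) \<circ> supp"
  have "\<phi> \<in> iso ?U (character_group ?G)"
    unfolding \<phi>_def by (rule iso_set_trans[OF universal_grading_iso pairing_iso])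
  moreover have "braid C x g \<cdot>\<^bsub>C\<^esub> braid C g x = scl C (\<phi> M (iso_class C g)) (idm C (g \<otimes>\<^sub>o\<^bsub>C\<^esub> x))"
    if M: "M \<in> carrier ?U" and h: "simple_object C x \<and> K0_class C x \<in> M \<and> invertible_object C g" for M x g
  proof -
    have "iso_class C g \<in> carrier ?G" using h by (auto simp: invertible_group_def)
    then have "\<phi> M (iso_class C g) = pairing (iso_class C g) (supp M)" by (simp add: \<phi>_def)
    then show ?thesis using pairing_formula[OF M] h by simp
  qed
  ultimately show ?thesis
    using group_universal_grading group.group_character_group[OF group_invertible] by blast
qed

end
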